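(* Let $\Gamma$ be a connected graph such that for every vertex $u$ the subgraph induced on the neighbourhood of $u$ is isomorphic to the collinearity graph of a generalized quadrangle of order $(3,3)$ (i.e. to the collinearity graph of $W(3)$ or of $Q_4(3)$). Then $\Gamma\cong\mathcal{U}_5$.
   Context: $W(3)$ is the generalized quadrangle of points of $PG(3,3)$ and lines totally isotropic for a nondegenerate symplectic form; $Q_4(3)$ is the generalized quadrangle of singular points and lines of $PG(4,3)$ for a nondegenerate quadratic form. These are the only two generalized quadrangles of order $(3,3)$. For $n\ge1$, $\mathcal{U}_n$ is the graph whose vertices are the nonisotropic points of an $n$-dimensional $\mathrm{GF}(4)$-vector space carrying a nondegenerate hermitian form, two vertices being adjacent iff they are perpendicular. *)

theory Defs
  imports "HOL-Library.Numeral_Type"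
begin

definition simple_graph :: "'a set \<Rightarrow> ('a \<Rightarrow> 'a \<Rightarrow> bool) \<Rightarrow> bool" where
  "simple_graph V adj \<longleftrightarrow>
     (\<forall>x y. adj x y \<longrightarrow> x \<in> V \<and> y \<in> V \<and> x \<noteq> y \<and> adj y x)"

definition connected_graph :: "'a set \<Rightarrow> ('a \<Rightarrow> 'a \<Rightarrow> bool) \<Rightarrow> bool" where
  "connected_graph V adj \<longleftrightarrow> V \<noteq> {} \<and> (\<forall>x\<in>V. \<forall>y\<in>V. adj\<^sup>*\<^sup>* x y)"

definition graph_iso :: "'a set \<Rightarrow> ('a \<Rightarrow> 'a \<Rightarrow> bool) \<Rightarrow> 'b set \<Rightarrow> ('b \<Rightarrow> 'b \<Rightarrow> bool) \<Rightarrow> bool" where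
  "graph_iso A r B s \<longleftrightarrow>
     (\<exists>f. bij_betw f A B \<and> (\<forall>x\<in>A. \<forall>y\<in>A. r x y \<longleftrightarrow> s (f x) (f y)))"

text \<open>Elements 0, 1, w, w+1 where w^2 = w + 1.\<close>
datatype gf4 = G0 | G1 | Gw | Gw1

fun gf4_bits :: "gf4 \<Rightarrow> bool \<times> bool" where
  "gf4_bits G0 = (False, False)" | "gf4_bits G1 = (True, False)"
| "gf4_bits Gw = (False, True)" | "gf4_bits Gw1 = (True, True)"

fun gf4_of_bits :: "bool \<times> bool \<Rightarrow> gf4" where
  "gf4_of_bits (False, False) = G0" | "gf4_of_bits (True, False) = G1"
| "gf4_of_bits (False, True) = Gw" | "gf4_of_bits (True, True) = Gw1"

definition gf4_add :: "gf4 \<Rightarrow> gf4 \<Rightarrow> gf4" where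
  "gf4_add x y = (case (gf4_bits x, gf4_bits y) of ((a0, a1), (b0, b1)) \<Rightarrow>
      gf4_of_bits (a0 \<noteq> b0, a1 \<noteq> b1))"

text \<open>(a0 + a1 w)(b0 + b1 w) = (a0 b0 + a1 b1) + (a0 b1 + a1 b0 + a1 b1) w.\<close>
definition gf4_mul :: "gf4 \<Rightarrow> gf4 \<Rightarrow> gf4" where
  "gf4_mul x y = (case (gf4_bits x, gf4_bits y) of ((a0, a1), (b0, b1)) \<Rightarrow>
      gf4_of_bits ((a0 \<and> b0) \<noteq> (a1 \<and> b1), ((a0 \<and> b1) \<noteq> (a1 \<and> b0)) \<noteq> (a1 \<and> b1)))"

instantiation gf4 :: comm_ring_1
begin
definition "zero_gf4 = G0"
definition "one_gf4 = G1"
definition "plus_gf4 = gf4_add"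
definition "times_gf4 = gf4_mul"
definition "uminus_gf4 = (\<lambda>x::gf4. x)"
definition "minus_gf4 = gf4_add"
instance
proof
  fix a b c :: gf4
  show "a + b + c = a + (b + c)"
    by (cases a; cases b; cases c) (simp_all add: plus_gf4_def gf4_add_def)
  show "a + b = b + a"
    by (cases a; cases b) (simp_all add: plus_gf4_def gf4_add_def)
  show "0 + a = a"
    by (cases a) (simp_all add: plus_gf4_def gf4_add_def zero_gf4_def)
  show "- a + a = 0"
    by (cases a) (simp_all add: plus_gf4_def gf4_add_def zero_gf4_def uminus_gf4_def)
  show "a - b = a + - b"
    by (simp add: plus_gf4_def minus_gf4_def uminus_gf4_def)
  show "a * b * c = a * (b * c)"
    by (cases a; cases b; cases c) (simp_all add: times_gf4_def gf4_mul_def)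
  show "a * b = b * a"
    by (cases a; cases b) (simp_all add: times_gf4_def gf4_mul_def)
  show "1 * a = a"
    by (cases a) (simp_all add: times_gf4_def gf4_mul_def one_gf4_def)
  show "(a + b) * c = a * c + b * c"
    by (cases a; cases b; cases c) (simp_all add: times_gf4_def gf4_mul_def plus_gf4_def gf4_add_def)
  show "(0::gf4) \<noteq> 1"
    by (simp add: zero_gf4_def one_gf4_def)
qed
end

definition gf4_conj :: "gf4 \<Rightarrow> gf4" where
  "gf4_conj x = x * x"

definition smul :: "'k::comm_ring_1 \<Rightarrow> ('n \<Rightarrow> 'k) \<Rightarrow> ('n \<Rightarrow> 'k)" where
  "smul c v = (\<lambda>i. c * v i)"

text \<open>The projective point spanned by a vector v: its nonzero scalar multiples
(used only for fields, GF(3) and GF(4)).\<close>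
definition proj_pt :: "('n \<Rightarrow> 'k::comm_ring_1) \<Rightarrow> ('n \<Rightarrow> 'k) set" where
  "proj_pt v = {smul c v | c. c \<noteq> 0}"

definition proj_points :: "('n \<Rightarrow> 'k::comm_ring_1) set set" where
  "proj_points = {proj_pt v | v. v \<noteq> (\<lambda>_. 0)}"

definition symp3 :: "(4 \<Rightarrow> 3) \<Rightarrow> (4 \<Rightarrow> 3) \<Rightarrow> 3" where
  "symp3 x y = x 0 * y 1 - x 1 * y 0 + x 2 * y 3 - x 3 * y 2"

definition W3_points :: "(4 \<Rightarrow> 3) set set" where
  "W3_points = proj_points"

definition W3_coll :: "(4 \<Rightarrow> 3) set \<Rightarrow> (4 \<Rightarrow> 3) set \<Rightarrow> bool" where
  "W3_coll P Q \<longleftrightarrow> P \<in> W3_points \<and> Q \<in> W3_points \<and> P \<noteq> Q \<and>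
     (\<forall>x\<in>P. \<forall>y\<in>Q. \<forall>a b c d.
        symp3 (\<lambda>i. a * x i + b * y i) (\<lambda>i. c * x i + d * y i) = 0)"

definition quad3 :: "(5 \<Rightarrow> 3) \<Rightarrow> 3" where
  "quad3 x = x 0 * x 1 + x 2 * x 3 + x 4 * x 4"

definition Q43_points :: "(5 \<Rightarrow> 3) set set" where
  "Q43_points = {P \<in> proj_points. \<forall>x\<in>P. quad3 x = 0}"

definition Q43_coll :: "(5 \<Rightarrow> 3) set \<Rightarrow> (5 \<Rightarrow> 3) set \<Rightarrow> bool" where
  "Q43_coll P Q \<longleftrightarrow> P \<in> Q43_points \<and> Q \<in> Q43_points \<and> P \<noteq> Q \<and>
     (\<forall>x\<in>P. \<forall>y\<in>Q. \<forall>a b. quad3 (\<lambda>i. a * x i + b * y i) = 0)"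

text \<open>Standard nondegenerate hermitian form on GF(4)^n, the dimension n being
the cardinality of the finite index type 'n.\<close>
definition herm :: "('n::finite \<Rightarrow> gf4) \<Rightarrow> ('n \<Rightarrow> gf4) \<Rightarrow> gf4" where
  "herm x y = (\<Sum>i\<in>UNIV. x i * gf4_conj (y i))"

definition U_vertices :: "('n::finite \<Rightarrow> gf4) set set" where
  "U_vertices = {P \<in> proj_points. \<forall>x\<in>P. herm x x \<noteq> 0}"

definition U_adj :: "('n::finite \<Rightarrow> gf4) set \<Rightarrow> ('n \<Rightarrow> gf4) set \<Rightarrow> bool" where
  "U_adj P Q \<longleftrightarrow> P \<in> U_vertices \<and> Q \<in> U_vertices \<and> (\<forall>x\<in>P. \<forall>y\<in>Q. herm x y = 0)"

end

theory Submission
  imports Defs "HOL-Library.Code_Binary_Nat"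
begin

text \<open>Fix a vertex \<open>u\<close> and a vertex \<open>w\<close> at distance 2. The common neighbours of \<open>u\<close> and \<open>w\<close> form a hyperoval
  of the generalized quadrangle at \<open>u\<close> (every line is met in 0 or 2 points), and the three hyperovals coming
  from the further points of a 5-clique through an edge at \<open>u\<close> constrain each other. Both quadrangles of order
  (3,3) are given by explicit tables of lines, and propositional reasoning on these tables shows that the
  hyperovals at a vertex of type W(3) induce complete bipartite graphs, that the type is constant on the
  graph, and that the type of the parabolic quadrangle is impossible.

  The vertices of a 5-clique serve as an orthogonal frame. A vertex outside the frame is adjacent to
  exactly two or to no frame vertices. The local tables give exponents of coordinates for the former,
  a vertex of the latter kind is used to normalise them, and completeness of the bipartite graphs makes the
  five local coordinate systems agree up to a field automorphism, which is a matter of choosing signs. The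
  remaining vertices get their coordinates from their neighbours, and adjacency becomes orthogonality.\<close>

text \<open>The local part rests on one parity rule: by the quadrangle axiom a vertex outside a
  5-clique is adjacent to none or to exactly two of its members. For a clique through
  \<open>u\<close> it makes the common neighbours of \<open>u\<close> and \<open>w\<close> a
  hyperoval; for a clique through \<open>w\<close> it says how the hyperovals of its members overlap
  in the quadrangle at \<open>u\<close>. Exchanging \<open>u\<close> and \<open>w\<close> turns a
  fact about the overlap of two hyperovals into a fact about a single one, and this gives the
  condition \<open>pcond\<close>. The parabolic type fails because of antipodes: suitable hyperovals
  at \<open>u\<close> belonging to nonadjacent \<open>w\<close>, \<open>w'\<close> would give the
  same point \<open>v\<close> antipodes that are equal or adjacent, while a triad of Q_4(3) has
  either no centre or exactly two. The coordinates work because orthogonality over GF(4) can be read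
  off from exponents modulo 3: two powers of a primitive element sum to 0 iff they are equal, three
  iff they are distinct, five iff three are equal and the other two are the two remaining values.
  Vertices outside the frame have nonzero coordinates in three or five places, so only sums of one,
  two, three or five powers occur.\<close>

section \<open>The two quadrangles as tables, and conditions on sets of their points\<close>

definition linesW :: "nat list list" where
  "linesW =
    [[0, 1, 2, 3], [0, 4, 5, 6], [0, 7, 8, 9], [0, 10, 11, 12], [1, 13, 22, 31], [1, 14, 23, 32], [1, 15, 24,
     33], [2, 19, 29, 39], [2, 20, 30, 37], [2, 21, 28, 38], [3, 16, 27, 35], [3, 17, 25, 36], [3, 18, 26,
     34], [4, 13, 16, 19], [4, 14, 17, 20], [4, 15, 18, 21], [5, 22, 26, 30], [5, 23, 27, 28], [5, 24, 25,
     29], [6, 31, 36, 38], [6, 32, 34, 39], [6, 33, 35, 37], [7, 13, 25, 37], [7, 14, 26, 38], [7, 15, 27,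
     39], [8, 19, 23, 36], [8, 20, 24, 34], [8, 21, 22, 35], [9, 16, 30, 32], [9, 17, 28, 33], [9, 18, 29,
     31], [10, 13, 28, 34], [10, 14, 29, 35], [10, 15, 30, 36], [11, 19, 26, 33], [11, 20, 27, 31], [11, 21,
     25, 32], [12, 16, 24, 38], [12, 17, 22, 39], [12, 18, 23, 37]]"

definition linesQ :: "nat list list" where
  "linesQ =
    [[0, 1, 2, 3], [0, 4, 5, 6], [0, 7, 8, 9], [0, 10, 11, 12], [1, 13, 17, 21], [1, 14, 18, 19], [1, 15, 16,
     20], [2, 22, 26, 30], [2, 23, 27, 28], [2, 24, 25, 29], [3, 31, 35, 39], [3, 32, 36, 37], [3, 33, 34,
     38], [4, 13, 23, 33], [4, 14, 24, 31], [4, 15, 22, 32], [5, 16, 26, 36], [5, 17, 27, 34], [5, 18, 25,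
     35], [6, 19, 29, 39], [6, 20, 30, 37], [6, 21, 28, 38], [7, 13, 25, 37], [8, 14, 26, 38], [9, 15, 27,
     39], [7, 16, 28, 31], [8, 17, 29, 32], [9, 18, 30, 33], [7, 19, 22, 34], [8, 20, 23, 35], [9, 21, 24,
     36], [10, 13, 26, 39], [12, 14, 27, 37], [11, 15, 25, 38], [12, 16, 29, 33], [11, 17, 30, 31], [10, 18,
     28, 32], [11, 19, 23, 36], [10, 20, 24, 34], [12, 21, 22, 35]]"

definition nbs :: "nat list list \<Rightarrow> nat \<Rightarrow> nat list" where
  "nbs L x = remdups (filter (\<lambda>y. y \<noteq> x) (concat (filter (\<lambda>l. x \<in> set l) L)))"

fun hyp_line :: "(nat \<Rightarrow> bool) \<Rightarrow> nat list \<Rightarrow> bool" where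
  "hyp_line f [a, b, c, d] =
    ((f a \<longrightarrow> f b \<or> f c \<or> f d) \<and> (f b \<longrightarrow> f a \<or> f c \<or> f d) \<and>
     (f c \<longrightarrow> f b \<or> f a \<or> f d) \<and> (f d \<longrightarrow> f b \<or> f c \<or> f a) \<and>
     (\<not> f a \<or> \<not> f b \<or> \<not> f c) \<and> (\<not> f a \<or> \<not> f b \<or> \<not> f d) \<and>
     (\<not> f a \<or> \<not> f c \<or> \<not> f d) \<and> (\<not> f b \<or> \<not> f c \<or> \<not> f d))"
| "hyp_line f _ = True"

definition hyperoval :: "nat list list \<Rightarrow> (nat \<Rightarrow> bool) \<Rightarrow> bool" where
  "hyperoval L f = list_all (hyp_line f) L"

fun at_most_one :: "(nat \<Rightarrow> bool) \<Rightarrow> nat list \<Rightarrow> bool" where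
  "at_most_one f [] = True"
| "at_most_one f (x # xs) = (list_all (\<lambda>y. \<not> f x \<or> \<not> f y) xs \<and> at_most_one f xs)"

text \<open>Points 0 and \<open>d\<close> stand for two vertices of a 5-clique. \<open>aset\<close>
  collects the points that see exactly one of them and \<open>yset\<close> those that see neither:
  the two cases of the parity rule for the other three vertices of the clique.\<close>

definition aset :: "nat list list \<Rightarrow> nat \<Rightarrow> nat list" where
  "aset L d = (let n0 = nbs L 0; nd = nbs L d in
     filter (\<lambda>x. (x \<in> set n0) \<noteq> (x \<in> set nd) \<and> x \<noteq> 0 \<and> x \<noteq> d) [0..<40])"

definition yset :: "nat list list \<Rightarrow> nat \<Rightarrow> nat list" where
  "yset L d = (let n0 = nbs L 0; nd = nbs L d in
     filter (\<lambda>x. x \<notin> set n0 \<and> x \<notin> set nd) [1..<40])"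

definition ynb :: "nat list list \<Rightarrow> nat \<Rightarrow> (nat \<times> nat list) list" where
  "ynb L d = (let ys = yset L d in map (\<lambda>x. (x, filter (\<lambda>z. z \<in> set ys) (nbs L x))) ys)"

definition ynon :: "nat list list \<Rightarrow> nat \<Rightarrow> (nat \<times> nat list) list" where
  "ynon L d = (let ys = yset L d in
     map (\<lambda>x. let n = nbs L x in (x, filter (\<lambda>z. z \<noteq> x \<and> z \<notin> set n) ys)) ys)"

definition far :: "nat list list \<Rightarrow> nat list" where
  "far L = (let n0 = nbs L 0 in filter (\<lambda>x. x \<notin> set n0) [1..<40])"

definition dnon :: "nat list list \<Rightarrow> (nat \<times> nat list) list" where
  "dnon L = (let n0 = nbs L 0 in
     map (\<lambda>x. let n = nbs L x in (x, filter (\<lambda>d. d \<notin> set n) n0)) (far L))"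

definition plist :: "nat list list \<Rightarrow> (nat \<times> (nat \<times> nat) list) list" where
  "plist L = (let fs = far L in
     map (\<lambda>e. let xs = filter (\<lambda>x. x \<in> set fs) (nbs L e) in
       (e, concat (map (\<lambda>y. let n = nbs L y in map (Pair y) (filter (\<lambda>z. y < z \<and> z \<notin> set n) xs)) xs)))
     (nbs L 0))"

definition one_of :: "bool \<Rightarrow> bool \<Rightarrow> bool \<Rightarrow> bool" where
  "one_of a b c = ((a \<or> b \<or> c) \<and> (\<not> a \<or> \<not> b) \<and> (\<not> a \<or> \<not> c) \<and> (\<not> b \<or> \<not> c))"

definition none_or_two_of :: "bool \<Rightarrow> bool \<Rightarrow> bool \<Rightarrow> bool" where
  "none_or_two_of a b c =
     ((\<not> a \<or> \<not> b \<or> \<not> c) \<and> (\<not> a \<or> b \<or> c) \<and> (a \<or> \<not> b \<or> c) \<and> (a \<or> b \<or> \<not> c))"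

definition matched :: "(nat \<times> nat list) list \<Rightarrow> (nat \<Rightarrow> bool) \<Rightarrow> bool" where
  "matched ys f = list_all (\<lambda>(x, zs). f x \<longrightarrow> list_ex f zs) ys"

definition sparse :: "(nat \<times> nat list) list \<Rightarrow> (nat \<Rightarrow> bool) \<Rightarrow> bool" where
  "sparse ys f = list_all (\<lambda>(x, zs). f x \<longrightarrow> at_most_one f zs) ys"

text \<open>\<open>f\<close>, \<open>g\<close>, \<open>h\<close> are the traces of the three other
  members of a 5-clique through the points 0 and \<open>d\<close>. A point sees none or two members
  in all, hence one of the three on \<open>aset\<close> and none or two on
  \<open>yset\<close>.\<close>

definition split3 :: "nat list list \<Rightarrow> nat \<Rightarrow> (nat \<Rightarrow> bool) \<Rightarrow> (nat \<Rightarrow> bool) \<Rightarrow> (nat \<Rightarrow> bool) \<Rightarrow> bool" where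
  "split3 L d f g h \<longleftrightarrow> f 0 \<and> g 0 \<and> h 0 \<and> f d \<and> g d \<and> h d \<and>
     list_all (\<lambda>x. one_of (f x) (g x) (h x)) (aset L d) \<and>
     list_all (\<lambda>x. none_or_two_of (f x) (g x) (h x)) (yset L d)"

text \<open>A name for an intersection: one fresh variable per point stands for the conjunction,
  which keeps the clauses given to \<open>sat\<close> short.\<close>

definition both_on :: "nat list \<Rightarrow> (nat \<Rightarrow> bool) \<Rightarrow> (nat \<Rightarrow> bool) \<Rightarrow> (nat \<Rightarrow> bool) \<Rightarrow> bool" where
  "both_on ys f g i = list_all (\<lambda>x. i x = (f x \<and> g x)) ys"

definition triple :: "nat list list \<Rightarrow> nat \<Rightarrow> (nat \<Rightarrow> bool) \<Rightarrow> (nat \<Rightarrow> bool) \<Rightarrow> (nat \<Rightarrow> bool) \<Rightarrow> bool" where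
  "triple L d f g h \<longleftrightarrow> split3 L d f g h \<and>
     matched (ynb L d) (\<lambda>x. f x \<and> g x) \<and> sparse (ynb L d) (\<lambda>x. f x \<and> g x) \<and>
     matched (ynb L d) (\<lambda>x. f x \<and> h x) \<and> sparse (ynb L d) (\<lambda>x. f x \<and> h x) \<and>
     matched (ynb L d) (\<lambda>x. g x \<and> h x) \<and> sparse (ynb L d) (\<lambda>x. g x \<and> h x)"

text \<open>For a neighbour \<open>e\<close> of 0 outside the set, members of the set that are
  collinear with \<open>e\<close> but not with 0 are pairwise collinear. This is
  \<open>overlap_clique\<close> read from the other end of the pair \<open>u\<close>,
  \<open>w\<close>; see \<open>pcond_common\<close>.\<close>

definition pcond :: "nat list list \<Rightarrow> (nat \<Rightarrow> bool) \<Rightarrow> bool" where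
  "pcond L f = list_all (\<lambda>(e, ps). f e \<or> list_all (\<lambda>(y, z). \<not> f y \<or> \<not> f z) ps) (plist L)"

text \<open>Complete bipartiteness as seen from the base point 0: each member collinear with 0 is
  collinear with each member that is far from 0.\<close>

definition kbase :: "nat list list \<Rightarrow> (nat \<Rightarrow> bool) \<Rightarrow> bool" where
  "kbase L f = list_all (\<lambda>(x, ds). list_all (\<lambda>d. \<not> f x \<or> \<not> f d) ds) (dnon L)"

definition no_antipode :: "nat list list \<Rightarrow> (nat \<Rightarrow> bool) \<Rightarrow> bool" where
  "no_antipode L f = list_all (\<lambda>(x, ds). \<not> f x \<or> list_ex f ds) (dnon L)"

text \<open>The extra clause for singletons ends the recursion without a trailing
  \<open>True\<close>, so that an unfolded table is just the conjunction of its instances.\<close>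

lemma list_all_unfold:
  "list_all f [] = True" "list_all f [x] = f x"
  "list_all f (x # y # ys) = (f x \<and> list_all f (y # ys))"
  by auto

lemma list_ex_unfold:
  "list_ex f [] = False" "list_ex f [x] = f x"
  "list_ex f (x # y # ys) = (f x \<or> list_ex f (y # ys))"
  by auto

lemma at_most_one_unfold:
  "at_most_one f [] = True" "at_most_one f [x] = True"
  "at_most_one f [x, y] = (\<not> f x \<or> \<not> f y)"
  "at_most_one f (x # y # z # xs) =
     (list_all (\<lambda>y. \<not> f x \<or> \<not> f y) (y # z # xs) \<and> at_most_one f (y # z # xs))"
  by auto

lemmas prop_unfold = split3_def both_on_def matched_def sparse_def hyperoval_def one_of_def
  none_or_two_of_def pcond_def kbase_def no_antipode_def prod.case hyp_line.simps list_all_unfold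
  list_ex_unfold at_most_one_unfold

section \<open>Evaluated tables and the propositional facts about them\<close>

lemma table_eval_W:
  "aset linesW 1 =
     [4, 5, 6, 7, 8, 9, 10, 11, 12, 13, 14, 15, 22, 23, 24, 31, 32, 33]"
  "yset linesW 1 =
     [16, 17, 18, 19, 20, 21, 25, 26, 27, 28, 29, 30, 34, 35, 36, 37, 38, 39]"
  "ynb linesW 1 =
     [(16, [27, 35, 19, 30, 38]), (17, [25, 36, 20, 28, 39]), (18, [26, 34, 21, 29, 37]), (19, [29, 39, 16,
     36, 26]), (20, [30, 37, 17, 34, 27]), (21, [28, 38, 18, 35, 25]), (25, [17, 36, 29, 37, 21]), (26, [18,
     34, 30, 38, 19]), (27, [16, 35, 28, 39, 20]), (28, [21, 38, 27, 17, 34]), (29, [19, 39, 25, 18, 35]),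
     (30, [20, 37, 26, 16, 36]), (34, [18, 26, 39, 20, 28]), (35, [16, 27, 37, 21, 29]), (36, [17, 25, 38, 19,
     30]), (37, [20, 30, 35, 25, 18]), (38, [21, 28, 36, 26, 16]), (39, [19, 29, 34, 27, 17])]"
  "aset linesW 4 =
     [1, 2, 3, 7, 8, 9, 10, 11, 12, 13, 14, 15, 16, 17, 18, 19, 20, 21]"
  "yset linesW 4 =
     [22, 23, 24, 25, 26, 27, 28, 29, 30, 31, 32, 33, 34, 35, 36, 37, 38, 39]"
  "ynb linesW 4 =
     [(22, [31, 26, 30, 35, 39]), (23, [32, 27, 28, 36, 37]), (24, [33, 25, 29, 34, 38]), (25, [36, 24, 29,
     37, 32]), (26, [34, 22, 30, 38, 33]), (27, [35, 23, 28, 39, 31]), (28, [38, 23, 27, 33, 34]), (29, [39,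
     24, 25, 31, 35]), (30, [37, 22, 26, 32, 36]), (31, [22, 36, 38, 29, 27]), (32, [23, 34, 39, 30, 25]),
     (33, [24, 35, 37, 28, 26]), (34, [26, 32, 39, 24, 28]), (35, [27, 33, 37, 22, 29]), (36, [25, 31, 38, 23,
     30]), (37, [30, 33, 35, 25, 23]), (38, [28, 31, 36, 26, 24]), (39, [29, 32, 34, 27, 22])]"
  "aset linesW 5 =
     [1, 2, 3, 7, 8, 9, 10, 11, 12, 22, 23, 24, 25, 26, 27, 28, 29, 30]"
  "yset linesW 5 =
     [13, 14, 15, 16, 17, 18, 19, 20, 21, 31, 32, 33, 34, 35, 36, 37, 38, 39]"
  "ynb linesW 5 =
     [(13, [31, 16, 19, 37, 34]), (14, [32, 17, 20, 38, 35]), (15, [33, 18, 21, 39, 36]), (16, [35, 13, 19,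
     32, 38]), (17, [36, 14, 20, 33, 39]), (18, [34, 15, 21, 31, 37]), (19, [39, 13, 16, 36, 33]), (20, [37,
     14, 17, 34, 31]), (21, [38, 15, 18, 35, 32]), (31, [13, 36, 38, 18, 20]), (32, [14, 34, 39, 16, 21]),
     (33, [15, 35, 37, 17, 19]), (34, [18, 32, 39, 20, 13]), (35, [16, 33, 37, 21, 14]), (36, [17, 31, 38, 19,
     15]), (37, [20, 33, 35, 13, 18]), (38, [21, 31, 36, 14, 16]), (39, [19, 32, 34, 15, 17])]"
  "aset linesW 6 =
     [1, 2, 3, 7, 8, 9, 10, 11, 12, 31, 32, 33, 34, 35, 36, 37, 38, 39]"
  "yset linesW 6 =
     [13, 14, 15, 16, 17, 18, 19, 20, 21, 22, 23, 24, 25, 26, 27, 28, 29, 30]"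
  "ynb linesW 6 =
     [(13, [22, 16, 19, 25, 28]), (14, [23, 17, 20, 26, 29]), (15, [24, 18, 21, 27, 30]), (16, [27, 13, 19,
     30, 24]), (17, [25, 14, 20, 28, 22]), (18, [26, 15, 21, 29, 23]), (19, [29, 13, 16, 23, 26]), (20, [30,
     14, 17, 24, 27]), (21, [28, 15, 18, 22, 25]), (22, [13, 26, 30, 21, 17]), (23, [14, 27, 28, 19, 18]),
     (24, [15, 25, 29, 20, 16]), (25, [17, 24, 29, 13, 21]), (26, [18, 22, 30, 14, 19]), (27, [16, 23, 28, 15,
     20]), (28, [21, 23, 27, 17, 13]), (29, [19, 24, 25, 18, 14]), (30, [20, 22, 26, 16, 15])]"
  by code_simp+

lemma ynon_eval_W:
  "ynon linesW 1 =
     [(16, [17, 18, 20, 21, 25, 26, 28, 29, 34, 36, 37, 39]), (17, [16, 18, 19, 21, 26, 27, 29, 30, 34, 35,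
     37, 38]), (18, [16, 17, 19, 20, 25, 27, 28, 30, 35, 36, 38, 39]), (19, [17, 18, 20, 21, 25, 27, 28, 30,
     34, 35, 37, 38]), (20, [16, 18, 19, 21, 25, 26, 28, 29, 35, 36, 38, 39]), (21, [16, 17, 19, 20, 26, 27,
     29, 30, 34, 36, 37, 39]), (25, [16, 18, 19, 20, 26, 27, 28, 30, 34, 35, 38, 39]), (26, [16, 17, 20, 21,
     25, 27, 28, 29, 35, 36, 37, 39]), (27, [17, 18, 19, 21, 25, 26, 29, 30, 34, 36, 37, 38]), (28, [16, 18,
     19, 20, 25, 26, 29, 30, 35, 36, 37, 39]), (29, [16, 17, 20, 21, 26, 27, 28, 30, 34, 36, 37, 38]), (30,
     [17, 18, 19, 21, 25, 27, 28, 29, 34, 35, 38, 39]), (34, [16, 17, 19, 21, 25, 27, 29, 30, 35, 36, 37,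
     38]), (35, [17, 18, 19, 20, 25, 26, 28, 30, 34, 36, 38, 39]), (36, [16, 18, 20, 21, 26, 27, 28, 29, 34,
     35, 37, 39]), (37, [16, 17, 19, 21, 26, 27, 28, 29, 34, 36, 38, 39]), (38, [17, 18, 19, 20, 25, 27, 29,
     30, 34, 35, 37, 39]), (39, [16, 18, 20, 21, 25, 26, 28, 30, 35, 36, 37, 38])]"
  by code_simp

lemma plist_eval_W:
  "plist linesW =
     [(1, [(13, 14), (13, 23), (13, 32), (13, 15), (13, 24), (13, 33), (22, 23), (22, 32), (22, 24), (22, 33),
     (31, 32), (31, 33), (14, 22), (14, 31), (14, 15), (14, 24), (14, 33), (23, 31), (23, 24), (23, 33), (32,
     33), (15, 22), (15, 31), (15, 23), (15, 32), (24, 31), (24, 32)]), (2, [(19, 20), (19, 30), (19, 37),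
     (19, 21), (19, 28), (19, 38), (29, 30), (29, 37), (29, 38), (20, 29), (20, 39), (20, 21), (20, 28), (20,
     38), (30, 39), (30, 38), (37, 39), (37, 38), (21, 29), (21, 39), (21, 30), (21, 37), (28, 29), (28, 39),
     (28, 30), (28, 37), (38, 39)]), (3, [(16, 17), (16, 25), (16, 36), (16, 18), (16, 26), (16, 34), (27,
     36), (27, 34), (35, 36), (17, 27), (17, 35), (17, 18), (17, 26), (17, 34), (25, 27), (25, 35), (25, 26),
     (25, 34), (18, 27), (18, 35), (18, 25), (18, 36), (26, 27), (26, 35), (26, 36), (34, 35), (34, 36)]), (4,
     [(13, 14), (13, 17), (13, 20), (13, 15), (13, 18), (13, 21), (16, 17), (16, 20), (16, 18), (16, 21), (19,
     20), (19, 21), (14, 16), (14, 19), (14, 15), (14, 18), (14, 21), (17, 19), (17, 18), (17, 21), (20, 21),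
     (15, 16), (15, 19), (15, 17), (15, 20), (18, 19), (18, 20)]), (5, [(22, 23), (22, 27), (22, 28), (22,
     24), (22, 25), (22, 29), (26, 27), (26, 28), (26, 29), (23, 26), (23, 30), (23, 24), (23, 25), (23, 29),
     (27, 30), (27, 29), (28, 30), (28, 29), (24, 26), (24, 30), (24, 27), (24, 28), (25, 26), (25, 30), (25,
     27), (25, 28), (29, 30)]), (6, [(31, 32), (31, 34), (31, 39), (31, 33), (31, 35), (31, 37), (36, 39),
     (36, 37), (38, 39), (32, 36), (32, 38), (32, 33), (32, 35), (32, 37), (34, 36), (34, 38), (34, 35), (34,
     37), (33, 36), (33, 38), (33, 34), (33, 39), (35, 36), (35, 38), (35, 39), (37, 38), (37, 39)]), (7,
     [(13, 14), (13, 26), (13, 38), (13, 15), (13, 27), (13, 39), (25, 26), (25, 38), (25, 27), (25, 39), (37,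
     38), (37, 39), (14, 25), (14, 37), (14, 15), (14, 27), (14, 39), (26, 37), (26, 27), (26, 39), (38, 39),
     (15, 25), (15, 37), (15, 26), (15, 38), (27, 37), (27, 38)]), (8, [(19, 20), (19, 24), (19, 34), (19,
     21), (19, 22), (19, 35), (23, 24), (23, 34), (23, 35), (20, 23), (20, 36), (20, 21), (20, 22), (20, 35),
     (24, 36), (24, 35), (34, 36), (34, 35), (21, 23), (21, 36), (21, 24), (21, 34), (22, 23), (22, 36), (22,
     24), (22, 34), (35, 36)]), (9, [(16, 17), (16, 28), (16, 33), (16, 18), (16, 29), (16, 31), (30, 33),
     (30, 31), (32, 33), (17, 30), (17, 32), (17, 18), (17, 29), (17, 31), (28, 30), (28, 32), (28, 29), (28,
     31), (18, 30), (18, 32), (18, 28), (18, 33), (29, 30), (29, 32), (29, 33), (31, 32), (31, 33)]), (10,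
     [(13, 14), (13, 29), (13, 35), (13, 15), (13, 30), (13, 36), (28, 29), (28, 35), (28, 30), (28, 36), (34,
     35), (34, 36), (14, 28), (14, 34), (14, 15), (14, 30), (14, 36), (29, 34), (29, 30), (29, 36), (35, 36),
     (15, 28), (15, 34), (15, 29), (15, 35), (30, 34), (30, 35)]), (11, [(19, 20), (19, 27), (19, 31), (19,
     21), (19, 25), (19, 32), (26, 27), (26, 31), (26, 32), (20, 26), (20, 33), (20, 21), (20, 25), (20, 32),
     (27, 33), (27, 32), (31, 33), (31, 32), (21, 26), (21, 33), (21, 27), (21, 31), (25, 26), (25, 33), (25,
     27), (25, 31), (32, 33)]), (12, [(16, 17), (16, 22), (16, 39), (16, 18), (16, 23), (16, 37), (24, 39),
     (24, 37), (38, 39), (17, 24), (17, 38), (17, 18), (17, 23), (17, 37), (22, 24), (22, 38), (22, 23), (22,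
     37), (18, 24), (18, 38), (18, 22), (18, 39), (23, 24), (23, 38), (23, 39), (37, 38), (37, 39)])]"
  by code_simp

lemma dnon_eval_W:
  "dnon linesW =
     [(13, [2, 3, 5, 6, 8, 9, 11, 12]), (14, [2, 3, 5, 6, 8, 9, 11, 12]), (15, [2, 3, 5, 6, 8, 9, 11, 12]),
     (16, [1, 2, 5, 6, 7, 8, 10, 11]), (17, [1, 2, 5, 6, 7, 8, 10, 11]), (18, [1, 2, 5, 6, 7, 8, 10, 11]),
     (19, [1, 3, 5, 6, 7, 9, 10, 12]), (20, [1, 3, 5, 6, 7, 9, 10, 12]), (21, [1, 3, 5, 6, 7, 9, 10, 12]),
     (22, [2, 3, 4, 6, 7, 9, 10, 11]), (23, [2, 3, 4, 6, 7, 9, 10, 11]), (24, [2, 3, 4, 6, 7, 9, 10, 11]),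
     (25, [1, 2, 4, 6, 8, 9, 10, 12]), (26, [1, 2, 4, 6, 8, 9, 10, 12]), (27, [1, 2, 4, 6, 8, 9, 10, 12]),
     (28, [1, 3, 4, 6, 7, 8, 11, 12]), (29, [1, 3, 4, 6, 7, 8, 11, 12]), (30, [1, 3, 4, 6, 7, 8, 11, 12]),
     (31, [2, 3, 4, 5, 7, 8, 10, 12]), (32, [2, 3, 4, 5, 7, 8, 10, 12]), (33, [2, 3, 4, 5, 7, 8, 10, 12]),
     (34, [1, 2, 4, 5, 7, 9, 11, 12]), (35, [1, 2, 4, 5, 7, 9, 11, 12]), (36, [1, 2, 4, 5, 7, 9, 11, 12]),
     (37, [1, 3, 4, 5, 8, 9, 10, 11]), (38, [1, 3, 4, 5, 8, 9, 10, 11]), (39, [1, 3, 4, 5, 8, 9, 10, 11])]"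
  by code_simp

lemma far_eval_W:
  "far linesW =
     [13, 14, 15, 16, 17, 18, 19, 20, 21, 22, 23, 24, 25, 26, 27, 28, 29, 30, 31, 32, 33, 34, 35, 36, 37, 38,
     39]"
  by code_simp

lemma table_eval_Q:
  "aset linesQ 1 =
     [4, 5, 6, 7, 8, 9, 10, 11, 12, 13, 14, 15, 16, 17, 18, 19, 20, 21]"
  "yset linesQ 1 =
     [22, 23, 24, 25, 26, 27, 28, 29, 30, 31, 32, 33, 34, 35, 36, 37, 38, 39]"
  "ynb linesQ 1 =
     [(22, [26, 30, 32, 34, 35]), (23, [27, 28, 33, 35, 36]), (24, [25, 29, 31, 36, 34]), (25, [24, 29, 35,
     37, 38]), (26, [22, 30, 36, 38, 39]), (27, [23, 28, 34, 39, 37]), (28, [23, 27, 38, 31, 32]), (29, [24,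
     25, 39, 32, 33]), (30, [22, 26, 37, 33, 31]), (31, [35, 39, 24, 28, 30]), (32, [36, 37, 22, 29, 28]),
     (33, [34, 38, 23, 30, 29]), (34, [33, 38, 27, 22, 24]), (35, [31, 39, 25, 23, 22]), (36, [32, 37, 26, 24,
     23]), (37, [32, 36, 30, 25, 27]), (38, [33, 34, 28, 26, 25]), (39, [31, 35, 29, 27, 26])]"
  "aset linesQ 4 =
     [1, 2, 3, 7, 8, 9, 10, 11, 12, 13, 14, 15, 22, 23, 24, 31, 32, 33]"
  "yset linesQ 4 =
     [16, 17, 18, 19, 20, 21, 25, 26, 27, 28, 29, 30, 34, 35, 36, 37, 38, 39]"
  "ynb linesQ 4 =
     [(16, [20, 26, 36, 28, 29]), (17, [21, 27, 34, 29, 30]), (18, [19, 25, 35, 30, 28]), (19, [18, 29, 39,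
     34, 36]), (20, [16, 30, 37, 35, 34]), (21, [17, 28, 38, 36, 35]), (25, [29, 18, 35, 37, 38]), (26, [30,
     16, 36, 38, 39]), (27, [28, 17, 34, 39, 37]), (28, [27, 21, 38, 16, 18]), (29, [25, 19, 39, 17, 16]),
     (30, [26, 20, 37, 18, 17]), (34, [38, 17, 27, 19, 20]), (35, [39, 18, 25, 20, 21]), (36, [37, 16, 26, 21,
     19]), (37, [36, 20, 30, 25, 27]), (38, [34, 21, 28, 26, 25]), (39, [35, 19, 29, 27, 26])]"
  "aset linesQ 5 =
     [1, 2, 3, 7, 8, 9, 10, 11, 12, 16, 17, 18, 25, 26, 27, 34, 35, 36]"
  "yset linesQ 5 =
     [13, 14, 15, 19, 20, 21, 22, 23, 24, 28, 29, 30, 31, 32, 33, 37, 38, 39]"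
  "ynb linesQ 5 =
     [(13, [21, 23, 33, 37, 39]), (14, [19, 24, 31, 38, 37]), (15, [20, 22, 32, 39, 38]), (19, [14, 29, 39,
     22, 23]), (20, [15, 30, 37, 23, 24]), (21, [13, 28, 38, 24, 22]), (22, [30, 15, 32, 19, 21]), (23, [28,
     13, 33, 20, 19]), (24, [29, 14, 31, 21, 20]), (28, [23, 21, 38, 31, 32]), (29, [24, 19, 39, 32, 33]),
     (30, [22, 20, 37, 33, 31]), (31, [39, 14, 24, 28, 30]), (32, [37, 15, 22, 29, 28]), (33, [38, 13, 23, 30,
     29]), (37, [32, 20, 30, 13, 14]), (38, [33, 21, 28, 14, 15]), (39, [31, 19, 29, 15, 13])]"
  "aset linesQ 6 =
     [1, 2, 3, 7, 8, 9, 10, 11, 12, 19, 20, 21, 28, 29, 30, 37, 38, 39]"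
  "yset linesQ 6 =
     [13, 14, 15, 16, 17, 18, 22, 23, 24, 25, 26, 27, 31, 32, 33, 34, 35, 36]"
  "ynb linesQ 6 =
     [(13, [17, 23, 33, 25, 26]), (14, [18, 24, 31, 26, 27]), (15, [16, 22, 32, 27, 25]), (16, [15, 26, 36,
     31, 33]), (17, [13, 27, 34, 32, 31]), (18, [14, 25, 35, 33, 32]), (22, [26, 15, 32, 34, 35]), (23, [27,
     13, 33, 35, 36]), (24, [25, 14, 31, 36, 34]), (25, [24, 18, 35, 13, 15]), (26, [22, 16, 36, 14, 13]),
     (27, [23, 17, 34, 15, 14]), (31, [35, 14, 24, 16, 17]), (32, [36, 15, 22, 17, 18]), (33, [34, 13, 23, 18,
     16]), (34, [33, 17, 27, 22, 24]), (35, [31, 18, 25, 23, 22]), (36, [32, 16, 26, 24, 23])]"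
  "aset linesQ 7 =
     [1, 2, 3, 4, 5, 6, 10, 11, 12, 13, 16, 19, 22, 25, 28, 31, 34, 37]"
  "yset linesQ 7 =
     [14, 15, 17, 18, 20, 21, 23, 24, 26, 27, 29, 30, 32, 33, 35, 36, 38, 39]"
  "ynb linesQ 7 =
     [(14, [18, 24, 26, 38, 27]), (15, [20, 32, 27, 39, 38]), (17, [21, 27, 29, 32, 30]), (18, [14, 35, 30,
     33, 32]), (20, [15, 30, 23, 35, 24]), (21, [17, 38, 24, 36, 35]), (23, [27, 33, 20, 35, 36]), (24, [29,
     14, 21, 36, 20]), (26, [30, 36, 14, 38, 39]), (27, [23, 17, 15, 39, 14]), (29, [24, 39, 17, 32, 33]),
     (30, [26, 20, 18, 33, 17]), (32, [36, 15, 17, 29, 18]), (33, [38, 23, 18, 30, 29]), (35, [39, 18, 20, 23,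
     21]), (36, [32, 26, 21, 24, 23]), (38, [33, 21, 14, 26, 15]), (39, [35, 29, 15, 27, 26])]"
  "aset linesQ 10 =
     [1, 2, 3, 4, 5, 6, 7, 8, 9, 13, 18, 20, 24, 26, 28, 32, 34, 39]"
  "yset linesQ 10 =
     [14, 15, 16, 17, 19, 21, 22, 23, 25, 27, 29, 30, 31, 33, 35, 36, 37, 38]"
  "ynb linesQ 10 =
     [(14, [19, 31, 38, 27, 37]), (15, [16, 22, 27, 25, 38]), (16, [15, 36, 31, 29, 33]), (17, [21, 27, 29,
     30, 31]), (19, [14, 29, 22, 23, 36]), (21, [17, 38, 36, 22, 35]), (22, [30, 15, 19, 21, 35]), (23, [27,
     33, 35, 19, 36]), (25, [29, 35, 37, 15, 38]), (27, [23, 17, 15, 14, 37]), (29, [25, 19, 17, 16, 33]),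
     (30, [22, 37, 33, 17, 31]), (31, [35, 14, 16, 17, 30]), (33, [38, 23, 30, 16, 29]), (35, [31, 25, 23, 21,
     22]), (36, [37, 16, 21, 19, 23]), (37, [36, 30, 25, 14, 27]), (38, [33, 21, 14, 15, 25])]"
  "aset linesQ 11 =
     [1, 2, 3, 4, 5, 6, 7, 8, 9, 15, 17, 19, 23, 25, 30, 31, 36, 38]"
  "yset linesQ 11 =
     [13, 14, 16, 18, 20, 21, 22, 24, 26, 27, 28, 29, 32, 33, 34, 35, 37, 39]"
  "ynb linesQ 11 =
     [(13, [21, 33, 37, 26, 39]), (14, [18, 24, 26, 27, 37]), (16, [20, 26, 28, 29, 33]), (18, [14, 35, 33,
     28, 32]), (20, [16, 37, 35, 24, 34]), (21, [13, 28, 24, 22, 35]), (22, [26, 32, 34, 21, 35]), (24, [29,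
     14, 21, 20, 34]), (26, [22, 16, 14, 13, 39]), (27, [28, 34, 39, 14, 37]), (28, [27, 21, 16, 18, 32]),
     (29, [24, 39, 32, 16, 33]), (32, [37, 22, 29, 18, 28]), (33, [34, 13, 18, 16, 29]), (34, [33, 27, 22, 20,
     24]), (35, [39, 18, 20, 21, 22]), (37, [32, 20, 13, 14, 27]), (39, [35, 29, 27, 13, 26])]"
  "aset linesQ 12 =
     [1, 2, 3, 4, 5, 6, 7, 8, 9, 14, 16, 21, 22, 27, 29, 33, 35, 37]"
  "yset linesQ 12 =
     [13, 15, 17, 18, 19, 20, 23, 24, 25, 26, 28, 30, 31, 32, 34, 36, 38, 39]"
  "ynb linesQ 12 =
     [(13, [17, 23, 25, 26, 39]), (15, [20, 32, 39, 25, 38]), (17, [13, 34, 32, 30, 31]), (18, [19, 25, 30,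
     28, 32]), (19, [18, 39, 34, 23, 36]), (20, [15, 30, 23, 24, 34]), (23, [28, 13, 20, 19, 36]), (24, [25,
     31, 36, 20, 34]), (25, [24, 18, 13, 15, 38]), (26, [30, 36, 38, 13, 39]), (28, [23, 38, 31, 18, 32]),
     (30, [26, 20, 18, 17, 31]), (31, [39, 24, 28, 17, 30]), (32, [36, 15, 17, 18, 28]), (34, [38, 17, 19, 20,
     24]), (36, [32, 26, 24, 19, 23]), (38, [34, 28, 26, 15, 25]), (39, [31, 19, 15, 13, 26])]"
  by code_simp+

lemma ynon_eval_Q:
  "ynon linesQ 1 =
     [(22, [23, 24, 25, 27, 28, 29, 31, 33, 36, 37, 38, 39]), (23, [22, 24, 25, 26, 29, 30, 31, 32, 34, 37,
     38, 39]), (24, [22, 23, 26, 27, 28, 30, 32, 33, 35, 37, 38, 39]), (25, [22, 23, 26, 27, 28, 30, 31, 32,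
     33, 34, 36, 39]), (26, [23, 24, 25, 27, 28, 29, 31, 32, 33, 34, 35, 37]), (27, [22, 24, 25, 26, 29, 30,
     31, 32, 33, 35, 36, 38]), (28, [22, 24, 25, 26, 29, 30, 33, 34, 35, 36, 37, 39]), (29, [22, 23, 26, 27,
     28, 30, 31, 34, 35, 36, 37, 38]), (30, [23, 24, 25, 27, 28, 29, 32, 34, 35, 36, 38, 39]), (31, [22, 23,
     25, 26, 27, 29, 32, 33, 34, 36, 37, 38]), (32, [23, 24, 25, 26, 27, 30, 31, 33, 34, 35, 38, 39]), (33,
     [22, 24, 25, 26, 27, 28, 31, 32, 35, 36, 37, 39]), (34, [23, 25, 26, 28, 29, 30, 31, 32, 35, 36, 37,
     39]), (35, [24, 26, 27, 28, 29, 30, 32, 33, 34, 36, 37, 38]), (36, [22, 25, 27, 28, 29, 30, 31, 33, 34,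
     35, 38, 39]), (37, [22, 23, 24, 26, 28, 29, 31, 33, 34, 35, 38, 39]), (38, [22, 23, 24, 27, 29, 30, 31,
     32, 35, 36, 37, 39]), (39, [22, 23, 24, 25, 28, 30, 32, 33, 34, 36, 37, 38])]"
  by code_simp

lemma plist_eval_Q:
  "plist linesQ =
     [(1, [(13, 14), (13, 18), (13, 19), (13, 15), (13, 16), (13, 20), (17, 18), (17, 19), (17, 20), (14, 17),
     (14, 21), (14, 15), (14, 16), (14, 20), (18, 21), (18, 20), (19, 21), (19, 20), (15, 17), (15, 21), (15,
     18), (15, 19), (16, 17), (16, 21), (16, 18), (16, 19), (20, 21)]), (2, [(22, 23), (22, 27), (22, 28),
     (22, 24), (22, 25), (22, 29), (26, 27), (26, 28), (26, 29), (23, 26), (23, 30), (23, 24), (23, 25), (23,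
     29), (27, 30), (27, 29), (28, 30), (28, 29), (24, 26), (24, 30), (24, 27), (24, 28), (25, 26), (25, 30),
     (25, 27), (25, 28), (29, 30)]), (3, [(31, 32), (31, 36), (31, 37), (31, 33), (31, 34), (31, 38), (35,
     36), (35, 37), (35, 38), (32, 35), (32, 39), (32, 33), (32, 34), (32, 38), (36, 39), (36, 38), (37, 39),
     (37, 38), (33, 35), (33, 39), (33, 36), (33, 37), (34, 35), (34, 39), (34, 36), (34, 37), (38, 39)]), (4,
     [(13, 14), (13, 24), (13, 31), (13, 15), (13, 22), (13, 32), (23, 24), (23, 31), (23, 32), (14, 23), (14,
     33), (14, 15), (14, 22), (14, 32), (24, 33), (24, 32), (31, 33), (31, 32), (15, 23), (15, 33), (15, 24),
     (15, 31), (22, 23), (22, 33), (22, 24), (22, 31), (32, 33)]), (5, [(16, 17), (16, 27), (16, 34), (16,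
     18), (16, 25), (16, 35), (26, 27), (26, 34), (26, 35), (17, 26), (17, 36), (17, 18), (17, 25), (17, 35),
     (27, 36), (27, 35), (34, 36), (34, 35), (18, 26), (18, 36), (18, 27), (18, 34), (25, 26), (25, 36), (25,
     27), (25, 34), (35, 36)]), (6, [(19, 20), (19, 30), (19, 37), (19, 21), (19, 28), (19, 38), (29, 30),
     (29, 37), (29, 38), (20, 29), (20, 39), (20, 21), (20, 28), (20, 38), (30, 39), (30, 38), (37, 39), (37,
     38), (21, 29), (21, 39), (21, 30), (21, 37), (28, 29), (28, 39), (28, 30), (28, 37), (38, 39)]), (7,
     [(13, 16), (13, 28), (13, 31), (13, 19), (13, 22), (13, 34), (25, 28), (25, 31), (25, 34), (16, 25), (16,
     37), (16, 19), (16, 22), (16, 34), (28, 37), (28, 34), (31, 37), (31, 34), (19, 25), (19, 37), (19, 28),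
     (19, 31), (22, 25), (22, 37), (22, 28), (22, 31), (34, 37)]), (8, [(14, 17), (14, 29), (14, 32), (14,
     20), (14, 23), (14, 35), (26, 29), (26, 32), (26, 35), (17, 26), (17, 38), (17, 20), (17, 23), (17, 35),
     (29, 38), (29, 35), (32, 38), (32, 35), (20, 26), (20, 38), (20, 29), (20, 32), (23, 26), (23, 38), (23,
     29), (23, 32), (35, 38)]), (9, [(15, 18), (15, 30), (15, 33), (15, 21), (15, 24), (15, 36), (27, 30),
     (27, 33), (27, 36), (18, 27), (18, 39), (18, 21), (18, 24), (18, 36), (30, 39), (30, 36), (33, 39), (33,
     36), (21, 27), (21, 39), (21, 30), (21, 33), (24, 27), (24, 39), (24, 30), (24, 33), (36, 39)]), (10,
     [(13, 18), (13, 28), (13, 32), (13, 20), (13, 24), (13, 34), (26, 28), (26, 32), (26, 34), (18, 26), (18,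
     39), (18, 20), (18, 24), (18, 34), (28, 39), (28, 34), (32, 39), (32, 34), (20, 26), (20, 39), (20, 28),
     (20, 32), (24, 26), (24, 39), (24, 28), (24, 32), (34, 39)]), (11, [(15, 17), (15, 30), (15, 31), (15,
     19), (15, 23), (15, 36), (25, 30), (25, 31), (25, 36), (17, 25), (17, 38), (17, 19), (17, 23), (17, 36),
     (30, 38), (30, 36), (31, 38), (31, 36), (19, 25), (19, 38), (19, 30), (19, 31), (23, 25), (23, 38), (23,
     30), (23, 31), (36, 38)]), (12, [(14, 16), (14, 29), (14, 33), (14, 21), (14, 22), (14, 35), (27, 29),
     (27, 33), (27, 35), (16, 27), (16, 37), (16, 21), (16, 22), (16, 35), (29, 37), (29, 35), (33, 37), (33,
     35), (21, 27), (21, 37), (21, 29), (21, 33), (22, 27), (22, 37), (22, 29), (22, 33), (35, 37)])]"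
  by code_simp

lemma dnon_eval_Q:
  "dnon linesQ =
     [(13, [2, 3, 5, 6, 8, 9, 11, 12]), (14, [2, 3, 5, 6, 7, 9, 10, 11]), (15, [2, 3, 5, 6, 7, 8, 10, 12]),
     (16, [2, 3, 4, 6, 8, 9, 10, 11]), (17, [2, 3, 4, 6, 7, 9, 10, 12]), (18, [2, 3, 4, 6, 7, 8, 11, 12]),
     (19, [2, 3, 4, 5, 8, 9, 10, 12]), (20, [2, 3, 4, 5, 7, 9, 11, 12]), (21, [2, 3, 4, 5, 7, 8, 10, 11]),
     (22, [1, 3, 5, 6, 8, 9, 10, 11]), (23, [1, 3, 5, 6, 7, 9, 10, 12]), (24, [1, 3, 5, 6, 7, 8, 11, 12]),
     (25, [1, 3, 4, 6, 8, 9, 10, 12]), (26, [1, 3, 4, 6, 7, 9, 11, 12]), (27, [1, 3, 4, 6, 7, 8, 10, 11]),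
     (28, [1, 3, 4, 5, 8, 9, 11, 12]), (29, [1, 3, 4, 5, 7, 9, 10, 11]), (30, [1, 3, 4, 5, 7, 8, 10, 12]),
     (31, [1, 2, 5, 6, 8, 9, 10, 12]), (32, [1, 2, 5, 6, 7, 9, 11, 12]), (33, [1, 2, 5, 6, 7, 8, 10, 11]),
     (34, [1, 2, 4, 6, 8, 9, 11, 12]), (35, [1, 2, 4, 6, 7, 9, 10, 11]), (36, [1, 2, 4, 6, 7, 8, 10, 12]),
     (37, [1, 2, 4, 5, 8, 9, 10, 11]), (38, [1, 2, 4, 5, 7, 9, 10, 12]), (39, [1, 2, 4, 5, 7, 8, 11, 12])]"
  by code_simp

lemma nbs_eval_W:
  "nbs linesW 0 = [1, 2, 3, 4, 5, 6, 7, 8, 9, 10, 11, 12]"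
  "nbs linesW 1 = [0, 2, 3, 13, 22, 31, 14, 23, 32, 15, 24, 33]"
  "nbs linesW 2 = [0, 1, 3, 19, 29, 39, 20, 30, 37, 21, 28, 38]"
  "nbs linesW 3 = [0, 1, 2, 16, 27, 35, 17, 25, 36, 18, 26, 34]"
  "nbs linesW 4 = [0, 5, 6, 13, 16, 19, 14, 17, 20, 15, 18, 21]"
  "nbs linesW 5 = [0, 4, 6, 22, 26, 30, 23, 27, 28, 24, 25, 29]"
  "nbs linesW 6 = [0, 4, 5, 31, 36, 38, 32, 34, 39, 33, 35, 37]"
  "nbs linesW 7 = [0, 8, 9, 13, 25, 37, 14, 26, 38, 15, 27, 39]"
  "nbs linesW 8 = [0, 7, 9, 19, 23, 36, 20, 24, 34, 21, 22, 35]"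
  "nbs linesW 9 = [0, 7, 8, 16, 30, 32, 17, 28, 33, 18, 29, 31]"
  "nbs linesW 10 = [0, 11, 12, 13, 28, 34, 14, 29, 35, 15, 30, 36]"
  "nbs linesW 11 = [0, 10, 12, 19, 26, 33, 20, 27, 31, 21, 25, 32]"
  "nbs linesW 12 = [0, 10, 11, 16, 24, 38, 17, 22, 39, 18, 23, 37]"
  "nbs linesW 13 = [1, 22, 31, 4, 16, 19, 7, 25, 37, 10, 28, 34]"
  "nbs linesW 14 = [1, 23, 32, 4, 17, 20, 7, 26, 38, 10, 29, 35]"
  "nbs linesW 15 = [1, 24, 33, 4, 18, 21, 7, 27, 39, 10, 30, 36]"
  "nbs linesW 16 = [3, 27, 35, 4, 13, 19, 9, 30, 32, 12, 24, 38]"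
  "nbs linesW 17 = [3, 25, 36, 4, 14, 20, 9, 28, 33, 12, 22, 39]"
  "nbs linesW 18 = [3, 26, 34, 4, 15, 21, 9, 29, 31, 12, 23, 37]"
  "nbs linesW 19 = [2, 29, 39, 4, 13, 16, 8, 23, 36, 11, 26, 33]"
  "nbs linesW 20 = [2, 30, 37, 4, 14, 17, 8, 24, 34, 11, 27, 31]"
  "nbs linesW 21 = [2, 28, 38, 4, 15, 18, 8, 22, 35, 11, 25, 32]"
  "nbs linesW 22 = [1, 13, 31, 5, 26, 30, 8, 21, 35, 12, 17, 39]"
  "nbs linesW 23 = [1, 14, 32, 5, 27, 28, 8, 19, 36, 12, 18, 37]"
  "nbs linesW 24 = [1, 15, 33, 5, 25, 29, 8, 20, 34, 12, 16, 38]"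
  "nbs linesW 25 = [3, 17, 36, 5, 24, 29, 7, 13, 37, 11, 21, 32]"
  "nbs linesW 26 = [3, 18, 34, 5, 22, 30, 7, 14, 38, 11, 19, 33]"
  "nbs linesW 27 = [3, 16, 35, 5, 23, 28, 7, 15, 39, 11, 20, 31]"
  "nbs linesW 28 = [2, 21, 38, 5, 23, 27, 9, 17, 33, 10, 13, 34]"
  "nbs linesW 29 = [2, 19, 39, 5, 24, 25, 9, 18, 31, 10, 14, 35]"
  "nbs linesW 30 = [2, 20, 37, 5, 22, 26, 9, 16, 32, 10, 15, 36]"
  "nbs linesW 31 = [1, 13, 22, 6, 36, 38, 9, 18, 29, 11, 20, 27]"
  "nbs linesW 32 = [1, 14, 23, 6, 34, 39, 9, 16, 30, 11, 21, 25]"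
  "nbs linesW 33 = [1, 15, 24, 6, 35, 37, 9, 17, 28, 11, 19, 26]"
  "nbs linesW 34 = [3, 18, 26, 6, 32, 39, 8, 20, 24, 10, 13, 28]"
  "nbs linesW 35 = [3, 16, 27, 6, 33, 37, 8, 21, 22, 10, 14, 29]"
  "nbs linesW 36 = [3, 17, 25, 6, 31, 38, 8, 19, 23, 10, 15, 30]"
  "nbs linesW 37 = [2, 20, 30, 6, 33, 35, 7, 13, 25, 12, 18, 23]"
  "nbs linesW 38 = [2, 21, 28, 6, 31, 36, 7, 14, 26, 12, 16, 24]"
  "nbs linesW 39 = [2, 19, 29, 6, 32, 34, 7, 15, 27, 12, 17, 22]"
  by code_simp+


text \<open>\<open>o1\<close>, \<open>p1\<close>, \<open>q1\<close> are the traces of a 5-clique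
  through 0 and 1, told apart by the points 4, 5, 6 of a second line through 0; each of them also
  belongs to a triple at its own point of that line. An existential statement is made propositional
  by \<open>r\<close>, which marks points of the overlap \<open>op\<close> that have a noncollinear
  partner in \<open>op\<close>. Unsatisfiability means that the overlap is a clique.\<close>

lemma overlap_prop_W:
  assumes "hyperoval linesW o1" "hyperoval linesW p1" "split3 linesW 1 o1 p1 q1" "o1 4" "p1 5" "q1 6"
    "both_on (yset linesW 1) o1 p1 op" "both_on (yset linesW 1) o1 q1 oq" "both_on (yset linesW 1) p1 q1 pq"
    "matched (ynb linesW 1) op" "sparse (ynb linesW 1) op" "matched (ynb linesW 1) oq" "sparse (ynb linesW 1) oq"
    "matched (ynb linesW 1) pq" "sparse (ynb linesW 1) pq"
    "hyperoval linesW o2" "split3 linesW 4 o1 o2 o3"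
    "both_on (yset linesW 4) o1 o2 a1" "both_on (yset linesW 4) o1 o3 a2" "both_on (yset linesW 4) o2 o3 a3"
    "matched (ynb linesW 4) a1" "sparse (ynb linesW 4) a1" "matched (ynb linesW 4) a2" "sparse (ynb linesW 4) a2"
    "matched (ynb linesW 4) a3" "sparse (ynb linesW 4) a3"
    "hyperoval linesW p2" "split3 linesW 5 p1 p2 p3"
    "both_on (yset linesW 5) p1 p2 b1" "both_on (yset linesW 5) p1 p3 b2" "both_on (yset linesW 5) p2 p3 b3"
    "matched (ynb linesW 5) b1" "sparse (ynb linesW 5) b1" "matched (ynb linesW 5) b2" "sparse (ynb linesW 5) b2"
    "matched (ynb linesW 5) b3" "sparse (ynb linesW 5) b3"
    "hyperoval linesW q2" "split3 linesW 6 q1 q2 q3"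
    "both_on (yset linesW 6) q1 q2 c1" "both_on (yset linesW 6) q1 q3 c2" "both_on (yset linesW 6) q2 q3 c3"
    "matched (ynb linesW 6) c1" "sparse (ynb linesW 6) c1" "matched (ynb linesW 6) c2" "sparse (ynb linesW 6) c2"
    "matched (ynb linesW 6) c3" "sparse (ynb linesW 6) c3"
    "list_ex r (yset linesW 1)"
    "list_all (\<lambda>(x, zs). (r x \<longrightarrow> op x) \<and> (r x \<longrightarrow> list_ex op zs)) (ynon linesW 1)"
  shows False
  using assms[unfolded table_eval_W ynon_eval_W prop_unfold, unfolded linesW_def prop_unfold] by sat

lemma overlap_prop_Q:
  assumes "hyperoval linesQ o1" "hyperoval linesQ p1" "split3 linesQ 1 o1 p1 q1" "o1 4" "p1 5" "q1 6"
    "both_on (yset linesQ 1) o1 p1 op" "both_on (yset linesQ 1) o1 q1 oq" "both_on (yset linesQ 1) p1 q1 pq"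
    "matched (ynb linesQ 1) op" "sparse (ynb linesQ 1) op" "matched (ynb linesQ 1) oq" "sparse (ynb linesQ 1) oq"
    "matched (ynb linesQ 1) pq" "sparse (ynb linesQ 1) pq"
    "hyperoval linesQ o2" "split3 linesQ 4 o1 o2 o3"
    "both_on (yset linesQ 4) o1 o2 a1" "both_on (yset linesQ 4) o1 o3 a2" "both_on (yset linesQ 4) o2 o3 a3"
    "matched (ynb linesQ 4) a1" "sparse (ynb linesQ 4) a1" "matched (ynb linesQ 4) a2" "sparse (ynb linesQ 4) a2"
    "matched (ynb linesQ 4) a3" "sparse (ynb linesQ 4) a3"
    "hyperoval linesQ p2" "split3 linesQ 5 p1 p2 p3"
    "both_on (yset linesQ 5) p1 p2 b1" "both_on (yset linesQ 5) p1 p3 b2" "both_on (yset linesQ 5) p2 p3 b3"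
    "matched (ynb linesQ 5) b1" "sparse (ynb linesQ 5) b1" "matched (ynb linesQ 5) b2" "sparse (ynb linesQ 5) b2"
    "matched (ynb linesQ 5) b3" "sparse (ynb linesQ 5) b3"
    "hyperoval linesQ q2" "split3 linesQ 6 q1 q2 q3"
    "both_on (yset linesQ 6) q1 q2 c1" "both_on (yset linesQ 6) q1 q3 c2" "both_on (yset linesQ 6) q2 q3 c3"
    "matched (ynb linesQ 6) c1" "sparse (ynb linesQ 6) c1" "matched (ynb linesQ 6) c2" "sparse (ynb linesQ 6) c2"
    "matched (ynb linesQ 6) c3" "sparse (ynb linesQ 6) c3"
    "list_ex r (yset linesQ 1)"
    "list_all (\<lambda>(x, zs). (r x \<longrightarrow> op x) \<and> (r x \<longrightarrow> list_ex op zs)) (ynon linesQ 1)"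
  shows False
  using assms[unfolded table_eval_Q ynon_eval_Q prop_unfold, unfolded linesQ_def prop_unfold] by sat

text \<open>Here \<open>r\<close> marks the far members of \<open>f\<close> at which
  \<open>kbase\<close> fails.\<close>

lemma kbase_prop_W:
  assumes "hyperoval linesW f" "f 0" "pcond linesW f" "list_ex r (far linesW)"
    "list_all (\<lambda>(x, ds). (r x \<longrightarrow> f x) \<and> (r x \<longrightarrow> list_ex f ds)) (dnon linesW)"
  shows False
  using assms[unfolded plist_eval_W dnon_eval_W far_eval_W prop_unfold, unfolded linesW_def prop_unfold] by sat

text \<open>This is what separates the two types: no hyperoval of the parabolic quadrangle is
  complete bipartite around a point of it.\<close>

lemma kbase_prop_Q:
  assumes "hyperoval linesQ f" "f 0" "kbase linesQ f"
  shows False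
  using assms[unfolded dnon_eval_Q prop_unfold, unfolded linesQ_def prop_unfold] by sat

text \<open>Domination, the source of diameter two later on: \<open>r\<close> marks points that are
  outside the hyperoval and have no neighbour in it.\<close>

lemma cover_prop_W:
  assumes "hyperoval linesW f" "f 0" "kbase linesW f" "list_ex r [0..<40]"
    "list_all (\<lambda>y. (r y \<longrightarrow> \<not> f y) \<and> list_all (\<lambda>z. r y \<longrightarrow> \<not> f z) (nbs linesW y)) [0..<40]"
  shows False
proof -
  have u: "[0..<40] = [0, 1, 2, 3, 4, 5, 6, 7, 8, 9, 10, 11, 12, 13, 14, 15, 16, 17, 18, 19, 20, 21, 22, 23, 24, 25, 26, 27, 28, 29, 30, 31, 32, 33, 34, 35, 36, 37, 38, 39::nat]"
    by code_simp
  show ?thesis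
    using assms[unfolded u prop_unfold nbs_eval_W dnon_eval_W, unfolded linesW_def prop_unfold] by sat
qed

text \<open>An antipode of 0 is a member far from 0 that is collinear with all members collinear
  with 0. The three hyperovals of a 5-clique cannot all lack one.\<close>

lemma antipode_prop_Q:
  assumes "hyperoval linesQ f" "hyperoval linesQ g" "hyperoval linesQ h"
    "pcond linesQ f" "pcond linesQ g" "pcond linesQ h" "split3 linesQ 1 f g h"
    "both_on (yset linesQ 1) f g fg" "both_on (yset linesQ 1) f h fh" "both_on (yset linesQ 1) g h gh"
    "matched (ynb linesQ 1) fg" "matched (ynb linesQ 1) fh" "matched (ynb linesQ 1) gh"
    "no_antipode linesQ f" "no_antipode linesQ g" "no_antipode linesQ h"
  shows False
  using assms[unfolded table_eval_Q plist_eval_Q dnon_eval_Q prop_unfold, unfolded linesQ_def prop_unfold] by sat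

fun at_most_two :: "(nat \<Rightarrow> bool) \<Rightarrow> nat list \<Rightarrow> bool" where
  "at_most_two c [] = True"
| "at_most_two c (x # xs) = ((c x \<longrightarrow> at_most_one c xs) \<and> at_most_two c xs)"

text \<open>The list \<open>ys\<close> keeps the entries already passed, so that
  \<open>ys @ xs\<close> consists of all entries other than the current one.\<close>

fun none_alone :: "(nat \<Rightarrow> bool) \<Rightarrow> nat list \<Rightarrow> nat list \<Rightarrow> bool" where
  "none_alone c ys [] = True"
| "none_alone c ys (x # xs) = ((c x \<longrightarrow> list_ex c (ys @ xs)) \<and> none_alone c (x # ys) xs)"

text \<open>The points 1 to 12 are the neighbours of 0. The clauses say that two traces share none
  or exactly two of them, the rule for the centres of a triad in Q_4(3).\<close>

definition none_or_two_common :: "(nat \<Rightarrow> bool) \<Rightarrow> bool" where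
  "none_or_two_common c \<longleftrightarrow> none_alone c [] [1..<13] \<and> at_most_two c [1..<13]"

lemma at_most_two_unfold:
  "at_most_two c [] = True" "at_most_two c [x] = True" "at_most_two c [x, y] = True"
  "at_most_two c (x # y # z # xs) = ((c x \<longrightarrow> at_most_one c (y # z # xs)) \<and> at_most_two c (y # z # xs))"
  by auto

lemma none_alone_unfold:
  "none_alone c ys [x] = (c x \<longrightarrow> list_ex c ys)"
  "none_alone c ys (x # y # xs) = ((c x \<longrightarrow> list_ex c (ys @ y # xs)) \<and> none_alone c (x # ys) (y # xs))"
  by auto


lemma upt_eval:
  "[1..<13] = [1::nat, 2, 3, 4, 5, 6, 7, 8, 9, 10, 11, 12]" "[4..<13] = [4::nat, 5, 6, 7, 8, 9, 10, 11, 12]"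
  by code_simp+

lemma antipode_filter_eval:
  "filter (\<lambda>x. x \<notin> set (nbs linesQ 4)) (nbs linesQ 2) = [1, 3, 26, 30, 27, 28, 25, 29]"
  "filter (\<lambda>x. x \<notin> set (nbs linesQ 5)) (nbs linesQ 2) = [1, 3, 22, 30, 23, 28, 24, 29]"
  "filter (\<lambda>x. x \<notin> set (nbs linesQ 6)) (nbs linesQ 2) = [1, 3, 22, 26, 23, 27, 24, 25]"
  "filter (\<lambda>x. x \<notin> set (nbs linesQ 7)) (nbs linesQ 2) = [1, 3, 26, 30, 23, 27, 24, 29]"
  "filter (\<lambda>x. x \<notin> set (nbs linesQ 8)) (nbs linesQ 2) = [1, 3, 22, 30, 27, 28, 24, 25]"
  "filter (\<lambda>x. x \<notin> set (nbs linesQ 9)) (nbs linesQ 2) = [1, 3, 22, 26, 23, 28, 25, 29]"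
  "filter (\<lambda>x. x \<notin> set (nbs linesQ 10)) (nbs linesQ 2) = [1, 3, 22, 30, 23, 27, 25, 29]"
  "filter (\<lambda>x. x \<notin> set (nbs linesQ 11)) (nbs linesQ 2) = [1, 3, 22, 26, 27, 28, 24, 29]"
  "filter (\<lambda>x. x \<notin> set (nbs linesQ 12)) (nbs linesQ 2) = [1, 3, 26, 30, 23, 28, 24, 25]"
  "filter (\<lambda>c. c \<notin> set (nbs linesQ 4) \<and> c \<noteq> 4) [4, 5, 6, 7, 8, 9, 10, 11, 12] = [7, 8, 9, 10, 11, 12]"
  "filter (\<lambda>c. c \<notin> set (nbs linesQ 5) \<and> c \<noteq> 5) [4, 5, 6, 7, 8, 9, 10, 11, 12] = [7, 8, 9, 10, 11, 12]"
  "filter (\<lambda>c. c \<notin> set (nbs linesQ 6) \<and> c \<noteq> 6) [4, 5, 6, 7, 8, 9, 10, 11, 12] = [7, 8, 9, 10, 11, 12]"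
  "filter (\<lambda>c. c \<notin> set (nbs linesQ 7) \<and> c \<noteq> 7) [4, 5, 6, 7, 8, 9, 10, 11, 12] = [4, 5, 6, 10, 11, 12]"
  "filter (\<lambda>c. c \<notin> set (nbs linesQ 8) \<and> c \<noteq> 8) [4, 5, 6, 7, 8, 9, 10, 11, 12] = [4, 5, 6, 10, 11, 12]"
  "filter (\<lambda>c. c \<notin> set (nbs linesQ 9) \<and> c \<noteq> 9) [4, 5, 6, 7, 8, 9, 10, 11, 12] = [4, 5, 6, 10, 11, 12]"
  "filter (\<lambda>c. c \<notin> set (nbs linesQ 10) \<and> c \<noteq> 10) [4, 5, 6, 7, 8, 9, 10, 11, 12] = [4, 5, 6, 7, 8, 9]"
  "filter (\<lambda>c. c \<notin> set (nbs linesQ 11) \<and> c \<noteq> 11) [4, 5, 6, 7, 8, 9, 10, 11, 12] = [4, 5, 6, 7, 8, 9]"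
  "filter (\<lambda>c. c \<notin> set (nbs linesQ 12) \<and> c \<noteq> 12) [4, 5, 6, 7, 8, 9, 10, 11, 12] = [4, 5, 6, 7, 8, 9]"
  by code_simp+

text \<open>The three versions differ in the point 10, 11 or 12 on the fourth line through 0, the
  position still open once 0, 1, 4, 7 and 2 are normalised. Antipodes of the point 2 are sought
  among 4 to 12, since they are collinear with 0 but not with 2; \<open>s1\<close> marks one for
  \<open>w\<close>, \<open>s2\<close> one for \<open>w1\<close>, and the last premise makes them
  distinct and noncollinear.\<close>

lemma antipodes_prop_Q0:
  assumes "hyperoval linesQ y" "pcond linesQ y" "hyperoval linesQ w" "pcond linesQ w" "hyperoval linesQ w1" "pcond linesQ w1" "hyperoval linesQ w2" "pcond linesQ w2" "hyperoval linesQ w3" "pcond linesQ w3"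
    "split3 linesQ 1 w2 y r2"
    "both_on (yset linesQ 1) w2 y i1" "matched (ynb linesQ 1) i1" "both_on (yset linesQ 1) w2 r2 i2" "matched (ynb linesQ 1) i2" "both_on (yset linesQ 1) y r2 i3" "matched (ynb linesQ 1) i3"
    "split3 linesQ 4 w y r"
    "both_on (yset linesQ 4) w y i4" "matched (ynb linesQ 4) i4" "both_on (yset linesQ 4) w r i5" "matched (ynb linesQ 4) i5" "both_on (yset linesQ 4) y r i6" "matched (ynb linesQ 4) i6"
    "split3 linesQ 7 w1 y r1"
    "both_on (yset linesQ 7) w1 y i7" "matched (ynb linesQ 7) i7" "both_on (yset linesQ 7) w1 r1 i8" "matched (ynb linesQ 7) i8" "both_on (yset linesQ 7) y r1 i9" "matched (ynb linesQ 7) i9"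
    "split3 linesQ 10 w3 y r3"
    "both_on (yset linesQ 10) w3 y i10" "matched (ynb linesQ 10) i10" "both_on (yset linesQ 10) w3 r3 i11" "matched (ynb linesQ 10) i11" "both_on (yset linesQ 10) y r3 i12" "matched (ynb linesQ 10) i12"
    "both_on [1..<13] w w1 c0" "none_or_two_common c0"
    "both_on [1..<13] w w2 c1" "none_or_two_common c1"
    "both_on [1..<13] w r2 c2" "none_or_two_common c2"
    "both_on [1..<13] w w3 c3" "none_or_two_common c3"
    "both_on [1..<13] w r3 c4" "none_or_two_common c4"
    "both_on [1..<13] w1 w2 c5" "none_or_two_common c5"
    "both_on [1..<13] w1 r2 c6" "none_or_two_common c6"
    "both_on [1..<13] w1 w3 c7" "none_or_two_common c7"
    "both_on [1..<13] w1 r3 c8" "none_or_two_common c8"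
    "both_on [1..<13] w2 w3 c9" "none_or_two_common c9"
    "both_on [1..<13] w2 r3 c10" "none_or_two_common c10"
    "both_on [1..<13] r2 w3 c11" "none_or_two_common c11"
    "both_on [1..<13] r2 r3 c12" "none_or_two_common c12"
    "w 2" "w1 2" "list_ex s1 [4..<13]"
    "list_all (\<lambda>b. (s1 b \<longrightarrow> w b) \<and> list_all (\<lambda>x. s1 b \<longrightarrow> \<not> w x) (filter (\<lambda>x. x \<notin> set (nbs linesQ b)) (nbs linesQ 2))) [4..<13]"
    "list_all (\<lambda>b. (s2 b \<longrightarrow> w1 b) \<and> list_all (\<lambda>x. s2 b \<longrightarrow> \<not> w1 x) (filter (\<lambda>x. x \<notin> set (nbs linesQ b)) (nbs linesQ 2))) [4..<13]"
    "list_all (\<lambda>b. s1 b \<longrightarrow> list_ex s2 (filter (\<lambda>c. c \<notin> set (nbs linesQ b) \<and> c \<noteq> b) [4..<13])) [4..<13]"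
  shows False
  using assms[unfolded none_or_two_common_def upt_eval, unfolded table_eval_Q plist_eval_Q prop_unfold at_most_two_unfold none_alone_unfold append.simps antipode_filter_eval, unfolded linesQ_def prop_unfold] by sat

lemma antipodes_prop_Q1:
  assumes "hyperoval linesQ y" "pcond linesQ y" "hyperoval linesQ w" "pcond linesQ w" "hyperoval linesQ w1" "pcond linesQ w1" "hyperoval linesQ w2" "pcond linesQ w2" "hyperoval linesQ w3" "pcond linesQ w3"
    "split3 linesQ 1 w2 y r2"
    "both_on (yset linesQ 1) w2 y i1" "matched (ynb linesQ 1) i1" "both_on (yset linesQ 1) w2 r2 i2" "matched (ynb linesQ 1) i2" "both_on (yset linesQ 1) y r2 i3" "matched (ynb linesQ 1) i3"
    "split3 linesQ 4 w y r"
    "both_on (yset linesQ 4) w y i4" "matched (ynb linesQ 4) i4" "both_on (yset linesQ 4) w r i5" "matched (ynb linesQ 4) i5" "both_on (yset linesQ 4) y r i6" "matched (ynb linesQ 4) i6"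
    "split3 linesQ 7 w1 y r1"
    "both_on (yset linesQ 7) w1 y i7" "matched (ynb linesQ 7) i7" "both_on (yset linesQ 7) w1 r1 i8" "matched (ynb linesQ 7) i8" "both_on (yset linesQ 7) y r1 i9" "matched (ynb linesQ 7) i9"
    "split3 linesQ 11 w3 y r3"
    "both_on (yset linesQ 11) w3 y i10" "matched (ynb linesQ 11) i10" "both_on (yset linesQ 11) w3 r3 i11" "matched (ynb linesQ 11) i11" "both_on (yset linesQ 11) y r3 i12" "matched (ynb linesQ 11) i12"
    "both_on [1..<13] w w1 c0" "none_or_two_common c0"
    "both_on [1..<13] w w2 c1" "none_or_two_common c1"
    "both_on [1..<13] w r2 c2" "none_or_two_common c2"
    "both_on [1..<13] w w3 c3" "none_or_two_common c3"
    "both_on [1..<13] w r3 c4" "none_or_two_common c4"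
    "both_on [1..<13] w1 w2 c5" "none_or_two_common c5"
    "both_on [1..<13] w1 r2 c6" "none_or_two_common c6"
    "both_on [1..<13] w1 w3 c7" "none_or_two_common c7"
    "both_on [1..<13] w1 r3 c8" "none_or_two_common c8"
    "both_on [1..<13] w2 w3 c9" "none_or_two_common c9"
    "both_on [1..<13] w2 r3 c10" "none_or_two_common c10"
    "both_on [1..<13] r2 w3 c11" "none_or_two_common c11"
    "both_on [1..<13] r2 r3 c12" "none_or_two_common c12"
    "w 2" "w1 2" "list_ex s1 [4..<13]"
    "list_all (\<lambda>b. (s1 b \<longrightarrow> w b) \<and> list_all (\<lambda>x. s1 b \<longrightarrow> \<not> w x) (filter (\<lambda>x. x \<notin> set (nbs linesQ b)) (nbs linesQ 2))) [4..<13]"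
    "list_all (\<lambda>b. (s2 b \<longrightarrow> w1 b) \<and> list_all (\<lambda>x. s2 b \<longrightarrow> \<not> w1 x) (filter (\<lambda>x. x \<notin> set (nbs linesQ b)) (nbs linesQ 2))) [4..<13]"
    "list_all (\<lambda>b. s1 b \<longrightarrow> list_ex s2 (filter (\<lambda>c. c \<notin> set (nbs linesQ b) \<and> c \<noteq> b) [4..<13])) [4..<13]"
  shows False
  using assms[unfolded none_or_two_common_def upt_eval, unfolded table_eval_Q plist_eval_Q prop_unfold at_most_two_unfold none_alone_unfold append.simps antipode_filter_eval, unfolded linesQ_def prop_unfold] by sat

lemma antipodes_prop_Q2:
  assumes "hyperoval linesQ y" "pcond linesQ y" "hyperoval linesQ w" "pcond linesQ w" "hyperoval linesQ w1" "pcond linesQ w1" "hyperoval linesQ w2" "pcond linesQ w2" "hyperoval linesQ w3" "pcond linesQ w3"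
    "split3 linesQ 1 w2 y r2"
    "both_on (yset linesQ 1) w2 y i1" "matched (ynb linesQ 1) i1" "both_on (yset linesQ 1) w2 r2 i2" "matched (ynb linesQ 1) i2" "both_on (yset linesQ 1) y r2 i3" "matched (ynb linesQ 1) i3"
    "split3 linesQ 4 w y r"
    "both_on (yset linesQ 4) w y i4" "matched (ynb linesQ 4) i4" "both_on (yset linesQ 4) w r i5" "matched (ynb linesQ 4) i5" "both_on (yset linesQ 4) y r i6" "matched (ynb linesQ 4) i6"
    "split3 linesQ 7 w1 y r1"
    "both_on (yset linesQ 7) w1 y i7" "matched (ynb linesQ 7) i7" "both_on (yset linesQ 7) w1 r1 i8" "matched (ynb linesQ 7) i8" "both_on (yset linesQ 7) y r1 i9" "matched (ynb linesQ 7) i9"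
    "split3 linesQ 12 w3 y r3"
    "both_on (yset linesQ 12) w3 y i10" "matched (ynb linesQ 12) i10" "both_on (yset linesQ 12) w3 r3 i11" "matched (ynb linesQ 12) i11" "both_on (yset linesQ 12) y r3 i12" "matched (ynb linesQ 12) i12"
    "both_on [1..<13] w w1 c0" "none_or_two_common c0"
    "both_on [1..<13] w w2 c1" "none_or_two_common c1"
    "both_on [1..<13] w r2 c2" "none_or_two_common c2"
    "both_on [1..<13] w w3 c3" "none_or_two_common c3"
    "both_on [1..<13] w r3 c4" "none_or_two_common c4"
    "both_on [1..<13] w1 w2 c5" "none_or_two_common c5"
    "both_on [1..<13] w1 r2 c6" "none_or_two_common c6"
    "both_on [1..<13] w1 w3 c7" "none_or_two_common c7"
    "both_on [1..<13] w1 r3 c8" "none_or_two_common c8"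
    "both_on [1..<13] w2 w3 c9" "none_or_two_common c9"
    "both_on [1..<13] w2 r3 c10" "none_or_two_common c10"
    "both_on [1..<13] r2 w3 c11" "none_or_two_common c11"
    "both_on [1..<13] r2 r3 c12" "none_or_two_common c12"
    "w 2" "w1 2" "list_ex s1 [4..<13]"
    "list_all (\<lambda>b. (s1 b \<longrightarrow> w b) \<and> list_all (\<lambda>x. s1 b \<longrightarrow> \<not> w x) (filter (\<lambda>x. x \<notin> set (nbs linesQ b)) (nbs linesQ 2))) [4..<13]"
    "list_all (\<lambda>b. (s2 b \<longrightarrow> w1 b) \<and> list_all (\<lambda>x. s2 b \<longrightarrow> \<not> w1 x) (filter (\<lambda>x. x \<notin> set (nbs linesQ b)) (nbs linesQ 2))) [4..<13]"
    "list_all (\<lambda>b. s1 b \<longrightarrow> list_ex s2 (filter (\<lambda>c. c \<notin> set (nbs linesQ b) \<and> c \<noteq> b) [4..<13])) [4..<13]"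
  shows False
  using assms[unfolded none_or_two_common_def upt_eval, unfolded table_eval_Q plist_eval_Q prop_unfold at_most_two_unfold none_alone_unfold append.simps antipode_filter_eval, unfolded linesQ_def prop_unfold] by sat



section \<open>Automorphisms of the tables\<close>

text \<open>Permutations are lists of images. The suffix in the name is the point whose orbit
  matters; \<open>transitive_W0\<close> to \<open>transitive_Q2\<close> record which points are
  fixed meanwhile.\<close>

definition gensW0 :: "nat list list" where
  "gensW0 =
     [[39, 2, 19, 29, 6, 32, 34, 7, 15, 27, 12, 17, 22, 0, 38, 37, 5, 31, 35, 4, 36, 33, 1, 21, 30, 9, 14, 25,
     11, 16, 23, 3, 28, 20, 10, 24, 18, 8, 26, 13], [1, 0, 2, 3, 13, 22, 31, 14, 23, 32, 15, 33, 24, 4, 7, 10,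
     16, 25, 34, 19, 37, 28, 5, 8, 12, 17, 26, 35, 21, 39, 30, 6, 9, 11, 18, 27, 36, 20, 38, 29], [7, 0, 8, 9,
     13, 25, 37, 14, 26, 38, 15, 39, 27, 1, 4, 10, 31, 16, 28, 22, 19, 34, 3, 5, 11, 32, 17, 29, 24, 21, 36,
     2, 6, 12, 33, 18, 30, 23, 20, 35]]"

definition gensW1 :: "nat list list" where
  "gensW1 =
     [[0, 12, 10, 11, 1, 2, 3, 8, 7, 9, 5, 4, 6, 22, 23, 24, 31, 32, 33, 13, 14, 15, 39, 37, 38, 21, 19, 20,
     30, 28, 29, 17, 18, 16, 26, 27, 25, 35, 36, 34], [0, 10, 11, 12, 1, 2, 3, 7, 9, 8, 4, 6, 5, 13, 14, 15,
     22, 23, 24, 31, 32, 33, 28, 29, 30, 37, 38, 39, 19, 20, 21, 34, 35, 36, 16, 17, 18, 25, 26, 27], [0, 9,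
     7, 8, 1, 2, 3, 11, 10, 12, 6, 4, 5, 31, 33, 32, 22, 24, 23, 13, 15, 14, 29, 28, 30, 20, 19, 21, 38, 37,
     39, 18, 17, 16, 36, 35, 34, 27, 26, 25]]"

definition gensW4 :: "nat list list" where
  "gensW4 =
     [[0, 1, 2, 3, 12, 10, 11, 8, 7, 9, 5, 6, 4, 22, 24, 23, 17, 16, 18, 39, 38, 37, 13, 15, 14, 35, 34, 36,
     30, 29, 28, 31, 33, 32, 26, 25, 27, 21, 20, 19], [0, 1, 2, 3, 11, 10, 12, 6, 4, 5, 9, 8, 7, 31, 32, 33,
     27, 25, 26, 20, 21, 19, 13, 14, 15, 36, 34, 35, 29, 30, 28, 22, 23, 24, 18, 16, 17, 38, 39, 37], [0, 1,
     2, 3, 10, 11, 12, 7, 9, 8, 4, 5, 6, 13, 15, 14, 34, 36, 35, 28, 30, 29, 31, 33, 32, 25, 27, 26, 19, 21,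
     20, 22, 24, 23, 16, 18, 17, 37, 39, 38]]"

definition gensW5 :: "nat list list" where
  "gensW5 =
     [[0, 1, 2, 3, 4, 6, 5, 10, 11, 12, 7, 8, 9, 13, 15, 14, 16, 18, 17, 19, 21, 20, 31, 33, 32, 34, 36, 35,
     37, 39, 38, 22, 24, 23, 25, 27, 26, 28, 30, 29]]"

definition gensQ0 :: "nat list list" where
  "gensQ0 =
     [[39, 3, 31, 35, 6, 19, 29, 9, 15, 27, 10, 13, 26, 0, 38, 37, 36, 1, 34, 33, 32, 2, 30, 4, 28, 7, 11, 14,
     24, 16, 17, 21, 20, 5, 18, 22, 23, 8, 25, 12], [1, 0, 2, 3, 13, 21, 17, 14, 19, 18, 15, 20, 16, 4, 7, 10,
     12, 6, 9, 8, 11, 5, 26, 23, 25, 24, 22, 28, 27, 29, 30, 37, 39, 33, 38, 36, 35, 31, 34, 32], [2, 0, 1, 3,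
     22, 26, 30, 23, 27, 28, 24, 25, 29, 4, 12, 7, 8, 5, 10, 11, 9, 6, 19, 15, 21, 13, 14, 16, 20, 17, 18, 35,
     34, 32, 36, 39, 38, 33, 37, 31]]"

definition gensQ1 :: "nat list list" where
  "gensQ1 =
     [[0, 12, 10, 11, 1, 2, 3, 4, 5, 6, 8, 9, 7, 14, 16, 21, 22, 27, 29, 33, 35, 37, 13, 18, 20, 24, 26, 28,
     32, 34, 39, 15, 17, 19, 23, 25, 30, 31, 36, 38], [0, 11, 10, 12, 1, 3, 2, 4, 6, 5, 9, 8, 7, 15, 19, 17,
     31, 38, 36, 23, 30, 25, 13, 20, 18, 32, 39, 34, 24, 28, 26, 14, 21, 16, 33, 37, 35, 22, 29, 27]]"

definition gensQ4 :: "nat list list" where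
  "gensQ4 =
     [[0, 1, 2, 3, 12, 10, 11, 4, 5, 6, 8, 9, 7, 14, 16, 21, 13, 18, 20, 15, 17, 19, 22, 27, 29, 24, 26, 28,
     23, 25, 30, 33, 35, 37, 32, 34, 39, 31, 36, 38], [0, 1, 2, 3, 11, 12, 10, 4, 5, 6, 9, 7, 8, 15, 17, 19,
     14, 16, 21, 13, 18, 20, 23, 25, 30, 22, 27, 29, 24, 26, 28, 31, 36, 38, 33, 35, 37, 32, 34, 39]]"

definition gensQ5 :: "nat list list" where
  "gensQ5 =
     [[0, 1, 3, 2, 4, 6, 5, 7, 9, 8, 10, 12, 11, 13, 15, 14, 19, 21, 20, 16, 18, 17, 31, 33, 32, 37, 39, 38,
     34, 36, 35, 22, 24, 23, 28, 30, 29, 25, 27, 26]]"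

definition gensQ7 :: "nat list list" where
  "gensQ7 =
     [[0, 1, 2, 3, 4, 5, 6, 12, 10, 11, 8, 9, 7, 14, 13, 15, 16, 18, 17, 21, 20, 19, 22, 24, 23, 27, 26, 25,
     29, 28, 30, 33, 32, 31, 35, 34, 36, 37, 39, 38], [0, 1, 2, 3, 4, 5, 6, 11, 12, 10, 9, 7, 8, 15, 14, 13,
     17, 16, 18, 19, 21, 20, 23, 22, 24, 25, 27, 26, 30, 29, 28, 31, 33, 32, 36, 35, 34, 38, 37, 39]]"

definition gensQ2 :: "nat list list" where
  "gensQ2 =
     [[0, 1, 3, 2, 4, 6, 5, 7, 9, 8, 10, 12, 11, 13, 15, 14, 19, 21, 20, 16, 18, 17, 31, 33, 32, 37, 39, 38,
     34, 36, 35, 22, 24, 23, 28, 30, 29, 25, 27, 26]]"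


lemma in_nbs: "y \<in> set (nbs L x) \<longleftrightarrow> y \<noteq> x \<and> (\<exists>l\<in>set L. x \<in> set l \<and> y \<in> set l)"
  unfolding nbs_def by auto

lemma nbs_sym: "y \<in> set (nbs L x) \<longleftrightarrow> x \<in> set (nbs L y)"
  by (auto simp: in_nbs)

lemma distinct_nbs: "distinct (nbs L x)"
  unfolding nbs_def by simp

text \<open>The lines of both tables are written in increasing order, which is why the image of a
  line is sorted before it is looked up.\<close>

definition table_auto :: "nat list list \<Rightarrow> nat list \<Rightarrow> bool" where
  "table_auto L p \<longleftrightarrow> length p = 40 \<and> distinct p \<and> list_all (\<lambda>x. x < 40) p \<and>
     list_all (\<lambda>l. sort (map ((!) p) l) \<in> set L) L"

definition table_form :: "nat list list \<Rightarrow> bool" where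
  "table_form L \<longleftrightarrow> list_all (\<lambda>l. length l = 4 \<and> distinct l \<and> list_all (\<lambda>x. x < 40) l) L"

lemma table_form_W: "table_form linesW" and table_form_Q: "table_form linesQ"
  by code_simp+

fun orbit :: "nat list list \<Rightarrow> nat \<Rightarrow> nat list \<Rightarrow> nat list" where
  "orbit P 0 xs = xs"
| "orbit P (Suc n) xs = orbit P n (remdups (xs @ concat (map (\<lambda>p. map ((!) p) xs) P)))"

definition moves :: "nat list list \<Rightarrow> nat list list \<Rightarrow> nat \<Rightarrow> nat list \<Rightarrow> nat \<Rightarrow> nat list \<Rightarrow> bool" where
  "moves L P n F a ts \<longleftrightarrow> a < 40 \<and>
     list_all (\<lambda>p. table_auto L p \<and> list_all (\<lambda>j. j < 40 \<and> p ! j = j) F) P \<and>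
     (let s = orbit P n [a] in list_all (\<lambda>t. t \<in> set s) ts)"

lemma table_auto_bij:
  assumes "table_auto L p"
  shows "bij_betw ((!) p) {..<40} {..<40}"
proof -
  have len: "length p = 40" and "distinct p" and lt: "\<And>x. x \<in> set p \<Longrightarrow> x < 40"
    using assms by (auto simp: table_auto_def list_all_iff)
  have inj: "inj_on ((!) p) {..<40}"
    using \<open>distinct p\<close> len by (auto simp: inj_on_def nth_eq_iff_index_eq)
  moreover have "(!) p ` {..<40} \<subseteq> {..<40}"
    using lt len by (auto intro: nth_mem)
  ultimately show ?thesis
    by (simp add: bij_betw_def endo_inj_surj)
qed

text \<open>Mapping lines to lines preserves collinearity. It is also reflected, because an
  injective map of the finite set of collinear pairs into itself is onto.\<close>

lemma table_auto_nbs: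
  assumes a: "table_auto L p" and L: "table_form L" and x: "x < 40" and y: "y < 40"
  shows "p ! y \<in> set (nbs L (p ! x)) \<longleftrightarrow> y \<in> set (nbs L x)"
proof -
  have bij: "bij_betw ((!) p) {..<40} {..<40}"
    using a by (rule table_auto_bij)
  define R where "R = {(x, y). x < 40 \<and> y < 40 \<and> y \<in> set (nbs L x)}"
  define h where "h = (\<lambda>(x, y). (p ! x, p ! y))"
  have finR: "finite R"
    by (rule finite_subset[of _ "{..<40} \<times> {..<40}"]) (auto simp: R_def)
  have inj: "inj_on h R"
    using bij by (auto simp: inj_on_def h_def R_def bij_betw_def)
  have "h ` R \<subseteq> R"
  proof (clarsimp simp: h_def R_def)
    fix a b assume ab: "a < 40" "b < 40" "b \<in> set (nbs L a)"
    then obtain l where l: "l \<in> set L" "a \<in> set l" "b \<in> set l" "b \<noteq> a"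
      by (auto simp: in_nbs)
    have "sort (map ((!) p) l) \<in> set L"
      using assms(1) l(1) by (auto simp: table_auto_def list_all_iff)
    moreover have "p ! a \<noteq> p ! b"
      using bij ab l(4) by (auto simp: bij_betw_def inj_on_def)
    ultimately have "p ! b \<in> set (nbs L (p ! a))"
      unfolding in_nbs using l by (intro conjI bexI[of _ "sort (map ((!) p) l)"]) auto
    moreover have "p ! a < 40" "p ! b < 40"
      using bij ab by (auto simp: bij_betw_def)
    ultimately show "p ! a < 40 \<and> p ! b < 40 \<and> p ! b \<in> set (nbs L (p ! a))"
      by simp
  qed
  then have img: "h ` R = R"
    using finR inj by (simp add: endo_inj_surj)
  show ?thesis
  proof
    assume "p ! y \<in> set (nbs L (p ! x))"
    moreover have "p ! x < 40" "p ! y < 40"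
      using bij x y by (auto simp: bij_betw_def)
    ultimately have "(p ! x, p ! y) \<in> h ` R"
      by (simp add: img) (simp add: R_def)
    then obtain a b where ab: "(a, b) \<in> R" "p ! a = p ! x" "p ! b = p ! y"
      by (auto simp: h_def)
    then have "a = x" "b = y"
      using bij x y by (auto simp: bij_betw_def inj_on_def R_def)
    then show "y \<in> set (nbs L x)"
      using ab(1) by (simp add: R_def)
  next
    assume "y \<in> set (nbs L x)"
    then have "(x, y) \<in> R"
      using x y by (simp add: R_def)
    then have "h (x, y) \<in> R"
      using img by blast
    then show "p ! y \<in> set (nbs L (p ! x))"
      by (simp add: h_def R_def)
  qed
qed

definition coords :: "('a \<Rightarrow> 'a \<Rightarrow> bool) \<Rightarrow> nat list list \<Rightarrow> 'a \<Rightarrow> (nat \<Rightarrow> 'a) \<Rightarrow> bool" where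
  "coords adj L u g \<longleftrightarrow> bij_betw g {..<40} {v. adj u v} \<and>
     (\<forall>i<40. \<forall>j<40. adj (g i) (g j) \<longleftrightarrow> j \<in> set (nbs L i))"

lemma coords_auto:
  assumes "coords adj L u g" "table_auto L p" "table_form L"
  shows "coords adj L u (\<lambda>i. g (p ! i))"
proof -
  have b: "bij_betw ((!) p) {..<40} {..<40}"
    using assms(2) by (rule table_auto_bij)
  have "bij_betw (g \<circ> (!) p) {..<40} {v. adj u v}"
    using bij_betw_trans[OF b] assms(1) unfolding coords_def by blast
  moreover have "p ! i < 40" if "i < 40" for i
    using b that by (auto simp: bij_betw_def)
  moreover have "adj (g (p ! i)) (g (p ! j)) \<longleftrightarrow> j \<in> set (nbs L i)" if "i < 40" "j < 40" for i j
  proof -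
    have "adj (g (p ! i)) (g (p ! j)) \<longleftrightarrow> p ! j \<in> set (nbs L (p ! i))"
      using assms(1) calculation(2) that unfolding coords_def by blast
    then show ?thesis
      using table_auto_nbs[OF assms(2,3) that] by blast
  qed
  ultimately show ?thesis
    unfolding coords_def o_def by blast
qed

lemma coords_move:
  assumes c: "coords adj L u g" and L: "table_form L" and m: "moves L P n F a ts"
    and i: "i \<in> set ts"
  shows "\<exists>g'. coords adj L u g' \<and> g' a = g i \<and> (\<forall>j\<in>set F. g' j = g j)"
proof -
  \<comment> \<open>The set quantifies over all coordinates \<open>g\<close>, so that a permutation
    can be absorbed into \<open>g\<close> before the next one is applied.\<close>
  define S where "S = {i. \<forall>g. coords adj L u g \<longrightarrow>
    (\<exists>g'. coords adj L u g' \<and> g' a = g i \<and> (\<forall>j\<in>set F. g' j = g j))}"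
  have step: "p ! x \<in> S" if xS: "x \<in> S" and pP: "p \<in> set P" for x p
    unfolding S_def
  proof (intro CollectI allI impI)
    fix g assume g: "coords adj L u g"
    have p: "table_auto L p" "\<And>j. j \<in> set F \<Longrightarrow> p ! j = j"
      using m pP by (simp_all add: moves_def list_all_iff)
    have "coords adj L u (\<lambda>i. g (p ! i))"
      by (rule coords_auto[OF g p(1) L])
    then obtain g' where "coords adj L u g'" "g' a = g (p ! x)" "\<forall>j\<in>set F. g' j = g (p ! j)"
      using xS unfolding S_def by blast
    then show "\<exists>g'. coords adj L u g' \<and> g' a = g (p ! x) \<and> (\<forall>j\<in>set F. g' j = g j)"
      using p(2) by metis
  qed
  have orb: "set xs \<subseteq> S \<Longrightarrow> set (orbit P n xs) \<subseteq> S" for xs n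
  proof (induction n arbitrary: xs)
    case (Suc n)
    have "y \<in> S" if "y \<in> set (remdups (xs @ concat (map (\<lambda>p. map ((!) p) xs) P)))" for y
    proof -
      have "y \<in> set xs \<or> (\<exists>p\<in>set P. \<exists>x\<in>set xs. y = p ! x)"
        using that by auto
      then show ?thesis
        using Suc.prems step by blast
    qed
    then have "set (remdups (xs @ concat (map (\<lambda>p. map ((!) p) xs) P))) \<subseteq> S"
      by blast
    then show ?case
      using Suc.IH by simp
  qed simp
  have "a \<in> S"
    unfolding S_def by blast
  then have "set (orbit P n [a]) \<subseteq> S"
    by (intro orb) simp
  moreover have "i \<in> set (orbit P n [a])"
    using m i unfolding moves_def list_all_iff Let_def by blast
  ultimately have "i \<in> S" by blast
  then show ?thesis
    using c unfolding S_def by blast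
qed


lemma transitive_W0: "moves linesW gensW0 5 [] 0 [0..<40]"
  by code_simp

lemma transitive_W1: "moves linesW gensW1 4 [0] 1 [1..<13]"
  by code_simp

lemma transitive_W4: "moves linesW gensW4 2 [0, 1] 4 [4..<13]"
  by code_simp

lemma transitive_W5: "moves linesW gensW5 1 [0, 1, 4] 5 [5, 6]"
  by code_simp

lemma transitive_Q0: "moves linesQ gensQ0 6 [] 0 [0..<40]"
  by code_simp

lemma transitive_Q1: "moves linesQ gensQ1 5 [0] 1 [1..<13]"
  by code_simp

lemma transitive_Q4: "moves linesQ gensQ4 4 [0, 1] 4 [4..<13]"
  by code_simp

lemma transitive_Q5: "moves linesQ gensQ5 1 [0, 1, 4] 5 [5, 6]"
  by code_simp

lemma transitive_Q7: "moves linesQ gensQ7 3 [0, 1, 4] 7 [7..<13]"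
  by code_simp

lemma transitive_Q2: "moves linesQ gensQ2 1 [0, 1, 4, 7] 2 [2, 3]"
  by code_simp


lemma base_W:
  "set (nbs linesW 0) = {1..<13}" "set (nbs linesW 0) \<inter> set (nbs linesW 1) = {2, 3}"
  "3 \<in> set (nbs linesW 2)" "set (nbs linesW 0) \<inter> set (nbs linesW 4) = {5, 6}"
  "list_all (\<lambda>k. one_of (0 \<in> set (nbs linesW k) \<or> 1 \<in> set (nbs linesW k)) (2 \<in> set (nbs linesW k))
     (3 \<in> set (nbs linesW k)) \<and> \<not> (0 \<in> set (nbs linesW k) \<and> 1 \<in> set (nbs linesW k))) [4..<40]"
  by code_simp+

lemma base_Q:
  "set (nbs linesQ 0) = {1..<13}" "set (nbs linesQ 0) \<inter> set (nbs linesQ 1) = {2, 3}"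
  "3 \<in> set (nbs linesQ 2)" "set (nbs linesQ 0) \<inter> set (nbs linesQ 4) = {5, 6}"
  "list_all (\<lambda>k. one_of (0 \<in> set (nbs linesQ k) \<or> 1 \<in> set (nbs linesQ k)) (2 \<in> set (nbs linesQ k))
     (3 \<in> set (nbs linesQ k)) \<and> \<not> (0 \<in> set (nbs linesQ k) \<and> 1 \<in> set (nbs linesQ k))) [4..<40]"
  by code_simp+


section \<open>From propositional facts to statements about table points\<close>

lemma far_nbs0: "x \<in> set (far L) \<longleftrightarrow> 1 \<le> x \<and> x < 40 \<and> x \<notin> set (nbs L 0)"
  by (auto simp: far_def)

lemma at_most_one_iff:
  "distinct xs \<Longrightarrow> at_most_one f xs \<longleftrightarrow> (\<forall>x\<in>set xs. \<forall>y\<in>set xs. f x \<longrightarrow> f y \<longrightarrow> x = y)"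
  by (induction xs) (auto simp: list_all_iff)

lemma both_on_conj: "both_on ys f g (\<lambda>x. f x \<and> g x)"
  by (simp add: both_on_def list_all_iff)

lemma triple_parts:
  assumes "triple L d f g h"
  shows "split3 L d f g h" "matched (ynb L d) (\<lambda>x. f x \<and> g x)" "sparse (ynb L d) (\<lambda>x. f x \<and> g x)"
    "matched (ynb L d) (\<lambda>x. f x \<and> h x)" "sparse (ynb L d) (\<lambda>x. f x \<and> h x)"
    "matched (ynb L d) (\<lambda>x. g x \<and> h x)" "sparse (ynb L d) (\<lambda>x. g x \<and> h x)"
  using assms unfolding triple_def by blast+

lemma overlap_table:
  assumes L: "L \<in> {linesW, linesQ}"
    and h: "hyperoval L o1" "hyperoval L p1" "hyperoval L o2" "hyperoval L p2" "hyperoval L q2"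
    and t: "triple L 1 o1 p1 q1" "triple L 4 o1 o2 o3" "triple L 5 p1 p2 p3" "triple L 6 q1 q2 q3"
    and b: "o1 4" "p1 5" "q1 6"
    and x: "x \<in> set (yset L 1)" "o1 x" "p1 x" and z: "z \<in> set (yset L 1)" "o1 z" "p1 z" and "x \<noteq> z"
  shows "z \<in> set (nbs L x)"
proof (rule ccontr)
  assume nz: "z \<notin> set (nbs L x)"
  define r where "r = (\<lambda>x. (o1 x \<and> p1 x) \<and> (\<exists>z\<in>set (yset L 1). z \<noteq> x \<and> z \<notin> set (nbs L x) \<and> o1 z \<and> p1 z))"
  have "r x"
    unfolding r_def using nz x(2,3) z \<open>x \<noteq> z\<close> by (intro conjI bexI[of _ z]) simp_all
  then have r1: "list_ex r (yset L 1)"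
    unfolding list_ex_iff using x(1) by (rule bexI)
  have r2: "list_all (\<lambda>(x, zs). (r x \<longrightarrow> o1 x \<and> p1 x) \<and> (r x \<longrightarrow> list_ex (\<lambda>x. o1 x \<and> p1 x) zs)) (ynon L 1)"
    unfolding list_all_iff list_ex_iff ynon_def Let_def r_def by auto
  note a = h(1,2) triple_parts(1)[OF t(1)] b both_on_conj both_on_conj both_on_conj triple_parts(2-)[OF t(1)]
    h(3) triple_parts(1)[OF t(2)] both_on_conj both_on_conj both_on_conj triple_parts(2-)[OF t(2)]
    h(4) triple_parts(1)[OF t(3)] both_on_conj both_on_conj both_on_conj triple_parts(2-)[OF t(3)]
    h(5) triple_parts(1)[OF t(4)] both_on_conj both_on_conj both_on_conj triple_parts(2-)[OF t(4)] r1 r2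
  from L consider "L = linesW" | "L = linesQ" by blast
  then show False
  proof cases
    case 1
    show False
      by (rule overlap_prop_W[OF a[unfolded 1]])
  next
    case 2
    show False
      by (rule overlap_prop_Q[OF a[unfolded 2]])
  qed
qed

lemma kbase_table_W:
  assumes "hyperoval linesW f" "f 0" "pcond linesW f"
  shows "kbase linesW f"
proof (rule ccontr)
  assume k: "\<not> kbase linesW f"
  define r where "r = (\<lambda>x. f x \<and> (\<exists>d\<in>set (nbs linesW 0). d \<notin> set (nbs linesW x) \<and> f d))"
  have "list_ex r (far linesW)"
    using k unfolding kbase_def list_all_iff list_ex_iff dnon_def Let_def r_def by auto
  moreover have "list_all (\<lambda>(x, ds). (r x \<longrightarrow> f x) \<and> (r x \<longrightarrow> list_ex f ds)) (dnon linesW)"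
    unfolding list_all_iff list_ex_iff dnon_def Let_def r_def by auto
  ultimately show False
    by (rule kbase_prop_W[OF assms])
qed

lemma cover_table_W:
  assumes "hyperoval linesW f" "f 0" "kbase linesW f" "y < 40" "\<not> f y"
  shows "\<exists>z\<in>set (nbs linesW y). f z"
proof (rule ccontr)
  assume n: "\<not> ?thesis"
  define r where "r = (\<lambda>y. \<not> f y \<and> (\<forall>z\<in>set (nbs linesW y). \<not> f z))"
  have "r y"
    using n assms(4,5) unfolding r_def by auto
  then have "list_ex r [0..<40]"
    using assms(4) unfolding list_ex_iff set_upt by (intro bexI[of _ y]) simp_all
  moreover have "list_all (\<lambda>y. (r y \<longrightarrow> \<not> f y) \<and> list_all (\<lambda>z. r y \<longrightarrow> \<not> f z) (nbs linesW y)) [0..<40]"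
    unfolding list_all_iff r_def by blast
  ultimately show False
    by (rule cover_prop_W[OF assms(1-3)])
qed

lemma antipode_table_Q:
  assumes h: "hyperoval linesQ f" "hyperoval linesQ g" "hyperoval linesQ h"
    and p: "pcond linesQ f" "pcond linesQ g" "pcond linesQ h" and t: "triple linesQ 1 f g h"
  shows "\<exists>o1\<in>{f, g, h}. \<exists>x\<in>set (far linesQ). o1 x \<and> (\<forall>d\<in>set (nbs linesQ 0). o1 d \<longrightarrow> d \<in> set (nbs linesQ x))"
proof (rule ccontr)
  assume n: "\<not> ?thesis"
  have na: "no_antipode linesQ o1" if "o1 \<in> {f, g, h}" for o1
    using n that unfolding no_antipode_def list_all_iff list_ex_iff dnon_def Let_def by auto
  have na': "no_antipode linesQ f" "no_antipode linesQ g" "no_antipode linesQ h"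
    using na by blast+
  show False
    by (rule antipode_prop_Q[OF h p triple_parts(1)[OF t] both_on_conj both_on_conj both_on_conj
        triple_parts(2,4,6)[OF t] na'])
qed

lemma at_most_two_intro:
  assumes "distinct xs" "\<And>x y z. x \<in> set xs \<Longrightarrow> y \<in> set xs \<Longrightarrow> z \<in> set xs \<Longrightarrow> c x \<Longrightarrow> c y \<Longrightarrow> c z \<Longrightarrow>
    x = y \<or> x = z \<or> y = z"
  shows "at_most_two c xs"
  using assms
proof (induction xs)
  case (Cons x xs)
  have d: "distinct xs" "x \<notin> set xs"
    using Cons.prems(1) by auto
  have "at_most_one c xs" if "c x"
    unfolding at_most_one_iff[OF d(1)]
    using Cons.prems(2)[of x] d(2) that by (metis list.set_intros)
  moreover have "at_most_two c xs"
    using Cons.IH[OF d(1)] Cons.prems(2) by (meson list.set_intros(2))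
  ultimately show ?case
    by simp
qed simp

lemma none_alone_intro:
  assumes "distinct xs" "\<And>x. x \<in> set xs \<Longrightarrow> c x \<Longrightarrow> \<exists>y\<in>set xs \<union> set ys. y \<noteq> x \<and> c y"
  shows "none_alone c ys xs"
  using assms
proof (induction xs arbitrary: ys)
  case (Cons x xs)
  have "none_alone c (x # ys) xs"
    using Cons.prems by (intro Cons.IH) auto
  moreover have "list_ex c (ys @ xs)" if "c x"
    using Cons.prems(2)[of x] that by (auto simp: list_ex_iff)
  ultimately show ?case by simp
qed simp

text \<open>In the application 0, 1, 4, 7 and \<open>d\<close> are indices of a vertex and of one
  neighbour on each of the four lines through it; \<open>y\<close> sees all five of them, and each
  line yields one triple containing \<open>y\<close>. The index 2 belongs to the vertex whose
  antipodes are compared.\<close>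

lemma antipodes_table_Q:
  assumes h: "hyperoval linesQ y" "hyperoval linesQ w" "hyperoval linesQ w1" "hyperoval linesQ w2" "hyperoval linesQ w3"
    and p: "pcond linesQ y" "pcond linesQ w" "pcond linesQ w1" "pcond linesQ w2" "pcond linesQ w3"
    and t: "triple linesQ 1 w2 y r2" "triple linesQ 4 w y r" "triple linesQ 7 w1 y r1" "triple linesQ d w3 y r3"
    and d: "d \<in> {10, 11, 12}"
    and c: "none_or_two_common (\<lambda>x. w x \<and> w1 x)" "none_or_two_common (\<lambda>x. w x \<and> w2 x)"
      "none_or_two_common (\<lambda>x. w x \<and> r2 x)" "none_or_two_common (\<lambda>x. w x \<and> w3 x)"
      "none_or_two_common (\<lambda>x. w x \<and> r3 x)" "none_or_two_common (\<lambda>x. w1 x \<and> w2 x)"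
      "none_or_two_common (\<lambda>x. w1 x \<and> r2 x)" "none_or_two_common (\<lambda>x. w1 x \<and> w3 x)"
      "none_or_two_common (\<lambda>x. w1 x \<and> r3 x)" "none_or_two_common (\<lambda>x. w2 x \<and> w3 x)"
      "none_or_two_common (\<lambda>x. w2 x \<and> r3 x)" "none_or_two_common (\<lambda>x. r2 x \<and> w3 x)"
      "none_or_two_common (\<lambda>x. r2 x \<and> r3 x)"
    and v: "w 2" "w1 2"
    and b: "4 \<le> b" "b < 13" "w b" "\<And>x. x \<in> set (nbs linesQ 2) \<Longrightarrow> w x \<Longrightarrow> x \<in> set (nbs linesQ b)"
    and b': "4 \<le> b'" "b' < 13" "w1 b'" "\<And>x. x \<in> set (nbs linesQ 2) \<Longrightarrow> w1 x \<Longrightarrow> x \<in> set (nbs linesQ b')"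
  shows "b = b' \<or> b' \<in> set (nbs linesQ b)"
proof (rule ccontr)
  assume n: "\<not> ?thesis"
  have m: "b \<in> set [4..<13]" "b' \<in> set [4..<13]"
    using b b' unfolding set_upt atLeastLessThan_iff by blast+
  have s: "list_ex (\<lambda>x. x = b) [4..<13]"
    "list_all (\<lambda>e. (e = b \<longrightarrow> w e) \<and> list_all (\<lambda>x. e = b \<longrightarrow> \<not> w x) (filter (\<lambda>x. x \<notin> set (nbs linesQ e)) (nbs linesQ 2))) [4..<13]"
    "list_all (\<lambda>e. (e = b' \<longrightarrow> w1 e) \<and> list_all (\<lambda>x. e = b' \<longrightarrow> \<not> w1 x) (filter (\<lambda>x. x \<notin> set (nbs linesQ e)) (nbs linesQ 2))) [4..<13]"
    "list_all (\<lambda>e. e = b \<longrightarrow> list_ex (\<lambda>x. x = b') (filter (\<lambda>c. c \<notin> set (nbs linesQ e) \<and> c \<noteq> e) [4..<13])) [4..<13]"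
    unfolding list_ex_iff list_all_iff set_filter using m b(3,4) b'(3,4) n by auto
  note a = h(1) p(1) h(2) p(2) h(3) p(3) h(4) p(4) h(5) p(5)
    triple_parts(1)[OF t(1)] both_on_conj triple_parts(2)[OF t(1)] both_on_conj triple_parts(4)[OF t(1)]
    both_on_conj triple_parts(6)[OF t(1)]
    triple_parts(1)[OF t(2)] both_on_conj triple_parts(2)[OF t(2)] both_on_conj triple_parts(4)[OF t(2)]
    both_on_conj triple_parts(6)[OF t(2)]
    triple_parts(1)[OF t(3)] both_on_conj triple_parts(2)[OF t(3)] both_on_conj triple_parts(4)[OF t(3)]
    both_on_conj triple_parts(6)[OF t(3)]
  note c' = both_on_conj c(1) both_on_conj c(2) both_on_conj c(3) both_on_conj c(4) both_on_conj c(5) both_on_conj c(6) both_on_conj c(7) both_on_conj c(8) both_on_conj c(9) both_on_conj c(10) both_on_conj c(11) both_on_conj c(12) both_on_conj c(13)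
  from d consider "d = 10" | "d = 11" | "d = 12" by blast
  then show False
  proof cases
    case 1
    show False
      by (rule antipodes_prop_Q0[OF a triple_parts(1)[OF t(4)[unfolded 1]] both_on_conj triple_parts(2)[OF t(4)[unfolded 1]] both_on_conj triple_parts(4)[OF t(4)[unfolded 1]]
    both_on_conj triple_parts(6)[OF t(4)[unfolded 1]] c' v s])
  next
    case 2
    show False
      by (rule antipodes_prop_Q1[OF a triple_parts(1)[OF t(4)[unfolded 2]] both_on_conj triple_parts(2)[OF t(4)[unfolded 2]] both_on_conj triple_parts(4)[OF t(4)[unfolded 2]]
    both_on_conj triple_parts(6)[OF t(4)[unfolded 2]] c' v s])
  next
    case 3
    show False
      by (rule antipodes_prop_Q2[OF a triple_parts(1)[OF t(4)[unfolded 3]] both_on_conj triple_parts(2)[OF t(4)[unfolded 3]] both_on_conj triple_parts(4)[OF t(4)[unfolded 3]]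
    both_on_conj triple_parts(6)[OF t(4)[unfolded 3]] c' v s])
  qed
qed

section \<open>Cliques and hyperovals in a locally quadrangular graph\<close>

locale locally_gq =
  fixes V :: "'a set" and adj :: "'a \<Rightarrow> 'a \<Rightarrow> bool"
  assumes simple: "simple_graph V adj"
    and local: "u \<in> V \<Longrightarrow> \<exists>L g. L \<in> {linesW, linesQ} \<and> coords adj L u g"
begin

lemma adj_sym: "adj x y \<longleftrightarrow> adj y x"
  using simple by (auto simp: simple_graph_def)

lemma adj_irrefl [simp]: "\<not> adj x x"
  using simple by (auto simp: simple_graph_def)

lemma adj_ne: "adj x y \<Longrightarrow> x \<noteq> y"
  by auto

lemma adj_V: "adj x y \<Longrightarrow> x \<in> V"
  using simple by (auto simp: simple_graph_def)

definition has_type :: "'a \<Rightarrow> nat list list \<Rightarrow> bool" where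
  "has_type u L \<longleftrightarrow> L \<in> {linesW, linesQ} \<and> (\<exists>g. coords adj L u g)"

lemma has_type_ex: "u \<in> V \<Longrightarrow> \<exists>L. has_type u L"
  using local by (auto simp: has_type_def)

lemma has_type_form: "has_type u L \<Longrightarrow> table_form L"
  using table_form_W table_form_Q by (auto simp: has_type_def)

lemma coordsD:
  assumes "coords adj L u g"
  shows "i < 40 \<Longrightarrow> adj u (g i)" "i < 40 \<Longrightarrow> j < 40 \<Longrightarrow> adj (g i) (g j) \<longleftrightarrow> j \<in> set (nbs L i)"
    "i < 40 \<Longrightarrow> j < 40 \<Longrightarrow> g i = g j \<longleftrightarrow> i = j" "adj u x \<Longrightarrow> \<exists>i<40. x = g i"
  using assms by (auto simp: coords_def bij_betw_def inj_on_def)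

lemma has_type_moves:
  assumes "has_type u L"
  shows "\<exists>P n. moves L P n [] 0 [0..<40]" "\<exists>P n. moves L P n [0] 1 [1..<13]"
    "\<exists>P n. moves L P n [0, 1] 4 [4..<13]" "\<exists>P n. moves L P n [0, 1, 4] 5 [5, 6]"
proof -
  have "L = linesW \<or> L = linesQ"
    using assms unfolding has_type_def by blast
  then show "\<exists>P n. moves L P n [] 0 [0..<40]" "\<exists>P n. moves L P n [0] 1 [1..<13]"
    "\<exists>P n. moves L P n [0, 1] 4 [4..<13]" "\<exists>P n. moves L P n [0, 1, 4] 5 [5, 6]"
    using transitive_W0 transitive_Q0 transitive_W1 transitive_Q1 transitive_W4 transitive_Q4
      transitive_W5 transitive_Q5 by blast+
qed

text \<open>Automorphisms of the table allow any neighbour to be placed at index 0. The lemmas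
  \<open>coords_edge\<close>, \<open>coords_path\<close> and \<open>coords_claw\<close> continue
  this with stabilisers, so that each later argument only treats one configuration.\<close>

lemma coords_base:
  assumes "has_type u L" "adj u v"
  shows "\<exists>g. coords adj L u g \<and> g 0 = v"
proof -
  obtain g where g: "coords adj L u g"
    using assms by (auto simp: has_type_def)
  obtain i where i: "i < 40" "v = g i"
    using coordsD(4)[OF g assms(2)] by auto
  obtain P n where m: "moves L P n [] 0 [0..<40]"
    using has_type_moves(1)[OF assms(1)] by blast
  have "i \<in> set [0..<40]"
    unfolding set_upt atLeastLessThan_iff using i(1) by blast
  then show ?thesis
    using coords_move[OF g has_type_form[OF assms(1)] m] i(2) by metis
qed

lemma has_type_nbs0:
  assumes "has_type u L"
  shows "set (nbs L 0) = {1..<13}" "set (nbs L 0) \<inter> set (nbs L 1) = {2, 3}"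
    "3 \<in> set (nbs L 2)" "set (nbs L 0) \<inter> set (nbs L 4) = {5, 6}"
proof -
  have "L = linesW \<or> L = linesQ"
    using assms unfolding has_type_def by blast
  then have *: "set (nbs L 0) = {1..<13} \<and> set (nbs L 0) \<inter> set (nbs L 1) = {2, 3} \<and>
    3 \<in> set (nbs L 2) \<and> set (nbs L 0) \<inter> set (nbs L 4) = {5, 6}"
  proof
    assume 1: "L = linesW"
    show ?thesis
      unfolding 1 by (intro conjI base_W(1-4))
  next
    assume 1: "L = linesQ"
    show ?thesis
      unfolding 1 by (intro conjI base_Q(1-4))
  qed
  show "set (nbs L 0) = {1..<13}" "set (nbs L 0) \<inter> set (nbs L 1) = {2, 3}"
    "3 \<in> set (nbs L 2)" "set (nbs L 0) \<inter> set (nbs L 4) = {5, 6}"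
    by (rule *[THEN conjunct1], rule *[THEN conjunct2, THEN conjunct1],
        rule *[THEN conjunct2, THEN conjunct2, THEN conjunct1], rule *[THEN conjunct2, THEN conjunct2, THEN conjunct2])
qed

lemma coords_edge:
  assumes "has_type u L" "adj u v" "adj u d" "adj v d"
  shows "\<exists>g. coords adj L u g \<and> g 0 = v \<and> g 1 = d"
proof -
  obtain g where g: "coords adj L u g" "g 0 = v"
    using coords_base[OF assms(1,2)] by blast
  obtain i where i: "i < 40" "d = g i"
    using coordsD(4)[OF g(1) assms(3)] by auto
  have "i \<in> set (nbs L 0)"
    using coordsD(2)[OF g(1), of 0 i] i assms(4) g(2) by auto
  then have "i \<in> set [1..<13]"
    using has_type_nbs0(1)[OF assms(1)] by (simp only: set_upt)
  moreover obtain P n where m: "moves L P n [0] 1 [1..<13]"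
    using has_type_moves(2)[OF assms(1)] by blast
  ultimately obtain g' where g': "coords adj L u g'" "g' 1 = g i" "\<forall>j\<in>set [0]. g' j = g j"
    using coords_move[OF g(1) has_type_form[OF assms(1)] m] by metis
  then show ?thesis
    using i(2) g(2) by (intro exI[of _ g']) simp
qed

lemma coords_path:
  assumes "has_type u L" "adj u v" "adj u d" "adj v d" "adj u c" "adj v c" "\<not> adj d c" "d \<noteq> c"
  shows "\<exists>g. coords adj L u g \<and> g 0 = v \<and> g 1 = d \<and> g 4 = c"
proof -
  obtain g where g: "coords adj L u g" "g 0 = v" "g 1 = d"
    using coords_edge[OF assms(1-4)] by blast
  obtain i where i: "i < 40" "c = g i"
    using coordsD(4)[OF g(1) assms(5)] by auto
  have i0: "i \<in> set (nbs L 0)" and i1: "i \<notin> set (nbs L 1)" and ne: "i \<noteq> 1"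
    using coordsD(2)[OF g(1), of 0 i] coordsD(2)[OF g(1), of 1 i] i assms g by auto
  have "i \<notin> {2, 3}"
    using has_type_nbs0(2)[OF assms(1)] i0 i1 by blast
  moreover have "1 \<le> i" "i < 13"
    using i0 has_type_nbs0(1)[OF assms(1)] by auto
  ultimately have "4 \<le> i \<and> i < 13"
    using ne by simp
  then have "i \<in> set [4..<13]"
    by (simp only: set_upt atLeastLessThan_iff)
  moreover obtain P n where m: "moves L P n [0, 1] 4 [4..<13]"
    using has_type_moves(3)[OF assms(1)] by blast
  ultimately obtain g' where g': "coords adj L u g'" "g' 4 = g i" "\<forall>j\<in>set [0, 1]. g' j = g j"
    using coords_move[OF g(1) has_type_form[OF assms(1)] m] by metis
  then show ?thesis
    using i(2) g(2,3) by (intro exI[of _ g']) simp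
qed

definition clique5 :: "'a \<Rightarrow> 'a \<Rightarrow> 'a \<Rightarrow> 'a \<Rightarrow> 'a \<Rightarrow> bool" where
  "clique5 a b c d e \<longleftrightarrow> adj a b \<and> adj a c \<and> adj a d \<and> adj a e \<and> adj b c \<and> adj b d \<and> adj b e \<and>
     adj c d \<and> adj c e \<and> adj d e"

text \<open>In the quadrangle at \<open>u\<close> the edge \<open>v\<close>, \<open>d\<close> spans
  a line of four points. Hence a triangle lies in exactly one 5-clique.\<close>

lemma triangle_common:
  assumes "adj u v" "adj u d" "adj v d"
  shows "\<exists>e f. clique5 u v d e f \<and> (\<forall>x. adj u x \<longrightarrow> adj v x \<longrightarrow> adj d x \<longrightarrow> x = e \<or> x = f)"
proof -
  obtain L where L: "has_type u L"
    using has_type_ex adj_V assms(1) by blast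
  obtain g where g: "coords adj L u g" "g 0 = v" "g 1 = d"
    using coords_edge[OF L assms] by blast
  note n = has_type_nbs0[OF L]
  have m: "2 \<in> set (nbs L 0)" "3 \<in> set (nbs L 0)" "2 \<in> set (nbs L 1)" "3 \<in> set (nbs L 1)"
    using n(2) by auto
  have "clique5 u v d (g 2) (g 3)"
    unfolding clique5_def using assms m n(3) coordsD(1)[OF g(1), of 2] coordsD(1)[OF g(1), of 3]
      coordsD(2)[OF g(1), of 0 2] coordsD(2)[OF g(1), of 0 3] coordsD(2)[OF g(1), of 1 2]
      coordsD(2)[OF g(1), of 1 3] coordsD(2)[OF g(1), of 2 3] g(2,3) by simp
  moreover have "x = g 2 \<or> x = g 3" if x: "adj u x" "adj v x" "adj d x" for x
  proof -
    obtain i where i: "i < 40" "x = g i"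
      using coordsD(4)[OF g(1) x(1)] by auto
    have "i \<in> set (nbs L 0) \<inter> set (nbs L 1)"
      using coordsD(2)[OF g(1), of 0 i] coordsD(2)[OF g(1), of 1 i] i x g by auto
    then have "i = 2 \<or> i = 3"
      using n(2) by blast
    then show ?thesis
      using i by blast
  qed
  ultimately show ?thesis by blast
qed

lemma clique5_perm:
  assumes "clique5 a b c d e"
  shows "clique5 b a c d e" "clique5 c a b d e" "clique5 d a b c e" "clique5 e a b c d"
    "clique5 a c b d e" "clique5 a d b c e" "clique5 a e b c d"
  using assms by (auto simp: clique5_def adj_sym)

text \<open>The parity rule. In the quadrangle at \<open>a\<close> the other four members form a
  line, and \<open>x\<close> is a point off it, hence collinear with exactly one of its
  points.\<close>

lemma clique5_nbr:
  assumes C: "clique5 a b c d e" and x: "adj x a" "x \<noteq> b" "x \<noteq> c" "x \<noteq> d" "x \<noteq> e"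
  shows "adj x b \<and> \<not> adj x c \<and> \<not> adj x d \<and> \<not> adj x e \<or> \<not> adj x b \<and> adj x c \<and> \<not> adj x d \<and> \<not> adj x e \<or>
    \<not> adj x b \<and> \<not> adj x c \<and> adj x d \<and> \<not> adj x e \<or> \<not> adj x b \<and> \<not> adj x c \<and> \<not> adj x d \<and> adj x e"
proof -
  obtain L where L: "has_type a L"
    using has_type_ex[OF adj_V, of a b] C by (auto simp: clique5_def)
  obtain g where g: "coords adj L a g" "g 0 = b" "g 1 = c"
    using coords_edge[OF L, of b c] C by (auto simp: clique5_def)
  note n = has_type_nbs0[OF L] and cD = coordsD[OF g(1)]
  have idx: "i \<in> {2, 3}" if "adj a (g i)" "adj b (g i)" "adj c (g i)" "i < 40" for i
  proof -
    have "i \<in> set (nbs L 0) \<inter> set (nbs L 1)"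
      using cD(2)[of 0 i] cD(2)[of 1 i] that g by auto
    then show ?thesis
      using n(2) by blast
  qed
  obtain i where i: "i < 40" "d = g i"
    using cD(4)[of d] C by (auto simp: clique5_def)
  obtain j where j: "j < 40" "e = g j"
    using cD(4)[of e] C by (auto simp: clique5_def)
  obtain k where k: "k < 40" "x = g k"
    using cD(4)[of x] x by (auto simp: adj_sym)
  have ij: "i \<in> {2, 3}" "j \<in> {2, 3}" "i \<noteq> j"
    using idx[of i] idx[of j] i j C by (auto simp: clique5_def)
  have k4: "4 \<le> k"
  proof (rule ccontr)
    assume "\<not> 4 \<le> k"
    then have "k = 0 \<or> k = 1 \<or> k = i \<or> k = j"
      using ij by auto
    then show False
      using x k i j g by auto
  qed
  have "L = linesW \<or> L = linesQ"
    using L unfolding has_type_def by blast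
  then have "list_all (\<lambda>k. one_of (0 \<in> set (nbs L k) \<or> 1 \<in> set (nbs L k)) (2 \<in> set (nbs L k))
     (3 \<in> set (nbs L k)) \<and> \<not> (0 \<in> set (nbs L k) \<and> 1 \<in> set (nbs L k))) [4..<40]"
  proof
    assume 1: "L = linesW"
    show ?thesis
      unfolding 1 by (rule base_W(5))
  next
    assume 1: "L = linesQ"
    show ?thesis
      unfolding 1 by (rule base_Q(5))
  qed
  moreover have "k \<in> set [4..<40]"
    unfolding set_upt atLeastLessThan_iff using k(1) k4 by blast
  ultimately have o: "one_of (0 \<in> set (nbs L k) \<or> 1 \<in> set (nbs L k)) (2 \<in> set (nbs L k)) (3 \<in> set (nbs L k))"
    "\<not> (0 \<in> set (nbs L k) \<and> 1 \<in> set (nbs L k))"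
    unfolding list_all_iff by blast+
  have ad: "adj x b \<longleftrightarrow> 0 \<in> set (nbs L k)" "adj x c \<longleftrightarrow> 1 \<in> set (nbs L k)"
    "adj x d \<longleftrightarrow> i \<in> set (nbs L k)" "adj x e \<longleftrightarrow> j \<in> set (nbs L k)"
    using cD(2)[of k 0] cD(2)[of k 1] cD(2)[of k i] cD(2)[of k j] k g i j by auto
  have "i = 2 \<and> j = 3 \<or> i = 3 \<and> j = 2"
    using ij by auto
  then show ?thesis
  proof (elim disjE conjE)
    assume e: "i = 2" "j = 3"
    show ?thesis
      using o unfolding ad one_of_def e by sat
  next
    assume e: "i = 3" "j = 2"
    show ?thesis
      using o unfolding ad one_of_def e by sat
  qed
qed

text \<open>The parity rule as clauses, in the shape that \<open>sat\<close> can combine with the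
  table conditions.\<close>

lemma clique5_cnf:
  assumes "clique5 a b c d e" "x \<noteq> b" "x \<noteq> c" "x \<noteq> d" "x \<noteq> e"
  shows "adj x a \<longrightarrow> adj x b \<or> adj x c \<or> adj x d \<or> adj x e"
    "\<not> adj x a \<or> \<not> adj x b \<or> \<not> adj x c" "\<not> adj x a \<or> \<not> adj x b \<or> \<not> adj x d"
    "\<not> adj x a \<or> \<not> adj x b \<or> \<not> adj x e" "\<not> adj x a \<or> \<not> adj x c \<or> \<not> adj x d"
    "\<not> adj x a \<or> \<not> adj x c \<or> \<not> adj x e" "\<not> adj x a \<or> \<not> adj x d \<or> \<not> adj x e"
  using clique5_nbr[OF assms(1) _ assms(2-5)] by blast+

lemma clique5_mem:
  assumes "clique5 a b c d e" "adj x a" "adj x b" "adj x c"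
  shows "x = d \<or> x = e"
  using clique5_nbr[OF assms(1,2)] assms(3,4) adj_ne[OF assms(3)] adj_ne[OF assms(4)] by blast

lemma coords_line:
  assumes "coords adj L u g" "table_form L" "[a, b, c, d] \<in> set L"
  shows "clique5 u (g a) (g b) (g c) (g d)"
proof -
  have l: "distinct [a, b, c, d]" "a < 40" "b < 40" "c < 40" "d < 40"
    using assms by (auto simp: table_form_def list_all_iff)
  have "adj (g x) (g y)" if "x \<in> {a, b, c, d}" "y \<in> {a, b, c, d}" "x \<noteq> y" for x y
  proof -
    have "y \<in> set (nbs L x)"
      unfolding in_nbs using assms(3) that by (intro conjI bexI[of _ "[a, b, c, d]"]) auto
    moreover have "x < 40" "y < 40"
      using that l by auto
    ultimately show ?thesis
      using coordsD(2)[OF assms(1)] by blast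
  qed
  then show ?thesis
    unfolding clique5_def using l coordsD(1)[OF assms(1)] by simp
qed

text \<open>A line at \<open>u\<close> together with \<open>u\<close> is a 5-clique. As
  \<open>w\<close> does not see \<open>u\<close>, the none or two members it sees all lie on the
  line.\<close>

lemma hyperoval_common:
  assumes g: "coords adj L u g" and L: "table_form L" and uw: "u \<noteq> w" "\<not> adj u w"
  shows "hyperoval L (\<lambda>n. adj w (g n))"
  unfolding hyperoval_def list_all_iff
proof
  fix l assume l: "l \<in> set L"
  then have "length l = 4" and lt: "\<And>x. x \<in> set l \<Longrightarrow> x < 40"
    using L by (auto simp: table_form_def list_all_iff)
  then obtain a b c d where ld: "l = [a, b, c, d]"
    by (auto simp: length_Suc_conv numeral_eq_Suc)
  have C: "clique5 u (g a) (g b) (g c) (g d)"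
    using coords_line[OF g L] l ld by simp
  have w: "w \<noteq> g a" "w \<noteq> g b" "w \<noteq> g c" "w \<noteq> g d" "\<not> adj w u"
    using uw C by (auto simp: clique5_def adj_sym)
  have p: "clique5 (g a) u (g b) (g c) (g d)" "clique5 (g b) u (g a) (g c) (g d)"
    "clique5 (g c) u (g a) (g b) (g d)" "clique5 (g d) u (g a) (g b) (g c)"
    using clique5_perm[OF C] by auto
  have wu: "w \<noteq> u"
    using uw by blast
  show "hyp_line (\<lambda>n. adj w (g n)) l"
    unfolding ld hyp_line.simps
    using clique5_cnf[OF p(1) wu w(2,3,4)] clique5_cnf[OF p(2) wu w(1,3,4)]
      clique5_cnf[OF p(3) wu w(1,2,4)] clique5_cnf[OF p(4) wu w(1,2,3)] w(5) by (intro conjI; sat)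
qed

text \<open>Let \<open>x\<close> be in the overlap of the hyperovals of \<open>w\<close> and
  \<open>w'\<close>, off \<open>v\<close> and \<open>d\<close>. The triangle of \<open>x\<close>,
  \<open>w\<close>, \<open>w'\<close> has two further vertices in its 5-clique, and by parity
  \<open>u\<close> sees exactly one of them: the unique partner of \<open>x\<close> in the
  overlap.\<close>

lemma overlap_matched:
  assumes g: "coords adj L u g" and C: "clique5 v d w w' w''" and u: "adj u v" "adj u d" "u \<noteq> w" "u \<noteq> w'" "u \<noteq> w''"
    and k: "g 0 = v" "g k = d" "k < 40"
  shows "matched (ynb L k) (\<lambda>x. adj w (g x) \<and> adj w' (g x)) \<and>
    sparse (ynb L k) (\<lambda>x. adj w (g x) \<and> adj w' (g x))"
proof -
  have unw: "\<not> adj u w" "\<not> adj u w'" "\<not> adj u w''"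
    using clique5_nbr[OF C u(1) adj_ne[OF u(2)] u(3-5)] u(2) by blast+
  have Cw: "clique5 w v d w' w''" "clique5 w' v d w w''"
    using clique5_perm[OF C] by auto
  have main: "\<exists>z. z \<in> set (nbs L x) \<and> z \<in> set (yset L k) \<and> adj w (g z) \<and> adj w' (g z) \<and>
      (\<forall>z'. z' < 40 \<longrightarrow> z' \<in> set (nbs L x) \<longrightarrow> adj w (g z') \<longrightarrow> adj w' (g z') \<longrightarrow> z' = z)"
    if x: "x \<in> set (yset L k)" "adj w (g x)" "adj w' (g x)" for x
  proof -
    have x40: "x < 40" "x \<notin> set (nbs L 0)" "x \<notin> set (nbs L k)"
      using x(1) by (auto simp: yset_def Let_def)
    have xv: "\<not> adj (g x) v" "\<not> adj (g x) d"
      using x40 coordsD(2)[OF g, of 0 x] coordsD(2)[OF g, of k x] k by (auto simp: adj_sym)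
    obtain a b where ab: "clique5 (g x) w w' a b"
      "\<And>y. adj (g x) y \<Longrightarrow> adj w y \<Longrightarrow> adj w' y \<Longrightarrow> y = a \<or> y = b"
      using triangle_common[of "g x" w w'] x C by (auto simp: clique5_def adj_sym)
    have "adj u (g x)"
      using coordsD(1)[OF g] x40 by simp
    moreover have "u \<noteq> a" "u \<noteq> b"
      using ab(1) unw by (auto simp: clique5_def adj_sym)
    \<comment> \<open>Of this clique \<open>u\<close> sees \<open>g x\<close> but neither
      \<open>w\<close> nor \<open>w'\<close>, so exactly one of the remaining two.\<close>
    ultimately have "adj u a \<noteq> adj u b"
      using clique5_nbr[OF ab(1), of u] unw u by auto
    then obtain c where c: "adj u c" "c = a \<or> c = b" "\<And>y. y = a \<or> y = b \<Longrightarrow> adj u y \<Longrightarrow> y = c"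
      by blast
    have cx: "adj (g x) c" "adj w c" "adj w' c"
      using ab(1) c(2) by (auto simp: clique5_def)
    obtain z where z: "z < 40" "c = g z"
      using coordsD(4)[OF g c(1)] by auto
    have "c \<noteq> v" "c \<noteq> d" "c \<noteq> w'" "c \<noteq> w''"
      using cx xv c(1) unw by auto
    then have nv: "\<not> adj c v" "\<not> adj c d"
      using clique5_nbr[OF Cw(1), of c] cx by (auto simp: adj_sym)
    have "z \<noteq> 0"
      using \<open>c \<noteq> v\<close> z k by metis
    then have zy: "z \<in> set (yset L k)"
      using nv z coordsD(2)[OF g, of 0 z] coordsD(2)[OF g, of k z] k
      by (auto simp: yset_def Let_def adj_sym)
    have zx: "z \<in> set (nbs L x)"
      using cx z x40 coordsD(2)[OF g, of x z] by auto
    have zu: "z' = z" if z': "z' < 40" "z' \<in> set (nbs L x)" "adj w (g z')" "adj w' (g z')" for z'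
    proof -
      have "adj (g x) (g z')"
        using z' x40 coordsD(2)[OF g, of x z'] by auto
      then have "g z' = c"
        using ab(2) c(3) z' coordsD(1)[OF g] by blast
      then show ?thesis
        using z z' coordsD(3)[OF g] by auto
    qed
    have "adj w (g z)" "adj w' (g z)"
      using cx z(2) by simp_all
    then show ?thesis
      using zy zx zu by blast
  qed
  have lt: "z < 40" if "z \<in> set (yset L k)" for z
    using that by (auto simp: yset_def Let_def)
  show ?thesis
  proof
    show "matched (ynb L k) (\<lambda>x. adj w (g x) \<and> adj w' (g x))"
      unfolding matched_def ynb_def Let_def list_all_iff list_ex_iff
    proof (clarsimp)
      fix x assume "x \<in> set (yset L k)" "adj w (g x)" "adj w' (g x)"
      from main[OF this]
      show "\<exists>xa. xa \<in> set (nbs L x) \<and> xa \<in> set (yset L k) \<and> adj w (g xa) \<and> adj w' (g xa)"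
        by blast
    qed
    show "sparse (ynb L k) (\<lambda>x. adj w (g x) \<and> adj w' (g x))"
      unfolding sparse_def ynb_def Let_def list_all_iff
    proof (clarsimp simp: at_most_one_iff distinct_nbs)
      fix x a b assume x: "x \<in> set (yset L k)" "adj w (g x)" "adj w' (g x)"
        and a: "a \<in> set (nbs L x)" "a \<in> set (yset L k)" "adj w (g a)" "adj w' (g a)"
        and b: "b \<in> set (nbs L x)" "b \<in> set (yset L k)" "adj w (g b)" "adj w' (g b)"
      from main[OF x] a b lt show "a = b"
        by metis
    qed
  qed
qed

lemma triple_common:
  assumes g: "coords adj L u g" and C: "clique5 v d w w' w''" and u: "adj u v" "adj u d" "u \<noteq> w" "u \<noteq> w'" "u \<noteq> w''"
    and k: "g 0 = v" "g k = d" "k < 40"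
  shows "triple L k (\<lambda>x. adj w (g x)) (\<lambda>x. adj w' (g x)) (\<lambda>x. adj w'' (g x))"
proof -
  have unw: "\<not> adj u w" "\<not> adj u w'" "\<not> adj u w''"
    using clique5_nbr[OF C u(1) adj_ne[OF u(2)] u(3-5)] u(2) by blast+
  have P: "clique5 d v w w' w''" "clique5 w v d w' w''" "clique5 w' v d w w''" "clique5 w'' v d w w'"
    "clique5 v d w w'' w'" "clique5 v d w' w'' w"
    using C by (auto simp: clique5_def adj_sym)
  have ad: "adj (g x) v \<longleftrightarrow> x \<in> set (nbs L 0)" "adj (g x) d \<longleftrightarrow> x \<in> set (nbs L k)" if "x < 40" for x
    using that coordsD(2)[OF g, of 0 x] coordsD(2)[OF g, of k x] k by (auto simp: adj_sym)
  have ne: "g x \<noteq> w" "g x \<noteq> w'" "g x \<noteq> w''" if "x < 40" for x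
    using coordsD(1)[OF g that] unw by auto
  have one: "one_of (adj w (g x)) (adj w' (g x)) (adj w'' (g x))" if "x \<in> set (aset L k)" for x
  proof -
    have x: "x < 40" "x \<noteq> 0" "x \<noteq> k" "(x \<in> set (nbs L 0)) \<noteq> (x \<in> set (nbs L k))"
      using that by (auto simp: aset_def Let_def)
    then have n: "g x \<noteq> v" "g x \<noteq> d"
      using coordsD(3)[OF g, of x 0] coordsD(3)[OF g, of x k] k by auto
    have "adj (g x) v \<noteq> adj (g x) d"
      using x ad[of x] by simp
    then show ?thesis
      unfolding one_of_def adj_sym[of w] adj_sym[of w'] adj_sym[of w'']
      using clique5_cnf[OF C n(2) ne[OF x(1)]] clique5_cnf[OF P(1) n(1) ne[OF x(1)]] by sat
  qed
  have two: "none_or_two_of (adj w (g x)) (adj w' (g x)) (adj w'' (g x))" if "x \<in> set (yset L k)" for x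
  proof -
    have x: "x < 40" "x \<noteq> 0" "x \<notin> set (nbs L 0)" "x \<notin> set (nbs L k)"
      using that by (auto simp: yset_def Let_def)
    then have na: "\<not> adj (g x) v" "\<not> adj (g x) d" "g x \<noteq> v"
      using ad[of x] coordsD(3)[OF g, of x 0] k by auto
    have "adj v d"
      using C by (simp add: clique5_def)
    then have nd: "g x \<noteq> d"
      using na(1) adj_sym by blast
    show ?thesis
      unfolding none_or_two_of_def adj_sym[of w] adj_sym[of w'] adj_sym[of w'']
      using clique5_cnf[OF P(2) na(3) nd ne(2,3)[OF x(1)]] clique5_cnf[OF P(3) na(3) nd ne(1,3)[OF x(1)]]
        clique5_cnf[OF P(4) na(3) nd ne(1,2)[OF x(1)]] na by sat
  qed
  have "adj w (g 0)" "adj w' (g 0)" "adj w'' (g 0)" "adj w (g k)" "adj w' (g k)" "adj w'' (g k)"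
    using C k by (simp_all add: clique5_def adj_sym)
  then have "split3 L k (\<lambda>x. adj w (g x)) (\<lambda>x. adj w' (g x)) (\<lambda>x. adj w'' (g x))"
    unfolding split3_def list_all_iff using one two by blast
  then show ?thesis
    unfolding triple_def
    using overlap_matched[OF g C u k] overlap_matched[OF g P(5) u(1,2,3,5,4) k]
      overlap_matched[OF g P(6) u(1,2,4,5,3) k] by blast
qed

end

context locally_gq
begin

lemma second_line: "has_type u L \<Longrightarrow> [0, 4, 5, 6] \<in> set L"
  by (auto simp: has_type_def linesW_def linesQ_def)

lemma has_type_cases: "has_type u L \<Longrightarrow> L = linesW \<or> L = linesQ"
  unfolding has_type_def by blast

text \<open>By \<open>overlap_matched\<close> each point of the overlap has one partner there. The
  assertion is that there is at most one such pair; it follows from \<open>overlap_table\<close>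
  once the three hyperovals are in standard position.\<close>

lemma overlap_clique:
  assumes C: "clique5 v d w w' w''" and u: "adj u v" "adj u d" "u \<noteq> w" "u \<noteq> w'" "u \<noteq> w''"
    and y: "adj u y" "adj w y" "adj w' y" "y \<noteq> v" "y \<noteq> d"
    and z: "adj u z" "adj w z" "adj w' z" "z \<noteq> v" "z \<noteq> d" and yz: "y \<noteq> z"
  shows "adj y z"
proof -
  obtain L where L: "has_type u L"
    using has_type_ex adj_V u(1) by blast
  have form: "table_form L"
    using has_type_form[OF L] .
  have vd: "adj v d" and wv: "adj w v" "adj w' v" "adj w'' v"
    using C by (auto simp: clique5_def adj_sym)
  have unw: "\<not> adj u w" "\<not> adj u w'" "\<not> adj u w''"
    using clique5_nbr[OF C u(1) adj_ne[OF u(2)] u(3-5)] u(2) by blast+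
  note ln = second_line[OF L]
  obtain g0 where g0: "coords adj L u g0" "g0 0 = v" "g0 1 = d"
    using coords_edge[OF L u(1,2) vd] by blast
  have line: "hyp_line (\<lambda>n. adj x (h n)) [0, 4, 5, 6]" if "coords adj L u h" "\<not> adj u x" "u \<noteq> x" for h x
    using hyperoval_common[OF that(1) form that(3,2)] ln unfolding hyperoval_def list_all_iff by blast
  have "adj w (g0 4) \<or> adj w (g0 5) \<or> adj w (g0 6)"
    using line[OF g0(1) unw(1) u(3)] wv(1) g0(2) by simp
  then obtain j where j: "j \<in> {4, 5, 6}" "adj w (g0 j)" by blast
  have j40: "j < 40" using j by auto
  have jn: "j \<in> set (nbs L 0)" and j1: "j \<notin> set (nbs L 1)"
  proof -
    show j0: "j \<in> set (nbs L 0)"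
      unfolding has_type_nbs0(1)[OF L] using j by auto
    show "j \<notin> set (nbs L 1)"
    proof
      assume "j \<in> set (nbs L 1)"
      then have "j \<in> {2, 3}"
        using j0 has_type_nbs0(2)[OF L] by blast
      then show False using j(1) by auto
    qed
  qed
  have c: "adj u (g0 j)" "adj v (g0 j)" "\<not> adj d (g0 j)" "d \<noteq> g0 j"
  proof -
    show "adj u (g0 j)"
      using coordsD(1)[OF g0(1) j40] .
    show "adj v (g0 j)"
      using coordsD(2)[OF g0(1), of 0 j] j40 jn g0(2) by simp
    show "\<not> adj d (g0 j)"
      using coordsD(2)[OF g0(1), of 1 j] j40 j1 g0(3) by simp
    show "d \<noteq> g0 j"
      using coordsD(3)[OF g0(1), of 1 j] j40 g0(3) j(1) by auto
  qed
  obtain g1 where g1: "coords adj L u g1" "g1 0 = v" "g1 1 = d" "g1 4 = g0 j"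
    using coords_path[OF L u(1,2) vd c] by blast
  have as: "4 \<in> set (aset L 1)" "5 \<in> set (aset L 1)" "6 \<in> set (aset L 1)"
    using has_type_cases[OF L] by (auto simp: table_eval_W table_eval_Q simp del: One_nat_def)
  have one: "one_of (adj w (h i)) (adj w' (h i)) (adj w'' (h i))"
    if h: "coords adj L u h" "h 0 = v" "h 1 = d" and i: "i \<in> set (aset L 1)" for h i
    using triple_parts(1)[OF triple_common[OF h(1) C u h(2,3)]] i unfolding split3_def list_all_iff by simp
  have "\<not> adj w' (g1 4)"
    using one[OF g1(1-3) as(1)] j(2) g1(4) by (auto simp: one_of_def)
  then have "adj w' (g1 5) \<or> adj w' (g1 6)"
    using line[OF g1(1) unw(2) u(4)] wv(2) g1(2) by simp
  then obtain i where i: "i \<in> set [5, 6]" "adj w' (g1 i)"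
    by auto
  obtain P n where m: "moves L P n [0, 1, 4] 5 [5, 6]"
    using has_type_moves(4)[OF L] by blast
  obtain g where g: "coords adj L u g" "g 5 = g1 i" "\<forall>j\<in>set [0, 1, 4]. g j = g1 j"
    using coords_move[OF g1(1) form m i(1)] by blast
  then have g': "g 0 = v" "g 1 = d" "adj w (g 4)" "adj w' (g 5)"
    using g1 j(2) i(2) by auto
  have w6: "adj w'' (g 6)"
    using one[OF g(1) g'(1,2) as(1)] one[OF g(1) g'(1,2) as(2)] line[OF g(1) unw(3) u(5)] wv(3) g'
    by (auto simp: one_of_def)
  have n0: "4 \<in> set (nbs L 0)" "5 \<in> set (nbs L 0)" "6 \<in> set (nbs L 0)"
    unfolding has_type_nbs0(1)[OF L] by auto
  \<comment> \<open>A vertex \<open>x\<close> adjacent to \<open>v\<close> and \<open>g k\<close>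
    lies with them in a 5-clique; its two further members provide a triple at the index
    \<open>k\<close>.\<close>
  have ext: "\<exists>a b. hyperoval L (\<lambda>n. adj a (g n)) \<and> triple L k (\<lambda>n. adj x (g n)) (\<lambda>n. adj a (g n)) (\<lambda>n. adj b (g n))"
    if x: "adj x v" "\<not> adj u x" "u \<noteq> x" "adj x (g k)" and k: "k \<in> set (nbs L 0)" "k < 40" for x k
  proof -
    have vk: "adj v (g k)" "adj u (g k)"
      using coordsD(2)[OF g(1), of 0 k] coordsD(1)[OF g(1) k(2)] k g'(1) by auto
    obtain a b where ab: "clique5 v (g k) x a b"
      using triangle_common[of v "g k" x] vk x by (auto simp: adj_sym)
    have ne: "u \<noteq> a" "u \<noteq> b"
      using ab x(2) by (auto simp: clique5_def adj_sym)
    have na: "\<not> adj u a"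
      using clique5_nbr[OF ab u(1) adj_ne[OF vk(2)] x(3) ne] vk(2) by blast
    show ?thesis
      using triple_common[OF g(1) ab u(1) vk(2) x(3) ne g'(1) refl k(2)]
        hyperoval_common[OF g(1) form ne(1) na] by blast
  qed
  obtain a1 b1 where e1: "hyperoval L (\<lambda>n. adj a1 (g n))"
    "triple L 4 (\<lambda>n. adj w (g n)) (\<lambda>n. adj a1 (g n)) (\<lambda>n. adj b1 (g n))"
    using ext[OF wv(1) unw(1) u(3) g'(3) n0(1)] by auto
  obtain a2 b2 where e2: "hyperoval L (\<lambda>n. adj a2 (g n))"
    "triple L 5 (\<lambda>n. adj w' (g n)) (\<lambda>n. adj a2 (g n)) (\<lambda>n. adj b2 (g n))"
    using ext[OF wv(2) unw(2) u(4) g'(4) n0(2)] by auto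
  obtain a3 b3 where e3: "hyperoval L (\<lambda>n. adj a3 (g n))"
    "triple L 6 (\<lambda>n. adj w'' (g n)) (\<lambda>n. adj a3 (g n)) (\<lambda>n. adj b3 (g n))"
    using ext[OF wv(3) unw(3) u(5) w6 n0(3)] by auto
  have t1: "triple L 1 (\<lambda>n. adj w (g n)) (\<lambda>n. adj w' (g n)) (\<lambda>n. adj w'' (g n))"
    using triple_common[OF g(1) C u g'(1,2)] by simp
  have idx: "\<exists>n\<in>set (yset L 1). n < 40 \<and> g n = x" if x: "adj u x" "adj w x" "adj w' x" "x \<noteq> v" "x \<noteq> d" for x
  proof -
    obtain n where n: "n < 40" "x = g n"
      using coordsD(4)[OF g(1) x(1)] by blast
    have "x \<noteq> w''"
      using x(1) unw(3) by blast
    moreover have xw: "adj x w" "adj x w'"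
      using x(2,3) adj_sym by blast+
    ultimately have "\<not> adj x v" "\<not> adj x d"
      using clique5_nbr[OF clique5_perm(2)[OF C] xw(1) x(4,5) adj_ne[OF xw(2)]] by blast+
    then have "n \<notin> set (nbs L 0)" "n \<notin> set (nbs L 1)"
      using coordsD(2)[OF g(1), of 0 n] coordsD(2)[OF g(1), of 1 n] n g'(1,2) by (auto simp: adj_sym)
    moreover have "n \<noteq> 0"
      using x(4) n g'(1) by metis
    ultimately show ?thesis
      using n unfolding yset_def Let_def by (intro bexI[of _ n]) auto
  qed
  obtain iy where iy: "iy \<in> set (yset L 1)" "iy < 40" "g iy = y"
    using idx[OF y] by blast
  obtain iz where iz: "iz \<in> set (yset L 1)" "iz < 40" "g iz = z"
    using idx[OF z] by blast
  have "iz \<in> set (nbs L iy)"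
    by (rule overlap_table[OF _ hyperoval_common[OF g(1) form u(3) unw(1)] hyperoval_common[OF g(1) form u(4) unw(2)]
        e1(1) e2(1) e3(1) t1 e1(2) e2(2) e3(2) g'(3,4) w6 iy(1) _ _ iz(1)])
      (use has_type_cases[OF L] iy iz y z yz in auto)
  then show ?thesis
    using coordsD(2)[OF g(1) iy(2) iz(2)] iy iz by simp
qed

text \<open>The roles of \<open>u\<close> and \<open>w\<close> are exchanged: \<open>u\<close> and
  \<open>g e\<close> are taken as two members of a 5-clique whose hyperovals live in the quadrangle
  at \<open>w\<close>, and \<open>g a\<close>, \<open>g b\<close> lie in their overlap.\<close>

lemma pcond_common:
  assumes g: "coords adj L u g" and L: "has_type u L" and uw: "u \<noteq> w" "\<not> adj u w" and w0: "adj w (g 0)"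
  shows "pcond L (\<lambda>n. adj w (g n))"
proof -
  have "\<not> adj w (g a) \<or> \<not> adj w (g b)"
    if e: "e \<in> set (nbs L 0)" "\<not> adj w (g e)" and a: "a \<in> set (nbs L e)" "a \<in> set (far L)"
      and b: "b \<in> set (nbs L e)" "b \<in> set (far L)" and ab: "a < b" "b \<notin> set (nbs L a)" for e a b
  proof (rule ccontr)
    assume "\<not> ?thesis"
    then have wab: "adj w (g a)" "adj w (g b)" by auto
    have lt: "e < 40" "a < 40" "b < 40"
      using e(1) a b has_type_nbs0(1)[OF L] by (auto simp: far_nbs0)
    have ue: "adj u (g 0)" "adj u (g e)" "adj (g 0) (g e)" "adj (g e) (g a)" "adj (g e) (g b)" "adj u (g a)" "adj u (g b)"
      using coordsD(1)[OF g] coordsD(2)[OF g, of 0 e] coordsD(2)[OF g, of e a] coordsD(2)[OF g, of e b] lt e a b by auto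
    obtain p q where pq: "clique5 u (g 0) (g e) p q"
      using triangle_common[OF ue(1-3)] by blast
    have pq': "clique5 (g 0) u (g e) p q"
      using clique5_perm(1)[OF pq] .
    have wne: "w \<noteq> g e" "w \<noteq> p" "w \<noteq> q"
      using pq uw by (auto simp: clique5_def)
    have "adj w p \<noteq> adj w q"
      using clique5_nbr[OF pq' w0 uw(1)[symmetric] wne] uw(2) e(2) adj_sym by blast
    then obtain d f where df: "adj w d" "\<not> adj w f" "d = p \<and> f = q \<or> d = q \<and> f = p" by blast
    \<comment> \<open>Of the 5-clique through \<open>u\<close>, \<open>g 0\<close> and
      \<open>g e\<close> the vertex \<open>w\<close> sees \<open>g 0\<close> and exactly one more,
      named \<open>d\<close>. Thus \<open>g 0\<close>, \<open>d\<close> are the points common to all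
      three hyperovals at \<open>w\<close>.\<close>
    have C: "clique5 (g 0) d u (g e) f"
      using pq df(3) by (auto simp: clique5_def adj_sym)
    have wf: "w \<noteq> f"
      using df wne by auto
    have nad: "\<not> adj (g 0) (g a)" "\<not> adj (g 0) (g b)" "g a \<noteq> g 0" "g b \<noteq> g 0" "g a \<noteq> g b"
      using coordsD(2)[OF g, of 0 a] coordsD(2)[OF g, of 0 b] coordsD(3)[OF g, of a 0] coordsD(3)[OF g, of b 0]
        coordsD(3)[OF g, of a b] lt a b ab by (auto simp: far_nbs0)
    have nd: "g a \<noteq> d" "g b \<noteq> d"
      using nad(1,2) C by (auto simp: clique5_def)
    have "adj (g a) (g b)"
      by (rule overlap_clique[OF C w0 df(1) uw(1)[symmetric] wne(1) wf wab(1) ue(6,4) nad(3) nd(1) wab(2) ue(7,5) nad(4) nd(2) nad(5)])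
    then show False
      using coordsD(2)[OF g lt(2,3)] ab(2) by blast
  qed
  then show ?thesis
    unfolding pcond_def plist_def Let_def list_all_iff by auto
qed

text \<open>Equivalently, nonadjacency is transitive on the common neighbours, so they form a
  complete multipartite graph; since a hyperoval has at most two points on a line it has no
  triangle, and there are at most two parts.\<close>

lemma complete_bipartite_common:
  assumes L: "has_type u linesW" and uw: "u \<noteq> w" "\<not> adj u w" and a: "adj u a" "adj w a"
    and b: "adj u b" "adj w b" and c: "adj u c" "adj w c" and ab: "adj a b" and ac: "\<not> adj a c" "a \<noteq> c"
  shows "adj b c"
proof -
  obtain g where g: "coords adj linesW u g" "g 0 = a"
    using coords_base[OF L a(1)] by blast
  obtain i where i: "i < 40" "b = g i"
    using coordsD(4)[OF g(1) b(1)] by blast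
  obtain j where j: "j < 40" "c = g j"
    using coordsD(4)[OF g(1) c(1)] by blast
  have w0: "adj w (g 0)"
    using a g by simp
  have "kbase linesW (\<lambda>n. adj w (g n))"
    by (rule kbase_table_W[OF hyperoval_common[OF g(1) has_type_form[OF L] uw] w0 pcond_common[OF g(1) L uw w0]])
  moreover have "i \<in> set (nbs linesW 0)" "j \<in> set (far linesW)"
  proof -
    show "i \<in> set (nbs linesW 0)"
      using coordsD(2)[OF g(1), of 0 i] i ab g(2) by simp
    have "j \<notin> set (nbs linesW 0)"
      using coordsD(2)[OF g(1), of 0 j] j ac g(2) by auto
    moreover have "j \<noteq> 0"
      using j(2) ac(2) g(2) by metis
    ultimately show "j \<in> set (far linesW)"
      using j(1) by (simp add: far_nbs0)
  qed
  ultimately have "i \<in> set (nbs linesW j)"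
    using b(2) c(2) i(2) j(2) unfolding kbase_def dnon_def Let_def list_all_iff by auto
  then show ?thesis
    using coordsD(2)[OF g(1) j(1) i(1)] i j adj_sym by simp
qed

lemma not_complete_bipartite_common:
  assumes L: "has_type u linesQ" and uw: "u \<noteq> w" "\<not> adj u w" and a: "adj u a" "adj w a"
  shows "\<exists>b c. adj u b \<and> adj w b \<and> adj u c \<and> adj w c \<and> adj a b \<and> \<not> adj a c \<and> a \<noteq> c \<and> \<not> adj b c"
proof (rule ccontr)
  assume n: "\<not> ?thesis"
  obtain g where g: "coords adj linesQ u g" "g 0 = a"
    using coords_base[OF L a(1)] by blast
  have w0: "adj w (g 0)"
    using a g by simp
  have "\<not> adj w (g x) \<or> \<not> adj w (g d)" if x: "x \<in> set (far linesQ)" and d: "d \<in> set (nbs linesQ 0)" "d \<notin> set (nbs linesQ x)" for x d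
  proof (rule ccontr)
    assume "\<not> ?thesis"
    then have wx: "adj w (g x)" "adj w (g d)" by auto
    have lt: "x < 40" "d < 40" "x \<notin> set (nbs linesQ 0)" "x \<noteq> 0"
      using x d(1) has_type_nbs0(1)[OF L] by (auto simp: far_nbs0)
    have "adj u (g d)" "adj u (g x)"
      using coordsD(1)[OF g(1)] lt by auto
    moreover have "adj a (g d)" "\<not> adj a (g x)" "a \<noteq> g x" "\<not> adj (g d) (g x)"
      using coordsD(2)[OF g(1), of 0 d] coordsD(2)[OF g(1), of 0 x] coordsD(3)[OF g(1), of 0 x]
        coordsD(2)[OF g(1), of x d] lt d g(2) adj_sym by auto
    ultimately show False
      using n wx by blast
  qed
  then have "kbase linesQ (\<lambda>n. adj w (g n))"
    unfolding kbase_def dnon_def Let_def list_all_iff by auto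
  then show False
    using kbase_prop_Q[OF hyperoval_common[OF g(1) has_type_form[OF L] uw], of] w0 by blast
qed

text \<open>The common neighbourhood is the same graph from either end, and it is complete bipartite
  only at a vertex of type W(3).\<close>

lemma type_W_dist2:
  assumes "has_type u linesW" "u \<noteq> w" "\<not> adj u w" "adj u a" "adj w a"
  shows "has_type w linesW"
proof (rule ccontr)
  assume "\<not> has_type w linesW"
  moreover have "w \<in> V"
    using assms(5) adj_V by blast
  ultimately have "has_type w linesQ"
    using has_type_ex has_type_cases by blast
  moreover have "w \<noteq> u" "\<not> adj w u"
    using assms(2,3) adj_sym by auto
  ultimately obtain b c where "adj w b" "adj u b" "adj w c" "adj u c" "adj a b" "\<not> adj a c" "a \<noteq> c" "\<not> adj b c"
    using not_complete_bipartite_common[of w u a] assms(4,5) by blast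
  then show False
    using complete_bipartite_common[OF assms, of b c] by blast
qed

text \<open>Adjacent vertices are reached by two steps of \<open>type_W_dist2\<close>, through a
  vertex at distance two from both.\<close>

lemma type_W_adj:
  assumes "has_type u linesW" "adj u v"
  shows "has_type v linesW"
proof -
  obtain g0 where g0: "coords adj linesW u g0" "g0 0 = v"
    using coords_base[OF assms] by blast
  define d where "d = g0 1"
  have "(1::nat) \<in> set (nbs linesW 0)"
    by (simp add: base_W(1))
  then have d: "adj u d" "adj v d"
    unfolding d_def using coordsD(1)[OF g0(1), of 1] coordsD(2)[OF g0(1), of 0 1] g0(2) by auto
  obtain L where L: "has_type d L"
    using has_type_ex adj_V adj_sym d(1) by blast
  obtain g where g: "coords adj L d g" "g 0 = u" "g 1 = v"
    using coords_edge[OF L, of u v] d assms(2) adj_sym by blast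
  \<comment> \<open>In both tables the point 39 is collinear with neither 0 nor 1, so the unknown
    type of \<open>d\<close> does not matter.\<close>
  have n39: "39 \<in> set (yset L 1)"
    using has_type_cases[OF L] by (auto simp: table_eval_W table_eval_Q simp del: One_nat_def)
  define x where "x = g 39"
  have "39 \<notin> set (nbs L 0)" "39 \<notin> set (nbs L 1)"
    using n39 by (auto simp: yset_def Let_def)
  then have x: "adj d x" "\<not> adj u x" "\<not> adj v x" "u \<noteq> x" "v \<noteq> x"
    unfolding x_def using coordsD(1)[OF g(1), of 39] coordsD(2)[OF g(1), of 0 39] coordsD(2)[OF g(1), of 1 39]
      coordsD(3)[OF g(1), of 0 39] coordsD(3)[OF g(1), of 1 39] g(2,3) by auto
  have "has_type x linesW"
    using type_W_dist2[OF assms(1) x(4,2), of d] d x adj_sym by blast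
  then show ?thesis
    using type_W_dist2[of x v d] x d adj_sym by metis
qed

end

section \<open>Excluding the parabolic quadrangle\<close>

lemma nbs_lt: "table_form L \<Longrightarrow> y \<in> set (nbs L x) \<Longrightarrow> y < 40"
  by (auto simp: in_nbs table_form_def list_all_iff)

lemma filter_singleton: "length (filter P xs) = 1 \<Longrightarrow> \<exists>a\<in>set xs. P a \<and> (\<forall>b\<in>set xs. P b \<longrightarrow> b = a)"
proof -
  assume "length (filter P xs) = 1"
  then obtain a where a: "filter P xs = [a]"
    by (auto simp: length_Suc_conv)
  have "set (filter P xs) = {a}"
    unfolding a by simp
  then show ?thesis
    unfolding set_filter by blast
qed

text \<open>The points 1, 4 and \<open>k\<close> are pairwise noncollinear with centre 0, and the
  first item says that they have exactly one more centre. The search starts at 1 to leave out the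
  centre 0 itself.\<close>

lemma triad_table_Q:
  "let n1 = nbs linesQ 1; n4 = nbs linesQ 4 in list_all (\<lambda>k. let nk = nbs linesQ k in
     length (filter (\<lambda>x. x \<in> set n1 \<and> x \<in> set n4 \<and> x \<in> set nk) [1..<40]) = 1 \<and>
     list_ex (\<lambda>y. y \<in> set n1 \<and> y \<in> set n4 \<and> y \<notin> set nk \<and> y \<noteq> k) [1..<40]) [7..<13]"
  by code_simp

lemma common_table:
  "let n1 = nbs linesW 1; n4 = nbs linesW 4 in length (filter (\<lambda>x. x \<in> set n1 \<and> x \<in> set n4) [0..<40]) = 4"
  "let n1 = nbs linesQ 1; n4 = nbs linesQ 4 in length (filter (\<lambda>x. x \<in> set n1 \<and> x \<in> set n4) [0..<40]) = 4"
  by code_simp+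

lemma lines_Q: "[0, 4, 5, 6] \<in> set linesQ" "[0, 7, 8, 9] \<in> set linesQ" "[0, 10, 11, 12] \<in> set linesQ"
  by (simp_all add: linesQ_def)

lemma cross_table_Q:
  "let n1 = nbs linesQ 1 in list_all (\<lambda>i. let n = nbs linesQ i in i \<notin> set n1 \<and> list_all (\<lambda>j. j \<notin> set n \<and> j \<notin> set n1) [7, 8, 9]) [4, 5, 6]"
  by code_simp

context locally_gq
begin

lemma coords_claw:
  assumes L: "has_type u L" and v: "adj u v" and d: "adj u d" "adj v d" and c: "adj u c" "adj v c" and e: "adj u e" "adj v e"
    and n: "\<not> adj d c" "d \<noteq> c" "\<not> adj d e" "d \<noteq> e" "\<not> adj c e" "c \<noteq> e"
  shows "\<exists>g k. coords adj L u g \<and> g 0 = v \<and> g 1 = d \<and> g 4 = c \<and> e = g k \<and> k \<in> set [7..<13]"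
proof -
  obtain g where g: "coords adj L u g" "g 0 = v" "g 1 = d" "g 4 = c"
    using coords_path[OF L v d c n(1,2)] by blast
  obtain k where k: "k < 40" "e = g k"
    using coordsD(4)[OF g(1) e(1)] by blast
  have k0: "k \<in> set (nbs L 0)" and k1: "k \<notin> set (nbs L 1)" and k4: "k \<notin> set (nbs L 4)"
    using coordsD(2)[OF g(1), of 0 k] coordsD(2)[OF g(1), of 1 k] coordsD(2)[OF g(1), of 4 k] k g e n by auto
  have "k \<noteq> 1" "k \<noteq> 4"
    using k g n by auto
  moreover have "k \<noteq> 2" "k \<noteq> 3"
    using k0 k1 has_type_nbs0(2)[OF L] by auto
  moreover have "k \<noteq> 5" "k \<noteq> 6"
    using k0 k4 has_type_nbs0(4)[OF L] by auto
  moreover have "1 \<le> k" "k < 13"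
    using k0 unfolding has_type_nbs0(1)[OF L] by auto
  ultimately have "7 \<le> k \<and> k < 13"
    by simp
  then have "k \<in> set [7..<13]"
    unfolding set_upt atLeastLessThan_iff .
  then show ?thesis
    using g k by blast
qed

lemma triad_Q:
  assumes L: "has_type u linesQ" and x: "adj u x" "adj c x" and y: "adj u y" "adj c y" and z: "adj u z" "adj c z" and c: "adj u c"
    and n: "\<not> adj x y" "x \<noteq> y" "\<not> adj x z" "x \<noteq> z" "\<not> adj y z" "y \<noteq> z"
  shows "\<exists>c'. adj u c' \<and> adj x c' \<and> adj y c' \<and> adj z c' \<and> c' \<noteq> c \<and>
      (\<forall>e. adj u e \<longrightarrow> adj x e \<longrightarrow> adj y e \<longrightarrow> adj z e \<longrightarrow> e = c \<or> e = c')"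
    "\<exists>y'. adj u y' \<and> adj x y' \<and> adj y y' \<and> \<not> adj z y' \<and> y' \<noteq> z \<and> y' \<noteq> c"
proof -
  obtain g k where g: "coords adj linesQ u g" "g 0 = c" "g 1 = x" "g 4 = y" "z = g k" "k \<in> set [7..<13]"
    using coords_claw[OF L c x y z n] by blast
  have k40: "k < 40"
    using g(6) unfolding set_upt by simp
  have ad: "adj x (g i) \<longleftrightarrow> i \<in> set (nbs linesQ 1)" "adj y (g i) \<longleftrightarrow> i \<in> set (nbs linesQ 4)"
    "adj z (g i) \<longleftrightarrow> i \<in> set (nbs linesQ k)" if "i < 40" for i
    using coordsD(2)[OF g(1), of 1 i] coordsD(2)[OF g(1), of 4 i] coordsD(2)[OF g(1) k40 that] that g(3-5) by auto
  have t: "length (filter (\<lambda>x. x \<in> set (nbs linesQ 1) \<and> x \<in> set (nbs linesQ 4) \<and> x \<in> set (nbs linesQ k)) [1..<40]) = 1"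
    "list_ex (\<lambda>y. y \<in> set (nbs linesQ 1) \<and> y \<in> set (nbs linesQ 4) \<and> y \<notin> set (nbs linesQ k) \<and> y \<noteq> k) [1..<40]"
    using triad_table_Q g(6) unfolding Let_def list_all_iff by blast+
  obtain a where a: "a \<in> set [1..<40]" "a \<in> set (nbs linesQ 1)" "a \<in> set (nbs linesQ 4)" "a \<in> set (nbs linesQ k)"
    "\<And>b. b \<in> set [1..<40] \<Longrightarrow> b \<in> set (nbs linesQ 1) \<Longrightarrow> b \<in> set (nbs linesQ 4) \<Longrightarrow> b \<in> set (nbs linesQ k) \<Longrightarrow> b = a"
    using filter_singleton[OF t(1)] by blast
  have a40: "a < 40" "a \<noteq> 0"
    using a(1) unfolding set_upt by auto
  have "e = c \<or> e = g a" if e: "adj u e" "adj x e" "adj y e" "adj z e" for e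
  proof -
    obtain i where i: "i < 40" "e = g i"
      using coordsD(4)[OF g(1) e(1)] by blast
    show ?thesis
    proof (cases "i = 0")
      case False
      then have "i \<in> set [1..<40]"
        using i(1) unfolding set_upt by simp
      then have "i = a"
        using a(5) ad[OF i(1)] e i(2) by blast
      then show ?thesis using i by blast
    qed (use i g in blast)
  qed
  moreover have "g a \<noteq> c"
    using coordsD(3)[OF g(1), of a 0] a40 g(2) by auto
  ultimately show "\<exists>c'. adj u c' \<and> adj x c' \<and> adj y c' \<and> adj z c' \<and> c' \<noteq> c \<and>
      (\<forall>e. adj u e \<longrightarrow> adj x e \<longrightarrow> adj y e \<longrightarrow> adj z e \<longrightarrow> e = c \<or> e = c')"
    using a(2-4) ad[OF a40(1)] coordsD(1)[OF g(1) a40(1)] by blast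
  obtain b where b: "b \<in> set [1..<40]" "b \<in> set (nbs linesQ 1)" "b \<in> set (nbs linesQ 4)" "b \<notin> set (nbs linesQ k)" "b \<noteq> k"
    using t(2) unfolding list_ex_iff by blast
  have b40: "b < 40" "b \<noteq> 0"
    using b(1) unfolding set_upt by auto
  have "g b \<noteq> c" "g b \<noteq> z"
    using coordsD(3)[OF g(1), of b 0] coordsD(3)[OF g(1) b40(1) k40] b40 g(2,5) b(5) by auto
  then show "\<exists>y'. adj u y' \<and> adj x y' \<and> adj y y' \<and> \<not> adj z y' \<and> y' \<noteq> z \<and> y' \<noteq> c"
    using b ad[OF b40(1)] coordsD(1)[OF g(1) b40(1)] by blast
qed

lemma card_common:
  assumes c: "adj u c" and x: "adj u x" "adj c x" and y: "adj u y" "adj c y" and n: "\<not> adj x y" "x \<noteq> y"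
  shows "card {z. adj u z \<and> adj x z \<and> adj y z} = 4"
proof -
  obtain L where L: "has_type u L"
    using has_type_ex adj_V c by blast
  obtain g where g: "coords adj L u g" "g 0 = c" "g 1 = x" "g 4 = y"
    using coords_path[OF L c x y n] by blast
  have ad: "adj x (g i) \<longleftrightarrow> i \<in> set (nbs L 1)" "adj y (g i) \<longleftrightarrow> i \<in> set (nbs L 4)" if "i < 40" for i
    using coordsD(2)[OF g(1), of 1 i] coordsD(2)[OF g(1), of 4 i] that g(3,4) by auto
  define ns where "ns = filter (\<lambda>x. x \<in> set (nbs L 1) \<and> x \<in> set (nbs L 4)) [0..<40]"
  have "L = linesW \<or> L = linesQ"
    by (rule has_type_cases[OF L])
  then have len: "length ns = 4"
    using common_table unfolding Let_def ns_def by blast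
  have dn: "distinct ns" and sub: "i < 40" if "i \<in> set ns" for i
    using that unfolding ns_def set_filter set_upt by simp_all
  have "{z. adj u z \<and> adj x z \<and> adj y z} = g ` set ns"
  proof
    show "{z. adj u z \<and> adj x z \<and> adj y z} \<subseteq> g ` set ns"
    proof
      fix z assume "z \<in> {z. adj u z \<and> adj x z \<and> adj y z}"
      then have z: "adj u z" "adj x z" "adj y z" by auto
      obtain i where i: "i < 40" "z = g i"
        using coordsD(4)[OF g(1) z(1)] by blast
      have "i \<in> set ns"
        unfolding ns_def set_filter set_upt using z ad[OF i(1)] i by simp
      then show "z \<in> g ` set ns" using i by blast
    qed
    show "g ` set ns \<subseteq> {z. adj u z \<and> adj x z \<and> adj y z}"
    proof
      fix z assume "z \<in> g ` set ns"
      then obtain i where i: "i \<in> set ns" "z = g i" by blast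
      have "i \<in> set (nbs L 1)" "i \<in> set (nbs L 4)"
        using i(1) unfolding ns_def by simp_all
      then show "z \<in> {z. adj u z \<and> adj x z \<and> adj y z}"
        using ad[OF sub[OF i(1)]] coordsD(1)[OF g(1) sub[OF i(1)]] i(2) by simp
    qed
  qed
  moreover have "inj_on g (set ns)"
    using coordsD(3)[OF g(1)] sub by (auto simp: inj_on_def)
  moreover have "distinct ns"
    unfolding ns_def by simp
  ultimately show ?thesis
    using len by (simp add: card_image distinct_card)
qed

text \<open>In the hyperoval of the common neighbours of \<open>u\<close> and \<open>w\<close>,
  \<open>x\<close> is an antipode of \<open>v\<close>: not collinear with \<open>v\<close>, but
  collinear with all its neighbours in the hyperoval.\<close>

definition antip :: "'a \<Rightarrow> 'a \<Rightarrow> 'a \<Rightarrow> 'a \<Rightarrow> bool" where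
  "antip u w v x \<longleftrightarrow> adj u x \<and> adj w x \<and> \<not> adj v x \<and> x \<noteq> v \<and> (\<forall>c. adj u c \<longrightarrow> adj w c \<longrightarrow> adj v c \<longrightarrow> adj x c)"

lemma antipode_exists:
  assumes L: "has_type u linesQ" and C: "clique5 v d w w' w''" and u: "adj u v" "adj u d" "u \<noteq> w" "u \<noteq> w'" "u \<noteq> w''"
  shows "\<exists>t\<in>{w, w', w''}. \<exists>x. antip u t v x"
proof -
  have form: "table_form linesQ"
    using has_type_form[OF L] .
  have vd: "adj v d" and wv: "adj w v" "adj w' v" "adj w'' v"
    using C by (auto simp: clique5_def adj_sym)
  have unw: "\<not> adj u w" "\<not> adj u w'" "\<not> adj u w''"
    using clique5_nbr[OF C u(1) adj_ne[OF u(2)] u(3-5)] u(2) by blast+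
  obtain g where g: "coords adj linesQ u g" "g 0 = v" "g 1 = d"
    using coords_edge[OF L u(1,2) vd] by blast
  have t1: "triple linesQ 1 (\<lambda>n. adj w (g n)) (\<lambda>n. adj w' (g n)) (\<lambda>n. adj w'' (g n))"
    using triple_common[OF g(1) C u g(2,3)] by simp
  have w0: "adj w (g 0)" "adj w' (g 0)" "adj w'' (g 0)"
    using wv g(2) by auto
  obtain o1 x where o1: "o1 \<in> {\<lambda>n. adj w (g n), \<lambda>n. adj w' (g n), \<lambda>n. adj w'' (g n)}" "x \<in> set (far linesQ)" "o1 x"
    "\<forall>d\<in>set (nbs linesQ 0). o1 d \<longrightarrow> d \<in> set (nbs linesQ x)"
    using antipode_table_Q[OF hyperoval_common[OF g(1) form u(3) unw(1)] hyperoval_common[OF g(1) form u(4) unw(2)]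
      hyperoval_common[OF g(1) form u(5) unw(3)] pcond_common[OF g(1) L u(3) unw(1) w0(1)]
      pcond_common[OF g(1) L u(4) unw(2) w0(2)] pcond_common[OF g(1) L u(5) unw(3) w0(3)] t1] by blast
  then obtain t where t: "t \<in> {w, w', w''}" "o1 = (\<lambda>n. adj t (g n))"
    by blast
  have x: "x < 40" "x \<notin> set (nbs linesQ 0)" "x \<noteq> 0"
    using o1(2) by (auto simp: far_nbs0)
  have "adj u (g x)" "\<not> adj v (g x)" "g x \<noteq> v"
    using coordsD(1)[OF g(1) x(1)] coordsD(2)[OF g(1), of 0 x] coordsD(3)[OF g(1), of x 0] x g(2) by auto
  moreover have "adj (g x) c" if c: "adj u c" "adj t c" "adj v c" for c
  proof -
    obtain i where i: "i < 40" "c = g i"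
      using coordsD(4)[OF g(1) c(1)] by blast
    have "i \<in> set (nbs linesQ 0)"
      using coordsD(2)[OF g(1), of 0 i] i c(3) g(2) by auto
    then have "i \<in> set (nbs linesQ x)"
      using o1(4) t(2) c(2) i(2) by simp
    then show ?thesis
      using coordsD(2)[OF g(1) x(1) i(1)] i(2) by simp
  qed
  ultimately have "antip u t v (g x)"
    using o1(3) t(2) unfolding antip_def by blast
  then show ?thesis using t(1) by blast
qed

text \<open>Parity again: in the 5-clique on \<open>d\<close>, \<open>y\<close>, \<open>w\<close>
  the vertex \<open>u\<close> sees \<open>d\<close> and exactly one of the two added members. That
  member is \<open>p\<close>, the other \<open>r\<close>.\<close>

lemma split_clique:
  assumes "adj d y" "adj d w" "adj y w" "adj u d" "\<not> adj u y" "\<not> adj u w" "u \<noteq> y" "u \<noteq> w"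
  shows "\<exists>p r. clique5 d p w y r \<and> adj u p \<and> u \<noteq> r"
proof -
  obtain a b where ab: "clique5 d y w a b"
    using triangle_common[OF assms(1,2,3)] by blast
  have ne: "u \<noteq> a" "u \<noteq> b"
    using ab assms(5) by (auto simp: clique5_def adj_sym)
  have "adj u a \<or> adj u b"
    using clique5_nbr[OF ab assms(4,7,8) ne] assms(5,6) by blast
  moreover have "clique5 d a w y b" "clique5 d b w y a"
    using ab by (auto simp: clique5_def adj_sym)
  ultimately show ?thesis
    using ne by blast
qed

text \<open>In the quadrangle at \<open>d\<close> these are two lines through \<open>y\<close>. They
  are distinct because \<open>p\<close> and \<open>q\<close> are noncollinear, and then no point of
  one other than \<open>y\<close> is collinear with a point of the other.\<close>

lemma cross_nonadj:
  assumes A: "clique5 d p a y a2" and B: "clique5 d q b y b2" and pq: "\<not> adj p q" "p \<noteq> q"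
  shows "\<not> adj a b" "a \<noteq> b"
proof -
  have A': "clique5 d y a p a2" "adj a2 p" "adj a p"
    using A by (auto simp: clique5_def adj_sym)
  have B': "adj q d" "adj q y" "adj q b" "adj b d" "adj b y"
    using B by (auto simp: clique5_def adj_sym)
  show "a \<noteq> b"
  proof
    assume "a = b"
    then have "q = p \<or> q = a2"
      using clique5_mem[OF A'(1), of q] B' by simp
    then show False
      using pq A'(2) adj_sym by blast
  qed
  show "\<not> adj a b"
  proof
    assume "adj a b"
    then have "b = p \<or> b = a2"
      using clique5_mem[OF A'(1) B'(4,5)] adj_sym by blast
    then show False
    proof
      assume "b = p"
      then show False using B'(3) pq(1) adj_sym by blast
    next
      assume b: "b = a2"
      have "clique5 d y a2 p a"
        using A by (auto simp: clique5_def adj_sym)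
      then have "q = p \<or> q = a"
        using clique5_mem[of d y a2 p a q] B' b by simp
      then show False
        using pq A'(3) adj_sym by blast
    qed
  qed
qed

text \<open>In the quadrangle at \<open>d\<close> the vertices \<open>u\<close>, \<open>a\<close>,
  \<open>b\<close> form a triad. Its centres are the common neighbours of \<open>a\<close> and
  \<open>b\<close> among the points 1 to 12 of the coordinates at \<open>u\<close>.\<close>

lemma none_or_two_common_triad:
  assumes Q: "has_type d linesQ" and g: "coords adj linesQ u g" "g 0 = d" and du: "adj d u"
    and a: "adj d a" "\<not> adj u a" "u \<noteq> a" and b: "adj d b" "\<not> adj u b" "u \<noteq> b" and ab: "\<not> adj a b" "a \<noteq> b"
  shows "none_or_two_common (\<lambda>x. adj a (g x) \<and> adj b (g x))"
proof -
  have n0: "x \<in> set (nbs linesQ 0) \<longleftrightarrow> x \<in> set [1..<13]" for x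
    unfolding base_Q(1) set_upt by (rule refl)
  have key: "\<exists>x'\<in>set [1..<13]. x' \<noteq> x \<and> (adj a (g x') \<and> adj b (g x')) \<and>
      (\<forall>z\<in>set [1..<13]. adj a (g z) \<longrightarrow> adj b (g z) \<longrightarrow> z = x \<or> z = x')"
    if x: "x \<in> set [1..<13]" "adj a (g x)" "adj b (g x)" for x
  proof -
    have lt: "z < 40" if "z \<in> set [1..<13]" for z
      using that unfolding set_upt by simp
    have ud: "adj u (g z)" "adj d (g z)" if "z \<in> set [1..<13]" for z
      using coordsD(1)[OF g(1) lt[OF that]] coordsD(2)[OF g(1) _ lt[OF that], of 0] that n0 g(2) by auto
    obtain c' where c': "adj d c'" "adj u c'" "adj a c'" "adj b c'" "c' \<noteq> g x"
      "\<And>e. adj d e \<Longrightarrow> adj u e \<Longrightarrow> adj a e \<Longrightarrow> adj b e \<Longrightarrow> e = g x \<or> e = c'"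
      using triad_Q(1)[OF Q du _ a(1) _ b(1) _ ud(2)[OF x(1)] a(2,3) b(2,3) ab] ud(1)[OF x(1)] x(2,3) adj_sym by blast
    obtain x' where x': "x' < 40" "c' = g x'"
      using coordsD(4)[OF g(1) c'(2)] by blast
    have m: "x' \<in> set [1..<13]"
      using coordsD(2)[OF g(1), of 0 x'] x' c'(1) g(2) n0 by simp
    have "z = x \<or> z = x'" if z: "z \<in> set [1..<13]" "adj a (g z)" "adj b (g z)" for z
      using c'(6)[OF ud(2)[OF z(1)] ud(1)[OF z(1)] z(2,3)] coordsD(3)[OF g(1) lt[OF z(1)] lt[OF x(1)]]
        coordsD(3)[OF g(1) lt[OF z(1)] x'(1)] x'(2) by blast
    moreover have "x' \<noteq> x"
      using x'(2) c'(5) by blast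
    ultimately show ?thesis
      using m c'(3,4) unfolding x'(2) by blast
  qed
  have "none_alone (\<lambda>x. adj a (g x) \<and> adj b (g x)) [] [1..<13]"
    by (rule none_alone_intro[OF distinct_upt]) (use key in blast)+
  moreover have "at_most_two (\<lambda>x. adj a (g x) \<and> adj b (g x)) [1..<13]"
    by (rule at_most_two_intro[OF distinct_upt]) (use key in blast)+
  ultimately show ?thesis
    unfolding none_or_two_common_def by blast
qed

end

context locally_gq
begin

text \<open>Coordinates at \<open>u\<close> with \<open>d\<close> at index 0 force the two antipodes
  of \<open>v\<close> to be equal or adjacent. Either way the vertices adjacent to \<open>u\<close>,
  \<open>v\<close>, \<open>w\<close> and \<open>w'\<close>, of which there are exactly two, lead to
  a contradiction.\<close>

lemma type_Q_contradiction:
  assumes Q: "\<And>u. u \<in> V \<Longrightarrow> has_type u linesQ" and uv: "adj u v" "adj u d" "adj v d"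
    and w: "adj v w" "adj d w" "\<not> adj u w" "u \<noteq> w" and w': "adj v w'" "adj d w'" "\<not> adj u w'" "u \<noteq> w'"
    and ww: "\<not> adj w w'" "w \<noteq> w'" and x: "antip u w v x" and x': "antip u w' v x'"
  shows False
proof -
  note x = x[unfolded antip_def] and x' = x'[unfolded antip_def]
  have form: "table_form linesQ"
    by (rule table_form_Q)
  have Qu: "has_type u linesQ" and Qv: "has_type v linesQ" and Qd: "has_type d linesQ"
    using Q adj_V uv adj_sym by blast+
  have s: "adj v u" "adj d u" "adj d v" "adj w v" "adj w d" "adj w' v" "adj w' d"
    using uv w w' adj_sym by blast+
  have xd: "adj x d" "adj x' d"
    using x x' uv s by blast+
  have wu: "\<not> adj w u" "\<not> adj w' u"
    using w w' adj_sym by blast+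
  obtain c' where c': "adj v c'" "adj u c'" "adj w c'" "adj w' c'" "c' \<noteq> d"
    "\<And>e. adj v e \<Longrightarrow> adj u e \<Longrightarrow> adj w e \<Longrightarrow> adj w' e \<Longrightarrow> e = d \<or> e = c'"
    using triad_Q(1)[OF Qv s(1,2) w(1,2) w'(1,2) uv(3) w(3,4) w'(3,4) ww] by blast
  have "x = x' \<or> adj x x'"
  proof -
    \<comment> \<open>In the quadrangle at \<open>d\<close> the point \<open>y\<close> is joined to
      both \<open>w\<close> and \<open>w'\<close>. Its four lines there will each contain one
      neighbour of \<open>u\<close>: \<open>p1\<close> on the line of \<open>w\<close>,
      \<open>p2\<close> on that of \<open>w'\<close>, then \<open>p0\<close> and
      \<open>p3\<close>.\<close>
    obtain y where y: "adj d y" "adj w y" "adj w' y" "\<not> adj u y" "y \<noteq> u" "y \<noteq> v"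
      using triad_Q(2)[OF Qd w(2,1) w'(2,1) s(2,1) s(3) ww wu(1) w(4)[symmetric] wu(2) w'(4)[symmetric]] by blast
    have ys: "adj y w" "adj y w'" "adj y d" "\<not> adj y u" "u \<noteq> y" "adj d w" "adj d w'"
      using y w w' adj_sym by blast+
    have yv: "\<not> adj y v"
    proof
      assume "adj y v"
      then obtain e f where ef: "clique5 d v y e f" "\<forall>x. adj d x \<longrightarrow> adj v x \<longrightarrow> adj y x \<longrightarrow> x = e \<or> x = f"
        using triangle_common[OF s(3) y(1)] adj_sym by blast
      then have "w = e \<or> w = f" "w' = e \<or> w' = f"
        using w w' ys by blast+
      then show False
        using ww ef(1) unfolding clique5_def using adj_sym by blast
    qed
    obtain p1 r where p1: "clique5 d p1 w y r" "adj u p1" "u \<noteq> r"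
      using split_clique[OF y(1) w(2) ys(1) uv(2) y(4) w(3) ys(5) w(4)] by blast
    obtain p2 r1 where p2: "clique5 d p2 w' y r1" "adj u p2" "u \<noteq> r1"
      using split_clique[OF y(1) w'(2) ys(2) uv(2) y(4) w'(3) ys(5) w'(4)] by blast
    \<comment> \<open>The line of \<open>d\<close> and \<open>v\<close> at \<open>u\<close> has two
      more points, and by parity \<open>y\<close> is adjacent to exactly one of them. This
      \<open>p0\<close> ties the position of \<open>v\<close> to the configuration.\<close>
    obtain a b where ab: "clique5 u d v a b"
      using triangle_common[OF uv(2,1) s(3)] by blast
    have ne: "y \<noteq> a" "y \<noteq> b"
      using ab y(4) by (auto simp: clique5_def)
    have "adj y a \<or> adj y b"
      using clique5_nbr[OF clique5_perm(1)[OF ab] ys(3) y(5,6) ne] ys(4) yv by blast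
    moreover have "clique5 u d v b a"
      using ab by (auto simp: clique5_def adj_sym)
    ultimately obtain p0 q0 where p0: "clique5 u d v p0 q0" "adj y p0"
      using ab by blast
    have p0': "adj u p0" "adj d p0" "adj v p0" "adj p0 d" "adj p0 v" "adj p0 y"
      using p0 by (auto simp: clique5_def adj_sym)
    obtain w2 r2 where "clique5 d p0 y w2 r2"
      using triangle_common[OF p0'(2) y(1) p0'(6)] by blast
    then have w2: "clique5 d p0 w2 y r2"
      by (auto simp: clique5_def adj_sym)
    have ur: "\<not> adj u r" "\<not> adj u r1"
      using clique5_nbr[OF p1(1) uv(2) adj_ne[OF p1(2)] w(4) ys(5) p1(3)] p1(2)
        clique5_nbr[OF p2(1) uv(2) adj_ne[OF p2(2)] w'(4) ys(5) p2(3)] p2(2) by blast+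
    have n01: "\<not> adj p0 p" "p0 \<noteq> p"
      if p: "clique5 d p t y s" "\<not> adj u s" "adj v t" "\<not> adj u t" "u \<noteq> t" for p t s
    proof -
      have P: "clique5 d p y t s" "adj t d" "adj t v" "adj t p"
        using p by (auto simp: clique5_def adj_sym)
      show "\<not> adj p0 p"
      proof
        assume "adj p0 p"
        then have "p0 = t \<or> p0 = s"
          using clique5_mem[OF P(1) p0'(4) _ p0'(6)] by blast
        then show False
          using p0'(1) p(2,4) by blast
      qed
      show "p0 \<noteq> p"
      proof
        assume e: "p0 = p"
        have "clique5 d v p0 u q0" "adj u q0"
          using p0(1) by (auto simp: clique5_def adj_sym)
        then show False
          using clique5_mem[of d v p0 u q0 t] P e p(4,5) by blast
      qed
    qed
    note n1 = n01[OF p1(1) ur(1) w(1,3,4)] and n2 = n01[OF p2(1) ur(2) w'(1,3,4)]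
    have P1: "clique5 d p1 y w r" "adj p2 d" "adj p2 y" "adj w' p2"
      using p1(1) p2(1) by (auto simp: clique5_def adj_sym)
    have n3: "\<not> adj p1 p2"
    proof
      assume "adj p1 p2"
      then have "p2 = w \<or> p2 = r"
        using clique5_mem[OF P1(1) P1(2) _ P1(3)] adj_sym by blast
      then show False
        using p2(2) w(3) ur(1) by blast
    qed
    have n4: "p1 \<noteq> p2"
    proof
      assume "p1 = p2"
      then have "w' = w \<or> w' = r"
        using clique5_mem[OF P1(1) s(7), of] P1(4) y(3) by blast
      then show False
        using ww p1(1) by (auto simp: clique5_def adj_sym)
    qed
    have dp: "adj d p1" "adj d p2"
      using p1 p2 by (auto simp: clique5_def)
    obtain g1 k where g1: "coords adj linesQ u g1" "g1 0 = d" "g1 1 = p0" "g1 4 = p1" "p2 = g1 k" "k \<in> set [7..<13]"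
      using coords_claw[OF Qu uv(2) p0'(1,2) p1(2) dp(1) p2(2) dp(2) n1 n2 n3 n4] by blast
    obtain g2 where g2: "coords adj linesQ u g2" "g2 7 = p2" "\<forall>j\<in>set [0, 1, 4]. g2 j = g1 j"
      using coords_move[OF g1(1) form transitive_Q7 g1(6)] g1(5) by metis
    have g2': "g2 0 = d" "g2 1 = p0" "g2 4 = p1"
      using g2(3) g1 by auto
    obtain i where i: "i < 40" "v = g2 i"
      using coordsD(4)[OF g2(1) uv(1)] by blast
    have "i \<in> set (nbs linesQ 0) \<inter> set (nbs linesQ 1)"
      using coordsD(2)[OF g2(1), of 0 i] coordsD(2)[OF g2(1), of 1 i] i s(3) p0'(5) g2' by auto
    then have "i \<in> set [2, 3]"
      unfolding base_Q(2) by simp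
    then obtain g where g: "coords adj linesQ u g" "g 2 = v" "\<forall>j\<in>set [0, 1, 4, 7]. g j = g2 j"
      using coords_move[OF g2(1) form transitive_Q2] i(2) by metis
    have g': "g 0 = d" "g 1 = p0" "g 4 = p1" "g 7 = p2"
      using g(3) g2' g2(2) by auto
    \<comment> \<open>The hyperoval of \<open>y\<close> contains the point 0, hence exactly one more
      point of the fourth line. No automorphism is spent on it; the table lemma treats its three
      positions.\<close>
    have "hyp_line (\<lambda>n. adj y (g n)) [0, 10, 11, 12]"
      using hyperoval_common[OF g(1) form ys(5) y(4)] lines_Q(3) unfolding hyperoval_def list_all_iff by blast
    then have "adj y (g 10) \<or> adj y (g 11) \<or> adj y (g 12)"
      using ys(3) g'(1) by simp
    then obtain m where m: "m \<in> {10, 11, 12}" "adj y (g m)" by blast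
    define p3 where "p3 = g m"
    have m40: "m < 40"
      using m(1) by auto
    have m0: "m \<in> set (nbs linesQ 0)"
      unfolding base_Q(1) using m(1) by auto
    have p3: "adj u p3" "adj d p3" "adj y p3"
      unfolding p3_def using coordsD(1)[OF g(1) m40] coordsD(2)[OF g(1), of 0 m] m40 m0 m(2) g'(1) by auto
    obtain w3 r3 where "clique5 d p3 y w3 r3"
      using triangle_common[OF p3(2) y(1)] p3(3) adj_sym by blast
    then have w3: "clique5 d p3 w3 y r3"
      by (auto simp: clique5_def adj_sym)
    have une: "u \<noteq> w2" "u \<noteq> r2" "u \<noteq> w3" "u \<noteq> r3"
      using w2 w3 y(4) by (auto simp: clique5_def adj_sym)
    have unadj: "\<not> adj u w2" "\<not> adj u r2" "\<not> adj u w3" "\<not> adj u r3"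
      using clique5_nbr[OF w2 uv(2) adj_ne[OF p0'(1)] une(1) ys(5) une(2)] p0'(1)
        clique5_nbr[OF w3 uv(2) adj_ne[OF p3(1)] une(3) ys(5) une(4)] p3(1) by blast+
    have np: "\<not> adj (g a) p3 \<and> g a \<noteq> p3" if "a \<in> {1, 4, 7}" for a
    proof -
      have "list_all (\<lambda>a. list_all (\<lambda>m. m \<notin> set (nbs linesQ a)) [10, 11, 12]) [1, 4, 7]"
        by code_simp
      then have "m \<notin> set (nbs linesQ a)"
        using that m(1) by auto
      moreover have "a < 40" "a \<noteq> m"
        using that m(1) by auto
      ultimately show ?thesis
        unfolding p3_def using coordsD(2)[OF g(1) _ m40] coordsD(3)[OF g(1) _ m40] by blast
    qed
    have np': "\<not> adj p0 p3" "p0 \<noteq> p3" "\<not> adj p1 p3" "p1 \<noteq> p3" "\<not> adj p2 p3" "p2 \<noteq> p3"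
      using np[of 1] np[of 4] np[of 7] g' by auto
    have w2': "clique5 d p0 r2 y w2" and w3': "clique5 d p3 r3 y w3"
      using w2 w3 by (auto simp: clique5_def adj_sym)
    have n': "\<not> adj p1 p0" "p1 \<noteq> p0" "\<not> adj p2 p0" "p2 \<noteq> p0"
      using n1 n2 adj_sym by blast+
    have dw: "adj d w2" "adj d r2" "adj d w3" "adj d r3"
      using w2 w3 by (auto simp: clique5_def)
    note nt = none_or_two_common_triad[OF Qd g(1) g'(1) s(2)]
    \<comment> \<open>The thirteen pairs consist of vertices on different lines through
      \<open>y\<close> in the quadrangle at \<open>d\<close>, hence nonadjacent by
      \<open>cross_nonadj\<close>; only \<open>w\<close>, \<open>w'\<close> are nonadjacent by
      assumption.\<close>
    have c: "none_or_two_common (\<lambda>x. adj w (g x) \<and> adj w' (g x))" "none_or_two_common (\<lambda>x. adj w (g x) \<and> adj w2 (g x))"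
      "none_or_two_common (\<lambda>x. adj w (g x) \<and> adj r2 (g x))" "none_or_two_common (\<lambda>x. adj w (g x) \<and> adj w3 (g x))"
      "none_or_two_common (\<lambda>x. adj w (g x) \<and> adj r3 (g x))" "none_or_two_common (\<lambda>x. adj w' (g x) \<and> adj w2 (g x))"
      "none_or_two_common (\<lambda>x. adj w' (g x) \<and> adj r2 (g x))" "none_or_two_common (\<lambda>x. adj w' (g x) \<and> adj w3 (g x))"
      "none_or_two_common (\<lambda>x. adj w' (g x) \<and> adj r3 (g x))" "none_or_two_common (\<lambda>x. adj w2 (g x) \<and> adj w3 (g x))"
      "none_or_two_common (\<lambda>x. adj w2 (g x) \<and> adj r3 (g x))" "none_or_two_common (\<lambda>x. adj r2 (g x) \<and> adj w3 (g x))"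
      "none_or_two_common (\<lambda>x. adj r2 (g x) \<and> adj r3 (g x))"
      by (rule nt[OF w(2,3,4) w'(2,3,4) ww],
          rule nt[OF w(2,3,4) dw(1) unadj(1) une(1) cross_nonadj[OF p1(1) w2 n'(1,2)]],
          rule nt[OF w(2,3,4) dw(2) unadj(2) une(2) cross_nonadj[OF p1(1) w2' n'(1,2)]],
          rule nt[OF w(2,3,4) dw(3) unadj(3) une(3) cross_nonadj[OF p1(1) w3 np'(3,4)]],
          rule nt[OF w(2,3,4) dw(4) unadj(4) une(4) cross_nonadj[OF p1(1) w3' np'(3,4)]],
          rule nt[OF w'(2,3,4) dw(1) unadj(1) une(1) cross_nonadj[OF p2(1) w2 n'(3,4)]],
          rule nt[OF w'(2,3,4) dw(2) unadj(2) une(2) cross_nonadj[OF p2(1) w2' n'(3,4)]],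
          rule nt[OF w'(2,3,4) dw(3) unadj(3) une(3) cross_nonadj[OF p2(1) w3 np'(5,6)]],
          rule nt[OF w'(2,3,4) dw(4) unadj(4) une(4) cross_nonadj[OF p2(1) w3' np'(5,6)]],
          rule nt[OF dw(1) unadj(1) une(1) dw(3) unadj(3) une(3) cross_nonadj[OF w2 w3 np'(1,2)]],
          rule nt[OF dw(1) unadj(1) une(1) dw(4) unadj(4) une(4) cross_nonadj[OF w2 w3' np'(1,2)]],
          rule nt[OF dw(2) unadj(2) une(2) dw(3) unadj(3) une(3) cross_nonadj[OF w2' w3 np'(1,2)]],
          rule nt[OF dw(2) unadj(2) une(2) dw(4) unadj(4) une(4) cross_nonadj[OF w2' w3' np'(1,2)]])
    have h: "hyperoval linesQ (\<lambda>n. adj t (g n))" "pcond linesQ (\<lambda>n. adj t (g n))"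
      if "adj d t" "\<not> adj u t" "u \<noteq> t" for t
    proof -
      show "hyperoval linesQ (\<lambda>n. adj t (g n))"
        using hyperoval_common[OF g(1) form] that by blast
      have "adj t (g 0)"
        using that(1) g'(1) adj_sym by blast
      then show "pcond linesQ (\<lambda>n. adj t (g n))"
        using pcond_common[OF g(1) Qu] that by blast
    qed
    have t: "triple linesQ 1 (\<lambda>n. adj w2 (g n)) (\<lambda>n. adj y (g n)) (\<lambda>n. adj r2 (g n))"
      "triple linesQ 4 (\<lambda>n. adj w (g n)) (\<lambda>n. adj y (g n)) (\<lambda>n. adj r (g n))"
      "triple linesQ 7 (\<lambda>n. adj w' (g n)) (\<lambda>n. adj y (g n)) (\<lambda>n. adj r1 (g n))"
      "triple linesQ m (\<lambda>n. adj w3 (g n)) (\<lambda>n. adj y (g n)) (\<lambda>n. adj r3 (g n))"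
      using triple_common[OF g(1) w2 uv(2) p0'(1) une(1) ys(5) une(2) g'(1,2)]
        triple_common[OF g(1) p1(1) uv(2) p1(2) w(4) ys(5) p1(3) g'(1,3)]
        triple_common[OF g(1) p2(1) uv(2) p2(2) w'(4) ys(5) p2(3) g'(1,4)]
        triple_common[OF g(1) w3 uv(2) p3(1) une(3) ys(5) une(4) g'(1) p3_def[symmetric] m40] by simp_all
    \<comment> \<open>An antipode is adjacent to \<open>d\<close>, which is a common neighbour of
      \<open>u\<close>, \<open>v\<close> and the vertex \<open>t\<close> it belongs to, but not to
      \<open>v\<close> at index 2. This confines its index to 4 to 12.\<close>
    have idx: "\<exists>b. 4 \<le> b \<and> b < 13 \<and> z = g b \<and> adj t (g b) \<and>
        (\<forall>e. e \<in> set (nbs linesQ 2) \<longrightarrow> adj t (g e) \<longrightarrow> e \<in> set (nbs linesQ b))"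
      if z: "antip u t v z" and zd: "adj z d" for t z
    proof -
      note z = z[unfolded antip_def]
      obtain b where b: "b < 40" "z = g b"
        using coordsD(4)[OF g(1)] z by blast
      have b0: "b \<in> set (nbs linesQ 0)"
        using coordsD(2)[OF g(1), of 0 b] b zd g'(1) adj_sym by simp
      have b2: "b \<notin> set (nbs linesQ 2)" "b \<noteq> 2"
        using coordsD(2)[OF g(1), of 2 b] b z g(2) by auto
      have "1 \<in> set (nbs linesQ 2)" "3 \<in> set (nbs linesQ 2)"
        by code_simp+
      then have "b \<noteq> 1" "b \<noteq> 3"
        using b2 by auto
      moreover have "1 \<le> b" "b < 13"
        using b0 unfolding base_Q(1) by auto
      ultimately have "4 \<le> b"
        using b2(2) by simp
      moreover have "e \<in> set (nbs linesQ b)" if e: "e \<in> set (nbs linesQ 2)" "adj t (g e)" for e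
      proof -
        have e40: "e < 40"
          using nbs_lt[OF form e(1)] .
        have "adj u (g e)" "adj v (g e)"
          using coordsD(1)[OF g(1) e40] coordsD(2)[OF g(1), of 2 e] e40 e(1) g(2) by auto
        then have "adj z (g e)"
          using z e(2) by blast
        then show ?thesis
          using coordsD(2)[OF g(1) b(1) e40] b(2) by simp
      qed
      ultimately show ?thesis
        using \<open>b < 13\<close> b(2) z by blast
    qed
    obtain b where b: "4 \<le> b" "b < 13" "x = g b" "adj w (g b)"
      "\<And>e. e \<in> set (nbs linesQ 2) \<Longrightarrow> adj w (g e) \<Longrightarrow> e \<in> set (nbs linesQ b)"
      using idx[of w x] assms(15) xd(1) by blast
    obtain b' where b': "4 \<le> b'" "b' < 13" "x' = g b'" "adj w' (g b')"
      "\<And>e. e \<in> set (nbs linesQ 2) \<Longrightarrow> adj w' (g e) \<Longrightarrow> e \<in> set (nbs linesQ b')"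
      using idx[of w' x'] assms(16) xd(2) by blast
    have v2: "adj w (g 2)" "adj w' (g 2)"
      using s g(2) by auto
    have "b = b' \<or> b' \<in> set (nbs linesQ b)"
      by (rule antipodes_table_Q[OF h(1)[OF y(1,4) ys(5)] h(1)[OF w(2,3,4)] h(1)[OF w'(2,3,4)] h(1)[OF dw(1) unadj(1) une(1)]
          h(1)[OF dw(3) unadj(3) une(3)] h(2)[OF y(1,4) ys(5)] h(2)[OF w(2,3,4)] h(2)[OF w'(2,3,4)]
          h(2)[OF dw(1) unadj(1) une(1)] h(2)[OF dw(3) unadj(3) une(3)] t m(1) c v2 b(1,2,4,5) b'(1,2,4,5)])
    moreover have "b < 40" "b' < 40"
      using b(2) b'(2) by auto
    ultimately show ?thesis
      using coordsD(2)[OF g(1), of b b'] b(3) b'(3) by blast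
  qed
  then show False
  proof
    assume e: "x = x'"
    \<comment> \<open>If the antipodes coincide, the two sets of four common neighbours both equal
      the four common neighbours of \<open>u\<close>, \<open>v\<close> and \<open>x\<close>. Then
      the triad \<open>u\<close>, \<open>w\<close>, \<open>w'\<close> at \<open>v\<close> has four
      centres instead of two.\<close>
    define S where "S t = {c. adj v c \<and> adj u c \<and> adj t c}" for t
    have x0: "adj u x" "\<not> adj v x" "x \<noteq> v"
      using x by blast+
    have T: "card {c. adj u c \<and> adj v c \<and> adj x c} = 4"
      by (rule card_common[OF uv(2,1) s(3) x0(1) _ x0(2) x0(3)[symmetric]]) (use xd adj_sym in blast)
    then have fin: "finite {c. adj u c \<and> adj v c \<and> adj x c}"
      by (intro card_ge_0_finite) simp
    have "card (S w) = 4" "card (S w') = 4"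
      unfolding S_def using card_common[OF uv(3) s(1,2) w(1,2,3,4)] card_common[OF uv(3) s(1,2) w'(1,2,3,4)] by simp_all
    moreover have "S w \<subseteq> {c. adj u c \<and> adj v c \<and> adj x c}" "S w' \<subseteq> {c. adj u c \<and> adj v c \<and> adj x c}"
      unfolding S_def using x x' e by blast+
    ultimately have "S w = S w'"
      using card_subset_eq[OF fin] T by metis
    then have "S w \<subseteq> {d, c'}"
      unfolding S_def using c'(6) by blast
    then have "card (S w) \<le> card {d, c'}"
      by (intro card_mono) auto
    then have "card (S w) \<le> 2"
      using c'(5) by simp
    then show False
      using \<open>card (S w) = 4\<close> by simp
  next
    assume xx: "adj x x'"
    have ux: "adj u x" "adj u x'" "x \<noteq> v" "x' \<noteq> v"
      using x x' by blast+
    obtain e f where ef: "clique5 u x x' e f" "\<forall>z. adj u z \<longrightarrow> adj x z \<longrightarrow> adj x' z \<longrightarrow> z = e \<or> z = f"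
      using triangle_common[OF ux(1,2) xx] by blast
    have "adj x c'" "adj x' c'"
      using x x' c' by blast+
    then have "d = e \<or> d = f" "c' = e \<or> c' = f"
      using ef(2) uv(2) xd c'(2) by blast+
    \<comment> \<open>Both \<open>d\<close> and \<open>c'\<close> see the edge \<open>x\<close>,
      \<open>x'\<close>, so all lie in one 5-clique with \<open>u\<close>. Since \<open>v\<close>
      sees \<open>u\<close>, \<open>d\<close> and \<open>c'\<close>, it would have to be
      \<open>x\<close> or \<open>x'\<close>.\<close>
    then have "clique5 u d c' x x'"
      using ef(1) c'(5) by (auto simp: clique5_def adj_sym)
    then show False
      using clique5_mem[of u d c' x x' v] s uv c'(1) ux(3,4) by blast
  qed
qed

lemma no_type_Q:
  assumes Q: "\<And>u. u \<in> V \<Longrightarrow> has_type u linesQ" and u: "u \<in> V"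
  shows False
proof -
  have form: "table_form linesQ"
    by (rule table_form_Q)
  obtain g where g: "coords adj linesQ u g"
    using Q[OF u] by (auto simp: has_type_def)
  define v d where "v = g 0" and "d = g 1"
  have uv: "adj u v" "adj u d" "adj v d"
    unfolding v_def d_def using coordsD(1)[OF g] coordsD(2)[OF g, of 0 1] base_Q(1) by auto
  have Qv: "has_type v linesQ"
    using Q adj_V uv(3) by blast
  obtain h where h: "coords adj linesQ v h" "h 0 = d" "h 1 = u"
    using coords_edge[OF Qv uv(3)] uv adj_sym by blast
  have un: "u \<noteq> h i" if "i < 40" "i \<noteq> 1" for i
    using coordsD(3)[OF h(1), of 1 i] that h(3) by auto
  \<comment> \<open>Two lines through \<open>d\<close> in the quadrangle at \<open>v\<close> give
    two 5-cliques. Each contains a vertex with an antipode of \<open>v\<close>, and these two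
    vertices are nonadjacent.\<close>
  have C1: "clique5 v d (h 4) (h 5) (h 6)" and C2: "clique5 v d (h 7) (h 8) (h 9)"
    using coords_line[OF h(1) form lines_Q(1)] coords_line[OF h(1) form lines_Q(2)] h(2) by simp_all
  obtain w x where w: "w \<in> {h 4, h 5, h 6}" "antip u w v x"
    using antipode_exists[OF Q[OF u] C1 uv(1,2)] un by auto
  obtain w' x' where w': "w' \<in> {h 7, h 8, h 9}" "antip u w' v x'"
    using antipode_exists[OF Q[OF u] C2 uv(1,2)] un by auto
  obtain i where i: "i \<in> {4, 5, 6}" "w = h i"
    using w(1) by blast
  obtain j where j: "j \<in> {7, 8, 9}" "w' = h j"
    using w'(1) by blast
  have "i \<in> set [4, 5, 6]" "j \<in> set [7, 8, 9]"
    using i(1) j(1) by auto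
  then have t: "i \<notin> set (nbs linesQ 1)" "j \<notin> set (nbs linesQ i)" "j \<notin> set (nbs linesQ 1)"
    using cross_table_Q unfolding Let_def list_all_iff by blast+
  have lt: "i < 40" "j < 40" "i \<noteq> j" "i \<noteq> 1" "j \<noteq> 1"
    using i(1) j(1) by auto
  have n: "\<not> adj u w" "u \<noteq> w" "\<not> adj u w'" "u \<noteq> w'" "\<not> adj w w'" "w \<noteq> w'"
    using coordsD(2)[OF h(1), of 1 i] coordsD(2)[OF h(1), of 1 j] coordsD(2)[OF h(1), of i j] coordsD(3)[OF h(1), of i j]
      un[of i] un[of j] lt t i(2) j(2) h(3) by auto
  have "adj v w" "adj d w" "adj v w'" "adj d w'"
    using C1 C2 w(1) w'(1) by (auto simp: clique5_def)
  then show False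
    using type_Q_contradiction[OF Q uv _ _ n(1,2) _ _ n(3-6) w(2) w'(2)] by blast
qed

lemma all_type_W:
  assumes conn: "connected_graph V adj"
  shows "\<forall>u\<in>V. has_type u linesW"
proof -
  have "\<exists>u\<in>V. has_type u linesW"
  proof (rule ccontr)
    assume "\<not> ?thesis"
    then have "has_type u linesQ" if "u \<in> V" for u
      using that has_type_ex has_type_cases by blast
    moreover obtain u where "u \<in> V"
      using conn by (auto simp: connected_graph_def)
    ultimately show False
      using no_type_Q by blast
  qed
  then obtain u where u: "u \<in> V" "has_type u linesW" by blast
  have "has_type x linesW" if "adj\<^sup>*\<^sup>* u x" for x
    using that by (induction) (use u type_W_adj in blast)+
  then show ?thesis
    using conn u(1) by (auto simp: connected_graph_def)
qed

end

section \<open>Arithmetic modulo 3 and projective points over GF(3)\<close>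

lemma three_eq_0: "(3::3) = 0"
  by simp

lemma three_cases: "(x::3) = 0 \<or> x = 1 \<or> x = 2"
proof (cases x)
  case (of_int z)
  then have "z = 0 \<or> z = 1 \<or> z = 2" by auto
  then show ?thesis using of_int(1) by auto
qed

lemma uminus_3: "- (x::3) = 2 * x"
  using three_cases[of x] by auto

lemma of_nat_3_mod: "(of_nat a :: 3) = of_nat (a mod 3)"
proof -
  have "(of_nat a :: 3) = of_nat (3 * (a div 3) + a mod 3)"
    by simp
  also have "\<dots> = of_nat (a mod 3)"
    by (simp only: of_nat_add of_nat_mult of_nat_numeral three_eq_0 mult_zero_left add_0)
  finally show ?thesis .
qed

lemma of_nat_3_eq: "(of_nat a :: 3) = of_nat b \<longleftrightarrow> a mod 3 = b mod 3"
proof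
  have small: "x = y" if "x < 3" "y < 3" "(of_nat x :: 3) = of_nat y" for x y :: nat
  proof -
    have "x = 0 \<or> x = 1 \<or> x = 2" "y = 0 \<or> y = 1 \<or> y = 2"
      using that by auto
    then show ?thesis
      using that(3) by auto
  qed
  assume "(of_nat a :: 3) = of_nat b"
  then have "(of_nat (a mod 3) :: 3) = of_nat (b mod 3)"
    using of_nat_3_mod[of a] of_nat_3_mod[of b] by simp
  then show "a mod 3 = b mod 3"
    by (intro small) simp_all
next
  assume "a mod 3 = b mod 3"
  then show "(of_nat a :: 3) = of_nat b"
    using of_nat_3_mod[of a] of_nat_3_mod[of b] by simp
qed

lemma of_nat_3_eq_0: "(of_nat a :: 3) = 0 \<longleftrightarrow> a mod 3 = 0"
  using of_nat_3_eq[of a 0] by simp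

fun lists3 :: "nat \<Rightarrow> nat list list" where
  "lists3 0 = [[]]"
| "lists3 (Suc d) = concat (map (\<lambda>l. map (\<lambda>x. x # l) [0, 1, 2]) (lists3 d))"

lemma set_lists3: "l \<in> set (lists3 d) \<longleftrightarrow> length l = d \<and> (\<forall>x\<in>set l. x < 3)"
proof (induction d arbitrary: l)
  case (Suc d)
  show ?case
  proof (cases l)
    case (Cons x k)
    have "x = 0 \<or> x = 1 \<or> x = 2 \<longleftrightarrow> x < 3"
      by auto
    then show ?thesis
      using Suc.IH[of k] Cons by auto
  qed auto
qed auto

text \<open>A projective point over GF(3) has two representatives; doubling passes to the other
  one.\<close>

definition dbl :: "nat list \<Rightarrow> nat list" where
  "dbl l = map (\<lambda>x. 2 * x mod 3) l"

lemma dbl_dbl: "l \<in> set (lists3 d) \<Longrightarrow> dbl (dbl l) = l"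
proof -
  assume "l \<in> set (lists3 d)"
  then have "x = 0 \<or> x = 1 \<or> x = 2" if "x \<in> set l" for x
    using that by (auto simp: set_lists3)
  then have "2 * (2 * x mod 3) mod 3 = x" if "x \<in> set l" for x
    using that by fastforce
  then show ?thesis
    unfolding dbl_def by (simp add: map_idI)
qed

text \<open>The map \<open>ix\<close> numbers the index type, so that vectors become lists on which
  the tables can be evaluated.\<close>

definition vec3 :: "('n \<Rightarrow> nat) \<Rightarrow> nat list \<Rightarrow> 'n \<Rightarrow> 3" where
  "vec3 ix l = (\<lambda>j. of_nat (l ! ix j))"

context
  fixes ix :: "'n \<Rightarrow> nat" and d :: nat
  assumes ix: "bij_betw ix UNIV {..<d}"
begin

lemma vec3_lt: "ix j < d"
  using ix by (auto simp: bij_betw_def)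

lemma vec3_ex: "\<exists>l\<in>set (lists3 d). v = vec3 ix l"
proof
  define c where "c x = (if x = (0::3) then 0 else if x = 1 then 1 else 2 :: nat)" for x
  have c: "of_nat (c x) = x" "c x < 3" for x
    using three_cases[of x] by (auto simp: c_def)
  define l where "l = map (\<lambda>k. c (v (inv_into UNIV ix k))) [0..<d]"
  have "inv_into UNIV ix (ix j) = j" for j
    using ix by (simp add: bij_betw_def)
  then show "v = vec3 ix l"
    unfolding vec3_def l_def using vec3_lt c(1) by simp
  show "l \<in> set (lists3 d)"
    unfolding set_lists3 l_def using c(2) by auto
qed

lemma vec3_inj:
  assumes "l \<in> set (lists3 d)" "l' \<in> set (lists3 d)" "vec3 ix l = vec3 ix l'"
  shows "l = l'"
proof (rule nth_equalityI)
  show "length l = length l'"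
    using assms by (simp add: set_lists3)
  fix k assume k: "k < length l"
  then obtain j where j: "k = ix j"
    using ix assms(1) by (auto simp: bij_betw_def set_lists3)
  have "l ! k < 3" "l' ! k < 3"
    using assms(1,2) k by (auto simp: set_lists3)
  moreover have "(of_nat (l ! k) :: 3) = of_nat (l' ! k)"
    using fun_cong[OF assms(3), of j] j by (simp add: vec3_def)
  ultimately show "l ! k = l' ! k"
    unfolding of_nat_3_eq by simp
qed

lemma proj_pt_vec3:
  assumes "length l = d"
  shows "proj_pt (vec3 ix l) = {vec3 ix l, vec3 ix (dbl l)}"
proof -
  have "smul c (vec3 ix l) \<in> {vec3 ix l, vec3 ix (dbl l)}" if "c \<noteq> 0" for c
    using three_cases[of c] that
  proof (elim disjE)
    assume "c = 2"
    have "smul 2 (vec3 ix l) j = vec3 ix (dbl l) j" for j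
    proof -
      have "vec3 ix (dbl l) j = of_nat (2 * (l ! ix j))"
        unfolding vec3_def dbl_def using vec3_lt[of j] assms by (simp add: of_nat_3_eq del: of_nat_mult)
      then show ?thesis
        by (simp add: smul_def vec3_def)
    qed
    then show ?thesis
      using \<open>c = 2\<close> by blast
  qed (auto simp: smul_def)
  moreover have "vec3 ix l = smul 1 (vec3 ix l)" "vec3 ix (dbl l) = smul 2 (vec3 ix l)"
  proof -
    show "vec3 ix (dbl l) = smul 2 (vec3 ix l)"
    proof
      fix j
      have "vec3 ix (dbl l) j = of_nat (2 * (l ! ix j))"
        unfolding vec3_def dbl_def using vec3_lt[of j] assms by (simp add: of_nat_3_eq del: of_nat_mult)
      then show "vec3 ix (dbl l) j = smul 2 (vec3 ix l) j"
        by (simp add: smul_def vec3_def)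
    qed
  qed (simp add: smul_def)
  moreover have "(1::3) \<noteq> 0" "(2::3) \<noteq> 0" by simp_all
  ultimately show ?thesis
    unfolding proj_pt_def by blast
qed

text \<open>The list \<open>T\<close> has one representative for each point. Distinctness of
  \<open>T @ map dbl T\<close> gives injectivity, and completeness of this list among the nonzero
  lists gives surjectivity.\<close>

lemma proj_table_bij:
  assumes T: "list_all (\<lambda>l. length l = d \<and> list_all (\<lambda>x. x < 3) l) T" "distinct (T @ map dbl T)" "length T = 40"
    and S: "\<And>i. i < 40 \<Longrightarrow> proj_pt (vec3 ix (T ! i)) \<in> S" "S \<subseteq> proj_points"
    and surj: "\<And>l. l \<in> set (lists3 d) \<Longrightarrow> proj_pt (vec3 ix l) \<in> S \<Longrightarrow> \<exists>x\<in>set l. x \<noteq> 0 \<Longrightarrow> l \<in> set T \<or> l \<in> set (map dbl T)"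
  shows "bij_betw (\<lambda>i. proj_pt (vec3 ix (T ! i))) {..<40} S"
proof -
  have TL: "T ! i \<in> set (lists3 d)" "length (T ! i) = d" if "i < 40" for i
    using T(1,3) that by (auto simp: list_all_iff set_lists3)
  have dl: "dbl l \<in> set (lists3 d)" if "l \<in> set (lists3 d)" for l
    using that by (auto simp: set_lists3 dbl_def)
  have "i = j" if ij: "i < 40" "j < 40" and e: "proj_pt (vec3 ix (T ! i)) = proj_pt (vec3 ix (T ! j))" for i j
  proof -
    have "vec3 ix (T ! i) = vec3 ix (T ! j) \<or> vec3 ix (T ! i) = vec3 ix (dbl (T ! j))"
      using e proj_pt_vec3[OF TL(2)[OF ij(1)]] proj_pt_vec3[OF TL(2)[OF ij(2)]] by blast
    then have "T ! i = T ! j \<or> T ! i = dbl (T ! j)"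
      using vec3_inj TL ij dl by blast
    moreover have "T ! i \<noteq> dbl (T ! j)"
      using T(2,3) ij by (auto simp: distinct_append) (metis disjoint_iff image_eqI nth_mem)
    ultimately show ?thesis
      using T(2,3) ij by (simp add: nth_eq_iff_index_eq)
  qed
  then have "inj_on (\<lambda>i. proj_pt (vec3 ix (T ! i))) {..<40}"
    by (auto simp: inj_on_def)
  moreover have "P \<in> (\<lambda>i. proj_pt (vec3 ix (T ! i))) ` {..<40}" if P: "P \<in> S" for P
  proof -
    obtain v where v: "P = proj_pt v" "v \<noteq> (\<lambda>_. 0)"
      using P S(2) by (auto simp: proj_points_def)
    obtain l where l: "l \<in> set (lists3 d)" "v = vec3 ix l"
      using vec3_ex by blast
    have len: "length l = d"
      using l(1) by (simp add: set_lists3)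
    have "\<exists>x\<in>set l. x \<noteq> 0"
    proof (rule ccontr)
      assume "\<not> ?thesis"
      then have "l ! ix j = 0" for j
        using vec3_lt[of j] len nth_mem by metis
      then have "vec3 ix l j = 0" for j
        by (simp add: vec3_def)
      then show False
        using v(2) l(2) by auto
    qed
    then consider "l \<in> set T" | "l \<in> set (map dbl T)"
      using surj[OF l(1)] P v(1) l(2) by blast
    then obtain i where i: "i < 40" "l = T ! i \<or> l = dbl (T ! i)"
      by cases (use T(3) in \<open>auto simp: in_set_conv_nth\<close>)
    have "proj_pt (vec3 ix l) = proj_pt (vec3 ix (T ! i))"
      using i(2)
    proof
      assume e: "l = dbl (T ! i)"
      have "dbl l = T ! i"
        unfolding e using dbl_dbl[OF TL(1)[OF i(1)]] .
      then show ?thesis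
        using proj_pt_vec3[OF len] proj_pt_vec3[OF TL(2)[OF i(1)]] e by auto
    qed simp
    then show ?thesis
      using i(1) v(1) l(2) by blast
  qed
  ultimately show ?thesis
    unfolding bij_betw_def using S(1) by blast
qed

end

section \<open>The tables agree with W(3) and Q_4(3)\<close>

definition ix4 :: "4 \<Rightarrow> nat" where
  "ix4 j = (if j = 0 then 0 else if j = 1 then 1 else if j = 2 then 2 else 3)"

definition ix5 :: "5 \<Rightarrow> nat" where
  "ix5 j = (if j = 0 then 0 else if j = 1 then 1 else if j = 2 then 2 else if j = 3 then 3 else 4)"

lemma four_cases: "(j::4) = 0 \<or> j = 1 \<or> j = 2 \<or> j = 3"
proof (cases j)
  case (of_int z)
  then have "z = 0 \<or> z = 1 \<or> z = 2 \<or> z = 3" by auto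
  then show ?thesis using of_int(1) by auto
qed

lemma five_cases: "(j::5) = 0 \<or> j = 1 \<or> j = 2 \<or> j = 3 \<or> j = 4"
proof (cases j)
  case (of_int z)
  then have "z = 0 \<or> z = 1 \<or> z = 2 \<or> z = 3 \<or> z = 4" by auto
  then show ?thesis using of_int(1) by auto
qed

lemma ix4_simps [simp]: "ix4 0 = 0" "ix4 1 = 1" "ix4 2 = 2" "ix4 3 = 3"
  by (simp_all add: ix4_def)

lemma ix5_simps [simp]: "ix5 0 = 0" "ix5 1 = 1" "ix5 2 = 2" "ix5 3 = 3" "ix5 4 = 4"
  by (simp_all add: ix5_def)

lemma ix4_bij: "bij_betw ix4 UNIV {..<4}"
proof -
  have "inj ix4"
    using four_cases by (intro injI) (smt (verit) ix4_simps one_neq_zero zero_neq_numeral one_eq_numeral_iff numeral_eq_iff num.distinct)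
  moreover have "k \<in> range ix4" if "k < 4" for k
  proof -
    have "k = ix4 0 \<or> k = ix4 1 \<or> k = ix4 2 \<or> k = ix4 3"
      using that by auto
    then show ?thesis by blast
  qed
  ultimately show ?thesis
    by (auto simp: bij_betw_def ix4_def)
qed

lemma ix5_bij: "bij_betw ix5 UNIV {..<5}"
proof -
  have "inj ix5"
    using five_cases by (intro injI) (smt (verit) ix5_simps one_neq_zero zero_neq_numeral one_eq_numeral_iff numeral_eq_iff num.distinct num.inject)
  moreover have "k \<in> range ix5" if "k < 5" for k
  proof -
    have "k = ix5 0 \<or> k = ix5 1 \<or> k = ix5 2 \<or> k = ix5 3 \<or> k = ix5 4"
      using that by auto
    then show ?thesis by blast
  qed
  ultimately show ?thesis
    by (auto simp: bij_betw_def ix5_def)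
qed

text \<open>The order matters: entry \<open>i\<close> represents the point \<open>i\<close> of
  \<open>linesW\<close>, as \<open>form_table_W\<close> confirms.\<close>

definition vecsW :: "nat list list" where
  "vecsW =
    [[1, 0, 0, 0], [0, 0, 1, 0], [1, 0, 1, 0], [2, 0, 1, 0], [0, 0, 0, 1], [1, 0, 0, 1], [2, 0, 0, 1], [0, 0,
     1, 1], [1, 0, 1, 1], [2, 0, 1, 1], [0, 0, 1, 2], [1, 0, 1, 2], [2, 0, 1, 2], [0, 1, 0, 0], [1, 1, 0, 0],
     [2, 1, 0, 0], [0, 1, 0, 1], [1, 1, 0, 1], [2, 1, 0, 1], [0, 1, 0, 2], [1, 1, 0, 2], [2, 1, 0, 2], [0, 1,
     1, 0], [1, 1, 1, 0], [2, 1, 1, 0], [0, 1, 1, 1], [1, 1, 1, 1], [2, 1, 1, 1], [0, 1, 1, 2], [1, 1, 1, 2],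
     [2, 1, 1, 2], [0, 1, 2, 0], [1, 1, 2, 0], [2, 1, 2, 0], [0, 1, 2, 1], [1, 1, 2, 1], [2, 1, 2, 1], [0, 1,
     2, 2], [1, 1, 2, 2], [2, 1, 2, 2]]"

definition vecsQ :: "nat list list" where
  "vecsQ =
    [[1, 0, 0, 0, 0], [0, 0, 1, 0, 0], [1, 0, 1, 0, 0], [2, 0, 1, 0, 0], [0, 0, 0, 2, 0], [1, 0, 0, 2, 0],
     [2, 0, 0, 2, 0], [0, 0, 1, 2, 1], [1, 0, 1, 2, 1], [2, 0, 1, 2, 1], [0, 0, 1, 2, 2], [1, 0, 1, 2, 2], [2,
     0, 1, 2, 2], [0, 1, 0, 0, 0], [2, 1, 0, 0, 1], [2, 1, 0, 0, 2], [2, 1, 1, 0, 2], [0, 1, 1, 0, 0], [2, 1,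
     1, 0, 1], [2, 1, 2, 0, 1], [2, 1, 2, 0, 2], [0, 1, 2, 0, 0], [2, 1, 0, 2, 2], [0, 1, 0, 2, 0], [2, 1, 0,
     2, 1], [0, 1, 1, 2, 1], [0, 1, 1, 2, 2], [1, 1, 1, 2, 0], [2, 1, 2, 2, 0], [1, 1, 2, 2, 1], [1, 1, 2, 2,
     2], [2, 1, 0, 1, 1], [2, 1, 0, 1, 2], [0, 1, 0, 1, 0], [2, 1, 1, 1, 0], [1, 1, 1, 1, 1], [1, 1, 1, 1, 2],
     [0, 1, 2, 1, 2], [1, 1, 2, 1, 0], [0, 1, 2, 1, 1]]"

text \<open>Natural numbers are reduced modulo 3 only at the end, so the factor 2 plays the part of
  -1.\<close>

fun sympl :: "nat list \<Rightarrow> nat list \<Rightarrow> nat" where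
  "sympl [a, b, c, d] [a', b', c', d'] = a * b' + 2 * (b * a') + c * d' + 2 * (d * c')"
| "sympl _ _ = 0"

fun quadl :: "nat list \<Rightarrow> nat" where
  "quadl [a, b, c, d, e] = a * b + c * d + e * e"
| "quadl _ = 0"

text \<open>The bilinear form belonging to \<open>quadl\<close>; two singular points span a singular
  line iff it vanishes on them.\<close>

fun polarl :: "nat list \<Rightarrow> nat list \<Rightarrow> nat" where
  "polarl [a, b, c, d, e] [a', b', c', d', e'] = a * b' + b * a' + c * d' + d * c' + (e * e' + e * e')"
| "polarl _ _ = 0"

definition form_table :: "nat list list \<Rightarrow> nat list list \<Rightarrow> (nat list \<Rightarrow> nat list \<Rightarrow> nat) \<Rightarrow> bool" where
  "form_table L T f \<longleftrightarrow> list_all (\<lambda>(i, x). let n = nbs L i in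
     list_all (\<lambda>(j, y). (j \<in> set n) = (i \<noteq> j \<and> f x y mod 3 = 0)) (enumerate 0 T)) (enumerate 0 T)"

lemma vecsW_table:
  "list_all (\<lambda>l. length l = 4 \<and> list_all (\<lambda>x. x < 3) l) vecsW" "distinct (vecsW @ map dbl vecsW)" "length vecsW = 40"
  "list_all (\<lambda>l. list_all (\<lambda>x. x = 0) l \<or> l \<in> set vecsW \<or> l \<in> set (map dbl vecsW)) (lists3 4)"
  "list_all (\<lambda>l. \<not> list_all (\<lambda>x. x = 0) l) vecsW"
  by code_simp+

lemma form_table_W: "form_table linesW vecsW sympl"
  by code_simp

lemma vecsQ_table:
  "list_all (\<lambda>l. length l = 5 \<and> list_all (\<lambda>x. x < 3) l) vecsQ" "distinct (vecsQ @ map dbl vecsQ)" "length vecsQ = 40"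
  "list_all (\<lambda>l. list_all (\<lambda>x. x = 0) l \<or> quadl l mod 3 \<noteq> 0 \<or> l \<in> set vecsQ \<or> l \<in> set (map dbl vecsQ)) (lists3 5)"
  "list_all (\<lambda>l. \<not> list_all (\<lambda>x. x = 0) l) vecsQ" "list_all (\<lambda>l. quadl l mod 3 = 0) vecsQ"
  by code_simp+

lemma form_table_Q: "form_table linesQ vecsQ polarl"
  by code_simp

lemma form_table_entry:
  assumes "form_table L T f" "length T = 40" "i < 40" "j < 40"
  shows "j \<in> set (nbs L i) \<longleftrightarrow> i \<noteq> j \<and> f (T ! i) (T ! j) mod 3 = 0"
proof -
  have mem: "(k, T ! k) \<in> set (enumerate 0 T)" if "k < 40" for k
    using that assms(2) by (simp add: in_set_enumerate_eq)
  have "\<forall>z\<in>set (enumerate 0 T). case z of (j, y) \<Rightarrow> (j \<in> set (nbs L i)) = (i \<noteq> j \<and> f (T ! i) y mod 3 = 0)"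
    using bspec[OF assms(1)[unfolded form_table_def Let_def list_all_iff] mem[OF assms(3)]] unfolding prod.case .
  from bspec[OF this mem[OF assms(4)]] show ?thesis
    unfolding prod.case .
qed

lemma symp3_vec3:
  assumes "length x = 4" "length y = 4"
  shows "symp3 (vec3 ix4 x) (vec3 ix4 y) = of_nat (sympl x y)"
proof -
  obtain a b c d where x: "x = [a, b, c, d]"
    using assms(1) by (auto simp: length_Suc_conv numeral_eq_Suc)
  obtain a' b' c' d' where y: "y = [a', b', c', d']"
    using assms(2) by (auto simp: length_Suc_conv numeral_eq_Suc)
  show ?thesis
    unfolding symp3_def vec3_def x y by (simp add: diff_conv_add_uminus uminus_3 eval_nat_numeral)
qed

lemma quad3_vec3:
  assumes "length x = 5"
  shows "quad3 (vec3 ix5 x) = of_nat (quadl x)"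
proof -
  obtain a b c d e where x: "x = [a, b, c, d, e]"
    using assms by (auto simp: length_Suc_conv numeral_eq_Suc)
  show ?thesis
    unfolding quad3_def vec3_def x by (simp add: eval_nat_numeral)
qed

text \<open>The form is alternating, so on a span it is multiplied by the determinant of the
  coefficients. Hence a line is totally isotropic as soon as two spanning vectors are
  orthogonal.\<close>

lemma symp3_comb: "symp3 (\<lambda>i. a * x i + b * y i) (\<lambda>i. c * x i + e * y i) = (a * e - b * c) * symp3 x y"
  unfolding symp3_def by (simp add: algebra_simps)

lemma symp3_smul: "symp3 (smul a x) (smul b y) = a * b * symp3 x y"
  unfolding symp3_def smul_def by (simp add: algebra_simps)

definition polar3 :: "(5 \<Rightarrow> 3) \<Rightarrow> (5 \<Rightarrow> 3) \<Rightarrow> 3" where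
  "polar3 x y = x 0 * y 1 + x 1 * y 0 + x 2 * y 3 + x 3 * y 2 + (x 4 * y 4 + x 4 * y 4)"

lemma polar3_vec3:
  assumes "length x = 5" "length y = 5"
  shows "polar3 (vec3 ix5 x) (vec3 ix5 y) = of_nat (polarl x y)"
proof -
  obtain a b c d e where x: "x = [a, b, c, d, e]"
    using assms(1) by (auto simp: length_Suc_conv numeral_eq_Suc)
  obtain a' b' c' d' e' where y: "y = [a', b', c', d', e']"
    using assms(2) by (auto simp: length_Suc_conv numeral_eq_Suc)
  show ?thesis
    unfolding polar3_def vec3_def x y by (simp add: eval_nat_numeral)
qed

lemma quad3_comb: "quad3 (\<lambda>i. a * x i + b * y i) = a * a * quad3 x + b * b * quad3 y + a * b * polar3 x y"
  unfolding quad3_def polar3_def by (simp add: algebra_simps)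

lemma quad3_smul: "quad3 (smul a x) = a * a * quad3 x"
  unfolding quad3_def smul_def by (simp add: algebra_simps)

lemma polar3_smul: "polar3 (smul a x) (smul b y) = a * b * polar3 x y"
  unfolding polar3_def smul_def by (simp add: algebra_simps)

lemma proj_pt_self: "v \<in> proj_pt (v :: 'n \<Rightarrow> 'k::comm_ring_1)"
proof -
  have "v = smul 1 v"
    by (simp add: smul_def)
  then show ?thesis
    unfolding proj_pt_def using one_neq_zero by blast
qed

lemma vec3_nonzero:
  assumes "bij_betw ix UNIV {..<d}" "l \<in> set (lists3 d)" "\<not> list_all (\<lambda>x. x = 0) l"
  shows "proj_pt (vec3 ix l) \<in> proj_points"
proof -
  obtain x where x: "x \<in> set l" "x \<noteq> 0"
    using assms(3) unfolding list_all_iff by blast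
  then obtain k where "k < length l" "l ! k = x"
    unfolding in_set_conv_nth by blast
  then have k: "k < d" "l ! k \<noteq> 0" "l ! k < 3"
    using assms(2) x by (auto simp: set_lists3)
  have "k \<in> range ix"
    using assms(1) k(1) by (auto simp: bij_betw_def)
  then obtain j where j: "ix j = k" by blast
  have "vec3 ix l j \<noteq> 0"
    unfolding vec3_def j of_nat_3_eq_0 using k by simp
  then have "vec3 ix l \<noteq> (\<lambda>_. 0)" by auto
  then show ?thesis
    unfolding proj_points_def by blast
qed

lemma W3_model:
  "bij_betw (\<lambda>i. proj_pt (vec3 ix4 (vecsW ! i))) {..<40} W3_points"
  "i < 40 \<Longrightarrow> j < 40 \<Longrightarrow> W3_coll (proj_pt (vec3 ix4 (vecsW ! i))) (proj_pt (vec3 ix4 (vecsW ! j))) \<longleftrightarrow> j \<in> set (nbs linesW i)"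
proof -
  have mem: "vecsW ! i \<in> set vecsW" if "i < 40" for i
    using that vecsW_table(3) by simp
  have len: "length (vecsW ! i) = 4" if "i < 40" for i
    using mem[OF that] vecsW_table(1) unfolding list_all_iff by blast
  have pt: "proj_pt (vec3 ix4 (vecsW ! i)) \<in> W3_points" if "i < 40" for i
    unfolding W3_points_def
    by (rule vec3_nonzero[OF ix4_bij]) (use mem[OF that] vecsW_table(1,5) in \<open>unfold list_all_iff set_lists3, blast\<close>)+
  show bij: "bij_betw (\<lambda>i. proj_pt (vec3 ix4 (vecsW ! i))) {..<40} W3_points"
  proof (rule proj_table_bij[OF ix4_bij vecsW_table(1-3) pt])
    show "W3_points \<subseteq> proj_points"
      by (simp add: W3_points_def)
    fix l :: "nat list" assume "l \<in> set (lists3 4)" "\<exists>x\<in>set l. x \<noteq> 0"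
    then show "l \<in> set vecsW \<or> l \<in> set (map dbl vecsW)"
      using bspec[OF vecsW_table(4)[unfolded list_all_iff[of _ "lists3 4"]], of l] by (auto simp: list_all_iff)
  qed
  assume ij: "i < 40" "j < 40"
  let ?x = "vec3 ix4 (vecsW ! i)" and ?y = "vec3 ix4 (vecsW ! j)"
  have ne: "proj_pt ?x = proj_pt ?y \<longleftrightarrow> i = j"
    using bij ij by (auto simp: bij_betw_def inj_on_def)
  have "(\<forall>x\<in>proj_pt ?x. \<forall>y\<in>proj_pt ?y. \<forall>a b c d. symp3 (\<lambda>i. a * x i + b * y i) (\<lambda>i. c * x i + d * y i) = 0) \<longleftrightarrow>
    symp3 ?x ?y = 0"
  proof
    assume "\<forall>x\<in>proj_pt ?x. \<forall>y\<in>proj_pt ?y. \<forall>a b c d. symp3 (\<lambda>i. a * x i + b * y i) (\<lambda>i. c * x i + d * y i) = 0"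
    then have "symp3 (\<lambda>i. 1 * ?x i + 0 * ?y i) (\<lambda>i. 0 * ?x i + 1 * ?y i) = 0"
      using proj_pt_self by blast
    then show "symp3 ?x ?y = 0"
      by simp
  next
    assume "symp3 ?x ?y = 0"
    then show "\<forall>x\<in>proj_pt ?x. \<forall>y\<in>proj_pt ?y. \<forall>a b c d. symp3 (\<lambda>i. a * x i + b * y i) (\<lambda>i. c * x i + d * y i) = 0"
      unfolding symp3_comb proj_pt_def by (auto simp: symp3_smul)
  qed
  also have "symp3 ?x ?y = 0 \<longleftrightarrow> sympl (vecsW ! i) (vecsW ! j) mod 3 = 0"
    by (simp only: symp3_vec3[OF len[OF ij(1)] len[OF ij(2)]] of_nat_3_eq_0)
  finally show "W3_coll (proj_pt ?x) (proj_pt ?y) \<longleftrightarrow> j \<in> set (nbs linesW i)"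
    by (simp only: W3_coll_def form_table_entry[OF form_table_W vecsW_table(3) ij] ne pt[OF ij(1)] pt[OF ij(2)] simp_thms)
qed

lemma Q43_model:
  "bij_betw (\<lambda>i. proj_pt (vec3 ix5 (vecsQ ! i))) {..<40} Q43_points"
  "i < 40 \<Longrightarrow> j < 40 \<Longrightarrow> Q43_coll (proj_pt (vec3 ix5 (vecsQ ! i))) (proj_pt (vec3 ix5 (vecsQ ! j))) \<longleftrightarrow> j \<in> set (nbs linesQ i)"
proof -
  have mem: "vecsQ ! i \<in> set vecsQ" if "i < 40" for i
    using that vecsQ_table(3) by simp
  have len: "length (vecsQ ! i) = 5" if "i < 40" for i
    using mem[OF that] vecsQ_table(1) unfolding list_all_iff by blast
  have sing: "quad3 (vec3 ix5 (vecsQ ! i)) = 0" if "i < 40" for i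
    unfolding quad3_vec3[OF len[OF that]] of_nat_3_eq_0 using mem[OF that] vecsQ_table(6) unfolding list_all_iff by blast
  have pt: "proj_pt (vec3 ix5 (vecsQ ! i)) \<in> Q43_points" if "i < 40" for i
  proof -
    have "proj_pt (vec3 ix5 (vecsQ ! i)) \<in> proj_points"
      by (rule vec3_nonzero[OF ix5_bij]) (use mem[OF that] vecsQ_table(1,5) in \<open>unfold list_all_iff set_lists3, blast\<close>)+
    then show ?thesis
      unfolding Q43_points_def using sing[OF that] by (auto simp: proj_pt_def quad3_smul)
  qed
  show bij: "bij_betw (\<lambda>i. proj_pt (vec3 ix5 (vecsQ ! i))) {..<40} Q43_points"
  proof (rule proj_table_bij[OF ix5_bij vecsQ_table(1-3) pt])
    show "Q43_points \<subseteq> proj_points"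
      by (auto simp: Q43_points_def)
    fix l :: "nat list" assume l: "l \<in> set (lists3 5)" "\<exists>x\<in>set l. x \<noteq> 0" "proj_pt (vec3 ix5 l) \<in> Q43_points"
    have "quad3 (vec3 ix5 l) = 0"
      using l(3) proj_pt_self unfolding Q43_points_def by blast
    moreover have "length l = 5"
      using l(1) by (simp add: set_lists3)
    ultimately have "quadl l mod 3 = 0"
      by (simp only: quad3_vec3 of_nat_3_eq_0)
    then show "l \<in> set vecsQ \<or> l \<in> set (map dbl vecsQ)"
      using bspec[OF vecsQ_table(4)[unfolded list_all_iff[of _ "lists3 5"]] l(1)] l(2) by (auto simp: list_all_iff)
  qed
  assume ij: "i < 40" "j < 40"
  let ?x = "vec3 ix5 (vecsQ ! i)" and ?y = "vec3 ix5 (vecsQ ! j)"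
  have ne: "proj_pt ?x = proj_pt ?y \<longleftrightarrow> i = j"
    using bij ij by (auto simp: bij_betw_def inj_on_def)
  note s = sing[OF ij(1)] sing[OF ij(2)]
  have "(\<forall>x\<in>proj_pt ?x. \<forall>y\<in>proj_pt ?y. \<forall>a b. quad3 (\<lambda>i. a * x i + b * y i) = 0) \<longleftrightarrow> polar3 ?x ?y = 0"
  proof
    assume "\<forall>x\<in>proj_pt ?x. \<forall>y\<in>proj_pt ?y. \<forall>a b. quad3 (\<lambda>i. a * x i + b * y i) = 0"
    then have "quad3 (\<lambda>i. 1 * ?x i + 1 * ?y i) = 0"
      using proj_pt_self by blast
    then show "polar3 ?x ?y = 0"
      unfolding quad3_comb s by simp
  next
    assume "polar3 ?x ?y = 0"
    then show "\<forall>x\<in>proj_pt ?x. \<forall>y\<in>proj_pt ?y. \<forall>a b. quad3 (\<lambda>i. a * x i + b * y i) = 0"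
      unfolding quad3_comb proj_pt_def using s by (auto simp: quad3_smul polar3_smul)
  qed
  also have "polar3 ?x ?y = 0 \<longleftrightarrow> polarl (vecsQ ! i) (vecsQ ! j) mod 3 = 0"
    by (simp only: polar3_vec3[OF len[OF ij(1)] len[OF ij(2)]] of_nat_3_eq_0)
  finally show "Q43_coll (proj_pt ?x) (proj_pt ?y) \<longleftrightarrow> j \<in> set (nbs linesQ i)"
    by (simp only: Q43_coll_def form_table_entry[OF form_table_Q vecsQ_table(3) ij] ne pt[OF ij(1)] pt[OF ij(2)] simp_thms)
qed

lemma graph_iso_coords:
  assumes G: "simple_graph V adj" and iso: "graph_iso {v \<in> V. adj u v} adj P coll"
    and p: "bij_betw p {..<40} P" "\<And>i j. i < 40 \<Longrightarrow> j < 40 \<Longrightarrow> coll (p i) (p j) \<longleftrightarrow> j \<in> set (nbs L i)"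
  shows "\<exists>g. coords adj L u g"
proof -
  have N: "{v \<in> V. adj u v} = {v. adj u v}"
    using G by (auto simp: simple_graph_def)
  obtain f where f: "bij_betw f {v. adj u v} P" "\<And>x y. adj u x \<Longrightarrow> adj u y \<Longrightarrow> adj x y \<longleftrightarrow> coll (f x) (f y)"
    using iso unfolding graph_iso_def N by auto
  define g where "g = inv_into {v. adj u v} f \<circ> p"
  have b: "bij_betw g {..<40} {v. adj u v}"
    unfolding g_def by (rule bij_betw_trans[OF p(1) bij_betw_inv_into[OF f(1)]])
  have fg: "f (g i) = p i" if "i < 40" for i
    unfolding g_def using bij_betw_inv_into_right[OF f(1)] p(1) that by (auto simp: bij_betw_def)
  have "adj u (g i)" if "i < 40" for i
    using b that by (auto simp: bij_betw_def)
  then have "adj (g i) (g j) \<longleftrightarrow> j \<in> set (nbs L i)" if "i < 40" "j < 40" for i j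
    using f(2)[of "g i" "g j"] fg p(2) that by simp
  then show ?thesis
    unfolding coords_def using b by blast
qed


section \<open>W(3) in unitary coordinates over GF(4)\<close>

definition exps :: "nat list list" where
  "exps =
    [[0, 3, 3, 3], [3, 0, 3, 3], [3, 3, 0, 3], [3, 3, 3, 0], [3, 0, 0, 0], [3, 0, 1, 2], [3, 0, 2, 1], [3, 0,
     1, 1], [3, 0, 2, 0], [3, 0, 0, 2], [3, 0, 2, 2], [3, 0, 1, 0], [3, 0, 0, 1], [0, 3, 0, 0], [0, 3, 1, 1],
     [0, 3, 2, 2], [0, 0, 0, 3], [0, 1, 1, 3], [0, 2, 2, 3], [0, 0, 3, 0], [0, 1, 3, 1], [0, 2, 3, 2], [0, 3,
     1, 2], [0, 3, 2, 0], [0, 3, 0, 1], [0, 2, 0, 3], [0, 0, 1, 3], [0, 1, 2, 3], [0, 1, 3, 0], [0, 2, 3, 1],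
     [0, 0, 3, 2], [0, 3, 2, 1], [0, 3, 0, 2], [0, 3, 1, 0], [0, 1, 0, 3], [0, 2, 1, 3], [0, 0, 2, 3], [0, 2,
     3, 0], [0, 0, 3, 1], [0, 1, 3, 2]]"

text \<open>The table \<open>exps\<close> identifies W(3) with the nonisotropic points of a 4-dimensional unitary
  space over GF(4): an entry below 3 is the exponent of a primitive element, the entry 3 stands for
  the coordinate 0. The vertices 0, ..., 3 are the coordinate axes.\<close>

definition eqn :: "nat list \<Rightarrow> nat list \<Rightarrow> nat \<Rightarrow> nat \<Rightarrow> bool" where
  "eqn x y r s \<longleftrightarrow> (x ! r + y ! s) mod 3 = (x ! s + y ! r) mod 3"

text \<open>For \<open>x\<close> with three nonzero coordinates: the three terms of the product with
  \<open>t\<close> are pairwise distinct, that is, they are the three nonzero elements of GF(4) and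
  sum to 0.\<close>

definition pdt :: "nat list \<Rightarrow> nat list \<Rightarrow> bool" where
  "pdt x t \<longleftrightarrow> list_all (\<lambda>r. x ! r = 3 \<or> list_all (\<lambda>s. s \<le> r \<or> x ! s = 3 \<or> \<not> eqn x t r s) [0..<4]) [0..<4]"

text \<open>A vertex outside a 5-clique and adjacent to none of it projects, away from one member,
  to a vector with four nonzero entries. Scaled so that the first exponent is 0 there are 27 of
  them; the lists are the points orthogonal to each.\<close>

definition hyps :: "nat list list" where
  "hyps = map (\<lambda>t. filter (\<lambda>x. pdt (exps ! x) t) [4..<40]) (map (\<lambda>t. 0 # t) (lists3 3))"

definition rest :: "nat \<Rightarrow> nat list" where
  "rest p = filter (\<lambda>q. q \<noteq> p) [0, 1, 2, 3]"

text \<open>For points with the same vanishing coordinate: \<open>b\<close> is adjacency, a sum of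
  three distinct terms, and \<open>e\<close> is equality, which is forced by proportional
  coordinates.\<close>

fun same_axis :: "nat list \<Rightarrow> nat list \<Rightarrow> nat list \<Rightarrow> bool \<Rightarrow> bool \<Rightarrow> bool" where
  "same_axis x y [q, r, s] b e = (b = (\<not> eqn x y q r \<and> \<not> eqn x y q s \<and> \<not> eqn x y r s) \<and> (e \<or> \<not> eqn x y q r \<or> \<not> eqn x y q s))"
| "same_axis x y _ b e = False"

text \<open>For points with different vanishing coordinates just two common coordinates are nonzero,
  and orthogonality means that the two terms are equal.\<close>

definition other_axis :: "nat list \<Rightarrow> nat list \<Rightarrow> nat \<Rightarrow> bool \<Rightarrow> bool" where
  "other_axis x y p b \<longleftrightarrow> list_all (\<lambda>r. r = p \<or> y ! r = 3 \<or> list_all (\<lambda>s. s \<le> r \<or> s = p \<or> y ! s = 3 \<or> b = eqn x y r s) [0..<4]) [0..<4]"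

fun eqn_on :: "nat list \<Rightarrow> nat list \<Rightarrow> nat list \<Rightarrow> bool" where
  "eqn_on x y [q, r, s] = (eqn x y q r \<and> eqn x y q s)"
| "eqn_on x y _ = False"

lemma list_all_upt: "list_all P [a..<b] \<longleftrightarrow> (\<forall>i. a \<le> i \<longrightarrow> i < b \<longrightarrow> P i)"
  by (auto simp: list_all_iff)

lemma length_exps: "length exps = 40"
  by code_simp

lemma exps_zero: "list_all (\<lambda>p. let n = nbs linesW p in list_all (\<lambda>i. (i \<in> set n) = (exps ! i ! p = 3)) [4..<40]) [0..<4]"
  by code_simp

lemma exps_adj:
  "let E = drop 4 (enumerate 0 exps) in list_all (\<lambda>(i, x). let n = nbs linesW i in list_all (\<lambda>p. x ! p \<noteq> 3 \<or>
     list_all (\<lambda>(j, y). if y ! p = 3 then same_axis x y (rest p) (j \<in> set n) (i = j) else other_axis x y p (j \<in> set n)) E)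
     [0..<4]) E"
  by code_simp

lemma exps_surj:
  "list_all (\<lambda>p. let X = filter (\<lambda>x. x ! p = 3) (drop 4 exps) in
     list_all (\<lambda>l. list_ex (\<lambda>x. eqn_on x l (rest p)) X) (lists3 4)) [0..<4]"
  by code_simp

text \<open>With \<open>P\<close> the points collinear with both \<open>i'\<close> and
  \<open>j\<close>, the set listed is \<open>P\<close> together with the points collinear with all
  of \<open>P\<close>, restricted to indices from 4 on. A path with middle \<open>i\<close> whose
  ends lie on the axes 0 and 1 thus determines one of the sets in \<open>hyps\<close>.\<close>

lemma exps_hyperovals:
  "let H = hyps in list_all (\<lambda>i. exps ! i ! 0 \<noteq> 3 \<or> (let n = nbs linesW i in
     list_all (\<lambda>i'. i' < 4 \<or> exps ! i' ! 0 \<noteq> 3 \<or> (let n' = nbs linesW i' in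
     list_all (\<lambda>j. j < 4 \<or> exps ! j ! 1 \<noteq> 3 \<or> (let m = nbs linesW j;
        P = filter (\<lambda>p. p \<in> set m) n'; Ns = map (nbs linesW) P in
        filter (\<lambda>x. x \<in> set P \<or> list_all (\<lambda>N. x \<in> set N) Ns) [4..<40] \<in> set H)) n)) n)) [4..<40]"
  by code_simp

lemma eqn_iff: "eqn x y r s \<longleftrightarrow> (of_nat (x ! r) - of_nat (y ! r) :: 3) = of_nat (x ! s) - of_nat (y ! s)"
proof -
  have *: "(of_nat (a + d) :: 3) = of_nat (c + b) \<longleftrightarrow> (of_nat a - of_nat b :: 3) = of_nat c - of_nat d" for a b c d
    by (auto simp: algebra_simps)
  show ?thesis
    unfolding eqn_def of_nat_3_eq[symmetric] by (rule *)
qed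

lemma eqn_sym: "eqn x y r s \<longleftrightarrow> eqn x y s r"
  by (auto simp: eqn_def)

lemma rest_eq:
  assumes "p < 4" "q < 4" "r < 4" "s < 4" "distinct [p, q, r, s]"
  obtains a b c where "rest p = [a, b, c]" "distinct [a, b, c]" "q \<in> {a, b, c}" "r \<in> {a, b, c}" "s \<in> {a, b, c}"
proof -
  have ne: "q \<noteq> p" "r \<noteq> p" "s \<noteq> p"
    using assms(5) by auto
  have "\<exists>a b c. rest p = [a, b, c] \<and> distinct [a, b, c] \<and> (\<forall>x<4. x \<noteq> p \<longrightarrow> x \<in> {a, b, c})"
  proof -
    have "p = 0 \<or> p = 1 \<or> p = 2 \<or> p = 3"
      using assms(1) by auto
    then show ?thesis
      by (elim disjE) (auto simp: rest_def)
  qed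
  then show ?thesis
    using that ne assms(2-4) by blast
qed

text \<open>The tables are checked only for the order of coordinates in \<open>rest p\<close>; this
  makes the conditions independent of that order.\<close>

lemma perm3:
  assumes "q \<in> {a, b, c}" "r \<in> {a, b, c}" "s \<in> {a, b, c}" "distinct [q, r, s]"
  shows "D a \<noteq> D b \<and> D a \<noteq> D c \<and> D b \<noteq> D c \<longleftrightarrow> D q \<noteq> D r \<and> D q \<noteq> D s \<and> D r \<noteq> D s"
    "D q = D r \<and> D q = D s \<longleftrightarrow> D a = D b \<and> D a = D c"
proof -
  have "q = a \<or> q = b \<or> q = c" "r = a \<or> r = b \<or> r = c" "s = a \<or> s = b \<or> s = c" "q \<noteq> r" "q \<noteq> s" "r \<noteq> s"
    using assms by auto
  then show "D a \<noteq> D b \<and> D a \<noteq> D c \<and> D b \<noteq> D c \<longleftrightarrow> D q \<noteq> D r \<and> D q \<noteq> D s \<and> D r \<noteq> D s"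
    "D q = D r \<and> D q = D s \<longleftrightarrow> D a = D b \<and> D a = D c"
    by (elim disjE; metis)+
qed

lemma exps_pair:
  assumes i: "4 \<le> i" "i < 40" and j: "4 \<le> j" "j < 40" and p: "p < 4" "exps ! i ! p = 3"
  shows "if exps ! j ! p = 3 then same_axis (exps ! i) (exps ! j) (rest p) (j \<in> set (nbs linesW i)) (i = j)
    else other_axis (exps ! i) (exps ! j) p (j \<in> set (nbs linesW i))"
proof -
  have mem: "(k, exps ! k) \<in> set (drop 4 (enumerate 0 exps))" if "4 \<le> k" "k < 40" for k
  proof -
    have "drop 4 (enumerate 0 exps) ! (k - 4) = (k, exps ! k)" "k - 4 < length (drop 4 (enumerate 0 exps))"
      using that length_exps by (simp_all add: nth_enumerate_eq)
    then show ?thesis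
      using nth_mem by metis
  qed
  have "list_all (\<lambda>p. exps ! i ! p \<noteq> 3 \<or> list_all (\<lambda>(j, y). if y ! p = 3 then same_axis (exps ! i) y (rest p) (j \<in> set (nbs linesW i)) (i = j)
      else other_axis (exps ! i) y p (j \<in> set (nbs linesW i))) (drop 4 (enumerate 0 exps))) [0..<4]"
    using bspec[OF exps_adj[unfolded Let_def, THEN list_all_iff[THEN iffD1]] mem[OF i]] unfolding prod.case .
  then have "list_all (\<lambda>(j, y). if y ! p = 3 then same_axis (exps ! i) y (rest p) (j \<in> set (nbs linesW i)) (i = j)
      else other_axis (exps ! i) y p (j \<in> set (nbs linesW i))) (drop 4 (enumerate 0 exps))"
    unfolding list_all_upt using p le0 by blast
  from bspec[OF this[THEN list_all_iff[THEN iffD1]] mem[OF j]] show ?thesis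
    unfolding prod.case .
qed

lemma exps_same:
  assumes i: "4 \<le> i" "i < 40" and j: "4 \<le> j" "j < 40" and p: "p < 4" "exps ! i ! p = 3" "exps ! j ! p = 3"
    and q: "q < 4" "r < 4" "s < 4" "distinct [p, q, r, s]"
  shows "j \<in> set (nbs linesW i) \<longleftrightarrow> \<not> eqn (exps ! i) (exps ! j) q r \<and> \<not> eqn (exps ! i) (exps ! j) q s \<and> \<not> eqn (exps ! i) (exps ! j) r s"
    "eqn (exps ! i) (exps ! j) q r \<Longrightarrow> eqn (exps ! i) (exps ! j) q s \<Longrightarrow> i = j"
proof -
  obtain a b c where abc: "rest p = [a, b, c]" "distinct [a, b, c]" "q \<in> {a, b, c}" "r \<in> {a, b, c}" "s \<in> {a, b, c}"
    using rest_eq[OF p(1) q] by blast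
  have d: "distinct [q, r, s]"
    using q(4) by auto
  have "same_axis (exps ! i) (exps ! j) [a, b, c] (j \<in> set (nbs linesW i)) (i = j)"
    using exps_pair[OF i j p(1,2)] p(3) abc(1) by simp
  then have *: "(j \<in> set (nbs linesW i)) = (\<not> eqn (exps ! i) (exps ! j) a b \<and> \<not> eqn (exps ! i) (exps ! j) a c \<and> \<not> eqn (exps ! i) (exps ! j) b c)"
    "i = j \<or> \<not> (eqn (exps ! i) (exps ! j) a b \<and> eqn (exps ! i) (exps ! j) a c)"
    unfolding same_axis.simps by blast+
  show "j \<in> set (nbs linesW i) \<longleftrightarrow> \<not> eqn (exps ! i) (exps ! j) q r \<and> \<not> eqn (exps ! i) (exps ! j) q s \<and> \<not> eqn (exps ! i) (exps ! j) r s"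
    unfolding *(1) eqn_iff by (rule perm3(1)[OF abc(3-5) d])
  show "eqn (exps ! i) (exps ! j) q r \<Longrightarrow> eqn (exps ! i) (exps ! j) q s \<Longrightarrow> i = j"
    using *(2) unfolding eqn_iff
    using perm3(2)[OF abc(3-5) d, of "\<lambda>r. of_nat (exps ! i ! r) - of_nat (exps ! j ! r) :: 3"] by blast
qed

lemma exps_other:
  assumes i: "4 \<le> i" "i < 40" and j: "4 \<le> j" "j < 40" and p: "p < 4" "exps ! i ! p = 3" "exps ! j ! p \<noteq> 3"
    and r: "r < 4" "s < 4" "exps ! j ! r \<noteq> 3" "exps ! j ! s \<noteq> 3" "distinct [p, r, s]"
  shows "j \<in> set (nbs linesW i) \<longleftrightarrow> eqn (exps ! i) (exps ! j) r s"
proof -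
  have oa: "other_axis (exps ! i) (exps ! j) p (j \<in> set (nbs linesW i))"
    using exps_pair[OF i j p(1,2)] p(3) by simp
  have *: "j \<in> set (nbs linesW i) \<longleftrightarrow> eqn (exps ! i) (exps ! j) r s"
    if "r < 4" "s < 4" "exps ! j ! r \<noteq> 3" "exps ! j ! s \<noteq> 3" "r \<noteq> p" "s \<noteq> p" "\<not> s \<le> r" for r s
    using oa that le0 unfolding other_axis_def list_all_upt by blast
  have "r \<noteq> p" "s \<noteq> p" "\<not> s \<le> r \<or> \<not> r \<le> s"
    using r(5) by auto
  then show ?thesis
    using *[of r s] *[of s r] r eqn_sym by blast
qed

lemma exps_ex:
  assumes l: "l \<in> set (lists3 4)" and p: "p < 4"
  shows "\<exists>i. 4 \<le> i \<and> i < 40 \<and> exps ! i ! p = 3 \<and>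
    (\<forall>q r s. q < 4 \<longrightarrow> r < 4 \<longrightarrow> s < 4 \<longrightarrow> distinct [p, q, r, s] \<longrightarrow> eqn (exps ! i) l q r \<and> eqn (exps ! i) l q s)"
proof -
  have "list_all (\<lambda>l. list_ex (\<lambda>x. eqn_on x l (rest p)) (filter (\<lambda>x. x ! p = 3) (drop 4 exps))) (lists3 4)"
    using exps_surj p le0 unfolding Let_def list_all_upt by blast
  from bspec[OF this[THEN list_all_iff[THEN iffD1]] l]
  obtain x where x: "x \<in> set (drop 4 exps)" "x ! p = 3" "eqn_on x l (rest p)"
    unfolding list_ex_iff set_filter by blast
  obtain k where k: "k < length (drop 4 exps)" "x = drop 4 exps ! k"
    using x(1) unfolding in_set_conv_nth by blast
  have i: "4 \<le> 4 + k" "4 + k < 40" "x = exps ! (4 + k)"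
    using k length_exps by simp_all
  have "eqn x l q r \<and> eqn x l q s" if q: "q < 4" "r < 4" "s < 4" "distinct [p, q, r, s]" for q r s
  proof -
    obtain a b c where abc: "rest p = [a, b, c]" "q \<in> {a, b, c}" "r \<in> {a, b, c}" "s \<in> {a, b, c}"
      by (rule rest_eq[OF p q])
    have d: "distinct [q, r, s]"
      using q(4) by auto
    have e: "eqn x l a b \<and> eqn x l a c"
      using x(3) unfolding abc(1) eqn_on.simps .
    show ?thesis
      using e unfolding eqn_iff
      by (rule perm3(2)[OF abc(2-4) d, of "\<lambda>r. of_nat (x ! r) - of_nat (l ! r) :: 3", THEN iffD2])
  qed
  then show ?thesis
    using i(1,2) x(2) unfolding i(3) by (intro exI[of _ "4 + k"]) simp
qed

lemma exps_hyperoval_ex: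
  assumes i: "4 \<le> i" "i < 40" "exps ! i ! 0 = 3" and i': "i' \<in> set (nbs linesW i)" "4 \<le> i'" "exps ! i' ! 0 = 3"
    and j: "j \<in> set (nbs linesW i)" "4 \<le> j" "exps ! j ! 1 = 3"
  shows "\<exists>t. \<forall>x. 4 \<le> x \<longrightarrow> x < 40 \<longrightarrow> (pdt (exps ! x) t \<longleftrightarrow> x \<in> set (nbs linesW i') \<and> x \<in> set (nbs linesW j) \<or>
    (\<forall>p. p \<in> set (nbs linesW i') \<longrightarrow> p \<in> set (nbs linesW j) \<longrightarrow> p \<in> set (nbs linesW x)))"
proof -
  define P where "P = filter (\<lambda>p. p \<in> set (nbs linesW j)) (nbs linesW i')"
  have "list_all (\<lambda>i'. i' < 4 \<or> exps ! i' ! 0 \<noteq> 3 \<or>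
     list_all (\<lambda>j. j < 4 \<or> exps ! j ! 1 \<noteq> 3 \<or> filter (\<lambda>x. x \<in> set (filter (\<lambda>p. p \<in> set (nbs linesW j)) (nbs linesW i')) \<or>
        list_all (\<lambda>N. x \<in> set N) (map (nbs linesW) (filter (\<lambda>p. p \<in> set (nbs linesW j)) (nbs linesW i')))) [4..<40] \<in> set hyps)
       (nbs linesW i)) (nbs linesW i)"
    using exps_hyperovals i unfolding Let_def list_all_upt[of _ 4 40] by blast
  from bspec[OF this[THEN list_all_iff[THEN iffD1]] i'(1)] i'(2,3)
  have "list_all (\<lambda>j. j < 4 \<or> exps ! j ! 1 \<noteq> 3 \<or> filter (\<lambda>x. x \<in> set (filter (\<lambda>p. p \<in> set (nbs linesW j)) (nbs linesW i')) \<or>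
        list_all (\<lambda>N. x \<in> set N) (map (nbs linesW) (filter (\<lambda>p. p \<in> set (nbs linesW j)) (nbs linesW i')))) [4..<40] \<in> set hyps)
       (nbs linesW i)"
    unfolding not_less[symmetric] by blast
  from bspec[OF this[THEN list_all_iff[THEN iffD1]] j(1)] j(2,3)
  have "filter (\<lambda>x. x \<in> set P \<or> list_all (\<lambda>N. x \<in> set N) (map (nbs linesW) P)) [4..<40] \<in> set hyps"
    unfolding not_less[symmetric] P_def by blast
  then obtain t where "filter (\<lambda>x. x \<in> set P \<or> list_all (\<lambda>N. x \<in> set N) (map (nbs linesW) P)) [4..<40] = filter (\<lambda>x. pdt (exps ! x) t) [4..<40]"
    unfolding hyps_def set_map by blast
  then have "set (filter (\<lambda>x. x \<in> set P \<or> list_all (\<lambda>N. x \<in> set N) (map (nbs linesW) P)) [4..<40]) = set (filter (\<lambda>x. pdt (exps ! x) t) [4..<40])"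
    by (rule arg_cong)
  then have PQ: "pdt (exps ! a) t \<longleftrightarrow> a \<in> set P \<or> list_all (\<lambda>N. a \<in> set N) (map (nbs linesW) P)" if "4 \<le> a" "a < 40" for a
    using that unfolding set_filter set_upt set_eq_iff mem_Collect_eq atLeastLessThan_iff by blast
  have P: "p \<in> set P \<longleftrightarrow> p \<in> set (nbs linesW i') \<and> p \<in> set (nbs linesW j)" for p
    unfolding P_def set_filter by blast
  have "list_all (\<lambda>N. a \<in> set N) (map (nbs linesW) P) \<longleftrightarrow>
      (\<forall>p. p \<in> set (nbs linesW i') \<longrightarrow> p \<in> set (nbs linesW j) \<longrightarrow> p \<in> set (nbs linesW a))" for a
    unfolding list_all_iff set_map P nbs_sym[of _ _ a] by (auto simp: P)
  then show ?thesis
    using PQ P by blast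
qed


section \<open>Common neighbourhoods when every vertex has type W(3)\<close>

locale locally_W3 = locally_gq +
  assumes all_W: "u \<in> V \<Longrightarrow> has_type u linesW" and conn: "connected_graph V adj"
begin

lemma adj_type_W: "adj u v \<Longrightarrow> has_type u linesW"
  using all_W adj_V by blast

lemma bip:
  assumes "u \<noteq> w" "\<not> adj u w" "adj u a" "adj w a" "adj u b" "adj w b" "adj u c" "adj w c" "adj a b" "\<not> adj a c" "a \<noteq> c"
  shows "adj b c"
  by (rule complete_bipartite_common[OF adj_type_W[OF assms(3)] assms])

lemma triangle_nbrs:
  assumes "adj u v" "adj u d" "adj v d" "adj u x" "adj v x" "adj d x" "adj u y" "adj v y" "adj d y" "x \<noteq> y"
  shows "adj x y"
proof -
  obtain e f where "clique5 u v d e f" "\<forall>x. adj u x \<longrightarrow> adj v x \<longrightarrow> adj d x \<longrightarrow> x = e \<or> x = f"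
    using triangle_common[OF assms(1-3)] by blast
  then have "adj e f" "x = e \<or> x = f" "y = e \<or> y = f"
    using assms by (auto simp: clique5_def)
  then show ?thesis
    using assms(10) adj_sym by blast
qed

lemma cover:
  assumes uw: "u \<noteq> w" "\<not> adj u w" and a: "adj u a" "adj w a" and y: "adj u y"
  shows "\<exists>z. adj u z \<and> adj w z \<and> (z = y \<or> adj z y)"
proof -
  have L: "has_type u linesW"
    using adj_type_W a by blast
  obtain g where g: "coords adj linesW u g" "g 0 = a"
    using coords_base[OF L a(1)] by blast
  obtain i where i: "i < 40" "y = g i"
    using coordsD(4)[OF g(1) y] by blast
  have w0: "adj w (g 0)"
    using a g by simp
  have h: "hyperoval linesW (\<lambda>n. adj w (g n))"
    by (rule hyperoval_common[OF g(1) has_type_form[OF L] uw])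
  have k: "kbase linesW (\<lambda>n. adj w (g n))"
    by (rule kbase_table_W[OF h w0 pcond_common[OF g(1) L uw w0]])
  show ?thesis
  proof (cases "adj w y")
    case False
    then obtain z where z: "z \<in> set (nbs linesW i)" "adj w (g z)"
      using cover_table_W[OF h w0 k i(1)] i(2) by blast
    have "z < 40"
      using nbs_lt[OF has_type_form[OF L] z(1)] .
    then show ?thesis
      using z coordsD(1)[OF g(1)] coordsD(2)[OF g(1) i(1)] i(2) adj_sym by blast
  qed (use y in blast)
qed

text \<open>The diameter is at most two. Along a path, \<open>cover\<close> applied to the last
  vertex and \<open>u\<close> replaces its common neighbour with \<open>u\<close> by one that is
  equal or adjacent to the next vertex.\<close>

lemma common_nbr:
  assumes "u \<in> V" "w \<in> V" "u \<noteq> w" "\<not> adj u w"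
  shows "\<exists>a. adj u a \<and> adj w a"
proof -
  have "x = u \<or> adj u x \<or> (\<exists>a. adj u a \<and> adj x a)" if "adj\<^sup>*\<^sup>* u x" for x
    using that
  proof induction
    case (step y z)
    then consider "adj u z \<or> z = u \<or> adj u y" | "y \<noteq> u" "\<not> adj y u" "\<exists>a. adj y a \<and> adj u a"
      using adj_sym by blast
    then show ?case
    proof cases
      case 1
      then show ?thesis using step.hyps(2) adj_sym by blast
    next
      case 2
      then obtain t where "adj y t" "adj u t" "t = z \<or> adj t z"
        using cover[of y u _ z] step.hyps(2) by blast
      then show ?thesis using adj_sym by blast
    qed
  qed simp
  then show ?thesis
    using conn assms unfolding connected_graph_def by blast
qed

text \<open>The nonadjacent pair \<open>i'\<close>, \<open>j\<close> lies on one side of the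
  bipartite graph; the claim is that all points seeing both lie on the other side.\<close>

lemma common_span:
  assumes uw: "u \<noteq> w" "\<not> adj u w" and i: "adj u i" "adj w i" and i': "adj u i'" "adj w i'" and j: "adj u j" "adj w j"
    and a: "adj i i'" "adj i j" "\<not> adj i' j" "i' \<noteq> j" and p: "adj u p" "adj p i'" "adj p j"
  shows "adj w p"
proof (rule ccontr)
  assume np: "\<not> adj w p"
  have ip: "adj i' p"
    using p adj_sym by blast
  \<comment> \<open>If \<open>w\<close> missed \<open>p\<close>, then of the 5-clique on
    \<open>u\<close>, \<open>i'\<close>, \<open>p\<close> it would see \<open>i'\<close> and exactly
    one more vertex \<open>s\<close>. Each position of \<open>s\<close> relative to \<open>i\<close>
    produces an impossible triangle.\<close>
  obtain e f where ef: "clique5 u i' p e f"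
    using triangle_common[OF i'(1) p(1) ip] by blast
  have ne: "w \<noteq> u" "w \<noteq> p" "w \<noteq> e" "w \<noteq> f"
    using uw ef by (auto simp: clique5_def)
  have "adj w e \<or> adj w f"
    using clique5_nbr[OF clique5_perm(1)[OF ef] i'(2) ne] np uw(2) adj_sym by blast
  then obtain s where s: "adj w s" "adj u s" "adj i' s" "adj p s"
    using ef unfolding clique5_def by blast
  have tri: False if "adj u t" "adj t p" "adj i' t" "adj j t" for t
    using triangle_nbrs[of u t p i' j] that i' j p a adj_sym by blast
  consider "s = i" | "s \<noteq> i" "adj i s" | "s \<noteq> i" "\<not> adj i s" by blast
  then show False
  proof cases
    case 1
    then show ?thesis using tri[of i] s a adj_sym i(1) by blast
  next
    case 2
    then show ?thesis
      using triangle_nbrs[of i i' s u w] s i i' a uw adj_sym by blast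
  next
    case 3
    then have "adj j s"
      using bip[OF uw i j s(2,1) a(2)] by blast
    then show ?thesis
      using tri[of s] s adj_sym by blast
  qed
qed

text \<open>A path of three vertices determines the whole hyperoval: one side is the set of points
  seeing \<open>i'\<close> and \<open>j\<close>, the other the set of points seeing that whole
  side.\<close>

lemma common_determined:
  assumes uw: "u \<noteq> w" "\<not> adj u w" and i: "adj u i" "adj w i" and i': "adj u i'" "adj w i'" and j: "adj u j" "adj w j"
    and a: "adj i i'" "adj i j" "\<not> adj i' j" "i' \<noteq> j" and x: "adj u x"
  shows "adj w x \<longleftrightarrow> adj x i' \<and> adj x j \<or> (\<forall>p. adj u p \<longrightarrow> adj p i' \<longrightarrow> adj p j \<longrightarrow> adj x p)"
proof
  assume wx: "adj w x"
  consider "x = i" | "x \<noteq> i" "\<not> adj i x" | "adj i x" by blast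
  then show "adj x i' \<and> adj x j \<or> (\<forall>p. adj u p \<longrightarrow> adj p i' \<longrightarrow> adj p j \<longrightarrow> adj x p)"
  proof cases
    case 2
    then show ?thesis
      using bip[OF uw i i' x wx a(1)] bip[OF uw i j x wx a(2)] adj_sym by blast
  next
    case 3
    have "adj x p" if p: "adj u p" "adj p i'" "adj p j" for p
    proof (cases "x = i'")
      case False
      have "\<not> adj i' x"
        using triangle_nbrs[of i i' x u w] 3 i i' x wx a uw adj_sym by blast
      then show ?thesis
        using bip[OF uw i' p(1) common_span[OF uw i i' j a p] x wx] False p(2) adj_sym by blast
    qed (use p adj_sym in blast)
    then show ?thesis by blast
  qed (use a in blast)
next
  assume "adj x i' \<and> adj x j \<or> (\<forall>p. adj u p \<longrightarrow> adj p i' \<longrightarrow> adj p j \<longrightarrow> adj x p)"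
  then show "adj w x"
  proof
    assume "adj x i' \<and> adj x j"
    then show ?thesis using common_span[OF uw i i' j a x] by blast
  next
    assume q: "\<forall>p. adj u p \<longrightarrow> adj p i' \<longrightarrow> adj p j \<longrightarrow> adj x p"
    \<comment> \<open>The cardinality four supplies a second vertex \<open>p\<close> of the side of
      \<open>i\<close>. Then \<open>common_span\<close> applies with the sides exchanged, to the
      pair \<open>i\<close>, \<open>p\<close>.\<close>
    have "card {z. adj u z \<and> adj i' z \<and> adj j z} = 4"
      by (rule card_common[OF i(1) i'(1) a(1) j(1) a(2-4)])
    moreover have "card {i} = 1" by simp
    ultimately have "\<not> {z. adj u z \<and> adj i' z \<and> adj j z} \<subseteq> {i}"
      using card_mono[of "{i}" "{z. adj u z \<and> adj i' z \<and> adj j z}"] by auto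
    then obtain p where p: "adj u p" "adj i' p" "adj j p" "p \<noteq> i" by blast
    have "\<not> adj i p"
      using triangle_nbrs[of u i p i' j] p i i' j a adj_sym by blast
    moreover have pw: "adj w p"
      using common_span[OF uw i i' j a p(1)] p adj_sym by blast
    moreover have "adj x i" "adj x p"
      using q i(1) a p adj_sym by blast+
    ultimately show ?thesis
      using common_span[OF uw i' i p(1) pw, of x] a(1) p x adj_sym by blast
  qed
qed

end


section \<open>Orthogonal frames and the vertices outside them\<close>

lemma ex_other3: "\<exists>m::5. m \<noteq> a \<and> m \<noteq> b \<and> m \<noteq> c"
proof (rule ccontr)
  assume "\<not> ?thesis"
  then have "UNIV \<subseteq> {a, b, c}" by blast
  then have "card (UNIV :: 5 set) \<le> card {a, b, c}"
    by (intro card_mono) auto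
  also have "\<dots> \<le> 3"
    by (simp add: card_insert_if)
  finally show False by simp
qed

lemma ex_rest3:
  assumes "(m::5) \<noteq> n"
  shows "\<exists>k l p. distinct [m, n, k, l, p]"
proof -
  have "card (UNIV - {m, n}) = 3"
    using assms by (simp add: card_Diff_subset)
  then obtain k l p where S: "UNIV - {m, n} = {k, l, p}" and ne: "k \<noteq> l" "l \<noteq> p" "k \<noteq> p"
    by (auto simp: card_3_iff)
  have "k \<in> UNIV - {m, n}" "l \<in> UNIV - {m, n}" "p \<in> UNIV - {m, n}"
    unfolding S by simp_all
  then have "distinct [m, n, k, l, p]"
    using assms ne by auto
  then show ?thesis by blast
qed

lemma five_exhaust:
  assumes "distinct [m, n, k, l, p :: 5]"
  shows "i = m \<or> i = n \<or> i = k \<or> i = l \<or> i = p"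
proof -
  have "card {m, n, k, l, p} = card (UNIV :: 5 set)"
    using assms by simp
  then have "{m, n, k, l, p} = UNIV"
    by (intro card_subset_eq) auto
  then show ?thesis by blast
qed


text \<open>The index type \<open>5\<close> is also the coordinate type of the unitary space;
  \<open>fr i\<close> will become the unit vector of the coordinate \<open>i\<close>.\<close>

locale frame = locally_W3 +
  fixes fr :: "5 \<Rightarrow> 'a"
  assumes frame: "i \<noteq> j \<Longrightarrow> adj (fr i) (fr j)"
begin

text \<open>These vertices will have vanishing coordinates exactly at \<open>m\<close> and
  \<open>n\<close>, and the vertices in \<open>generic\<close> will have none.\<close>

definition A :: "5 \<Rightarrow> 5 \<Rightarrow> 'a set" where
  "A m n = {x. x \<notin> range fr \<and> adj x (fr m) \<and> adj x (fr n)}"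

definition generic :: "'a set" where
  "generic = {w \<in> V. w \<notin> range fr \<and> (\<forall>i. \<not> adj w (fr i))}"

lemma A_sym: "A m n = A n m"
  by (auto simp: A_def)

lemma fr_V: "fr i \<in> V"
proof -
  obtain j where "j \<noteq> i"
    using ex_other3[of i i i] by metis
  then have "adj (fr i) (fr j)"
    by (intro frame) simp
  then show ?thesis
    by (rule adj_V)
qed

lemma fr_inj: "fr i = fr j \<longleftrightarrow> i = j"
  using frame[of i j] adj_ne by blast

lemma frame_clique: "distinct [m, n, k, l, p] \<Longrightarrow> clique5 (fr m) (fr n) (fr k) (fr l) (fr p)"
  unfolding clique5_def using frame by auto

lemma A_adj:
  assumes "m \<noteq> n" "x \<in> A m n"
  shows "adj x (fr i) \<longleftrightarrow> i = m \<or> i = n"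
proof -
  obtain k l p where d: "distinct [m, n, k, l, p]"
    using ex_rest3[OF assms(1)] by blast
  have x: "x \<noteq> fr j" "adj x (fr m)" "adj x (fr n)" for j
    using assms(2) by (auto simp: A_def)
  have "\<not> adj x (fr k)" "\<not> adj x (fr l)" "\<not> adj x (fr p)"
    using clique5_nbr[OF frame_clique[OF d] x(2) x(1) x(1) x(1) x(1)] x(3) by blast+
  then show ?thesis
    using five_exhaust[OF d, of i] x by blast
qed

lemma vertex_cases:
  assumes "v \<in> V"
  shows "v \<in> range fr \<or> (\<exists>m n. m \<noteq> n \<and> v \<in> A m n) \<or> v \<in> generic"
proof (cases "v \<in> range fr \<or> v \<in> generic")
  case False
  then obtain m where m: "adj v (fr m)" "v \<notin> range fr"
    using assms unfolding generic_def by blast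
  obtain n where "m \<noteq> n"
    using ex_other3 by metis
  then obtain k l p where d: "distinct [m, n, k, l, p]"
    using ex_rest3 by blast
  have ne: "v \<noteq> fr j" for j
    using m(2) by blast
  have "adj v (fr n) \<or> adj v (fr k) \<or> adj v (fr l) \<or> adj v (fr p)"
    using clique5_nbr[OF frame_clique[OF d] m(1) ne ne ne ne] by blast
  then show ?thesis
    using d m unfolding A_def by auto
qed blast

text \<open>If \<open>x\<close> and \<open>y\<close> were adjacent, then \<open>fr m\<close>,
  \<open>fr n\<close> and \<open>y\<close> would be common neighbours of \<open>x\<close> and
  \<open>fr k\<close> violating \<open>bip\<close>. In coordinates: only one common coordinate is
  nonzero, so the product is a single nonzero term.\<close>

lemma A_disjoint_nonadj:
  assumes d: "distinct [m, n, k, l]" and x: "x \<in> A m n" and y: "y \<in> A k l"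
  shows "\<not> adj x y"
proof
  assume xy: "adj x y"
  have mn: "m \<noteq> n" "k \<noteq> l" "k \<noteq> m" "k \<noteq> n" "m \<noteq> k" "m \<noteq> l" "n \<noteq> k" "n \<noteq> l"
    using d by auto
  note ax = A_adj[OF mn(1) x] and ay = A_adj[OF mn(2) y]
  have "x \<noteq> fr k" "fr m \<noteq> y"
    using x y by (auto simp: A_def)
  moreover have "\<not> adj x (fr k)" "adj x (fr m)" "adj x (fr n)" "adj (fr k) y" "\<not> adj (fr m) y"
    using ax ay mn adj_sym by metis+
  ultimately have "adj (fr n) y"
    using bip[of x "fr k" "fr m" "fr n" y] frame mn xy by blast
  then show False
    using ay mn adj_sym by blast
qed

text \<open>The three vertices are nonzero at the same two further coordinates, and adjacency will
  mean equal ratios there. This is the transitivity of that relation, proved from \<open>bip\<close>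
  for \<open>x\<close> and \<open>fr p\<close>.\<close>

lemma star:
  assumes d: "distinct [m, n, p]" and x: "x \<in> A m n" and y: "y \<in> A m p" and z: "z \<in> A n p" and a: "adj x y" "adj x z"
  shows "adj y z"
proof -
  have mn: "m \<noteq> n" "m \<noteq> p" "n \<noteq> p" "p \<noteq> m" "p \<noteq> n" "n \<noteq> m"
    using d by auto
  note ax = A_adj[OF mn(1) x] and ay = A_adj[OF mn(2) y] and az = A_adj[OF mn(3) z]
  have "x \<noteq> fr p" "fr n \<noteq> y"
    using x y by (auto simp: A_def)
  moreover have "\<not> adj x (fr p)" "adj x (fr n)" "adj (fr p) z" "adj (fr p) y" "adj (fr n) z" "\<not> adj (fr n) y"
    using ax ay az mn adj_sym by metis+
  ultimately have "adj z y"
    using bip[of x "fr p" "fr n" z y] frame mn a by blast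
  then show ?thesis
    using adj_sym by blast
qed

lemma generic_ex: "generic \<noteq> {}"
proof -
  obtain k l p :: 5 where d: "distinct [0, 1, k, l, p]"
    using ex_rest3[of 0 1] by auto
  define m n :: 5 where "m = 0" and "n = 1"
  have mn: "m \<noteq> n" "m \<noteq> k" "n \<noteq> k"
    using d by (auto simp: m_def n_def)
  obtain g where g: "coords adj linesW (fr m) g" "g 0 = fr n" "g 1 = fr k"
    using coords_edge[OF all_W[OF fr_V] frame[OF mn(1)] frame[OF mn(2)] frame[OF mn(3)]] by blast
  note W = all_W[OF fr_V[of m]]
  define x where "x = g 4"
  have "4 \<in> set (nbs linesW 0)"
    unfolding has_type_nbs0(1)[OF W] by simp
  moreover have "4 \<notin> set (nbs linesW 0) \<inter> set (nbs linesW 1)"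
    unfolding has_type_nbs0(2)[OF W] by simp
  ultimately have x: "adj (fr m) x" "adj (fr n) x" "\<not> adj (fr k) x" "x \<noteq> fr k"
    unfolding x_def using coordsD(1)[OF g(1), of 4] coordsD(2)[OF g(1), of 0 4] coordsD(2)[OF g(1), of 1 4]
      coordsD(3)[OF g(1), of 4 1] g by auto
  have xA: "x \<in> A m n"
    unfolding A_def
  proof (intro CollectI conjI notI)
    assume "x \<in> range fr"
    then obtain i where "x = fr i" by blast
    then show False
      using x(3,4) frame[of k i] by blast
  qed (use x adj_sym in blast)+
  \<comment> \<open>From the 5-clique on \<open>x\<close>, \<open>fr m\<close>, \<open>fr n\<close>
    one passes to a vertex \<open>v\<close> that sees \<open>x\<close> and \<open>y\<close> but
    neither frame vertex. If \<open>v\<close> saw any frame vertices they would be two others, which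
    \<open>A_disjoint_nonadj\<close> forbids.\<close>
  obtain y y' where y: "clique5 x (fr m) (fr n) y y'"
    using triangle_common[of x "fr m" "fr n"] x frame[OF mn(1)] adj_sym by blast
  have y': "adj x y" "adj y (fr m)" "adj y (fr n)"
    using y by (auto simp: clique5_def adj_sym)
  have Wx: "has_type x linesW"
    using adj_type_W y' by blast
  obtain h where h: "coords adj linesW x h" "h 0 = y" "h 1 = fr m"
    using coords_edge[OF Wx y'(1) _ y'(2)] x adj_sym by blast
  define v where "v = h 4"
  have "4 \<in> set (nbs linesW 0)"
    unfolding has_type_nbs0(1)[OF Wx] by simp
  moreover have "4 \<notin> set (nbs linesW 0) \<inter> set (nbs linesW 1)"
    unfolding has_type_nbs0(2)[OF Wx] by simp
  ultimately have v: "adj x v" "adj y v" "\<not> adj (fr m) v" "v \<noteq> fr m"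
    unfolding v_def using coordsD(1)[OF h(1), of 4] coordsD(2)[OF h(1), of 0 4] coordsD(2)[OF h(1), of 1 4]
      coordsD(3)[OF h(1), of 4 1] h by auto
  have vn: "v \<noteq> fr n" "\<not> adj v (fr n)"
  proof -
    show "v \<noteq> fr n"
      using v frame[OF mn(1)] by auto
    then show "\<not> adj v (fr n)"
      using triangle_nbrs[of x y "fr n" v "fr m"] v y' x frame mn adj_sym by metis
  qed
  have vf: "v \<noteq> fr i" for i
    using A_adj[OF mn(1) xA, of i] v vn by metis
  have "v \<notin> A a b" if ab: "a \<noteq> b" for a b
  proof
    assume va: "v \<in> A a b"
    have "a \<noteq> m" "a \<noteq> n" "b \<noteq> m" "b \<noteq> n"
      using A_adj[OF ab va] v vn adj_sym by blast+
    then show False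
      using A_disjoint_nonadj[of m n a b x v] xA va ab mn v(1) by auto
  qed
  moreover have "v \<in> V"
    by (rule adj_V[of v x]) (use v(1) adj_sym in blast)
  ultimately have "v \<in> generic"
    using vertex_cases[of v] vf by blast
  then show ?thesis by blast
qed

end

section \<open>Exponents of coordinates around one frame vertex\<close>

text \<open>The exponent of the ratio of two coordinates. Projective points determine only these
  differences, so all statements about labels are phrased with \<open>dv\<close>.\<close>

definition dv :: "(5 \<Rightarrow> 3) \<Rightarrow> 5 \<Rightarrow> 5 \<Rightarrow> 3" where
  "dv a k l = a k - a l"

text \<open>The differences of \<open>a\<close> and \<open>b\<close> at \<open>k\<close>,
  \<open>l\<close>, \<open>p\<close> are pairwise distinct, which is orthogonality when exactly
  these three coordinates are nonzero in common.\<close>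

definition pdd :: "(5 \<Rightarrow> 3) \<Rightarrow> (5 \<Rightarrow> 3) \<Rightarrow> 5 \<Rightarrow> 5 \<Rightarrow> 5 \<Rightarrow> bool" where
  "pdd a b k l p \<longleftrightarrow> dv a k l \<noteq> dv b k l \<and> dv a k p \<noteq> dv b k p \<and> dv a l p \<noteq> dv b l p"

text \<open>Three distinct elements of Z/3 form an arithmetic progression; in this form
  \<open>pdd\<close> becomes one equation and one inequation.\<close>

lemma pd3: "(x::3) \<noteq> 0 \<and> x + y \<noteq> 0 \<and> y \<noteq> 0 \<longleftrightarrow> x = y \<and> x \<noteq> 0"
  using three_cases[of x] three_cases[of y] by auto

lemma pdd_iff: "pdd a b k l p \<longleftrightarrow> dv a k l - dv b k l = dv a l p - dv b l p \<and> dv a k l \<noteq> dv b k l"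
proof -
  have "dv a k p \<noteq> dv b k p \<longleftrightarrow> (dv a k l - dv b k l) + (dv a l p - dv b l p) \<noteq> 0"
    by (auto simp: dv_def algebra_simps)
  moreover have "dv a k l \<noteq> dv b k l \<longleftrightarrow> dv a k l - dv b k l \<noteq> 0" "dv a l p \<noteq> dv b l p \<longleftrightarrow> dv a l p - dv b l p \<noteq> 0"
    by auto
  ultimately show ?thesis
    unfolding pdd_def using pd3[of "dv a k l - dv b k l" "dv a l p - dv b l p"] by metis
qed

lemma dv_table:
  "dv (\<lambda>i. of_nat (x ! pos i)) k l = dv (\<lambda>i. of_nat (y ! pos i)) k l \<longleftrightarrow> eqn x y (pos k) (pos l)"
proof -
  have "(of_nat a - of_nat b :: 3) = of_nat c - of_nat d \<longleftrightarrow> (of_nat (a + d) :: 3) = of_nat (b + c)" for a b c d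
    by (auto simp: algebra_simps)
  then show ?thesis
    unfolding dv_def eqn_def of_nat_3_eq by simp
qed

context frame
begin

text \<open>A coordinate system for the neighbours of \<open>fr m\<close> outside the frame. The
  clauses are adjacency across two and within one of the sets \<open>A m n\<close>, faithfulness,
  surjectivity, and the statement that a generic vertex acts on these neighbours like a vector with
  exponents \<open>t\<close>.\<close>

definition labelling :: "5 \<Rightarrow> ('a \<Rightarrow> 5 \<Rightarrow> 3) \<Rightarrow> bool" where
  "labelling m \<phi> \<longleftrightarrow>
    (\<forall>n k l p x y. distinct [m, n, k, l, p] \<longrightarrow> x \<in> A m n \<longrightarrow> y \<in> A m p \<longrightarrow> (adj x y \<longleftrightarrow> dv (\<phi> x) k l = dv (\<phi> y) k l)) \<and>
    (\<forall>n k l p x y. distinct [m, n, k, l, p] \<longrightarrow> x \<in> A m n \<longrightarrow> y \<in> A m n \<longrightarrow> (adj x y \<longleftrightarrow> pdd (\<phi> x) (\<phi> y) k l p)) \<and>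
    (\<forall>n k l p x y. distinct [m, n, k, l, p] \<longrightarrow> x \<in> A m n \<longrightarrow> y \<in> A m n \<longrightarrow>
       dv (\<phi> x) k l = dv (\<phi> y) k l \<longrightarrow> dv (\<phi> x) k p = dv (\<phi> y) k p \<longrightarrow> x = y) \<and>
    (\<forall>n k l p a. distinct [m, n, k, l, p] \<longrightarrow> (\<exists>x\<in>A m n. dv (\<phi> x) k l = dv a k l \<and> dv (\<phi> x) k p = dv a k p)) \<and>
    (\<forall>w\<in>generic. \<exists>t. \<forall>n k l p x. distinct [m, n, k, l, p] \<longrightarrow> x \<in> A m n \<longrightarrow> (adj w x \<longleftrightarrow> pdd (\<phi> x) t k l p))"

lemma labellingD:
  assumes "labelling m \<phi>"
  shows "distinct [m, n, k, l, p] \<Longrightarrow> x \<in> A m n \<Longrightarrow> y \<in> A m p \<Longrightarrow> adj x y \<longleftrightarrow> dv (\<phi> x) k l = dv (\<phi> y) k l"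
    "distinct [m, n, k, l, p] \<Longrightarrow> x \<in> A m n \<Longrightarrow> y \<in> A m n \<Longrightarrow> adj x y \<longleftrightarrow> pdd (\<phi> x) (\<phi> y) k l p"
    "distinct [m, n, k, l, p] \<Longrightarrow> x \<in> A m n \<Longrightarrow> y \<in> A m n \<Longrightarrow> dv (\<phi> x) k l = dv (\<phi> y) k l \<Longrightarrow>
       dv (\<phi> x) k p = dv (\<phi> y) k p \<Longrightarrow> x = y"
    "distinct [m, n, k, l, p] \<Longrightarrow> \<exists>x\<in>A m n. dv (\<phi> x) k l = dv a k l \<and> dv (\<phi> x) k p = dv a k p"
    "w \<in> generic \<Longrightarrow> \<exists>t. \<forall>n k l p x. distinct [m, n, k, l, p] \<longrightarrow> x \<in> A m n \<longrightarrow> (adj w x \<longleftrightarrow> pdd (\<phi> x) t k l p)"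
proof -
  note L = assms[unfolded labelling_def]
  show "distinct [m, n, k, l, p] \<Longrightarrow> x \<in> A m n \<Longrightarrow> y \<in> A m p \<Longrightarrow> adj x y \<longleftrightarrow> dv (\<phi> x) k l = dv (\<phi> y) k l"
    by (rule L[THEN conjunct1, rule_format])
  show "distinct [m, n, k, l, p] \<Longrightarrow> x \<in> A m n \<Longrightarrow> y \<in> A m n \<Longrightarrow> adj x y \<longleftrightarrow> pdd (\<phi> x) (\<phi> y) k l p"
    by (rule L[THEN conjunct2, THEN conjunct1, rule_format])
  show "distinct [m, n, k, l, p] \<Longrightarrow> x \<in> A m n \<Longrightarrow> y \<in> A m n \<Longrightarrow> dv (\<phi> x) k l = dv (\<phi> y) k l \<Longrightarrow>
       dv (\<phi> x) k p = dv (\<phi> y) k p \<Longrightarrow> x = y"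
    by (rule L[THEN conjunct2, THEN conjunct2, THEN conjunct1, rule_format])
  show "distinct [m, n, k, l, p] \<Longrightarrow> \<exists>x\<in>A m n. dv (\<phi> x) k l = dv a k l \<and> dv (\<phi> x) k p = dv a k p"
    by (rule L[THEN conjunct2, THEN conjunct2, THEN conjunct2, THEN conjunct1, rule_format])
  show "w \<in> generic \<Longrightarrow> \<exists>t. \<forall>n k l p x. distinct [m, n, k, l, p] \<longrightarrow> x \<in> A m n \<longrightarrow> (adj w x \<longleftrightarrow> pdd (\<phi> x) t k l p)"
    by (rule L[THEN conjunct2, THEN conjunct2, THEN conjunct2, THEN conjunct2, THEN bspec])
qed

lemma generic_adj:
  assumes "w \<in> generic"
  shows "\<not> adj w (fr i)" "\<not> adj (fr i) w" "w \<noteq> fr i" "fr i \<noteq> w" "w \<in> V"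
  using assms adj_sym unfolding generic_def by blast+

text \<open>At \<open>fr m\<close> the hyperoval of \<open>w\<close> dominates \<open>fr n\<close>.
  It avoids the frame, so the dominating vertex lies in \<open>A m n\<close>.\<close>

lemma generic_near:
  assumes w: "w \<in> generic" and mn: "m \<noteq> n"
  shows "\<exists>z\<in>A m n. adj w z"
proof -
  note wf = generic_adj[OF w]
  obtain a where a: "adj (fr m) a" "adj w a"
    using common_nbr[OF fr_V wf(5) wf(4) wf(2)] by blast
  obtain z where z: "adj (fr m) z" "adj w z" "z = fr n \<or> adj z (fr n)"
    using cover[OF wf(4,2) a frame[OF mn]] by blast
  then have "z \<in> A m n"
    unfolding A_def using wf adj_sym by auto
  then show ?thesis
    using z(2) by blast
qed

text \<open>This is the path that \<open>common_determined\<close> and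
  \<open>exps_hyperoval_ex\<close> take as input: two adjacent vertices on one axis and a third on
  another.\<close>

lemma generic_path:
  assumes w: "w \<in> generic" and d: "distinct [m, n, k]"
  shows "\<exists>i\<in>A m n. \<exists>i'\<in>A m n. \<exists>j\<in>A m k. adj w i \<and> adj w i' \<and> adj w j \<and> adj i i' \<and> adj i j \<and> \<not> adj i' j"
proof -
  note wf = generic_adj[OF w]
  have mn: "m \<noteq> n" "m \<noteq> k" "n \<noteq> k" "n \<noteq> m"
    using d by auto
  obtain z where z: "z \<in> A m n" "adj w z"
    using generic_near[OF w mn(1)] by blast
  have zf: "adj z (fr m)" "adj z (fr n)"
    using z(1) by (auto simp: A_def)
  obtain e f where ef: "clique5 z (fr m) (fr n) e f"
    using triangle_common[OF zf frame[OF mn(1)]] by blast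
  have "w \<noteq> e" "w \<noteq> f"
    using ef wf by (auto simp: clique5_def)
  then have "adj w e \<or> adj w f"
    using clique5_nbr[OF ef z(2) wf(3) wf(3)] wf(1) by blast
  then obtain z' where z': "adj w z'" "adj z z'" "adj (fr m) z'" "adj (fr n) z'"
    using ef unfolding clique5_def by blast
  have "z' \<in> A m n"
    unfolding A_def using z' wf(1) adj_sym by auto
  obtain y where y: "y \<in> A m k" "adj w y"
    using generic_near[OF w mn(2)] by blast
  have yf: "adj (fr m) y" "\<not> adj (fr n) y" "y \<noteq> fr n"
    using A_adj[OF mn(2) y(1)] mn y(1) adj_sym by (auto simp: A_def)
  have zf': "adj (fr m) z" "adj (fr n) z"
    using zf adj_sym by blast+
  \<comment> \<open>If \<open>y\<close> saw both \<open>z\<close> and \<open>z'\<close>, then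
    \<open>fr n\<close> and \<open>y\<close> would be common neighbours of a triangle and hence
    adjacent. By \<open>bip\<close> it sees at least one of them.\<close>
  have n1: "\<not> (adj z y \<and> adj z' y)"
    using triangle_nbrs[OF zf'(1) z'(3) z'(2) frame[OF mn(1)] zf(2) _ yf(1)] z'(4) yf adj_sym by blast
  have "z \<noteq> y"
    using zf'(2) yf(2) by blast
  then have n2: "adj z' y" if "\<not> adj z y"
    using bip[OF wf(4) wf(2) zf'(1) z(2) z'(3,1) yf(1) y(2) z'(2) that] by blast
  show ?thesis
    using n1 n2 z z' y \<open>z' \<in> A m n\<close> adj_sym by blast
qed

lemma labelling_ex: "\<exists>\<phi>. labelling m \<phi>"
proof -
  note W = all_W[OF fr_V[of m]]
  obtain n0 where "m \<noteq> n0"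
    using ex_other3[of m m m] by metis
  then obtain n1 k l where d0: "distinct [m, n0, n1, k, l]"
    using ex_rest3 by blast
  have ne0: "m \<noteq> n0" "m \<noteq> n1" "n0 \<noteq> n1" "m \<noteq> k" "m \<noteq> l" "n0 \<noteq> k" "n0 \<noteq> l" "n1 \<noteq> k" "n1 \<noteq> l" "k \<noteq> l"
    using d0 by auto
  obtain g where g: "coords adj linesW (fr m) g" "g 0 = fr n0" "g 1 = fr n1"
    using coords_edge[OF W frame[OF ne0(1)] frame[OF ne0(2)] frame[OF ne0(3)]] by blast
  note cD = coordsD[OF g(1)]
  have third: "fr i = g 2 \<or> fr i = g 3" if ni: "m \<noteq> i" "n0 \<noteq> i" "n1 \<noteq> i" for i
  proof -
    obtain j where j: "j < 40" "fr i = g j"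
      using cD(4)[OF frame[OF ni(1)]] by blast
    have "j \<in> set (nbs linesW 0) \<inter> set (nbs linesW 1)"
      using cD(2)[of 0 j] cD(2)[of 1 j] j g frame[OF ni(2)] frame[OF ni(3)] by simp
    then have "j \<in> {2, 3}"
      unfolding has_type_nbs0(2)[OF W] .
    then show ?thesis using j(2) by blast
  qed
  have "fr k \<noteq> fr l"
    using fr_inj ne0 by blast
  then have "fr k = g 2 \<and> fr l = g 3 \<or> fr l = g 2 \<and> fr k = g 3"
    using third[of k] third[of l] ne0 by metis
  then obtain n2 n3 where g23: "g 2 = fr n2" "g 3 = fr n3" and d: "distinct [m, n0, n1, n2, n3]"
    using ne0 by (elim disjE) force+
  \<comment> \<open>The four frame vertices other than \<open>fr m\<close> occupy the table points 0
    to 3, the axes of \<open>exps\<close>. \<open>pos\<close> translates indices into axes and is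
    applied to indices other than \<open>m\<close>; its last branch is meant for
    \<open>n3\<close>.\<close>
  define pos :: "5 \<Rightarrow> nat" where "pos i = (if i = n0 then 0 else if i = n1 then 1 else if i = n2 then 2 else 3)" for i
  have posn: "pos n0 = 0" "pos n1 = 1" "pos n2 = 2" "pos n3 = 3"
    using d by (auto simp: pos_def)
  have pos: "fr i = g (pos i)" "pos i < 4" if "i \<noteq> m" for i
    using five_exhaust[OF d, of i] that posn g g23 by auto
  have posi: "pos i = pos j \<longleftrightarrow> i = j" if "i \<noteq> m" "j \<noteq> m" for i j
    using pos(1)[OF that(1)] pos(1)[OF that(2)] fr_inj by metis
  have posr: "\<exists>i. i \<noteq> m \<and> r = pos i" if "r < 4" for r
  proof -
    have "r = pos n0 \<or> r = pos n1 \<or> r = pos n2 \<or> r = pos n3"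
      using that unfolding posn by auto
    moreover have "n0 \<noteq> m" "n1 \<noteq> m" "n2 \<noteq> m" "n3 \<noteq> m"
      using d by auto
    ultimately show ?thesis by blast
  qed
  define idx where "idx = inv_into {..<40} g"
  have idx: "idx (g i) = i" if "i < 40" for i
    unfolding idx_def using g(1) that by (intro inv_into_f_f) (auto simp: coords_def bij_betw_def)
  have gfr: "g i \<noteq> fr j" if "4 \<le> i" "i < 40" for i j
  proof
    assume e: "g i = fr j"
    then have "j \<noteq> m"
      using cD(1)[OF that(2)] by auto
    then have "g i = g (pos j)" "pos j < 4"
      using e pos by simp_all
    then show False
      using cD(3)[OF that(2), of "pos j"] that by auto
  qed
  have zero: "i \<in> set (nbs linesW p) \<longleftrightarrow> exps ! i ! p = 3" if "4 \<le> i" "i < 40" "p < 4" for i p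
    using exps_zero[unfolded list_all_upt Let_def, rule_format, OF le0 that(3,1,2)] .
  have gadj: "adj (g i) (fr n) \<longleftrightarrow> exps ! i ! pos n = 3" if i: "4 \<le> i" "i < 40" and "n \<noteq> m" for i n
  proof -
    have "adj (g (pos n)) (g i) \<longleftrightarrow> i \<in> set (nbs linesW (pos n))"
      using cD(2)[of "pos n" i] pos(2)[OF that(3)] i by simp
    then show ?thesis
      using zero[OF i pos(2)[OF that(3)]] pos(1)[OF that(3)] adj_sym by metis
  qed
  have gA: "g i \<in> A m n \<longleftrightarrow> exps ! i ! pos n = 3" if i: "4 \<le> i" "i < 40" and "n \<noteq> m" for i n
    using gadj[OF that] gfr[OF i] cD(1)[OF i(2)] adj_sym unfolding A_def by blast
  have Ag: "\<exists>i. 4 \<le> i \<and> i < 40 \<and> x = g i \<and> exps ! i ! pos n = 3 \<and> (\<forall>k. k \<noteq> m \<longrightarrow> k \<noteq> n \<longrightarrow> exps ! i ! pos k \<noteq> 3)"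
    if x: "x \<in> A m n" and n: "n \<noteq> m" for x n
  proof -
    have "adj (fr m) x"
      using x adj_sym unfolding A_def by blast
    then obtain i where i: "i < 40" "x = g i"
      using cD(4) by blast
    have i4: "4 \<le> i"
    proof (rule ccontr)
      assume "\<not> 4 \<le> i"
      then obtain j where "j \<noteq> m" "i = pos j"
        using posr[of i] by auto
      then have "x = fr j"
        using i(2) pos(1) by simp
      then show False
        using x unfolding A_def by blast
    qed
    have "exps ! i ! pos k \<noteq> 3" if "k \<noteq> m" "k \<noteq> n" for k
      using A_adj[OF n[symmetric] x, of k] gadj[OF i4 i(1) that(1)] that i(2) by auto
    moreover have "exps ! i ! pos n = 3"
      using gA[OF i4 i(1) n] x i(2) by simp
    ultimately show ?thesis
      using i i4 by blast
  qed
  define \<phi> where "\<phi> x = (\<lambda>i. of_nat (exps ! idx x ! pos i) :: 3)" for x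
  have \<phi>: "\<phi> (g i) = (\<lambda>j. of_nat (exps ! i ! pos j))" if "i < 40" for i
    unfolding \<phi>_def using idx[OF that] by simp
  have dv: "dv (\<phi> (g i)) k l = dv (\<phi> (g j)) k l \<longleftrightarrow> eqn (exps ! i) (exps ! j) (pos k) (pos l)"
    if "i < 40" "j < 40" for i j k l
    unfolding \<phi>[OF that(1)] \<phi>[OF that(2)] by (rule dv_table)
  have gg: "adj (g i) (g j) \<longleftrightarrow> j \<in> set (nbs linesW i)" if "i < 40" "j < 40" for i j
    using cD(2) that by blast
  have L1: "adj x y \<longleftrightarrow> dv (\<phi> x) k l = dv (\<phi> y) k l"
    if D: "distinct [m, n, k, l, p]" and x: "x \<in> A m n" and y: "y \<in> A m p" for n k l p x y
  proof -
    have ne: "n \<noteq> m" "p \<noteq> m" "k \<noteq> m" "l \<noteq> m" "n \<noteq> p" "k \<noteq> p" "l \<noteq> p" "n \<noteq> k" "n \<noteq> l" "k \<noteq> l"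
      using D by auto
    obtain i where i: "4 \<le> i" "i < 40" "x = g i" "exps ! i ! pos n = 3"
      using Ag[OF x ne(1)] by blast
    obtain j where j: "4 \<le> j" "j < 40" "y = g j" "\<And>k. k \<noteq> m \<Longrightarrow> k \<noteq> p \<Longrightarrow> exps ! j ! pos k \<noteq> 3"
      using Ag[OF y ne(2)] by blast
    have "distinct [pos n, pos k, pos l]"
      using ne posi by auto
    then show ?thesis
      unfolding i(3) j(3) gg[OF i(2) j(2)] dv[OF i(2) j(2)]
      using exps_other[OF i(1,2) j(1,2) pos(2)[OF ne(1)] i(4) j(4)[OF ne(1,5)] pos(2)[OF ne(3)] pos(2)[OF ne(4)]
        j(4)[OF ne(3,6)] j(4)[OF ne(4,7)]] by blast
  qed
  have L23: "adj x y \<longleftrightarrow> pdd (\<phi> x) (\<phi> y) k l p"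
    "dv (\<phi> x) k l = dv (\<phi> y) k l \<Longrightarrow> dv (\<phi> x) k p = dv (\<phi> y) k p \<Longrightarrow> x = y"
    if D: "distinct [m, n, k, l, p]" and x: "x \<in> A m n" and y: "y \<in> A m n" for n k l p x y
  proof -
    have ne: "n \<noteq> m" "p \<noteq> m" "k \<noteq> m" "l \<noteq> m" "n \<noteq> p" "k \<noteq> p" "l \<noteq> p" "n \<noteq> k" "n \<noteq> l" "k \<noteq> l"
      using D by auto
    obtain i where i: "4 \<le> i" "i < 40" "x = g i" "exps ! i ! pos n = 3"
      using Ag[OF x ne(1)] by blast
    obtain j where j: "4 \<le> j" "j < 40" "y = g j" "exps ! j ! pos n = 3"
      using Ag[OF y ne(1)] by blast
    have dd: "distinct [pos n, pos k, pos l, pos p]"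
      using ne posi by auto
    note E = exps_same[OF i(1,2) j(1,2) pos(2)[OF ne(1)] i(4) j(4) pos(2)[OF ne(3)] pos(2)[OF ne(4)] pos(2)[OF ne(2)] dd]
    show "adj x y \<longleftrightarrow> pdd (\<phi> x) (\<phi> y) k l p"
      unfolding i(3) j(3) pdd_def gg[OF i(2) j(2)] dv[OF i(2) j(2)] by (rule E(1))
    show "dv (\<phi> x) k l = dv (\<phi> y) k l \<Longrightarrow> dv (\<phi> x) k p = dv (\<phi> y) k p \<Longrightarrow> x = y"
      unfolding i(3) j(3) dv[OF i(2) j(2)] using E(2) by blast
  qed
  have L4: "\<exists>x\<in>A m n. dv (\<phi> x) k l = dv a k l \<and> dv (\<phi> x) k p = dv a k p"
    if D: "distinct [m, n, k, l, p]" for n k l p and a :: "5 \<Rightarrow> 3"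
  proof -
    have ne: "n \<noteq> m" "p \<noteq> m" "k \<noteq> m" "l \<noteq> m" "n \<noteq> p" "k \<noteq> p" "l \<noteq> p" "n \<noteq> k" "n \<noteq> l" "k \<noteq> l"
      using D by auto
    have pn: "distinct [pos n, pos k, pos l, pos p]"
      using ne posi by auto
    define c where "c x = (if x = (0::3) then 0 else if x = 1 then 1 else 2 :: nat)" for x
    have c: "of_nat (c x) = x" "c x < 3" for x
      using three_cases[of x] by (auto simp: c_def)
    \<comment> \<open>The prescribed exponents are listed in the order of the table axes, so that
      \<open>exps_ex\<close> can realise them.\<close>
    define t where "t = [c (a n0), c (a n1), c (a n2), c (a n3)]"
    have tl: "t \<in> set (lists3 4)"
      unfolding set_lists3 t_def using c(2) by auto
    have "of_nat (t ! pos i) = a i" if "i \<noteq> m" for i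
      using five_exhaust[OF d, of i] that
      by (elim disjE) (simp_all add: posn t_def c(1) eval_nat_numeral)
    then have at: "dv a i j = dv (\<lambda>i. of_nat (t ! pos i)) i j" if "i \<noteq> m" "j \<noteq> m" for i j
      using that by (simp add: dv_def)
    obtain i where i4: "4 \<le> i" "i < 40" and i: "exps ! i ! pos n = 3"
      "\<And>q r s. q < 4 \<Longrightarrow> r < 4 \<Longrightarrow> s < 4 \<Longrightarrow> distinct [pos n, q, r, s] \<Longrightarrow> eqn (exps ! i) t q r \<and> eqn (exps ! i) t q s"
      using exps_ex[OF tl pos(2)[OF ne(1)]] by blast
    have "g i \<in> A m n"
      using gA[OF i4 ne(1)] i(1) by simp
    moreover have "dv (\<phi> (g i)) k l = dv a k l" "dv (\<phi> (g i)) k p = dv a k p"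
      unfolding at[OF ne(3,4)] at[OF ne(3,2)] \<phi>[OF i4(2)] dv_table using i(2)[OF pos(2)[OF ne(3)] pos(2)[OF ne(4)] pos(2)[OF ne(2)] pn] by blast+
    ultimately show ?thesis by blast
  qed
  \<comment> \<open>The hyperoval of \<open>w\<close> at \<open>fr m\<close> is determined by a path
    from \<open>generic_path\<close>. The table lists the hyperoval of that path among
    \<open>hyps\<close>, and the corresponding exponents serve as \<open>t\<close>.\<close>
  have L5: "\<exists>t. \<forall>n k l p x. distinct [m, n, k, l, p] \<longrightarrow> x \<in> A m n \<longrightarrow> (adj w x \<longleftrightarrow> pdd (\<phi> x) t k l p)"
    if w: "w \<in> generic" for w
  proof -
    note wf = generic_adj[OF w]
    have d3: "distinct [m, n0, n1]"
      using d by simp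
    obtain x x' y where xy: "x \<in> A m n0" "x' \<in> A m n0" "y \<in> A m n1" "adj w x" "adj w x'" "adj w y"
      "adj x x'" "adj x y" "\<not> adj x' y"
      using generic_path[OF w d3] by blast
    have ne: "n0 \<noteq> m" "n1 \<noteq> m"
      using d by auto
    obtain i where i: "4 \<le> i" "i < 40" "x = g i" "exps ! i ! 0 = 3"
      using Ag[OF xy(1) ne(1)] posn by auto
    obtain i' where i': "4 \<le> i'" "i' < 40" "x' = g i'" "exps ! i' ! 0 = 3"
      using Ag[OF xy(2) ne(1)] posn by auto
    obtain j where j: "4 \<le> j" "j < 40" "y = g j" "exps ! j ! 1 = 3"
      using Ag[OF xy(3) ne(2)] posn by auto
    have "i' \<in> set (nbs linesW i)" "j \<in> set (nbs linesW i)"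
      using gg[OF i(2) i'(2)] gg[OF i(2) j(2)] xy(7,8) i(3) i'(3) j(3) by simp_all
    from exps_hyperoval_ex[OF i(1,2,4) \<open>i' \<in> set (nbs linesW i)\<close> i'(1,4) \<open>j \<in> set (nbs linesW i)\<close> j(1,4)]
    obtain t where PQ: "\<And>a. 4 \<le> a \<Longrightarrow> a < 40 \<Longrightarrow> pdt (exps ! a) t \<longleftrightarrow> a \<in> set (nbs linesW i') \<and> a \<in> set (nbs linesW j) \<or>
        (\<forall>p. p \<in> set (nbs linesW i') \<longrightarrow> p \<in> set (nbs linesW j) \<longrightarrow> p \<in> set (nbs linesW a))"
      by blast
    have form: "table_form linesW"
      by (rule table_form_W)
    have Pg: "a \<in> set (nbs linesW i') \<and> a \<in> set (nbs linesW j) \<longleftrightarrow> adj (g a) x' \<and> adj (g a) y" if "a < 40" for a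
      unfolding i'(3) j(3) using gg[OF i'(2) that] gg[OF j(2) that] adj_sym by auto
    have um: "adj (fr m) (g a)" if "a < 40" for a
      using cD(1) that by blast
    have wg: "adj w (g a) \<longleftrightarrow> pdt (exps ! a) t" if a: "4 \<le> a" "a < 40" for a
    proof -
      have ux: "adj (fr m) x" "adj (fr m) x'" "adj (fr m) y"
        using um i(2,3) i'(2,3) j(2,3) by auto
      have "x' \<noteq> y"
        using xy(7,8) A_adj[of m n0 x' n1] A_adj[of m n1 y n1] xy(2,3) d by auto
      then have "adj w (g a) \<longleftrightarrow> adj (g a) x' \<and> adj (g a) y \<or> (\<forall>p. adj (fr m) p \<longrightarrow> adj p x' \<longrightarrow> adj p y \<longrightarrow> adj (g a) p)"
        using common_determined[OF wf(4) wf(2) ux(1) xy(4) ux(2) xy(5) ux(3) xy(6-9) _ um[OF a(2)]] by blast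
      also have "(\<forall>p. adj (fr m) p \<longrightarrow> adj p x' \<longrightarrow> adj p y \<longrightarrow> adj (g a) p) \<longleftrightarrow>
        (\<forall>p. p \<in> set (nbs linesW i') \<longrightarrow> p \<in> set (nbs linesW j) \<longrightarrow> p \<in> set (nbs linesW a))"
      proof
        assume q: "\<forall>p. adj (fr m) p \<longrightarrow> adj p x' \<longrightarrow> adj p y \<longrightarrow> adj (g a) p"
        show "\<forall>p. p \<in> set (nbs linesW i') \<longrightarrow> p \<in> set (nbs linesW j) \<longrightarrow> p \<in> set (nbs linesW a)"
        proof (intro allI impI)
          fix b assume b: "b \<in> set (nbs linesW i')" "b \<in> set (nbs linesW j)"
          have b40: "b < 40"
            by (rule nbs_lt[OF form b(1)])
          show "b \<in> set (nbs linesW a)"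
            using q Pg[OF b40] b um[OF b40] gg[OF a(2) b40] by blast
        qed
      next
        assume q: "\<forall>p. p \<in> set (nbs linesW i') \<longrightarrow> p \<in> set (nbs linesW j) \<longrightarrow> p \<in> set (nbs linesW a)"
        show "\<forall>p. adj (fr m) p \<longrightarrow> adj p x' \<longrightarrow> adj p y \<longrightarrow> adj (g a) p"
        proof (intro allI impI)
          fix p assume p: "adj (fr m) p" "adj p x'" "adj p y"
          obtain b where b: "b < 40" "p = g b"
            using cD(4)[OF p(1)] by blast
          have "b \<in> set (nbs linesW a)"
            using q Pg[OF b(1)] p b(2) by blast
          then show "adj (g a) p"
            using gg[OF a(2) b(1)] b(2) by simp
        qed
      qed
      finally show ?thesis
        using Pg[OF a(2)] PQ[OF a] by blast
    qed
    have "adj w v \<longleftrightarrow> pdd (\<phi> v) (\<lambda>i. of_nat (t ! pos i)) k l p"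
      if D: "distinct [m, n, k, l, p]" and v: "v \<in> A m n" for n k l p v
    proof -
      have ne: "n \<noteq> m" "p \<noteq> m" "k \<noteq> m" "l \<noteq> m" "n \<noteq> p" "k \<noteq> p" "l \<noteq> p" "n \<noteq> k" "n \<noteq> l" "k \<noteq> l"
        using D by auto
      have pp: "pos k \<noteq> pos l" "pos k \<noteq> pos p" "pos l \<noteq> pos p" "pos l \<noteq> pos k" "pos p \<noteq> pos k" "pos p \<noteq> pos l"
        using ne posi by auto
      obtain a where a: "4 \<le> a" "a < 40" "v = g a" "exps ! a ! pos n = 3"
        "\<And>k. k \<noteq> m \<Longrightarrow> k \<noteq> n \<Longrightarrow> exps ! a ! pos k \<noteq> 3"
        using Ag[OF v ne(1)] by blast
      have z: "exps ! a ! pos k \<noteq> 3" "exps ! a ! pos l \<noteq> 3" "exps ! a ! pos p \<noteq> 3"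
        using a(5) ne by blast+
      have "pdt (exps ! a) t \<longleftrightarrow> \<not> eqn (exps ! a) t (pos k) (pos l) \<and> \<not> eqn (exps ! a) t (pos k) (pos p) \<and> \<not> eqn (exps ! a) t (pos l) (pos p)"
      proof
        assume "pdt (exps ! a) t"
        then have lt: "\<not> eqn (exps ! a) t r s" if "r < 4" "s < 4" "exps ! a ! r \<noteq> 3" "exps ! a ! s \<noteq> 3" "\<not> s \<le> r" for r s
          unfolding pdt_def list_all_upt using that le0 by blast
        have "\<not> eqn (exps ! a) t (pos i) (pos j)"
          if "i \<noteq> m" "j \<noteq> m" "exps ! a ! pos i \<noteq> 3" "exps ! a ! pos j \<noteq> 3" "pos j \<noteq> pos i" for i j
        proof -
          have "\<not> pos j \<le> pos i \<or> \<not> pos i \<le> pos j"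
            using that(5) by simp
          then show ?thesis
            using lt[of "pos i" "pos j"] lt[of "pos j" "pos i"] eqn_sym[of "exps ! a" t "pos i" "pos j"]
              pos(2)[OF that(1)] pos(2)[OF that(2)] that(3,4) by blast
        qed
        then show "\<not> eqn (exps ! a) t (pos k) (pos l) \<and> \<not> eqn (exps ! a) t (pos k) (pos p) \<and> \<not> eqn (exps ! a) t (pos l) (pos p)"
          using ne z pp by blast
      next
        assume e: "\<not> eqn (exps ! a) t (pos k) (pos l) \<and> \<not> eqn (exps ! a) t (pos k) (pos p) \<and> \<not> eqn (exps ! a) t (pos l) (pos p)"
        have "\<not> eqn (exps ! a) t r s" if rs: "r < 4" "s < 4" "exps ! a ! r \<noteq> 3" "exps ! a ! s \<noteq> 3" "\<not> s \<le> r" for r s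
        proof -
          obtain i where i: "i \<noteq> m" "r = pos i"
            using posr[OF rs(1)] by blast
          obtain j where j: "j \<noteq> m" "s = pos j"
            using posr[OF rs(2)] by blast
          have "i = k \<or> i = l \<or> i = p" "j = k \<or> j = l \<or> j = p"
            using five_exhaust[OF D, of i] five_exhaust[OF D, of j] i j rs a(4) by auto
          then show ?thesis
            using e eqn_sym rs(5) i j by (metis order_refl)
        qed
        then show "pdt (exps ! a) t"
          unfolding pdt_def list_all_upt by blast
      qed
      then show ?thesis
        unfolding a(3) wg[OF a(1,2)] pdd_def \<phi>[OF a(2)] dv_table .
    qed
    then show ?thesis by blast
  qed
  have "labelling m \<phi>"
    unfolding labelling_def
    by (intro conjI allI impI ballI; (rule L1 | rule L23(1) | rule L23(2) | rule L4 | rule L5); assumption)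
  then show ?thesis by blast
qed

end

section \<open>Gluing the five local coordinate systems\<close>

lemma dv_split: "dv a l p = dv a k p - dv a k l"
  by (simp add: dv_def)

lemma dv_eq_iff: "dv a k l = dv b k l \<longleftrightarrow> a k - b k = a l - b l"
  by (auto simp: dv_def algebra_simps)

lemma dv_zero [simp]: "dv (\<lambda>_. 0) k l = 0"
  by (simp add: dv_def)

lemma pdd_zero: "pdd a (\<lambda>_. 0) k l p \<longleftrightarrow> dv a k l = dv a l p \<and> dv a k l \<noteq> 0"
  unfolding pdd_iff by simp

lemma z3_cases: "(c::3) \<noteq> 0 \<Longrightarrow> x = 0 \<or> x = c \<or> x = - c"
  using three_cases[of c] three_cases[of x] by auto

lemma z3_neg_ne: "(c::3) \<noteq> 0 \<Longrightarrow> - c \<noteq> c"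
  using three_cases[of c] by auto

lemma ex_other4: "\<exists>m::5. m \<noteq> a \<and> m \<noteq> b \<and> m \<noteq> c \<and> m \<noteq> d"
proof (rule ccontr)
  assume "\<not> ?thesis"
  then have "UNIV \<subseteq> {a, b, c, d}" by blast
  then have "card (UNIV :: 5 set) \<le> card {a, b, c, d}"
    by (intro card_mono) auto
  also have "\<dots> \<le> 4"
    by (simp add: card_insert_if)
  finally show False by simp
qed

lemma (in frame) labelling_map:
  assumes L: "labelling m \<phi>" and T: "\<And>a b k l. dv (T a) k l = dv (T b) k l \<longleftrightarrow> dv a k l = dv b k l"
    and S: "\<And>a. \<exists>b. T b = a"
  shows "labelling m (\<lambda>x. T (\<phi> x))"
proof -
  have P: "pdd (T a) (T b) k l p \<longleftrightarrow> pdd a b k l p" for a b k l p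
    unfolding pdd_def T ..
  show ?thesis
    unfolding labelling_def
  proof (intro conjI allI impI ballI)
    fix n k l p x y assume *: "distinct [m, n, k, l, p]" "x \<in> A m n" "y \<in> A m p"
    show "adj x y \<longleftrightarrow> dv (T (\<phi> x)) k l = dv (T (\<phi> y)) k l"
      unfolding T by (rule labellingD(1)[OF L *])
  next
    fix n k l p x y assume *: "distinct [m, n, k, l, p]" "x \<in> A m n" "y \<in> A m n"
    show "adj x y \<longleftrightarrow> pdd (T (\<phi> x)) (T (\<phi> y)) k l p"
      unfolding P by (rule labellingD(2)[OF L *])
  next
    fix n k l p x y assume *: "distinct [m, n, k, l, p]" "x \<in> A m n" "y \<in> A m n"
      "dv (T (\<phi> x)) k l = dv (T (\<phi> y)) k l" "dv (T (\<phi> x)) k p = dv (T (\<phi> y)) k p"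
    show "x = y"
      by (rule labellingD(3)[OF L *[unfolded T]])
  next
    fix n k l p a assume *: "distinct [m, n, k, l, p]"
    obtain b where "T b = a"
      using S by blast
    then show "\<exists>x\<in>A m n. dv (T (\<phi> x)) k l = dv a k l \<and> dv (T (\<phi> x)) k p = dv a k p"
      using labellingD(4)[OF L *, of b] T by metis
  next
    fix w assume "w \<in> generic"
    from labellingD(5)[OF L this] obtain t where
      t: "\<forall>n k l p x. distinct [m, n, k, l, p] \<longrightarrow> x \<in> A m n \<longrightarrow> (adj w x \<longleftrightarrow> pdd (\<phi> x) t k l p)" ..
    show "\<exists>t. \<forall>n k l p x. distinct [m, n, k, l, p] \<longrightarrow> x \<in> A m n \<longrightarrow> (adj w x \<longleftrightarrow> pdd (T (\<phi> x)) t k l p)"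
      by (rule exI[of _ "T t"], unfold P, rule t)
  qed
qed

text \<open>The chosen vertex \<open>w0\<close> plays the part of the vector with all coordinates
  equal to 1.\<close>

locale based_frame = frame +
  fixes w0 :: 'a
  assumes w0: "w0 \<in> generic"
begin

text \<open>Normalised labellings give \<open>w0\<close> the exponent 0 everywhere. The remaining
  freedom that matters for gluing is the sign, corresponding to the field automorphism.\<close>

definition nlab :: "5 \<Rightarrow> ('a \<Rightarrow> 5 \<Rightarrow> 3) \<Rightarrow> bool" where
  "nlab m \<phi> \<longleftrightarrow> labelling m \<phi> \<and>
    (\<forall>n k l p x. distinct [m, n, k, l, p] \<longrightarrow> x \<in> A m n \<longrightarrow> (adj w0 x \<longleftrightarrow> pdd (\<phi> x) (\<lambda>_. 0) k l p))"

lemma nlabD: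
  assumes "nlab m \<phi>"
  shows "labelling m \<phi>" "distinct [m, n, k, l, p] \<Longrightarrow> x \<in> A m n \<Longrightarrow> adj w0 x \<longleftrightarrow> dv (\<phi> x) k l = dv (\<phi> x) l p \<and> dv (\<phi> x) k l \<noteq> 0"
proof -
  show "labelling m \<phi>"
    using assms unfolding nlab_def by blast
  assume "distinct [m, n, k, l, p]" "x \<in> A m n"
  then show "adj w0 x \<longleftrightarrow> dv (\<phi> x) k l = dv (\<phi> x) l p \<and> dv (\<phi> x) k l \<noteq> 0"
    using assms unfolding nlab_def pdd_zero by metis
qed

lemma nlab_ex: "\<exists>\<phi>. nlab m \<phi>"
proof -
  obtain \<phi> where L: "labelling m \<phi>"
    using labelling_ex by blast
  from labellingD(5)[OF L w0] obtain t where
    t: "\<forall>n k l p x. distinct [m, n, k, l, p] \<longrightarrow> x \<in> A m n \<longrightarrow> (adj w0 x \<longleftrightarrow> pdd (\<phi> x) t k l p)" ..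
  \<comment> \<open>Subtracting the exponents of \<open>w0\<close> is a diagonal change of
    coordinates; it preserves all relations between differences.\<close>
  define T where "T a = (\<lambda>i. a i - t i)" for a :: "5 \<Rightarrow> 3"
  have T: "dv (T a) k l = dv (T b) k l \<longleftrightarrow> dv a k l = dv b k l" for a b k l
    by (auto simp: T_def dv_def algebra_simps)
  have S: "\<exists>b. T b = a" for a
    by (rule exI[of _ "\<lambda>i. a i + t i"]) (simp add: T_def)
  have z: "(\<lambda>_. 0) = T t"
    by (simp add: T_def)
  have "pdd (T (\<phi> x)) (\<lambda>_. 0) k l p \<longleftrightarrow> pdd (\<phi> x) t k l p" for x k l p
    unfolding z pdd_def T ..
  then have "nlab m (\<lambda>x. T (\<phi> x))"
    unfolding nlab_def using t labelling_map[OF L T S] by blast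
  then show ?thesis by blast
qed

text \<open>Negating exponents is the field automorphism: it inverts the nonzero elements of GF(4),
  hence squares them.\<close>

lemma nlab_neg:
  assumes "nlab m \<phi>"
  shows "nlab m (\<lambda>x i. - \<phi> x i)"
proof -
  define T where "T a = (\<lambda>i. - a i)" for a :: "5 \<Rightarrow> 3"
  have T: "dv (T a) k l = dv (T b) k l \<longleftrightarrow> dv a k l = dv b k l" for a b k l
    by (auto simp: T_def dv_def algebra_simps)
  have S: "\<exists>b. T b = a" for a
    by (rule exI[of _ "\<lambda>i. - a i"]) (simp add: T_def)
  have z: "(\<lambda>_. 0) = T (\<lambda>_. 0)"
    by (simp add: T_def)
  have P: "pdd (T (\<phi> x)) (\<lambda>_. 0) k l p \<longleftrightarrow> pdd (\<phi> x) (\<lambda>_. 0) k l p" for x k l p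
    by (subst z, unfold pdd_def T) (rule refl)
  have "nlab m (\<lambda>x. T (\<phi> x))"
    unfolding nlab_def P using assms labelling_map[OF nlabD(1)[OF assms] T S] unfolding nlab_def by blast
  then show ?thesis
    unfolding T_def .
qed

text \<open>Equal ratios at \<open>k\<close>, \<open>l\<close> can be recognised without labels:
  choose \<open>y\<close> in \<open>A m p\<close> adjacent to \<open>x\<close> and
  \<open>x'\<close>, and \<open>z\<close> in \<open>A n p\<close> adjacent to \<open>x\<close>. By
  \<open>star\<close> the adjacencies pass from \<open>x\<close> through \<open>y\<close> to
  \<open>x'\<close>.\<close>

lemma class_transfer:
  assumes m: "labelling m \<phi>" and n: "labelling n \<psi>" and d: "distinct [m, n, k, l, p]"
    and x: "x \<in> A m n" "x' \<in> A m n" and e: "dv (\<phi> x) k l = dv (\<phi> x') k l"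
  shows "dv (\<psi> x) k l = dv (\<psi> x') k l"
proof -
  have d': "distinct [m, p, k, l, n]" "distinct [n, p, k, l, m]" "distinct [n, m, k, l, p]" "distinct [m, n, p]" "distinct [m, p, n]"
    using d by auto
  obtain y where y: "y \<in> A m p" "dv (\<phi> y) k l = dv (\<phi> x) k l"
    using labellingD(4)[OF m d'(1), of "\<phi> x"] by blast
  obtain z where z: "z \<in> A n p" "dv (\<psi> z) k l = dv (\<psi> x) k l"
    using labellingD(4)[OF n d'(2), of "\<psi> x"] by blast
  have xn: "x \<in> A n m" "x' \<in> A n m" "z \<in> A p n"
    using x z A_sym by blast+
  have "adj x y" "adj x' y"
    using labellingD(1)[OF m d x(1) y(1)] labellingD(1)[OF m d x(2) y(1)] y(2) e by simp_all
  moreover have "adj x z"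
    using labellingD(1)[OF n d'(3) xn(1) z(1)] z(2) by simp
  ultimately have "adj y z" "adj y x'"
    using star[OF d'(4) x(1) y(1) z(1)] adj_sym by blast+
  then have "adj x' z"
    using star[OF d'(5) y(1) x(2) xn(3)] by blast
  then show ?thesis
    using labellingD(1)[OF n d'(3) xn(2) z(1)] z(2) by simp
qed

text \<open>By \<open>class_transfer\<close> the two labellings induce the same three classes on
  \<open>A m n\<close>, so it suffices to compare their values on one representative of each class:
  0, \<open>c\<close> and \<open>- c\<close>.\<close>

lemma glue:
  assumes m: "nlab m \<phi>" and n: "nlab n \<psi>" and d: "distinct [m, n, k, l, p]" and x1: "x1 \<in> A m n" "adj w0 x1"
    and e: "dv (\<phi> x1) k l = dv (\<psi> x1) k l" and D: "distinct [m, n, i, j, h]" and x: "x \<in> A m n"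
  shows "dv (\<phi> x) i j = dv (\<psi> x) i j"
proof -
  note Lm = nlabD(1)[OF m] and Ln = nlabD(1)[OF n]
  have sym: "y \<in> A m n \<Longrightarrow> y \<in> A n m" for y
    using A_sym by blast
  have d': "distinct [n, m, k, l, p]" "distinct [n, m, i, j, h]"
    using d D by auto
  \<comment> \<open>A neighbour of \<open>w0\<close> has equal successive differences in both
    labellings, so agreement at one pair of coordinates spreads to all three.\<close>
  have "\<phi> x1 k - \<psi> x1 k = \<phi> x1 l - \<psi> x1 l" "\<phi> x1 l - \<psi> x1 l = \<phi> x1 p - \<psi> x1 p"
    using nlabD(2)[OF m d x1(1), THEN iffD1, OF x1(2)] nlabD(2)[OF n d'(1) sym[OF x1(1)], THEN iffD1, OF x1(2)] e
    unfolding dv_eq_iff[symmetric] by auto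
  moreover have "i = k \<or> i = l \<or> i = p" "j = k \<or> j = l \<or> j = p"
    using five_exhaust[OF d, of i] five_exhaust[OF d, of j] D by auto
  ultimately have e1: "dv (\<phi> x1) i j = dv (\<psi> x1) i j"
    unfolding dv_eq_iff by metis
  define c where "c = dv (\<phi> x1) i j"
  have c: "dv (\<phi> x1) i j = c" "dv (\<phi> x1) j h = c" "dv (\<psi> x1) i j = c" "dv (\<psi> x1) j h = c" "c \<noteq> 0"
    using nlabD(2)[OF m D x1(1), THEN iffD1, OF x1(2)] nlabD(2)[OF n d'(2) sym[OF x1(1)], THEN iffD1, OF x1(2)] e1
    by (auto simp: c_def)
  \<comment> \<open>The vertex with label 0 is adjacent to \<open>x1\<close> but not to
    \<open>w0\<close>, and these two facts force its value under \<open>\<psi>\<close> to be 0 as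
    well.\<close>
  obtain t where t: "t \<in> A m n" "dv (\<phi> t) i j = 0" "dv (\<phi> t) i h = 0"
    using labellingD(4)[OF Lm D, of "\<lambda>_. 0"] by auto
  have t': "dv (\<phi> t) j h = 0"
    unfolding dv_split[of _ j h i] t by simp
  \<comment> \<open>The vertex with the negated label is adjacent to \<open>w0\<close> and to
    \<open>x1\<close>. Under \<open>\<psi>\<close> the first excludes the value 0, the second the
    value \<open>c\<close>.\<close>
  obtain x2 where x2: "x2 \<in> A m n" "dv (\<phi> x2) i j = dv (\<lambda>i. - \<phi> x1 i) i j" "dv (\<phi> x2) i h = dv (\<lambda>i. - \<phi> x1 i) i h"
    using labellingD(4)[OF Lm D, of "\<lambda>i. - \<phi> x1 i"] by blast
  have "dv (\<lambda>i. - \<phi> x1 i) a b = - dv (\<phi> x1) a b" for a b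
    by (simp add: dv_def)
  then have x2': "dv (\<phi> x2) i j = - c" "dv (\<phi> x2) j h = - c"
    using x2(2,3) c dv_split[of "\<phi> x2" j h i] dv_split[of "\<phi> x1" j h i] by auto
  have "adj t x1"
    using labellingD(2)[OF Lm D t(1) x1(1)] unfolding pdd_iff using t t' c by simp
  then have "dv (\<psi> t) i j = dv (\<psi> t) j h"
    using labellingD(2)[OF Ln d'(2) sym[OF t(1)] sym[OF x1(1)]] unfolding pdd_iff using c by simp
  moreover have "\<not> adj w0 t"
    using nlabD(2)[OF m D t(1)] t(2) by simp
  ultimately have et: "dv (\<psi> t) i j = 0"
    using nlabD(2)[OF n d'(2) sym[OF t(1)]] by simp
  have "adj w0 x2"
    using nlabD(2)[OF m D x2(1)] x2' c(5) by simp
  then have "dv (\<psi> x2) i j \<noteq> 0"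
    using nlabD(2)[OF n d'(2) sym[OF x2(1)], THEN iffD1] by blast
  moreover have "adj x2 x1"
    using labellingD(2)[OF Lm D x2(1) x1(1)] unfolding pdd_iff using x2' c z3_neg_ne[OF c(5)] by simp
  then have "pdd (\<psi> x2) (\<psi> x1) i j h"
    using labellingD(2)[OF Ln d'(2) sym[OF x2(1)] sym[OF x1(1)]] by blast
  then have "dv (\<psi> x2) i j \<noteq> c"
    unfolding pdd_iff c by blast
  ultimately have e2: "dv (\<psi> x2) i j = - c"
    using z3_cases[OF c(5)] by blast
  consider "dv (\<phi> x) i j = dv (\<phi> t) i j" | "dv (\<phi> x) i j = dv (\<phi> x1) i j" | "dv (\<phi> x) i j = dv (\<phi> x2) i j"
    using z3_cases[OF c(5), of "dv (\<phi> x) i j"] t(2) c(1) x2'(1) by metis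
  then show ?thesis
  proof cases
    case 1
    then show ?thesis using class_transfer[OF Lm Ln D x t(1)] t(2) et by simp
  next
    case 2
    then show ?thesis using class_transfer[OF Lm Ln D x x1(1)] c by simp
  next
    case 3
    then show ?thesis using class_transfer[OF Lm Ln D x x2(1)] x2'(1) e2 by simp
  qed
qed

text \<open>On a neighbour of \<open>w0\<close> both labellings have nonzero differences, and
  nonzero elements of Z/3 agree up to sign.\<close>

lemma glue_sign:
  assumes m: "nlab m \<phi>" and mn: "m \<noteq> n"
  shows "\<exists>\<psi>. nlab n \<psi> \<and> (\<forall>k l p x. distinct [m, n, k, l, p] \<longrightarrow> x \<in> A m n \<longrightarrow> dv (\<phi> x) k l = dv (\<psi> x) k l)"
proof -
  obtain \<psi> where n: "nlab n \<psi>"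
    using nlab_ex by blast
  obtain x1 where x1: "x1 \<in> A m n" "adj w0 x1"
    using generic_near[OF w0 mn] by blast
  obtain k l p where d: "distinct [m, n, k, l, p]"
    using ex_rest3[OF mn] by blast
  have d': "distinct [n, m, k, l, p]" and x1': "x1 \<in> A n m"
    using d x1 A_sym by auto
  have "dv (\<phi> x1) k l \<noteq> 0" "dv (\<psi> x1) k l \<noteq> 0"
    using nlabD(2)[OF m d x1(1), THEN iffD1, OF x1(2)] nlabD(2)[OF n d' x1', THEN iffD1, OF x1(2)] by blast+
  then consider "dv (\<phi> x1) k l = dv (\<psi> x1) k l" | "dv (\<phi> x1) k l = dv (\<lambda>i. - \<psi> x1 i) k l"
    using z3_cases[of "dv (\<psi> x1) k l" "dv (\<phi> x1) k l"] by (auto simp: dv_def)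
  then show ?thesis
  proof cases
    case 1
    then show ?thesis
      using n glue[OF m n d x1] by blast
  next
    case 2
    then show ?thesis
      using nlab_neg[OF n] glue[OF m nlab_neg[OF n] d x1] by blast
  qed
qed

text \<open>The signs are chosen against the labelling at 0. What remains is that two labellings
  fixed in this way also agree with each other.\<close>

lemma family_ex:
  "\<exists>\<Phi>. (\<forall>m. nlab m (\<Phi> m)) \<and>
    (\<forall>m n k l p x. distinct [m, n, k, l, p] \<longrightarrow> x \<in> A m n \<longrightarrow> dv (\<Phi> m x) k l = dv (\<Phi> n x) k l)"
proof -
  obtain \<phi> where \<phi>: "nlab 0 \<phi>"
    using nlab_ex by blast
  have "\<forall>n. \<exists>\<psi>. nlab n \<psi> \<and> (0 \<noteq> n \<longrightarrow> (\<forall>k l p x. distinct [0, n, k, l, p] \<longrightarrow> x \<in> A 0 n \<longrightarrow> dv (\<phi> x) k l = dv (\<psi> x) k l)) \<and>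
      (0 = n \<longrightarrow> \<psi> = \<phi>)"
  proof
    fix n
    show "\<exists>\<psi>. nlab n \<psi> \<and> (0 \<noteq> n \<longrightarrow> (\<forall>k l p x. distinct [0, n, k, l, p] \<longrightarrow> x \<in> A 0 n \<longrightarrow> dv (\<phi> x) k l = dv (\<psi> x) k l)) \<and>
      (0 = n \<longrightarrow> \<psi> = \<phi>)"
      using glue_sign[OF \<phi>, of n] \<phi> by (cases "0 = n") blast+
  qed
  from choice[OF this] obtain \<Phi> where
    "\<forall>n. nlab n (\<Phi> n) \<and> (0 \<noteq> n \<longrightarrow> (\<forall>k l p x. distinct [0, n, k, l, p] \<longrightarrow> x \<in> A 0 n \<longrightarrow> dv (\<phi> x) k l = dv (\<Phi> n x) k l)) \<and>
      (0 = n \<longrightarrow> \<Phi> n = \<phi>)" ..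
  then have F: "\<And>n. nlab n (\<Phi> n)" "\<Phi> 0 = \<phi>"
    and F0: "\<And>n k l p x. distinct [0, n, k, l, p] \<Longrightarrow> x \<in> A 0 n \<Longrightarrow> dv (\<Phi> 0 x) k l = dv (\<Phi> n x) k l"
    by auto
  have both: "dv (\<Phi> m x) k l = dv (\<Phi> n x) k l"
    if d: "distinct [0, m, n, i, j]" and D: "distinct [m, n, k, l, p]" and x: "x \<in> A m n" for m n i j k l p x
  proof -
    have d': "distinct [m, 0, i, j, n]" "distinct [n, 0, i, j, m]" "distinct [m, n, i, j, 0]" "distinct [n, m, i, j, 0]"
      "distinct [0, m, i, j, n]" "distinct [0, n, i, j, m]" "distinct [m, n, 0]" "m \<noteq> n"
      using d by auto
    note Lm = nlabD(1)[OF F(1)[of m]] and Ln = nlabD(1)[OF F(1)[of n]] and L0 = nlabD(1)[OF F(1)[of 0]]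
    obtain x1 where x1: "x1 \<in> A m n" "adj w0 x1"
      using generic_near[OF w0 d'(8)] by blast
    obtain y where y: "y \<in> A m 0" "dv (\<Phi> m y) i j = dv (\<Phi> m x1) i j"
      using labellingD(4)[OF Lm d'(1), of "\<Phi> m x1"] by blast
    obtain z where z: "z \<in> A n 0" "dv (\<Phi> n z) i j = dv (\<Phi> n x1) i j"
      using labellingD(4)[OF Ln d'(2), of "\<Phi> n x1"] by blast
    have s: "x1 \<in> A n m" "y \<in> A 0 m" "z \<in> A 0 n"
      using x1 y z A_sym by blast+
    \<comment> \<open>The comparison of \<open>m\<close> and \<open>n\<close> goes through the
      quadrangle at \<open>fr 0\<close>: \<open>star\<close> makes \<open>y\<close> and
      \<open>z\<close> adjacent, and there adjacency means equal differences.\<close>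
    have "adj x1 y" "adj x1 z"
      using labellingD(1)[OF Lm d'(3) x1(1) y(1)] labellingD(1)[OF Ln d'(4) s(1) z(1)] y(2) z(2) by simp_all
    then have "adj y z"
      using star[OF d'(7) x1(1) y(1) z(1)] by blast
    then have "dv (\<Phi> 0 y) i j = dv (\<Phi> 0 z) i j"
      using labellingD(1)[OF L0 d'(5) s(2,3)] by simp
    then have "dv (\<Phi> m x1) i j = dv (\<Phi> n x1) i j"
      using F0[OF d'(5) s(2)] F0[OF d'(6) s(3)] y(2) z(2) by simp
    then show ?thesis
      using glue[OF F(1) F(1) d'(3) x1 _ D x] by blast
  qed
  have "dv (\<Phi> m x) k l = dv (\<Phi> n x) k l" if D: "distinct [m, n, k, l, p]" and x: "x \<in> A m n" for m n k l p x
  proof -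
    consider "m = 0" | "n = 0" | "k = 0" | "l = 0" | "p = 0"
      using five_exhaust[OF D, of 0] by metis
    then show ?thesis
    proof cases
      case 1
      then show ?thesis using F0[of n k l p x] D x by simp
    next
      case 2
      have "distinct [0, m, k, l, p]" "x \<in> A 0 m"
        using 2 D x A_sym by auto
      then show ?thesis using F0[of m k l p x] 2 by simp
    next
      case 3
      show ?thesis by (rule both[of m n l p, OF _ D x]) (use 3 D in auto)
    next
      case 4
      show ?thesis by (rule both[of m n k p, OF _ D x]) (use 4 D in auto)
    next
      case 5
      show ?thesis by (rule both[of m n k l, OF _ D x]) (use 5 D in auto)
    qed
  qed
  then show ?thesis
    using F(1) by blast
qed

definition family :: "5 \<Rightarrow> 'a \<Rightarrow> 5 \<Rightarrow> 3" where
  "family = (SOME \<Phi>. (\<forall>m. nlab m (\<Phi> m)) \<and>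
    (\<forall>m n k l p x. distinct [m, n, k, l, p] \<longrightarrow> x \<in> A m n \<longrightarrow> dv (\<Phi> m x) k l = dv (\<Phi> n x) k l))"

lemma family:
  shows "labelling m (family m)"
    and "distinct [m, n, k, l, p] \<Longrightarrow> x \<in> A m n \<Longrightarrow> dv (family m x) k l = dv (family n x) k l"
proof -
  have *: "(\<forall>m. nlab m (family m)) \<and>
    (\<forall>m n k l p x. distinct [m, n, k, l, p] \<longrightarrow> x \<in> A m n \<longrightarrow> dv (family m x) k l = dv (family n x) k l)"
    unfolding family_def by (rule someI_ex[OF family_ex])
  show "labelling m (family m)"
    using * nlabD(1) by blast
  show "distinct [m, n, k, l, p] \<Longrightarrow> x \<in> A m n \<Longrightarrow> dv (family m x) k l = dv (family n x) k l"
    by (rule *[THEN conjunct2, rule_format])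
qed

text \<open>A vertex of \<open>A m n\<close> carries two labels, from \<open>family m\<close> and
  from \<open>family n\<close>. They agree on the coordinates outside \<open>m\<close> and
  \<open>n\<close>, so the choice is harmless for \<open>dv\<close> at these coordinates.\<close>

definition labA :: "'a \<Rightarrow> 5 \<Rightarrow> 3" where
  "labA x = family (SOME m. adj x (fr m)) x"

lemma labA_family:
  assumes d: "distinct [m, n, k, l, p]" and x: "x \<in> A m n"
  shows "dv (labA x) k l = dv (family m x) k l"
proof -
  have "m \<noteq> n"
    using d by auto
  then have "adj x (fr m)"
    using A_adj x by blast
  then have "adj x (fr (SOME m. adj x (fr m)))"
    by (rule someI)
  then have "(SOME m. adj x (fr m)) = m \<or> (SOME m. adj x (fr m)) = n"
    using A_adj[OF \<open>m \<noteq> n\<close> x] by blast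
  then show ?thesis
    unfolding labA_def using family(2)[OF d x] by auto
qed

lemma labA:
  assumes d: "distinct [m, n, k, l, p]" and x: "x \<in> A m n"
  shows "y \<in> A m p \<Longrightarrow> adj x y \<longleftrightarrow> dv (labA x) k l = dv (labA y) k l"
    "y \<in> A m n \<Longrightarrow> adj x y \<longleftrightarrow> pdd (labA x) (labA y) k l p"
    "y \<in> A m n \<Longrightarrow> dv (labA x) k l = dv (labA y) k l \<Longrightarrow> dv (labA x) k p = dv (labA y) k p \<Longrightarrow> x = y"
proof -
  have d': "distinct [m, n, k, p, l]" "distinct [m, n, l, p, k]" "distinct [m, p, k, l, n]"
    using d by auto
  note fx = labA_family[OF d] labA_family[OF d'(1)] labA_family[OF d'(2)]
  show "adj x y \<longleftrightarrow> dv (labA x) k l = dv (labA y) k l" if y: "y \<in> A m p"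
    using labellingD(1)[OF family(1) d x y] fx(1)[OF x] labA_family[OF d'(3) y] by simp
  show "adj x y \<longleftrightarrow> pdd (labA x) (labA y) k l p" if y: "y \<in> A m n"
    unfolding pdd_def fx[OF x] fx[OF y] using labellingD(2)[OF family(1) d x y] unfolding pdd_def .
  show "x = y" if y: "y \<in> A m n" "dv (labA x) k l = dv (labA y) k l" "dv (labA x) k p = dv (labA y) k p"
    by (rule labellingD(3)[OF family(1) d x y(1)]) (use y fx[OF x] fx[OF y(1)] in simp_all)
qed

lemma labA_surj:
  assumes d: "distinct [m, n, k, l, p]"
  shows "\<exists>x\<in>A m n. dv (labA x) k l = dv a k l \<and> dv (labA x) k p = dv a k p \<and> dv (labA x) l p = dv a l p"
proof -
  have d': "distinct [m, n, k, p, l]"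
    using d by auto
  obtain x where x: "x \<in> A m n" "dv (family m x) k l = dv a k l" "dv (family m x) k p = dv a k p"
    using labellingD(4)[OF family(1) d, of a] by blast
  then have "dv (labA x) k l = dv a k l" "dv (labA x) k p = dv a k p"
    using labA_family[OF d x(1)] labA_family[OF d' x(1)] by simp_all
  then show ?thesis
    using x(1) dv_split[of _ l p k] by metis
qed

text \<open>Each frame vertex yields exponents \<open>T m\<close> for \<open>w\<close>, meaningful
  off \<open>m\<close>. They agree wherever two of them are meaningful and come from a single
  function \<open>q\<close>.\<close>

lemma generic_label_ex:
  assumes w: "w \<in> generic"
  shows "\<exists>q. \<forall>m n k l p x. distinct [m, n, k, l, p] \<longrightarrow> x \<in> A m n \<longrightarrow> (adj w x \<longleftrightarrow> pdd (labA x) q k l p)"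
proof -
  have "\<exists>t. \<forall>n k l p x. distinct [m, n, k, l, p] \<longrightarrow> x \<in> A m n \<longrightarrow> (adj w x \<longleftrightarrow> pdd (labA x) t k l p)" for m
  proof -
    from labellingD(5)[OF family(1)[of m] w] obtain t where
      t: "\<forall>n k l p x. distinct [m, n, k, l, p] \<longrightarrow> x \<in> A m n \<longrightarrow> (adj w x \<longleftrightarrow> pdd (family m x) t k l p)" ..
    have "adj w x \<longleftrightarrow> pdd (labA x) t k l p" if d: "distinct [m, n, k, l, p]" and x: "x \<in> A m n" for n k l p x
    proof -
      have d': "distinct [m, n, k, p, l]" "distinct [m, n, l, p, k]"
        using d by auto
      show ?thesis
        unfolding pdd_def labA_family[OF d x] labA_family[OF d'(1) x] labA_family[OF d'(2) x]
        using t d x unfolding pdd_def by blast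
    qed
    then show ?thesis by blast
  qed
  then obtain T where "\<forall>m n k l p x. distinct [m, n, k, l, p] \<longrightarrow> x \<in> A m n \<longrightarrow> (adj w x \<longleftrightarrow> pdd (labA x) (T m) k l p)"
    using choice[of "\<lambda>m t. \<forall>n k l p x. distinct [m, n, k, l, p] \<longrightarrow> x \<in> A m n \<longrightarrow> (adj w x \<longleftrightarrow> pdd (labA x) t k l p)"] by blast
  then have T: "\<And>m n k l p x. distinct [m, n, k, l, p] \<Longrightarrow> x \<in> A m n \<Longrightarrow> adj w x \<longleftrightarrow> pdd (labA x) (T m) k l p"
    by blast
  have agree: "dv (T m) k l = dv (T n) k l" if d: "distinct [m, n, k, l, p]" for m n k l p
  proof -
    have d': "distinct [n, m, k, l, p]"
      using d by auto
    \<comment> \<open>A shift \<open>e\<close> with equal nonzero successive differences turns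
      \<open>T m\<close> into the label of a neighbour of \<open>w\<close>. That neighbour must also
      be recognised by \<open>T n\<close>, which excludes one value of the discrepancy.\<close>
    have ne: "dv (T m) k l - dv (T n) k l \<noteq> - dv e k l" if e: "dv e k l = dv e l p" "dv e k l \<noteq> 0" for e
    proof -
      obtain x where x: "x \<in> A m n" "dv (labA x) k l = dv (\<lambda>i. T m i + e i) k l" "dv (labA x) l p = dv (\<lambda>i. T m i + e i) l p"
        using labA_surj[OF d, of "\<lambda>i. T m i + e i"] by blast
      have s: "dv (\<lambda>i. T m i + e i) a b = dv (T m) a b + dv e a b" for a b
        by (simp add: dv_def)
      have "adj w x"
        unfolding T[OF d x(1)] pdd_iff x(2,3) s using e by simp
      then have "pdd (labA x) (T n) k l p"
        using T[OF d', of x] x(1) A_sym by blast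
      then have "dv (T m) k l + dv e k l \<noteq> dv (T n) k l"
        unfolding pdd_iff x(2,3) s by blast
      then show ?thesis
        by (auto simp: algebra_simps)
    qed
    have kl: "k \<noteq> l" "k \<noteq> p" "l \<noteq> p"
      using d by auto
    \<comment> \<open>The progression 0, 1, 2 along \<open>k\<close>, \<open>l\<close>,
      \<open>p\<close> and its negative exclude both nonzero discrepancies.\<close>
    define e :: "5 \<Rightarrow> 3" where "e i = (if i = l then 1 else if i = p then 2 else 0)" for i
    have e: "dv e k l = 2" "dv e l p = 2" "dv (\<lambda>i. - e i) k l = 1" "dv (\<lambda>i. - e i) l p = 1"
      using kl by (simp_all add: dv_def e_def)
    have "dv (T m) k l - dv (T n) k l \<noteq> 1" "dv (T m) k l - dv (T n) k l \<noteq> 2"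
      using ne[of e] ne[of "\<lambda>i. - e i"] e by auto
    then show ?thesis
      using three_cases[of "dv (T m) k l - dv (T n) k l"] by auto
  qed
  have agree': "dv (T m) k l = dv (T n) k l" if "m \<noteq> k" "m \<noteq> l" "n \<noteq> k" "n \<noteq> l" for m n k l
  proof (cases "m = n \<or> k = l")
    case True
    then show ?thesis by (auto simp: dv_def)
  next
    case False
    obtain p where "p \<noteq> m" "p \<noteq> n" "p \<noteq> k" "p \<noteq> l"
      using ex_other4[of m n k l] by blast
    then have "distinct [m, n, k, l, p]"
      using False that by auto
    then show ?thesis by (rule agree)
  qed
  define M where "M i = (SOME m. m \<noteq> i \<and> m \<noteq> (0::5))" for i
  have M: "M i \<noteq> i" "M i \<noteq> 0" for i
    using someI_ex[of "\<lambda>m. m \<noteq> i \<and> m \<noteq> (0::5)"] ex_other3[of i 0 0] unfolding M_def by blast+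
  \<comment> \<open>The coordinate 0 is the reference with exponent 0; \<open>M i\<close> is an
    index for which the ratio of the coordinates \<open>i\<close> and 0 is available.\<close>
  define q where "q i = dv (T (M i)) i 0" for i
  have q: "dv q k l = dv (T m) k l" if mk: "m \<noteq> k" "m \<noteq> l" for m k l
  proof -
    obtain n where n: "n \<noteq> k" "n \<noteq> l" "n \<noteq> 0"
      using ex_other3[of k l 0] by blast
    have "q k = dv (T n) k 0" "q l = dv (T n) l 0"
      unfolding q_def using agree'[OF M n(1,3)] agree'[OF M n(2,3)] by blast+
    then have "dv q k l = dv (T n) k l"
      by (simp add: dv_def)
    then show ?thesis
      using agree'[OF mk n(1,2)] by simp
  qed
  have "adj w x \<longleftrightarrow> pdd (labA x) q k l p" if d: "distinct [m, n, k, l, p]" and x: "x \<in> A m n" for m n k l p x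
  proof -
    have ne: "m \<noteq> k" "m \<noteq> l" "m \<noteq> p"
      using d by auto
    show ?thesis
      unfolding pdd_def q[OF ne(1,2)] q[OF ne(1,3)] q[OF ne(2,3)] using T[OF d x] unfolding pdd_def .
  qed
  then show ?thesis by blast
qed

definition lab :: "'a \<Rightarrow> 5 \<Rightarrow> 3" where
  "lab v = (if v \<in> generic
     then SOME q. \<forall>m n k l p x. distinct [m, n, k, l, p] \<longrightarrow> x \<in> A m n \<longrightarrow> (adj v x \<longleftrightarrow> pdd (labA x) q k l p)
     else labA v)"

lemma lab_A: "x \<in> A m n \<Longrightarrow> lab x = labA x"
  unfolding lab_def generic_def A_def by auto

lemma lab_generic:
  assumes "w \<in> generic" and d: "distinct [m, n, k, l, p]" and x: "x \<in> A m n"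
  shows "adj w x \<longleftrightarrow> pdd (lab x) (lab w) k l p"
proof -
  have "\<forall>m n k l p x. distinct [m, n, k, l, p] \<longrightarrow> x \<in> A m n \<longrightarrow> (adj w x \<longleftrightarrow> pdd (labA x) (lab w) k l p)"
    using someI_ex[OF generic_label_ex[OF assms(1)]] assms(1) unfolding lab_def by simp
  then show ?thesis
    unfolding lab_A[OF x] using d x by blast
qed

lemma lab:
  assumes "distinct [m, n, k, l, p]" "x \<in> A m n"
  shows "y \<in> A m p \<Longrightarrow> adj x y \<longleftrightarrow> dv (lab x) k l = dv (lab y) k l"
    "y \<in> A m n \<Longrightarrow> adj x y \<longleftrightarrow> pdd (lab x) (lab y) k l p"
    "y \<in> A m n \<Longrightarrow> dv (lab x) k l = dv (lab y) k l \<Longrightarrow> dv (lab x) k p = dv (lab y) k p \<Longrightarrow> x = y"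
  using labA[OF assms] lab_A assms(2) by simp_all

lemma lab_surj:
  assumes "distinct [m, n, k, l, p]"
  shows "\<exists>x\<in>A m n. dv (lab x) k l = dv a k l \<and> dv (lab x) k p = dv a k p \<and> dv (lab x) l p = dv a l p"
  using labA_surj[OF assms, of a] lab_A by metis

end

section \<open>Sums of powers of a primitive element of GF(4)\<close>

definition pw :: "3 \<Rightarrow> gf4" where
  "pw a = (if a = 0 then G1 else if a = 1 then Gw else Gw1)"

lemma pw_simps [simp]: "pw 0 = G1" "pw 1 = Gw" "pw 2 = Gw1"
  by (simp_all add: pw_def)

lemma gf4_add_simps:
  "G0 + x = x" "x + G0 = x" "x + x = G0" "G1 + Gw = Gw1" "Gw + G1 = Gw1" "G1 + Gw1 = Gw" "Gw1 + G1 = Gw" "Gw + Gw1 = G1" "Gw1 + Gw = G1"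
  by (cases x; simp add: plus_gf4_def gf4_add_def)+

lemma gf4_mult_simps:
  "G0 * x = G0" "x * G0 = G0" "G1 * x = x" "x * G1 = x" "Gw * Gw = Gw1" "Gw * Gw1 = G1" "Gw1 * Gw = G1" "Gw1 * Gw1 = Gw"
  by (cases x; simp add: times_gf4_def gf4_mul_def)+

lemma gf4_zero_iff: "(x::gf4) = 0 \<longleftrightarrow> x = G0"
  by (simp add: zero_gf4_def)

lemma gf4_one: "(1::gf4) = G1"
  by (simp add: one_gf4_def)

lemma gf4_mult_eq_0: "(x::gf4) * y = 0 \<longleftrightarrow> x = 0 \<or> y = 0"
  by (cases x; cases y; simp add: gf4_zero_iff gf4_mult_simps)

lemma gf4_conj_eq_0: "gf4_conj x = 0 \<longleftrightarrow> x = 0"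
  unfolding gf4_conj_def by (simp add: gf4_mult_eq_0)

lemma gf4_conj_add: "gf4_conj (x + y) = gf4_conj x + gf4_conj y"
  unfolding gf4_conj_def by (cases x; cases y; simp add: gf4_add_simps gf4_mult_simps)

lemma gf4_conj_mult: "gf4_conj (x * y) = gf4_conj x * gf4_conj y"
  unfolding gf4_conj_def by (simp add: mult_ac)

lemma gf4_conj_conj: "gf4_conj (gf4_conj x) = x"
  unfolding gf4_conj_def by (cases x; simp add: gf4_mult_simps)

lemma gf4_norm: "x \<noteq> 0 \<Longrightarrow> x * gf4_conj x = 1"
  unfolding gf4_conj_def by (cases x; simp add: gf4_zero_iff gf4_one gf4_mult_simps)

lemma pw_nonzero: "pw a \<noteq> 0"
  by (simp add: pw_def gf4_zero_iff)

lemma pw_inj: "pw a = pw b \<longleftrightarrow> a = b"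
  using three_cases[of a] three_cases[of b] by auto

lemma pw_ex: "x \<noteq> 0 \<Longrightarrow> \<exists>a. x = pw a"
  by (cases x) (use pw_simps in \<open>metis gf4_zero_iff\<close>)+

lemma pw_add: "pw a * pw b = pw (a + b)"
  using three_cases[of a] three_cases[of b] by (auto simp: pw_def gf4_mult_simps)

lemma pw_diff: "pw a * gf4_conj (pw b) = pw (a - b)"
  using three_cases[of a] three_cases[of b] by (auto simp: pw_def gf4_conj_def gf4_mult_simps)

lemma pw_sum2: "pw a + pw b = 0 \<longleftrightarrow> a = b"
  using three_cases[of a] three_cases[of b] by (auto simp: gf4_add_simps gf4_zero_iff)

lemma pw_sum3: "pw a + pw b + pw c = 0 \<longleftrightarrow> a \<noteq> b \<and> a \<noteq> c \<and> b \<noteq> c"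
  using three_cases[of a] three_cases[of b] three_cases[of c] by (auto simp: gf4_add_simps gf4_zero_iff)

lemma z3_arith: "(x::3) - y = y - z \<Longrightarrow> x + y + z = 0"
  using three_cases[of x] three_cases[of y] three_cases[of z] by auto

lemma z3_double: "- ((x::3) + y) = x \<longleftrightarrow> x = y" "- ((x::3) + y) = y \<longleftrightarrow> x = y"
  using three_cases[of x] three_cases[of y] by auto

text \<open>The hypotheses are what adjacency of two generic vertices provides: each difference of
  exponents has a partner whose sum with it is the total \<open>s\<close>, and no four are equal.
  They leave only the distribution 3, 1, 1 among the three powers, for which the sum is the sum of
  all nonzero elements.\<close>

lemma pw_sum5:
  assumes "a + b = s \<or> a + c = s \<or> a + d = s \<or> a + e = s" "b + a = s \<or> b + c = s \<or> b + d = s \<or> b + e = s"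
    "c + a = s \<or> c + b = s \<or> c + d = s \<or> c + e = s" "d + a = s \<or> d + b = s \<or> d + c = s \<or> d + e = s"
    "e + a = s \<or> e + b = s \<or> e + c = s \<or> e + d = s" and s: "s = a + b + c + d + e"
    and n: "\<not> (a = b \<and> a = c \<and> a = d)" "\<not> (a = b \<and> a = c \<and> a = e)" "\<not> (a = b \<and> a = d \<and> a = e)"
    "\<not> (a = c \<and> a = d \<and> a = e)" "\<not> (b = c \<and> b = d \<and> b = e)"
  shows "pw a + pw b + pw c + pw d + pw e = 0"
proof -
  define b' c' d' e' where "b' = b - a" and "c' = c - a" and "d' = d - a" and "e' = e - a"
  have x: "b = a + b'" "c = a + c'" "d = a + d'" "e = a + e'"
    by (simp_all add: b'_def c'_def d'_def e'_def)
  \<comment> \<open>After translation by \<open>a\<close> the first exponent is 0 and the others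
    range over 81 cases. The total changes by five times \<open>a\<close>, which is
    \<open>- a\<close> modulo 3.\<close>
  have s': "s = (b' + c' + d' + e') - a"
  proof -
    have "a + a + a = 0"
      using three_cases[of a] by auto
    then have "(a + a + a) + (a + a) = - a"
      using three_cases[of a] by auto
    then have "a + (a + b') + (a + c') + (a + d') + (a + e') = - a + (b' + c' + d' + e')"
      by (metis (no_types) add.assoc add.commute add.left_commute)
    then show ?thesis
      unfolding s x by simp
  qed
  define t where "t = b' + c' + d' + e'"
  have h: "b' = t \<or> c' = t \<or> d' = t \<or> e' = t" "b' = t \<or> b' + c' = t \<or> b' + d' = t \<or> b' + e' = t"
    "c' = t \<or> c' + b' = t \<or> c' + d' = t \<or> c' + e' = t" "d' = t \<or> d' + b' = t \<or> d' + c' = t \<or> d' + e' = t"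
    "e' = t \<or> e' + b' = t \<or> e' + c' = t \<or> e' + d' = t"
  proof -
    have q: "(a + z) + (a + y) = t - a \<longleftrightarrow> z + y = t" "(a + z) + a = t - a \<longleftrightarrow> z = t" "a + (a + z) = t - a \<longleftrightarrow> z = t" for y z
      using three_cases[of a] three_cases[of t] three_cases[of y] three_cases[of z] by auto
    show "b' = t \<or> c' = t \<or> d' = t \<or> e' = t" "b' = t \<or> b' + c' = t \<or> b' + d' = t \<or> b' + e' = t"
      "c' = t \<or> c' + b' = t \<or> c' + d' = t \<or> c' + e' = t" "d' = t \<or> d' + b' = t \<or> d' + c' = t \<or> d' + e' = t"
      "e' = t \<or> e' + b' = t \<or> e' + c' = t \<or> e' + d' = t"
      using assms(1-5) unfolding s' t_def[symmetric] x q by blast+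
  qed
  have n': "\<not> (b' = 0 \<and> c' = 0 \<and> d' = 0)" "\<not> (b' = 0 \<and> c' = 0 \<and> e' = 0)" "\<not> (b' = 0 \<and> d' = 0 \<and> e' = 0)"
    "\<not> (c' = 0 \<and> d' = 0 \<and> e' = 0)" "\<not> (b' = c' \<and> b' = d' \<and> b' = e')"
    using n unfolding x by auto
  have "pw 0 + pw b' + pw c' + pw d' + pw e' = 0"
    using three_cases[of b'] three_cases[of c'] three_cases[of d'] three_cases[of e'] h n' unfolding t_def
    by (elim disjE[of "b' = 0"] disjE[of "b' = 1"] disjE[of "c' = 0"] disjE[of "c' = 1"]
      disjE[of "d' = 0"] disjE[of "d' = 1"] disjE[of "e' = 0"] disjE[of "e' = 1"])
      (simp_all add: gf4_add_simps gf4_zero_iff)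
  then have "pw a * (pw 0 + pw b' + pw c' + pw d' + pw e') = 0"
    by simp
  then show ?thesis
    unfolding distrib_left pw_add x by simp
qed

definition pattern311 :: "(5 \<Rightarrow> 3) \<Rightarrow> 5 \<Rightarrow> 5 \<Rightarrow> 5 \<Rightarrow> 5 \<Rightarrow> 5 \<Rightarrow> bool" where
  "pattern311 f k l p m n \<longleftrightarrow> f k = f l \<and> f k = f p \<and> f k \<noteq> f m \<and> f k \<noteq> f n \<and> f m \<noteq> f n"

text \<open>A sum of powers vanishes iff the three powers occur with the same parity. With five
  terms all three counts are odd, so they are 3, 1, 1.\<close>

lemma pw_sum5_pattern:
  assumes "pw (f 0) + pw (f 1) + pw (f 2) + pw (f 3) + pw (f 4) = 0"
  shows "pattern311 f 0 1 2 3 4 \<or> pattern311 f 0 1 3 2 4 \<or> pattern311 f 0 1 4 2 3 \<or> pattern311 f 0 2 3 1 4 \<or>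
    pattern311 f 0 2 4 1 3 \<or> pattern311 f 0 3 4 1 2 \<or> pattern311 f 1 2 3 0 4 \<or> pattern311 f 1 2 4 0 3 \<or>
    pattern311 f 1 3 4 0 2 \<or> pattern311 f 2 3 4 0 1"
  using three_cases[of "f 0"] three_cases[of "f 1"] three_cases[of "f 2"] three_cases[of "f 3"] three_cases[of "f 4"] assms
  unfolding pattern311_def by (elim disjE) (simp_all add: gf4_add_simps gf4_zero_iff)

lemma diff_cross:
  fixes x :: "'b::ab_group_add"
  assumes "x - a = y - b" "x - c = y - d"
  shows "a - c = b - d"
proof -
  have "a - c = (x - c) - (x - a)" by simp
  also have "\<dots> = b - d" unfolding assms by simp
  finally show ?thesis .
qed

lemma diff_solve:
  fixes p :: "'b::ab_group_add"
  assumes "p - q = r - s"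
  shows "s = (r - p) + q"
proof -
  have "s = r - (r - s)" by simp
  also have "\<dots> = (r - p) + q" unfolding assms[symmetric] by simp
  finally show ?thesis .
qed

lemma sum5:
  fixes f :: "5 \<Rightarrow> 'b::comm_monoid_add"
  assumes "distinct [m, n, k, l, p]"
  shows "sum f UNIV = f m + f n + f k + f l + f p"
proof -
  have U: "UNIV = {m, n, k, l, p}"
    using five_exhaust[OF assms] by blast
  show ?thesis
    unfolding U using assms by (simp add: add.assoc)
qed

lemma five_distinct: "distinct [0, 1, 2, 3, 4 :: 5]"
  by simp

section \<open>Generic vertices: uniqueness, adjacency and existence\<close>

context based_frame
begin

lemma agree_nbrs:
  assumes w: "w \<in> generic" "w' \<in> generic" and e: "\<And>i j. i \<noteq> m \<Longrightarrow> j \<noteq> m \<Longrightarrow> dv (lab w) i j = dv (lab w') i j"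
    and x: "x \<in> A m n" "m \<noteq> n"
  shows "adj w x \<longleftrightarrow> adj w' x"
proof -
  obtain k l p where d: "distinct [m, n, k, l, p]"
    using ex_rest3[OF x(2)] by blast
  then have "k \<noteq> m" "l \<noteq> m" "p \<noteq> m" by auto
  then show ?thesis
    unfolding lab_generic[OF w(1) d x(1)] lab_generic[OF w(2) d x(1)] pdd_def by (simp add: e)
qed

text \<open>Vertices agreeing off \<open>m\<close> have the same neighbours around
  \<open>fr m\<close>. If they were adjacent, the end vertices of a path from
  \<open>generic_path\<close> would be common neighbours of a triangle and thus adjacent.\<close>

lemma adj_not_agree:
  assumes w: "w \<in> generic" "w' \<in> generic" and a: "adj w w'"
    and e: "\<And>i j. i \<noteq> m \<Longrightarrow> j \<noteq> m \<Longrightarrow> dv (lab w) i j = dv (lab w') i j"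
  shows False
proof -
  obtain n where n: "m \<noteq> n"
    using ex_other3[of m m m] by metis
  obtain k where k: "k \<noteq> m" "k \<noteq> n"
    using ex_other3[of m n n] by blast
  have d: "distinct [m, n, k]"
    using n k by auto
  obtain i i' j where i: "i \<in> A m n" "i' \<in> A m n" "j \<in> A m k" "adj w i" "adj w i'" "adj w j" "adj i i'" "adj i j" "\<not> adj i' j"
    using generic_path[OF w(1) d] by blast
  have mk: "m \<noteq> k"
    using k by simp
  have s: "adj w' i" "adj w' i'" "adj w' j"
    using agree_nbrs[OF w e i(1) n] agree_nbrs[OF w e i(2) n] agree_nbrs[OF w e i(3) mk] i(4-6) by blast+
  have "i' \<noteq> j"
    using A_adj[OF n i(2), of n] A_adj[OF mk i(3), of n] n k by auto
  then show False
    using triangle_nbrs[OF a i(4) s(1) i(5) s(2) i(7) i(6) s(3) i(8)] i(9) by blast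
qed

text \<open>Distinct vertices with the same label would have common neighbours \<open>i\<close>,
  \<open>i'\<close> and \<open>z\<close>, with \<open>i\<close> and \<open>i'\<close> adjacent and
  \<open>z\<close> adjacent to neither, which \<open>bip\<close> excludes.\<close>

lemma lab_generic_inj:
  assumes w: "w \<in> generic" "w' \<in> generic" and e: "\<And>i j. dv (lab w) i j = dv (lab w') i j"
  shows "w = w'"
proof (rule ccontr)
  assume ne: "w \<noteq> w'"
  have na: "\<not> adj w w'"
    using adj_not_agree[OF w] e by blast
  obtain k l p :: 5 where d: "distinct [0, 1, k, l, p]"
    using ex_rest3[of 0 1] by auto
  have d3: "distinct [0, 1, k]" "distinct [0, 1, k, l]" and kl: "k \<noteq> l" "(0::5) \<noteq> 1"
    using d by auto
  obtain i i' where i: "i \<in> A 0 1" "i' \<in> A 0 1" "adj w i" "adj w i'" "adj i i'"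
    using generic_path[OF w(1) d3(1)] by blast
  obtain z where z: "z \<in> A k l" "adj w z"
    using generic_near[OF w(1) kl(1)] by blast
  have s: "adj w' i" "adj w' i'" "adj w' z"
    using agree_nbrs[OF w e i(1) kl(2)] agree_nbrs[OF w e i(2) kl(2)] agree_nbrs[OF w e z(1) kl(1)] i z by blast+
  have n: "\<not> adj i z" "\<not> adj i' z"
    using A_disjoint_nonadj[OF d3(2) i(1) z(1)] A_disjoint_nonadj[OF d3(2) i(2) z(1)] by blast+
  have "i \<noteq> z"
    using A_adj[OF kl(2) i(1), of k] A_adj[OF kl(1) z(1), of k] d by auto
  then show False
    using bip[OF ne na i(3) s(1) i(4) s(2) z(2) s(3) i(5) n(1)] n(2) by blast
qed

lemma adj_generic_sum:
  assumes w: "w \<in> generic" "w' \<in> generic" and a: "adj w w'"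
  shows "\<exists>n. n \<noteq> m \<and> (lab w m - lab w' m) + (lab w n - lab w' n) = (\<Sum>i\<in>UNIV. lab w i - lab w' i)"
proof -
  note wf = generic_adj[OF w(1)] and wf' = generic_adj[OF w(2)]
  obtain b where b: "adj w b" "adj (fr m) b"
    using common_nbr[OF wf(5) fr_V wf(3,1)] by blast
  \<comment> \<open>The common neighbours of \<open>w\<close> and \<open>fr m\<close> dominate
    \<open>w'\<close>, which gives a vertex of some \<open>A m n\<close> adjacent to both
    \<open>w\<close> and \<open>w'\<close>. The three differences at its nonzero coordinates then
    sum to 0.\<close>
  obtain z where z: "adj w z" "adj (fr m) z" "z = w' \<or> adj z w'"
    using cover[OF wf(3,1) b a] by blast
  have zw: "adj w' z"
    using z wf'(2) adj_sym by blast
  have zm: "adj z (fr m)" "z \<in> V"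
    using z(2) adj_sym adj_V by blast+
  have "z \<notin> generic" "z \<notin> range fr"
    using zm generic_adj(1)[of z m] wf(1) z(1) by blast+
  then obtain c n where "c \<noteq> n" "z \<in> A c n"
    using vertex_cases[OF zm(2)] by blast
  then have "\<exists>n. m \<noteq> n \<and> z \<in> A m n"
    using A_adj[of c n z m] zm(1) A_sym by metis
  then obtain n where n: "m \<noteq> n" "z \<in> A m n" by blast
  obtain k l p where d: "distinct [m, n, k, l, p]"
    using ex_rest3[OF n(1)] by blast
  have "dv (lab z) k l - dv (lab w) k l = dv (lab z) l p - dv (lab w) l p"
    "dv (lab z) k l - dv (lab w') k l = dv (lab z) l p - dv (lab w') l p"
    using lab_generic[OF w(1) d n(2)] lab_generic[OF w(2) d n(2)] z(1) zw unfolding pdd_iff by blast+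
  then have "dv (lab w) k l - dv (lab w') k l = dv (lab w) l p - dv (lab w') l p"
    by (rule diff_cross)
  then have "(lab w k - lab w' k) - (lab w l - lab w' l) = (lab w l - lab w' l) - (lab w p - lab w' p)"
    by (simp add: dv_def algebra_simps)
  from z3_arith[OF this] have "(\<Sum>i\<in>UNIV. lab w i - lab w' i) = (lab w m - lab w' m) + (lab w n - lab w' n)"
    unfolding sum5[OF d] by (simp add: add.assoc)
  then show ?thesis
    using n(1) by metis
qed

lemma dv_agree_iff: "(\<forall>i j. i \<noteq> m \<longrightarrow> j \<noteq> m \<longrightarrow> dv a i j = dv b i j) \<longleftrightarrow> (\<forall>i j. i \<noteq> m \<longrightarrow> j \<noteq> m \<longrightarrow> a i - b i = a j - b j)"
  unfolding dv_eq_iff ..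

lemma adj_generic_pw:
  assumes w: "w \<in> generic" "w' \<in> generic" and a: "adj w w'"
  shows "(\<Sum>i\<in>UNIV. pw (lab w i - lab w' i)) = 0"
proof -
  define f where "f i = lab w i - lab w' i" for i
  define s where "s = sum f UNIV"
  have E: "f m + f 0 = s \<and> m \<noteq> 0 \<or> f m + f 1 = s \<and> m \<noteq> 1 \<or> f m + f 2 = s \<and> m \<noteq> 2 \<or> f m + f 3 = s \<and> m \<noteq> 3 \<or> f m + f 4 = s \<and> m \<noteq> 4" for m
  proof -
    obtain n where "n \<noteq> m" "f m + f n = s"
      using adj_generic_sum[OF w a, of m] unfolding f_def s_def by blast
    then show ?thesis
      using five_cases[of n] by auto
  qed
  have N: "\<not> (\<forall>i j. i \<noteq> m \<longrightarrow> j \<noteq> m \<longrightarrow> f i = f j)" for m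
  proof
    assume "\<forall>i j. i \<noteq> m \<longrightarrow> j \<noteq> m \<longrightarrow> f i = f j"
    then have "\<forall>i j. i \<noteq> m \<longrightarrow> j \<noteq> m \<longrightarrow> dv (lab w) i j = dv (lab w') i j"
      unfolding dv_agree_iff f_def .
    then show False
      using adj_not_agree[OF w a] by blast
  qed
  have N4: "\<not> (f n = f k \<and> f n = f l \<and> f n = f p)" if d: "distinct [m, n, k, l, p]" for m n k l p
  proof
    assume e: "f n = f k \<and> f n = f l \<and> f n = f p"
    have "f i = f n" if "i \<noteq> m" for i
      using five_exhaust[OF d, of i] that e by auto
    then show False
      using N[of m] by metis
  qed
  have "pw (f 0) + pw (f 1) + pw (f 2) + pw (f 3) + pw (f 4) = 0"
  proof (rule pw_sum5[of _ _ s])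
    show "s = f 0 + f 1 + f 2 + f 3 + f 4"
      unfolding s_def by (rule sum5[OF five_distinct])
  qed (use E[of 0] E[of 1] E[of 2] E[of 3] E[of 4] in \<open>simp; blast\<close>,
       use E[of 0] E[of 1] E[of 2] E[of 3] E[of 4] in \<open>simp; blast\<close>,
       use E[of 0] E[of 1] E[of 2] E[of 3] E[of 4] in \<open>simp; blast\<close>,
       use E[of 0] E[of 1] E[of 2] E[of 3] E[of 4] in \<open>simp; blast\<close>,
       use E[of 0] E[of 1] E[of 2] E[of 3] E[of 4] in \<open>simp; blast\<close>,
       rule N4[of 4], simp, rule N4[of 3], simp, rule N4[of 2], simp, rule N4[of 1], simp, rule N4[of 0], simp)
  then show ?thesis
    unfolding sum5[OF five_distinct] f_def .
qed

text \<open>It suffices to find a triangle in the common neighbourhood of \<open>w\<close> and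
  \<open>w'\<close>, since common neighbours of a triangle are adjacent. Its vertices are taken in
  \<open>A p l\<close>, \<open>A p k\<close> and \<open>A k l\<close>.\<close>

lemma pattern_adj:
  assumes w: "w \<in> generic" "w' \<in> generic" and d: "distinct [k, l, p, m, n]"
    and P: "pattern311 (\<lambda>i. lab w i - lab w' i) k l p m n"
  shows "adj w w'"
proof -
  \<comment> \<open>In Z/3 the third element besides two distinct \<open>a\<close>, \<open>b\<close>
    is \<open>- (a + b)\<close>. So \<open>c\<close> avoids both labels wherever the differences of
    \<open>w\<close> and \<open>w'\<close> are unequal.\<close>
  define c where "c i = - (lab w i + lab w' i)" for i
  have dc: "dv c i j = - (dv (lab w) i j + dv (lab w') i j)" for i j
    by (simp add: dv_def c_def)
  have ne: "dv c i j \<noteq> dv (lab w) i j" "dv c i j \<noteq> dv (lab w') i j"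
    if "lab w i - lab w' i \<noteq> lab w j - lab w' j" for i j
    using that z3_double[of "dv (lab w) i j" "dv (lab w') i j"] unfolding dc dv_eq_iff[symmetric] by blast+
  have ex: "\<exists>z\<in>A a b. dv (lab z) m n = dv c m n \<and> adj w z \<and> adj w' z"
    if D: "distinct [a, b, m, n, i]" and q: "lab w m - lab w' m \<noteq> lab w n - lab w' n" "lab w m - lab w' m \<noteq> lab w i - lab w' i"
      "lab w n - lab w' n \<noteq> lab w i - lab w' i" for a b i
  proof -
    obtain z where z: "z \<in> A a b" "dv (lab z) m n = dv c m n" "dv (lab z) m i = dv c m i" "dv (lab z) n i = dv c n i"
      using lab_surj[OF D, of c] by blast
    have "adj w z" "adj w' z"
      unfolding lab_generic[OF w(1) D z(1)] lab_generic[OF w(2) D z(1)] pdd_def z(2-4)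
      using ne[OF q(1)] ne[OF q(2)] ne[OF q(3)] by blast+
    then show ?thesis using z by blast
  qed
  have q: "lab w k - lab w' k = lab w l - lab w' l" "lab w k - lab w' k = lab w p - lab w' p"
    "lab w k - lab w' k \<noteq> lab w m - lab w' m" "lab w k - lab w' k \<noteq> lab w n - lab w' n" "lab w m - lab w' m \<noteq> lab w n - lab w' n"
    using P unfolding pattern311_def by blast+
  have D: "distinct [p, l, m, n, k]" "distinct [p, k, m, n, l]" "distinct [k, l, m, n, p]" "distinct [l, p, m, n, k]" "distinct [k, p, m, n, l]"
    "distinct [l, k, m, n, p]"
    using d by auto
  obtain x where x: "x \<in> A p l" "dv (lab x) m n = dv c m n" "adj w x" "adj w' x"
    using ex[OF D(1)] q by metis
  obtain y where y: "y \<in> A p k" "dv (lab y) m n = dv c m n" "adj w y" "adj w' y"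
    using ex[OF D(2)] q by metis
  obtain z where z: "z \<in> A k l" "dv (lab z) m n = dv c m n" "adj w z" "adj w' z"
    using ex[OF D(3)] q by metis
  have s: "x \<in> A l p" "y \<in> A k p" "z \<in> A l k"
    using x y z A_sym by blast+
  have "adj x y"
    using lab(1)[OF D(1) x(1) y(1)] x(2) y(2) by simp
  moreover have "adj x z"
    using lab(1)[OF D(4) s(1) s(3)] x(2) z(2) by simp
  moreover have "adj y z"
    using lab(1)[OF D(5) s(2) z(1)] y(2) z(2) by simp
  moreover have "w \<noteq> w'"
    using q(3) by auto
  ultimately show ?thesis
    using triangle_nbrs[of x y z w w'] x y z adj_sym by blast
qed

text \<open>A triangle of the kind used in \<open>pattern_adj\<close> is completed to a 5-clique.
  Its two new members are generic and, up to a constant, have label \<open>c + e\<close> or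
  \<open>c - e\<close>; being distinct they cannot share a label, so one has \<open>c + e\<close>,
  which is \<open>q\<close>.\<close>

lemma lab_generic_surj: "\<exists>w\<in>generic. \<forall>i j. dv (lab w) i j = dv q i j"
proof -
  obtain k l p m n :: 5 where d: "distinct [k, l, p, m, n]"
    using five_distinct by blast
  have ne: "m \<noteq> n" "m \<noteq> k" "m \<noteq> l" "m \<noteq> p" "n \<noteq> k" "n \<noteq> l" "n \<noteq> p" "k \<noteq> l" "k \<noteq> p" "l \<noteq> p"
    using d by auto
  define e :: "5 \<Rightarrow> 3" where "e i = (if i = m then 1 else if i = n then 2 else 0)" for i
  define c where "c i = q i - e i" for i
  have D: "distinct [p, l, m, n, k]" "distinct [p, k, m, n, l]" "distinct [k, l, m, n, p]" "distinct [l, p, m, n, k]" "distinct [k, p, m, n, l]"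
    using d by auto
  obtain x where x: "x \<in> A p l" "dv (lab x) m n = dv c m n" "dv (lab x) m k = dv c m k" "dv (lab x) n k = dv c n k"
    using lab_surj[OF D(1), of c] by blast
  obtain y where y: "y \<in> A p k" "dv (lab y) m n = dv c m n" "dv (lab y) m l = dv c m l" "dv (lab y) n l = dv c n l"
    using lab_surj[OF D(2), of c] by blast
  obtain z where z: "z \<in> A k l" "dv (lab z) m n = dv c m n" "dv (lab z) m p = dv c m p" "dv (lab z) n p = dv c n p"
    using lab_surj[OF D(3), of c] by blast
  have s: "x \<in> A l p" "y \<in> A k p" "z \<in> A l k"
    using x y z A_sym by blast+
  have xyz: "adj x y" "adj x z" "adj y z"
    using lab(1)[OF D(1) x(1) y(1)] lab(1)[OF D(4) s(1) s(3)] lab(1)[OF D(5) s(2) z(1)] x(2) y(2) z(2) by simp_all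
  obtain v v' where v: "clique5 x y z v v'"
    using triangle_common[OF xyz] by blast
  \<comment> \<open>A nongeneric vertex adjacent to all three would lie in one of the same three
    sets \<open>A\<close>, because disjoint index pairs exclude adjacency. There the ratio at
    \<open>m\<close>, \<open>n\<close> would have to be both equal to and different from that of
    \<open>c\<close>.\<close>
  have gen: "u \<in> generic" if u: "adj x u" "adj y u" "adj z u" for u
  proof -
    have "u \<notin> range fr"
    proof
      assume "u \<in> range fr"
      then obtain i where "u = fr i" by blast
      then show False
        using u A_adj[OF _ x(1), of i] A_adj[OF _ y(1), of i] A_adj[OF _ z(1), of i] ne by metis
    qed
    moreover have "u \<notin> A a b" if ab: "a \<noteq> b" for a b
    proof
      assume ua: "u \<in> A a b"
      have meet: "a = i \<or> a = j \<or> b = i \<or> b = j" if "t \<in> A i j" "adj t u" "i \<noteq> j" for t i j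
        using A_disjoint_nonadj[of i j a b t u] that ua ab by auto
      have "(a = p \<or> a = l \<or> b = p \<or> b = l) \<and> (a = p \<or> a = k \<or> b = p \<or> b = k) \<and> (a = k \<or> a = l \<or> b = k \<or> b = l)"
        using meet[OF x(1) u(1)] meet[OF y(1) u(2)] meet[OF z(1) u(3)] ne by metis
      then have "a = p \<and> b = l \<or> a = l \<and> b = p \<or> a = p \<and> b = k \<or> a = k \<and> b = p \<or> a = k \<and> b = l \<or> a = l \<and> b = k"
        using ab ne by metis
      then have "u \<in> A p l \<or> u \<in> A p k \<or> u \<in> A k l"
        using ua ua[unfolded A_sym[of a b]] by (elim disjE conjE) simp_all
      moreover have "u \<notin> A p l"
      proof
        assume ul: "u \<in> A p l"
        have "dv (lab u) m n = dv (lab y) m n"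
          using lab(1)[OF D(1) ul y(1)] u(2) adj_sym by blast
        then show False
          using lab(2)[OF D(1) x(1) ul] u(1) x(2) y(2) unfolding pdd_def by simp
      qed
      moreover have "u \<notin> A p k"
      proof
        assume ul: "u \<in> A p k"
        have "dv (lab u) m n = dv (lab x) m n"
          using lab(1)[OF D(2) ul x(1)] u(1) adj_sym by blast
        then show False
          using lab(2)[OF D(2) y(1) ul] u(2) x(2) y(2) unfolding pdd_def by simp
      qed
      moreover have "u \<notin> A k l"
      proof
        assume ul: "u \<in> A k l"
        have "dv (lab u) m n = dv (lab y) m n"
          using lab(1)[OF D(3) ul s(2)] u(2) adj_sym by blast
        then show False
          using lab(2)[OF D(3) z(1) ul] u(3) z(2) y(2) unfolding pdd_def by simp
      qed
      ultimately show False by blast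
    qed
    moreover have "u \<in> V"
      using u(1) adj_sym adj_V by blast
    ultimately show ?thesis
      using vertex_cases by blast
  qed
  have lb: "(\<forall>i j. dv (lab u) i j = dv (\<lambda>i. c i + e i) i j) \<or> (\<forall>i j. dv (lab u) i j = dv (\<lambda>i. c i - e i) i j)"
    if u: "adj x u" "adj y u" "adj z u" for u
  proof -
    define h where "h i = lab u i - c i" for i
    have hd: "h i \<noteq> h j" if "dv c i j \<noteq> dv (lab u) i j" for i j
      using that unfolding h_def dv_eq_iff by (auto simp: algebra_simps)
    have ug: "u \<in> generic"
      using gen[OF u] .
    have "adj u x" "adj u y" "adj u z"
      using u adj_sym by blast+
    then have "pdd (lab x) (lab u) m n k" "pdd (lab y) (lab u) m n l" "pdd (lab z) (lab u) m n p"
      using lab_generic[OF ug D(1) x(1)] lab_generic[OF ug D(2) y(1)] lab_generic[OF ug D(3) z(1)] by blast+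
    then have hh: "h m \<noteq> h n" "h m \<noteq> h k" "h n \<noteq> h k" "h m \<noteq> h l" "h n \<noteq> h l" "h m \<noteq> h p" "h n \<noteq> h p"
      unfolding pdd_def x(2-4) y(2-4) z(2-4) using hd by blast+
    have third: "r = t" if "(a::3) \<noteq> b" "a \<noteq> r" "b \<noteq> r" "a \<noteq> t" "b \<noteq> t" for a b r t
      using that three_cases[of a] three_cases[of b] three_cases[of r] three_cases[of t] by auto
    have hk: "h l = h k" "h p = h k"
      using third[of "h m" "h n"] hh by blast+
    have "h m - h k = 1 \<and> h n - h k = 2 \<or> h m - h k = 2 \<and> h n - h k = 1"
      using hh(1-3) three_cases[of "h m"] three_cases[of "h n"] three_cases[of "h k"] by auto
    then have cases: "(\<forall>i. h i = h k + e i) \<or> (\<forall>i. h i = h k - e i)"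
    proof (elim disjE conjE)
      assume a: "h m - h k = 1" "h n - h k = 2"
      have "h i = h k + e i" for i
        using five_exhaust[OF d, of i] a hk ne by (elim disjE) (auto simp: e_def algebra_simps)
      then show ?thesis by blast
    next
      assume a: "h m - h k = 2" "h n - h k = 1"
      have m1: "(2::3) = - 1" "(1::3) = - 2" by simp_all
      have "h m = h k - 1" "h n = h k - 2"
        using a m1 by (metis add_uminus_conv_diff diff_add_cancel add.commute)+
      then have "h i = h k - e i" for i
        using five_exhaust[OF d, of i] hk ne by (elim disjE) (auto simp: e_def)
      then show ?thesis by blast
    qed
    have lu: "lab u i = c i + h i" for i
      by (simp add: h_def)
    show ?thesis
      using cases
    proof
      assume H: "\<forall>i. h i = h k + e i"
      have "dv (lab u) i j = dv (\<lambda>i. c i + e i) i j" for i j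
        unfolding dv_def lu H[rule_format, of i] H[rule_format, of j] by simp
      then show ?thesis by blast
    next
      assume H: "\<forall>i. h i = h k - e i"
      have "dv (lab u) i j = dv (\<lambda>i. c i - e i) i j" for i j
        unfolding dv_def lu H[rule_format, of i] H[rule_format, of j] by simp
      then show ?thesis by blast
    qed
  qed
  have vv: "adj x v" "adj y v" "adj z v" "adj x v'" "adj y v'" "adj z v'" "v \<noteq> v'"
    using v by (auto simp: clique5_def)
  have cq: "(\<lambda>i. c i + e i) = q"
    by (simp add: c_def)
  have "(\<forall>i j. dv (lab v) i j = dv q i j) \<or> (\<forall>i j. dv (lab v') i j = dv q i j)"
  proof (rule ccontr)
    assume "\<not> ?thesis"
    then have "\<forall>i j. dv (lab v) i j = dv (\<lambda>i. c i - e i) i j" "\<forall>i j. dv (lab v') i j = dv (\<lambda>i. c i - e i) i j"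
      using lb[OF vv(1-3)] lb[OF vv(4-6)] unfolding cq by blast+
    then have "v = v'"
      by (intro lab_generic_inj[OF gen[OF vv(1-3)] gen[OF vv(4-6)]]) simp
    then show False using vv(7) by blast
  qed
  then show ?thesis
    using gen[OF vv(1-3)] gen[OF vv(4-6)] by blast
qed

end

section \<open>The hermitian form and the isomorphism\<close>

lemma herm5:
  assumes "distinct [m, n, k, l, p :: 5]"
  shows "herm x y = x m * gf4_conj (y m) + x n * gf4_conj (y n) + x k * gf4_conj (y k) + x l * gf4_conj (y l) + x p * gf4_conj (y p)"
  unfolding herm_def by (rule sum5[OF assms])

lemma herm_smul: "herm (smul a x) (smul b y) = a * gf4_conj b * herm x y"
  unfolding herm_def smul_def sum_distrib_left by (simp add: gf4_conj_mult mult_ac)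

lemma gf4_conj_sum: "gf4_conj (sum f S) = (\<Sum>i\<in>S. gf4_conj (f i))"
proof -
  have "gf4_conj 0 = 0"
    by (simp add: gf4_conj_def)
  then show ?thesis
    by (induction S rule: infinite_finite_induct) (simp_all add: gf4_conj_add)
qed

lemma herm_eq_0_sym: "herm x y = 0 \<longleftrightarrow> herm y x = 0"
proof -
  have "gf4_conj (herm x y) = herm y x" for x y :: "'n::finite \<Rightarrow> gf4"
    unfolding herm_def gf4_conj_sum gf4_conj_mult gf4_conj_conj by (simp add: mult.commute)
  then show ?thesis
    by (metis gf4_conj_eq_0)
qed

lemma gf4_inverse: "(x::gf4) \<noteq> 0 \<Longrightarrow> \<exists>y. y \<noteq> 0 \<and> y * x = 1"
  using gf4_norm[of x] by (metis gf4_conj_eq_0 mult.commute)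

lemma smul_smul: "smul a (smul b v) = smul (a * b) v"
  by (simp add: smul_def mult.assoc)

lemma proj_pt_smul:
  fixes v :: "'n \<Rightarrow> gf4"
  assumes "c \<noteq> 0"
  shows "proj_pt (smul c v) = proj_pt v"
proof -
  obtain b where b: "b \<noteq> 0" "b * c = 1"
    using gf4_inverse[OF assms] by blast
  have "smul a v = smul (a * b) (smul c v)" for a
    using b(2) by (simp add: smul_smul mult.assoc)
  moreover have "a * b \<noteq> 0" "a * c \<noteq> 0" if "a \<noteq> 0" for a
    using that b(1) assms by (simp_all add: gf4_mult_eq_0)
  ultimately show ?thesis
    unfolding proj_pt_def smul_smul by blast
qed

lemma gf4_of_nat_even: "even n \<Longrightarrow> (of_nat n :: gf4) = 0"
proof -
  assume "even n"
  then obtain k where "n = k + k"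
    by (metis evenE mult_2)
  then show ?thesis
    by (simp add: gf4_add_simps gf4_zero_iff)
qed

text \<open>Every nonzero element of GF(4) has norm 1, so the form counts nonzero coordinates modulo
  2: nonisotropic means an odd number of them.\<close>

lemma herm_self: "herm x x = of_nat (card {i. x i \<noteq> 0})" for x :: "'n::finite \<Rightarrow> gf4"
proof -
  have "herm x x = (\<Sum>i\<in>UNIV. if x i \<noteq> 0 then 1 else 0)"
    unfolding herm_def by (rule sum.cong) (auto simp: gf4_norm)
  also have "\<dots> = (\<Sum>i\<in>{i. x i \<noteq> 0}. 1)"
    by (simp add: sum.If_cases)
  finally show ?thesis by simp
qed

lemma U_adj_proj_pt:
  assumes "proj_pt x \<in> U_vertices" "proj_pt y \<in> U_vertices"
  shows "U_adj (proj_pt x) (proj_pt y) \<longleftrightarrow> herm x y = 0"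
proof
  assume "U_adj (proj_pt x) (proj_pt y)"
  then show "herm x y = 0"
    unfolding U_adj_def using proj_pt_self by blast
next
  assume "herm x y = 0"
  then show "U_adj (proj_pt x) (proj_pt y)"
    unfolding U_adj_def using assms by (auto simp: proj_pt_def herm_smul)
qed

lemma proj_pt_U_vertices: "herm x x \<noteq> 0 \<Longrightarrow> proj_pt x \<in> U_vertices"
proof -
  assume h: "herm x x \<noteq> 0"
  then have "x \<noteq> (\<lambda>_. 0)"
    by (auto simp: herm_def)
  then have "proj_pt x \<in> proj_points"
    unfolding proj_points_def by blast
  moreover have "herm y y \<noteq> 0" if "y \<in> proj_pt x" for y
    using that h by (auto simp: proj_pt_def herm_smul gf4_mult_eq_0 gf4_conj_eq_0)
  ultimately show ?thesis
    unfolding U_vertices_def by blast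
qed

lemma ex_rest2:
  assumes "distinct [m, n, p :: 5]"
  shows "\<exists>k l. distinct [m, n, k, l, p]"
proof -
  obtain k where k: "k \<noteq> m" "k \<noteq> n" "k \<noteq> p"
    using ex_other3[of m n p] by blast
  obtain l where l: "l \<noteq> m" "l \<noteq> n" "l \<noteq> p" "l \<noteq> k"
    using ex_other4[of m n p k] by blast
  have "distinct [m, n, k, l, p]"
    using assms k l by auto
  then show ?thesis by blast
qed

context based_frame
begin

text \<open>The zeros record adjacency to the frame, and the frame itself becomes the standard
  basis.\<close>

definition F :: "'a \<Rightarrow> 5 \<Rightarrow> gf4" where
  "F v = (\<lambda>i. if v = fr i then 1 else if v \<in> range fr \<or> adj v (fr i) then 0 else pw (lab v i))"

lemma F_fr: "F (fr j) i = (if i = j then 1 else 0)"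
  by (auto simp: F_def fr_inj)

lemma F_A: "m \<noteq> n \<Longrightarrow> x \<in> A m n \<Longrightarrow> F x i = (if i = m \<or> i = n then 0 else pw (lab x i))"
proof -
  assume *: "m \<noteq> n" "x \<in> A m n"
  then have "x \<noteq> fr i" "x \<notin> range fr"
    unfolding A_def by blast+
  then show "F x i = (if i = m \<or> i = n then 0 else pw (lab x i))"
    unfolding F_def A_adj[OF *] by simp
qed

lemma F_generic: "w \<in> generic \<Longrightarrow> F w i = pw (lab w i)"
proof -
  assume w: "w \<in> generic"
  then have "w \<notin> range fr"
    unfolding generic_def by blast
  then show "F w i = pw (lab w i)"
    unfolding F_def using generic_adj(1,3)[OF w, of i] by simp
qed

lemma F_eq_0_iff: "F v i = 0 \<longleftrightarrow> v \<noteq> fr i \<and> (v \<in> range fr \<or> adj v (fr i))"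
  unfolding F_def by (simp add: pw_nonzero)

lemma herm_fr: "herm (F (fr j)) (F v) = 0 \<longleftrightarrow> adj (fr j) v"
proof -
  obtain n where "j \<noteq> n"
    using ex_other3[of j j j] by metis
  then obtain k l p where d: "distinct [j, n, k, l, p]"
    using ex_rest3 by blast
  then have "herm (F (fr j)) (F v) = gf4_conj (F v j)"
    unfolding herm5[OF d] F_fr by auto
  then have "herm (F (fr j)) (F v) = 0 \<longleftrightarrow> v \<noteq> fr j \<and> (v \<in> range fr \<or> adj v (fr j))"
    by (simp add: gf4_conj_eq_0 F_eq_0_iff)
  also have "\<dots> \<longleftrightarrow> adj (fr j) v"
  proof
    assume v: "v \<noteq> fr j \<and> (v \<in> range fr \<or> adj v (fr j))"
    show "adj (fr j) v"
    proof (cases "adj v (fr j)")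
      case False
      then obtain i where i: "v = fr i"
        using v by blast
      then show ?thesis
        using v frame[of j i] by auto
    qed (simp add: adj_sym[of _ v])
  next
    assume a: "adj (fr j) v"
    then show "v \<noteq> fr j \<and> (v \<in> range fr \<or> adj v (fr j))"
      using adj_ne[OF a] adj_sym[of "fr j" v] by simp
  qed
  finally show ?thesis .
qed

text \<open>The three cases have two, three and one common nonzero coordinates. The corresponding
  sums of powers are handled by \<open>pw_sum2\<close>, by \<open>pw_sum3\<close> and by the fact
  that a single power is not 0.\<close>

lemma herm_A_A:
  assumes d: "distinct [m, n, k, l, p]" and x: "x \<in> A m n"
  shows "y \<in> A m p \<Longrightarrow> herm (F x) (F y) = 0 \<longleftrightarrow> adj x y"
    "y \<in> A m n \<Longrightarrow> herm (F x) (F y) = 0 \<longleftrightarrow> adj x y"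
    "y \<in> A k l \<Longrightarrow> herm (F x) (F y) = 0 \<longleftrightarrow> adj x y"
proof -
  have ne: "m \<noteq> n" "m \<noteq> p" "k \<noteq> l" and ne': "k \<noteq> m" "k \<noteq> n" "k \<noteq> p" "l \<noteq> m" "l \<noteq> n" "l \<noteq> p" "p \<noteq> m" "p \<noteq> n" "p \<noteq> k" "p \<noteq> l"
    using d by auto
  note Fx = F_A[OF ne(1) x]
  have conj0: "gf4_conj 0 = 0"
    by (simp add: gf4_conj_eq_0)
  show "herm (F x) (F y) = 0 \<longleftrightarrow> adj x y" if y: "y \<in> A m p"
  proof -
    have "herm (F x) (F y) = pw (lab x k - lab y k) + pw (lab x l - lab y l)"
      unfolding herm5[OF d] Fx F_A[OF ne(2) y] using ne' ne by (simp add: pw_diff conj0)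
    then show ?thesis
      unfolding lab(1)[OF d x y] dv_eq_iff by (simp add: pw_sum2)
  qed
  show "herm (F x) (F y) = 0 \<longleftrightarrow> adj x y" if y: "y \<in> A m n"
  proof -
    have "herm (F x) (F y) = pw (lab x k - lab y k) + pw (lab x l - lab y l) + pw (lab x p - lab y p)"
      unfolding herm5[OF d] Fx F_A[OF ne(1) y] using ne' ne by (simp add: pw_diff conj0)
    then show ?thesis
      unfolding lab(2)[OF d x y] pdd_def dv_eq_iff by (simp add: pw_sum3)
  qed
  show "herm (F x) (F y) = 0 \<longleftrightarrow> adj x y" if y: "y \<in> A k l"
  proof -
    have "herm (F x) (F y) = pw (lab x p - lab y p)"
      unfolding herm5[OF d] Fx F_A[OF ne(3) y] using ne' ne by (simp add: pw_diff conj0)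
    moreover have "\<not> adj x y"
      by (rule A_disjoint_nonadj[OF _ x y]) (use d in auto)
    ultimately show ?thesis
      by (simp add: pw_nonzero)
  qed
qed

lemma herm_A:
  assumes mn: "m \<noteq> n" and x: "x \<in> A m n" and ab: "a \<noteq> b" and y: "y \<in> A a b"
  shows "herm (F x) (F y) = 0 \<longleftrightarrow> adj x y"
proof -
  have sx: "x \<in> A n m" and sy: "y \<in> A b a"
    using x y A_sym by blast+
  have "y \<in> A m n \<or> (\<exists>c. c \<noteq> m \<and> c \<noteq> n \<and> y \<in> A m c) \<or> (\<exists>c. c \<noteq> m \<and> c \<noteq> n \<and> y \<in> A n c) \<or>
      a \<noteq> m \<and> a \<noteq> n \<and> b \<noteq> m \<and> b \<noteq> n"
    using y sy ab by (cases "a = m"; cases "a = n"; cases "b = m"; cases "b = n") auto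
  then consider "y \<in> A m n" | c where "c \<noteq> m" "c \<noteq> n" "y \<in> A m c" | c where "c \<noteq> m" "c \<noteq> n" "y \<in> A n c" | "a \<noteq> m" "a \<noteq> n" "b \<noteq> m" "b \<noteq> n"
    by blast
  then show ?thesis
  proof cases
    case 1
    obtain k l p where "distinct [m, n, k, l, p]"
      using ex_rest3[OF mn] by blast
    then show ?thesis
      by (rule herm_A_A(2)[OF _ x 1])
  next
    case (2 c)
    have "distinct [m, n, c]"
      using 2 mn by auto
    then obtain k l where "distinct [m, n, k, l, c]"
      using ex_rest2 by blast
    then show ?thesis
      by (rule herm_A_A(1)[OF _ x 2(3)])
  next
    case (3 c)
    have "distinct [n, m, c]"
      using 3 mn by auto
    then obtain k l where "distinct [n, m, k, l, c]"
      using ex_rest2 by blast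
    then show ?thesis
      by (rule herm_A_A(1)[OF _ sx 3(3)])
  next
    case 4
    obtain p where "p \<noteq> m" "p \<noteq> n" "p \<noteq> a" "p \<noteq> b"
      using ex_other4[of m n a b] by blast
    then have "distinct [m, n, a, b, p]"
      using 4 mn ab by auto
    then show ?thesis
      by (rule herm_A_A(3)[OF _ x y])
  qed
qed

lemma herm_A_generic:
  assumes mn: "m \<noteq> n" and x: "x \<in> A m n" and w: "w \<in> generic"
  shows "herm (F x) (F w) = 0 \<longleftrightarrow> adj x w"
proof -
  obtain k l p where d: "distinct [m, n, k, l, p]"
    using ex_rest3[OF mn] by blast
  then have "herm (F x) (F w) = pw (lab x k - lab w k) + pw (lab x l - lab w l) + pw (lab x p - lab w p)"
    unfolding herm5[OF d] F_A[OF mn x] F_generic[OF w] by (auto simp: pw_diff)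
  then show ?thesis
    unfolding adj_sym[of x] lab_generic[OF w d x] pdd_def dv_eq_iff by (simp add: pw_sum3)
qed

lemma herm_generic:
  assumes w: "w \<in> generic" "w' \<in> generic"
  shows "herm (F w) (F w') = 0 \<longleftrightarrow> adj w w'"
proof -
  have h: "herm (F w) (F w') = (\<Sum>i\<in>UNIV. pw (lab w i - lab w' i))"
    unfolding herm_def F_generic[OF w(1)] F_generic[OF w(2)] pw_diff ..
  show ?thesis
  proof
    assume "herm (F w) (F w') = 0"
    then have "pw (lab w 0 - lab w' 0) + pw (lab w 1 - lab w' 1) + pw (lab w 2 - lab w' 2) + pw (lab w 3 - lab w' 3) + pw (lab w 4 - lab w' 4) = 0"
      unfolding h sum5[OF five_distinct] .
    from pw_sum5_pattern[of "\<lambda>i. lab w i - lab w' i", OF this] show "adj w w'"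
      by (elim disjE) (rule pattern_adj[OF w, rotated], assumption, simp)+
  next
    assume "adj w w'"
    then show "herm (F w) (F w') = 0"
      unfolding h by (rule adj_generic_pw[OF w])
  qed
qed

lemma herm_adj:
  assumes v: "v \<in> V" "v' \<in> V"
  shows "herm (F v) (F v') = 0 \<longleftrightarrow> adj v v'"
proof -
  have fr1: "herm (F v) (F v') = 0 \<longleftrightarrow> adj v v'" if "v \<in> range fr" for v v'
    using that herm_fr by blast
  have ag: "herm (F v) (F v') = 0 \<longleftrightarrow> adj v v'" if mn: "m \<noteq> n" "v \<in> A m n" "v' \<in> V" for v v' m n
  proof -
    consider "v' \<in> range fr" | a b where "a \<noteq> b" "v' \<in> A a b" | "v' \<in> generic"
      using vertex_cases[OF mn(3)] by blast
    then show ?thesis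
    proof cases
      case 1
      then show ?thesis
        using fr1[OF 1, of v] herm_eq_0_sym[of "F v"] adj_sym[of v] by blast
    next
      case 2
      then show ?thesis using herm_A[OF mn(1,2) 2] by blast
    next
      case 3
      then show ?thesis using herm_A_generic[OF mn(1,2) 3] by blast
    qed
  qed
  have sym: "herm (F v) (F v') = 0 \<longleftrightarrow> adj v v'" if "herm (F v') (F v) = 0 \<longleftrightarrow> adj v' v"
    using that herm_eq_0_sym[of "F v"] adj_sym[of v] by blast
  consider "v \<in> range fr" | "v' \<in> range fr" | m n where "m \<noteq> n" "v \<in> A m n" | m n where "m \<noteq> n" "v' \<in> A m n" | "v \<in> generic" "v' \<in> generic"
    using vertex_cases[OF v(1)] vertex_cases[OF v(2)] by blast
  then show ?thesis
  proof cases
    case 1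
    then show ?thesis by (rule fr1)
  next
    case 2
    then show ?thesis by (rule sym[OF fr1])
  next
    case 3
    then show ?thesis by (rule ag[OF _ _ v(2)])
  next
    case 4
    then show ?thesis by (rule sym[OF ag[OF _ _ v(1)]])
  next
    case 5
    then show ?thesis by (rule herm_generic)
  qed
qed

lemma A_V: "x \<in> A m n \<Longrightarrow> x \<in> V"
  unfolding A_def using adj_V by blast

lemma F_vertex: "v \<in> V \<Longrightarrow> proj_pt (F v) \<in> U_vertices"
  by (rule proj_pt_U_vertices) (simp add: herm_adj)

text \<open>Proportional vectors have the same zeros, which identifies the frame vertex or the pair
  \<open>m\<close>, \<open>n\<close>. They also have the same ratios, and labels are
  faithful.\<close>

lemma F_inj:
  assumes v: "v \<in> V" "v' \<in> V" and e: "proj_pt (F v) = proj_pt (F v')"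
  shows "v = v'"
proof -
  obtain c where c: "F v = smul c (F v')" "c \<noteq> 0"
    using proj_pt_self[of "F v"] unfolding e by (auto simp: proj_pt_def)
  have z: "F v i = 0 \<longleftrightarrow> F v' i = 0" for i
    unfolding c(1) smul_def using c(2) by (simp add: gf4_mult_eq_0)
  have zf: "F (fr j) i = 0 \<longleftrightarrow> i \<noteq> j" for i j
    by (simp add: F_fr)
  have zA: "F x i = 0 \<longleftrightarrow> i = m \<or> i = n" if "m \<noteq> n" "x \<in> A m n" for x m n i
    unfolding F_A[OF that] by (simp add: pw_nonzero)
  have zg: "F w i \<noteq> 0" if "w \<in> generic" for w i
    unfolding F_generic[OF that] by (rule pw_nonzero)
  \<comment> \<open>A unit vector has four zeros, a vector from \<open>A m n\<close> only
    two.\<close>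
  have fr_A: "\<not> (\<forall>i. i \<noteq> j \<longleftrightarrow> i = m \<or> i = n)" for j m n :: 5
    using ex_other3[of j m n] by blast
  have fr_g: "\<exists>i. i \<noteq> j" for j :: 5
    using ex_other3[of j j j] by blast
  obtain s where s: "c = pw s"
    using pw_ex[OF c(2)] by blast
  have dv: "dv (lab v) i j = dv (lab v') i j"
    if "F v i = pw (lab v i)" "F v' i = pw (lab v' i)" "F v j = pw (lab v j)" "F v' j = pw (lab v' j)" for i j
  proof -
    have "pw (lab v i) = pw (s + lab v' i)" "pw (lab v j) = pw (s + lab v' j)"
      using that fun_cong[OF c(1), of i] fun_cong[OF c(1), of j] unfolding s smul_def pw_add[symmetric] by simp_all
    then show ?thesis
      unfolding pw_inj by (simp add: dv_def)
  qed
  consider j where "v = fr j" | m n where "m \<noteq> n" "v \<in> A m n" | "v \<in> generic"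
    using vertex_cases[OF v(1)] by blast
  then show ?thesis
  proof cases
    case (1 j)
    consider j' where "v' = fr j'" | m n where "m \<noteq> n" "v' \<in> A m n" | "v' \<in> generic"
      using vertex_cases[OF v(2)] by blast
    then show ?thesis
    proof cases
      case (1 j')
      then show ?thesis
        using z[of j] zf[of j j] zf[of j' j] \<open>v = fr j\<close> by simp
    next
      case (2 m n)
      then have "i \<noteq> j \<longleftrightarrow> i = m \<or> i = n" for i
        using z[of i] zf[of j i] zA[OF 2, of i] \<open>v = fr j\<close> by simp
      then show ?thesis
        using fr_A[of j m n] by blast
    next
      case 3
      obtain i where "i \<noteq> j"
        using fr_g[of j] by blast
      then show ?thesis
        using z[of i] zf[of j i] zg[OF 3, of i] \<open>v = fr j\<close> by simp
    qed
  next
    case (2 m n)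
    consider j' where "v' = fr j'" | a b where "a \<noteq> b" "v' \<in> A a b" | "v' \<in> generic"
      using vertex_cases[OF v(2)] by blast
    then show ?thesis
    proof cases
      case (1 j')
      then have "i \<noteq> j' \<longleftrightarrow> i = m \<or> i = n" for i
        using z[of i] zf[of j' i] zA[OF 2, of i] by simp
      then show ?thesis
        using fr_A[of j' m n] by blast
    next
      case (2 a b)
      have mnab: "i = m \<or> i = n \<longleftrightarrow> i = a \<or> i = b" for i
        using z[of i] zA[OF 2, of i] zA[OF \<open>m \<noteq> n\<close> \<open>v \<in> A m n\<close>, of i] by simp
      have "a = m \<and> b = n \<or> a = n \<and> b = m"
        using mnab[of m] mnab[of n] \<open>m \<noteq> n\<close> by auto
      then have v': "v' \<in> A m n"
        using 2(2) 2(2)[unfolded A_sym[of a b]] by (elim disjE conjE) simp_all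
      obtain k l p where d: "distinct [m, n, k, l, p]"
        using ex_rest3[OF \<open>m \<noteq> n\<close>] by blast
      have pv: "F v i = pw (lab v i)" "F v' i = pw (lab v' i)" if "i \<noteq> m" "i \<noteq> n" for i
        using F_A[OF \<open>m \<noteq> n\<close> \<open>v \<in> A m n\<close>] F_A[OF \<open>m \<noteq> n\<close> v'] that by simp_all
      have "k \<noteq> m" "k \<noteq> n" "l \<noteq> m" "l \<noteq> n" "p \<noteq> m" "p \<noteq> n"
        using d by auto
      then have "dv (lab v) k l = dv (lab v') k l" "dv (lab v) k p = dv (lab v') k p"
        using dv[OF pv pv] by blast+
      then show ?thesis
        by (rule lab(3)[OF d \<open>v \<in> A m n\<close> v'])
    next
      case 3
      then show ?thesis
        using z[of m] zA[OF 2, of m] zg[OF 3, of m] by simp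
    qed
  next
    case 3
    consider j' where "v' = fr j'" | a b where "a \<noteq> b" "v' \<in> A a b" | "v' \<in> generic"
      using vertex_cases[OF v(2)] by blast
    then show ?thesis
    proof cases
      case (1 j')
      obtain i where "i \<noteq> j'"
        using fr_g[of j'] by blast
      then show ?thesis
        using z[of i] zf[of j' i] zg[OF 3, of i] 1 by simp
    next
      case (2 a b)
      then show ?thesis
        using z[of a] zA[OF 2, of a] zg[OF 3, of a] by simp
    next
      case g: 3
      show ?thesis
        by (rule lab_generic_inj[OF 3 g], rule dv) (simp_all add: F_generic 3 g)
    qed
  qed
qed

lemma F_surj:
  assumes P: "P \<in> U_vertices"
  shows "\<exists>u\<in>V. P = proj_pt (F u)"
proof -
  obtain v where v: "P = proj_pt v"
    using P by (auto simp: U_vertices_def proj_points_def)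
  have h: "herm v v \<noteq> 0"
    using P proj_pt_self unfolding v U_vertices_def by blast
  define a where "a i = (SOME b. v i = pw b)" for i
  have a: "v i = pw (a i)" if "v i \<noteq> 0" for i
    unfolding a_def by (rule someI_ex[OF pw_ex[OF that]])
  have fin: "P = proj_pt (F u)" if "\<And>i. v i = c * F u i" "c \<noteq> 0" for c u
  proof -
    have "v = smul c (F u)"
      by (rule ext) (simp add: smul_def that(1))
    then show ?thesis
      unfolding v using proj_pt_smul[OF that(2)] by simp
  qed
  define S where "S = {i. v i \<noteq> 0}"
  have "\<not> even (card S)"
    using h gf4_of_nat_even unfolding herm_self S_def by blast
  moreover have "card S \<le> 5"
    using card_mono[of "UNIV :: 5 set" S] by simp
  \<comment> \<open>The odd numbers up to 5 correspond to frame vertices, to the sets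
    \<open>A m n\<close> and to generic vertices.\<close>
  ultimately have "card S = 1 \<or> card S = 3 \<or> card S = 5"
    by (auto elim!: oddE)
  then show ?thesis
  proof (elim disjE)
    assume "card S = 1"
    then obtain j where j: "S = {j}"
      by (rule card_1_singletonE)
    have jz: "v i \<noteq> 0 \<longleftrightarrow> i = j" for i
      using j unfolding S_def by blast
    have e: "v i = v j * F (fr j) i" for i
      using jz[of i] by (cases "i = j") (simp_all add: F_fr)
    have "v j \<noteq> 0"
      using jz by blast
    then show ?thesis
      using fin[OF e] fr_V by blast
  next
    assume "card S = 3"
    then have "card (UNIV - S) = 2"
      by (simp add: card_Diff_subset)
    then obtain m n where mn: "UNIV - S = {m, n}" "m \<noteq> n"
      by (auto simp: card_2_iff)
    have zero: "v i = 0 \<longleftrightarrow> i = m \<or> i = n" for i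
      using mn(1) unfolding S_def by blast
    obtain k l p where d: "distinct [m, n, k, l, p]"
      using ex_rest3[OF mn(2)] by blast
    obtain x where x: "x \<in> A m n" "dv (lab x) k l = dv a k l" "dv (lab x) k p = dv a k p"
      using lab_surj[OF d, of a] by blast
    have e: "a l = (a k - lab x k) + lab x l" "a p = (a k - lab x k) + lab x p"
      by (rule diff_solve[OF x(2)[unfolded dv_def]], rule diff_solve[OF x(3)[unfolded dv_def]])
    have ve: "v i = pw (a k - lab x k) * F x i" for i
    proof (cases "v i = 0")
      case True
      then show ?thesis
        using zero[of i] F_A[OF mn(2) x(1), of i] by auto
    next
      case False
      then have i: "i \<noteq> m" "i \<noteq> n"
        using zero by blast+
      have "a i = (a k - lab x k) + lab x i"
        using five_exhaust[OF d, of i] i e by (elim disjE) simp_all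
      then show ?thesis
        unfolding a[OF False] F_A[OF mn(2) x(1)] using i by (simp add: pw_add)
    qed
    then show ?thesis
      using fin[OF ve pw_nonzero] A_V[OF x(1)] by blast
  next
    assume "card S = 5"
    then have "S = UNIV"
      by (intro card_subset_eq) simp_all
    then have nz: "v i \<noteq> 0" for i
      unfolding S_def by blast
    obtain w where w: "w \<in> generic" "\<forall>i j. dv (lab w) i j = dv a i j"
      using lab_generic_surj by blast
    have ve: "v i = pw (a 0 - lab w 0) * F w i" for i
    proof -
      have "a i = (a 0 - lab w 0) + lab w i"
        using w(2)[rule_format, of 0 i] unfolding dv_def by (rule diff_solve)
      then show ?thesis
        unfolding a[OF nz] F_generic[OF w(1)] by (simp add: pw_add)
    qed
    then show ?thesis
      using fin[OF ve pw_nonzero] generic_adj(5)[OF w(1)] by blast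
  qed
qed

lemma graph_iso_U5: "graph_iso V adj (U_vertices :: (5 \<Rightarrow> gf4) set set) U_adj"
proof -
  have "inj_on (\<lambda>v. proj_pt (F v)) V"
    using F_inj by (auto simp: inj_on_def)
  moreover have "(\<lambda>v. proj_pt (F v)) ` V = U_vertices"
    using F_vertex F_surj by blast
  ultimately have "bij_betw (\<lambda>v. proj_pt (F v)) V U_vertices"
    unfolding bij_betw_def by blast
  then show ?thesis
    unfolding graph_iso_def
  proof (intro exI conjI ballI)
    fix x y assume "x \<in> V" "y \<in> V"
    then show "adj x y \<longleftrightarrow> U_adj (proj_pt (F x)) (proj_pt (F y))"
      using U_adj_proj_pt[OF F_vertex F_vertex, of x y] herm_adj[of x y] by simp
  qed
qed

end

lemma (in locally_W3) graph_iso_unitary: "graph_iso V adj (U_vertices :: (5 \<Rightarrow> gf4) set set) U_adj"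
proof -
  obtain v where v: "v \<in> V"
    using conn by (auto simp: connected_graph_def)
  obtain g where g: "coords adj linesW v g"
    using all_W[OF v] by (auto simp: has_type_def)
  have C: "clique5 v (g 0) (g 1) (g 2) (g 3)"
    by (rule coords_line[OF g table_form_W]) (simp add: linesW_def)
  \<comment> \<open>Any vertex together with a line of the quadrangle at it is a 5-clique.\<close>
  define fr :: "5 \<Rightarrow> 'a" where
    "fr i = (if i = 0 then v else if i = 1 then g 0 else if i = 2 then g 1 else if i = 3 then g 2 else g 3)" for i
  have fr: "fr 0 = v" "fr 1 = g 0" "fr 2 = g 1" "fr 3 = g 2" "fr 4 = g 3"
    by (simp_all add: fr_def)
  have c: "adj v (g 0)" "adj v (g 1)" "adj v (g 2)" "adj v (g 3)" "adj (g 0) (g 1)" "adj (g 0) (g 2)" "adj (g 0) (g 3)"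
    "adj (g 1) (g 2)" "adj (g 1) (g 3)" "adj (g 2) (g 3)"
    using C unfolding clique5_def by blast+
  have "adj (fr i) (fr j)" if "i \<noteq> j" for i j
  proof -
    show ?thesis
      using five_cases[of i] five_cases[of j] that
      by (elim disjE) (simp_all only: fr c c[THEN adj_sym[THEN iffD1]] simp_thms)
  qed
  then interpret frame V adj fr
    by unfold_locales
  obtain w0 where "w0 \<in> generic"
    using generic_ex by blast
  then interpret based_frame V adj fr w0
    by unfold_locales
  show ?thesis
    by (rule graph_iso_U5)
qed

theorem mainTheorem3:
  fixes V :: "'a set" and adj :: "'a \<Rightarrow> 'a \<Rightarrow> bool"
  assumes "simple_graph V adj"
    and "connected_graph V adj"
    and "\<forall>u\<in>V. graph_iso {v\<in>V. adj u v} adj W3_points W3_coll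
              \<or> graph_iso {v\<in>V. adj u v} adj Q43_points Q43_coll"
  shows "graph_iso V adj (U_vertices :: (5 \<Rightarrow> gf4) set set) U_adj"
proof -
  have "\<exists>L g. L \<in> {linesW, linesQ} \<and> coords adj L u g" if "u \<in> V" for u
    using assms(3)[rule_format, OF that] graph_iso_coords[OF assms(1) _ W3_model, of u]
      graph_iso_coords[OF assms(1) _ Q43_model, of u] by blast
  then interpret locally_gq V adj
    by (rule locally_gq.intro[OF assms(1)])
  interpret locally_W3 V adj
    by unfold_locales (use all_type_W[OF assms(2)] assms(2) in blast)+
  show ?thesis
    by (rule graph_iso_unitary)
qed

end
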